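(* Let $0<\alpha<1$, $1<p<\infty$, $\frac1p+\frac1{p'}=1$. For $\varepsilon>0$ let $f^\varepsilon\in L^{p'}(R^\varepsilon)$ satisfy $|||f^\varepsilon|||_{L^{p'}(R^\varepsilon)}\le c$ with $c>0$ independent of $\varepsilon$ and $T_\varepsilon f^\varepsilon\rightharpoonup\hat f$ weakly in $L^{p'}((0,1)\times Y^* )$ as $\varepsilon\to0$. Let $u_\varepsilon\in W^{1,p}(R^\varepsilon)$ be the solution of $$\int_{R^\varepsilon}\left\{|\nabla u_\varepsilon|^{p-2}\nabla u_\varepsilon\cdot\nabla\varphi+|u_\varepsilon|^{p-2}u_\varepsilon\varphi\right\}dxdy=\int_{R^\varepsilon}f^\varepsilon\varphi\,dxdy\qquad\forall\varphi\in W^{1,p}(R^\varepsilon).$$ Let $(u,u_1)\in W^{1,p}(0,1)\times L^p((0,1);W^{1,p}_\#(Y^* ))$, $\partial_{y_2}u_1=0$, be the pair of limit functions described in the context, and define $$W_\varepsilon(x)=\left(\partial_xu(x)+\partial_{y_1}u_1\left(x,\frac{x}{\varepsilon^\alpha}\right),\,0\right),$$ regarded as a function on $R^\varepsilon$ independent of $y$, where $\partial_{y_1}u_1$ is extended $L$-periodically in $y_1$. Then $$\left\|T_\varepsilon\nabla u_\varepsilon-T_\varepsilon W_\varepsilon\right\|_{L^p((0,1)\times Y^* )}\to0\quad\text{as }\varepsilon\to0.$$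
   Context: Standing assumptions on $g$: $g:\mathbb{R}\to\mathbb{R}$ is strictly positive, bounded, lower semicontinuous and $L$-periodic ($L>0$), with $g_0=\min_{\mathbb R}g>0$. $\langle h\rangle_{(0,L)}=\frac1L\int_0^Lh(s)\,ds$ denotes the average. Thin domain: $R^\varepsilon=\{(x,y)\in\mathbb{R}^2:0<x<1,\ 0<y<\varepsilon g(x/\varepsilon^\alpha)\}$. The variational problem has a unique solution for each $\varepsilon>0$. Basic cell: $Y^*=\{(y_1,y_2):0<y_1<L,\ 0<y_2<g(y_1)\}$. $W^{1,p}_\#(Y^* )$ is the space of $\varphi\in W^{1,p}(Y^* )$ whose traces on the left lateral boundary ($y_1=0$) and right lateral boundary ($y_1=L$) coincide. Rescaled norm: $|||\varphi|||_{L^r(R^\varepsilon)}=\varepsilon^{-1/r}\|\varphi\|_{L^r(R^\varepsilon)}$ for $1\le r<\infty$. Unfolding operator: for $a\in\mathbb{R}$, $[a]_L$ is the unique integer with $a=[a]_LL+\{a\}_L$, $\{a\}_L\in[0,L)$. Let $N_\varepsilon$ be the largest integer with $\varepsilon^\alpha L(N_\varepsilon+1)\le1$, $I_\varepsilon=\mathrm{Int}\big(\bigcup_{k=0}^{N_\varepsilon}[kL\varepsilon^\alpha,(k+1)L\varepsilon^\alpha]\big)$, $\Lambda_\varepsilon=(0,1)\setminus I_\varepsilon$. For $\varphi$ Lebesgue measurable on $R^\varepsilon$, $T_\varepsilon\varphi(x,y_1,y_2)=\varphi(\varepsilon^\alpha[x/\varepsilon^\alpha]_LL+\varepsilon^\alpha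 y_1,\varepsilon y_2)$ for $(x,y_1,y_2)\in I_\varepsilon\times Y^*$ and $T_\varepsilon\varphi=0$ on $\Lambda_\varepsilon\times Y^*$; on vector fields $T_\varepsilon$ acts componentwise. The pair $(u,u_1)$: with $\bar f=\frac1{|Y^*|}\int_{Y^*}\hat f\,dy_1dy_2$, $u\in W^{1,p}(0,1)$ is the unique solution of $$\int_0^1\left[\frac{1}{\langle g\rangle_{(0,L)}\langle1/g^{p'-1}\rangle_{(0,L)}^{p-1}}|\partial_xu|^{p-2}\partial_xu\,\partial_x\varphi+|u|^{p-2}u\varphi\right]dx=\int_0^1\bar f\varphi\,dx\quad\forall\varphi\in W^{1,p}(0,1),$$ and $u_1\in L^p((0,1);W^{1,p}_\#(Y^* ))$ with $\partial_{y_2}u_1=0$ is such that $T_\varepsilon u_\varepsilon\rightharpoonup u$ weakly in $L^p((0,1);W^{1,p}(Y^* ))$ and $T_\varepsilon\partial_xu_\varepsilon\rightharpoonup\partial_xu+\partial_{y_1}u_1$ weakly in $L^p((0,1)\times Y^* )$. Since $\partial_{y_2}u_1=0$, $u_1$ is a function of $(x,y_1)$. It satisfies $$\partial_{y_1}u_1(x,y_1)=\frac{\partial_xu(x)}{g(y_1)^{p'-1}\langle1/g^{p'-1}\rangle_{(0,L)}}-\partial_xu(x),$$ and the evaluation $\partial_{y_1}u_1(x,x/\varepsilon^\alpha)$ is taken with this representative. *)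

theory Defs
  imports "HOL-Analysis.Analysis"
begin

(* Conventions. Elements of function spaces are genuine functions on the ambient type; only their
   restriction to the domain matters, and only up to null sets. Norms below are therefore
   seminorms. All integrals are Lebesgue integrals with respect to (completed) Lebesgue measure. *)

section \<open>Lebesgue and Sobolev spaces\<close>

definition Lp :: "real \<Rightarrow> 'a::euclidean_space set \<Rightarrow> ('a \<Rightarrow> 'b::real_normed_vector) set" where
  "Lp p S = {f. f \<in> borel_measurable (lebesgue_on S) \<and>
                integrable (lebesgue_on S) (\<lambda>x. norm (f x) powr p)}"

definition Lp_norm :: "real \<Rightarrow> 'a::euclidean_space set \<Rightarrow> ('a \<Rightarrow> 'b::real_normed_vector) \<Rightarrow> real" where
  "Lp_norm p S f = (LINT x|lebesgue_on S. norm (f x) powr p) powr (1 / p)"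

primrec Ck :: "nat \<Rightarrow> ('a::euclidean_space \<Rightarrow> real) \<Rightarrow> bool" where
  "Ck 0 f = continuous_on UNIV f"
| "Ck (Suc k) f = ((\<forall>x. f differentiable (at x)) \<and>
                   (\<forall>b\<in>Basis. Ck k (\<lambda>x. frechet_derivative f (at x) b)))"

definition smooth :: "('a::euclidean_space \<Rightarrow> real) \<Rightarrow> bool" where
  "smooth f \<longleftrightarrow> (\<forall>k. Ck k f)"

definition test_function :: "'a::euclidean_space set \<Rightarrow> ('a \<Rightarrow> real) \<Rightarrow> bool" where
  "test_function \<Omega> \<phi> \<longleftrightarrow> smooth \<phi> \<and> compact (closure {x. \<phi> x \<noteq> 0}) \<and> closure {x. \<phi> x \<noteq> 0} \<subseteq> \<Omega>"

definition locally_integrable ::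
    "'a::euclidean_space set \<Rightarrow> ('a \<Rightarrow> 'b::euclidean_space) \<Rightarrow> bool" where
  "locally_integrable \<Omega> f \<longleftrightarrow> (\<forall>K. compact K \<and> K \<subseteq> \<Omega> \<longrightarrow> integrable (lebesgue_on K) f)"

(* On the real line Basis = {1}, so the gradient is simply the weak derivative. *)
definition has_weak_gradient ::
    "'a::euclidean_space set \<Rightarrow> ('a \<Rightarrow> real) \<Rightarrow> ('a \<Rightarrow> 'a) \<Rightarrow> bool" where
  "has_weak_gradient \<Omega> u G \<longleftrightarrow>
     locally_integrable \<Omega> u \<and> locally_integrable \<Omega> G \<and>
     (\<forall>\<phi>. test_function \<Omega> \<phi> \<longrightarrow>
        (\<forall>b\<in>Basis. (LINT x|lebesgue_on \<Omega>. u x * frechet_derivative \<phi> (at x) b)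
                    = - (LINT x|lebesgue_on \<Omega>. (G x \<bullet> b) * \<phi> x)))"

(* u belongs to W^{1,p}(\<Omega>), and G is a representative of its weak gradient. *)
definition W1p_grad ::
    "real \<Rightarrow> 'a::euclidean_space set \<Rightarrow> ('a \<Rightarrow> real) \<Rightarrow> ('a \<Rightarrow> 'a) \<Rightarrow> bool" where
  "W1p_grad p \<Omega> u G \<longleftrightarrow> u \<in> Lp p \<Omega> \<and> G \<in> Lp p \<Omega> \<and> has_weak_gradient \<Omega> u G"

definition W1p :: "real \<Rightarrow> 'a::euclidean_space set \<Rightarrow> ('a \<Rightarrow> real) set" where
  "W1p p \<Omega> = {u. \<exists>G. W1p_grad p \<Omega> u G}"

(* The choice is immaterial: on an open set the weak gradient is unique up to a null set. *)
definition wgrad :: "'a::euclidean_space set \<Rightarrow> ('a \<Rightarrow> real) \<Rightarrow> 'a \<Rightarrow> 'a" where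
  "wgrad \<Omega> u = (SOME G. has_weak_gradient \<Omega> u G)"

definition W1p_norm :: "real \<Rightarrow> 'a::euclidean_space set \<Rightarrow> ('a \<Rightarrow> real) \<Rightarrow> real" where
  "W1p_norm p \<Omega> u = ((LINT x|lebesgue_on \<Omega>. \<bar>u x\<bar> powr p)
                     + (LINT x|lebesgue_on \<Omega>. norm (wgrad \<Omega> u x) powr p)) powr (1 / p)"

(* Weak formulation of the Neumann problem -div(a |\<nabla>u|^{p-2} \<nabla>u) + |u|^{p-2} u = f in \<Omega>, for a
   constant a. Note that 0 powr s = 0 for every s, so |\<xi>|^{p-2} \<xi> is 0 at \<xi> = 0 also when p <= 2. *)
definition plaplace_solution ::
    "real \<Rightarrow> real \<Rightarrow> 'a::euclidean_space set \<Rightarrow> ('a \<Rightarrow> real) \<Rightarrow> ('a \<Rightarrow> real) \<Rightarrow> ('a \<Rightarrow> 'a) \<Rightarrow> bool" where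
  "plaplace_solution p a \<Omega> f u Du \<longleftrightarrow>
     W1p_grad p \<Omega> u Du \<and>
     (\<forall>\<phi> D\<phi>. W1p_grad p \<Omega> \<phi> D\<phi> \<longrightarrow>
        (LINT x|lebesgue_on \<Omega>. a * (norm (Du x) powr (p - 2) * (Du x \<bullet> D\<phi> x))
                                + \<bar>u x\<bar> powr (p - 2) * u x * \<phi> x)
        = (LINT x|lebesgue_on \<Omega>. f x * \<phi> x))"

section \<open>Weak convergence and Bochner spaces\<close>

definition bounded_functional ::
    "('a \<Rightarrow> real) set \<Rightarrow> (('a \<Rightarrow> real) \<Rightarrow> real) \<Rightarrow> (('a \<Rightarrow> real) \<Rightarrow> real) \<Rightarrow> bool" where
  "bounded_functional V N l \<longleftrightarrow>
     (\<forall>v\<in>V. \<forall>w\<in>V. l (\<lambda>x. v x + w x) = l v + l w) \<and>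
     (\<forall>c. \<forall>v\<in>V. l (\<lambda>x. c * v x) = c * l v) \<and>
     (\<exists>C. \<forall>v\<in>V. \<bar>l v\<bar> \<le> C * N v)"

definition weakly_converges ::
    "('a \<Rightarrow> real) set \<Rightarrow> (('a \<Rightarrow> real) \<Rightarrow> real) \<Rightarrow> ('e \<Rightarrow> 'a \<Rightarrow> real) \<Rightarrow> ('a \<Rightarrow> real) \<Rightarrow> 'e filter \<Rightarrow> bool" where
  "weakly_converges V N w w0 F \<longleftrightarrow>
     (\<forall>\<^sub>F e in F. w e \<in> V) \<and> w0 \<in> V \<and>
     (\<forall>l. bounded_functional V N l \<longrightarrow> ((\<lambda>e. l (w e)) \<longlongrightarrow> l w0) F)"

(* The space L^p(I; X) for a space X of functions with (semi)norm N; its elements, maps from I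
   into X, are written in uncurried form. Strong measurability: almost everywhere limit, in the
   norm of X, of measurable maps with finitely many values in X. *)
definition strongly_measurable ::
    "'a::euclidean_space set \<Rightarrow> ('b \<Rightarrow> real) set \<Rightarrow> (('b \<Rightarrow> real) \<Rightarrow> real) \<Rightarrow> ('a \<times> 'b \<Rightarrow> real) \<Rightarrow> bool" where
  "strongly_measurable I X N v \<longleftrightarrow>
     (\<exists>s :: nat \<Rightarrow> 'a \<Rightarrow> 'b \<Rightarrow> real.
        (\<forall>n. finite (s n ` I) \<and> s n ` I \<subseteq> X \<and> (\<forall>h. {x\<in>I. s n x = h} \<in> sets lebesgue)) \<and>
        (AE x in lebesgue_on I. (\<lambda>n. N (\<lambda>y. s n x y - v (x, y))) \<longlonglongrightarrow> 0))"

definition Bochner_Lp ::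
    "real \<Rightarrow> 'a::euclidean_space set \<Rightarrow> ('b \<Rightarrow> real) set \<Rightarrow> (('b \<Rightarrow> real) \<Rightarrow> real) \<Rightarrow> ('a \<times> 'b \<Rightarrow> real) set" where
  "Bochner_Lp p I X N =
     {v. (AE x in lebesgue_on I. (\<lambda>y. v (x, y)) \<in> X) \<and> strongly_measurable I X N v \<and>
         integrable (lebesgue_on I) (\<lambda>x. N (\<lambda>y. v (x, y)) powr p)}"

definition Bochner_norm ::
    "real \<Rightarrow> 'a::euclidean_space set \<Rightarrow> (('b \<Rightarrow> real) \<Rightarrow> real) \<Rightarrow> ('a \<times> 'b \<Rightarrow> real) \<Rightarrow> real" where
  "Bochner_norm p I N v = (LINT x|lebesgue_on I. N (\<lambda>y. v (x, y)) powr p) powr (1 / p)"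

section \<open>Thin domain and basic cell\<close>

definition lower_semicont :: "(real \<Rightarrow> real) \<Rightarrow> bool" where
  "lower_semicont g \<longleftrightarrow> (\<forall>x c. c < g x \<longrightarrow> (\<forall>\<^sub>F y in at x. c < g y))"

definition mean :: "real \<Rightarrow> (real \<Rightarrow> real) \<Rightarrow> real" where
  "mean L h = (LINT s|lebesgue_on {0<..<L}. h s) / L"

definition thin_domain :: "(real \<Rightarrow> real) \<Rightarrow> real \<Rightarrow> real \<Rightarrow> (real \<times> real) set" where
  "thin_domain g \<alpha> \<epsilon> = {(x, y). 0 < x \<and> x < 1 \<and> 0 < y \<and> y < \<epsilon> * g (x / \<epsilon> powr \<alpha>)}"

definition cell :: "real \<Rightarrow> (real \<Rightarrow> real) \<Rightarrow> (real \<times> real) set" where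
  "cell L g = {(y1, y2). 0 < y1 \<and> y1 < L \<and> 0 < y2 \<and> y2 < g y1}"

(* \<gamma> is the trace of \<phi> : W^{1,p}(Q), Q a rectangle, on the vertical edge {c} \<times> J of Q. The trace
   operator is the continuous extension of the restriction to the edge of functions that are
   smooth up to the boundary. *)
definition edge_trace ::
    "real \<Rightarrow> (real \<times> real) set \<Rightarrow> real \<Rightarrow> real set \<Rightarrow> (real \<times> real \<Rightarrow> real) \<Rightarrow> (real \<Rightarrow> real) \<Rightarrow> bool" where
  "edge_trace p Q c J \<phi> \<gamma> \<longleftrightarrow>
     \<gamma> \<in> Lp p J \<and>
     (\<exists>\<psi> :: nat \<Rightarrow> real \<times> real \<Rightarrow> real.
        (\<forall>n. smooth (\<psi> n)) \<and>
        (\<lambda>n. W1p_norm p Q (\<lambda>z. \<phi> z - \<psi> n z)) \<longlonglongrightarrow> 0 \<and>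
        (\<lambda>n. Lp_norm p J (\<lambda>t. \<psi> n (c, t) - \<gamma> t)) \<longlonglongrightarrow> 0)"

(* Traces on the lateral boundaries {0} \<times> (0, g(0)) and {L} \<times> (0, g(L)) of the cell. For lower
   semicontinuous g, a neighbourhood in the cell of each point of these segments contains a
   rectangle with an edge through the point; the trace is prescribed on all such rectangles. *)
definition left_trace ::
    "real \<Rightarrow> real \<Rightarrow> (real \<Rightarrow> real) \<Rightarrow> (real \<times> real \<Rightarrow> real) \<Rightarrow> (real \<Rightarrow> real) \<Rightarrow> bool" where
  "left_trace p L g \<phi> \<gamma> \<longleftrightarrow>
     (\<forall>\<delta> a b. 0 < \<delta> \<and> 0 \<le> a \<and> a < b \<and> b \<le> g 0 \<and> {0<..<\<delta>} \<times> {a<..<b} \<subseteq> cell L g \<longrightarrow>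
        edge_trace p ({0<..<\<delta>} \<times> {a<..<b}) 0 {a<..<b} \<phi> \<gamma>)"

definition right_trace ::
    "real \<Rightarrow> real \<Rightarrow> (real \<Rightarrow> real) \<Rightarrow> (real \<times> real \<Rightarrow> real) \<Rightarrow> (real \<Rightarrow> real) \<Rightarrow> bool" where
  "right_trace p L g \<phi> \<gamma> \<longleftrightarrow>
     (\<forall>\<delta> a b. 0 < \<delta> \<and> 0 \<le> a \<and> a < b \<and> b \<le> g L \<and> {L-\<delta><..<L} \<times> {a<..<b} \<subseteq> cell L g \<longrightarrow>
        edge_trace p ({L-\<delta><..<L} \<times> {a<..<b}) L {a<..<b} \<phi> \<gamma>)"

definition W1p_per :: "real \<Rightarrow> real \<Rightarrow> (real \<Rightarrow> real) \<Rightarrow> (real \<times> real \<Rightarrow> real) set" where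
  "W1p_per p L g =
     {\<phi> \<in> W1p p (cell L g). \<exists>\<gamma>. left_trace p L g \<phi> \<gamma> \<and> right_trace p L g \<phi> \<gamma>}"

section \<open>Unfolding operator\<close>

definition per_int :: "real \<Rightarrow> real \<Rightarrow> int" where
  "per_int L a = \<lfloor>a / L\<rfloor>"

definition per_frac :: "real \<Rightarrow> real \<Rightarrow> real" where
  "per_frac L a = a - of_int (per_int L a) * L"

lemma per_int_unique:
  assumes "0 < L"
  shows "n = per_int L a \<longleftrightarrow> 0 \<le> a - of_int n * L \<and> a - of_int n * L < L"
proof -
  have "n = per_int L a \<longleftrightarrow> of_int n \<le> a / L \<and> a / L < of_int n + 1"
    unfolding per_int_def using floor_eq_iff[of "a / L" n] by blast
  moreover have "of_int n \<le> a / L \<longleftrightarrow> 0 \<le> a - of_int n * L"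
    using assms pos_le_divide_eq[of L "of_int n" a] by simp
  moreover have "a / L < of_int n + 1 \<longleftrightarrow> a - of_int n * L < L"
    using assms pos_divide_less_eq[of L a "of_int n + 1"] by (simp add: distrib_right) linarith
  ultimately show ?thesis by blast
qed

definition N_last :: "real \<Rightarrow> real \<Rightarrow> real \<Rightarrow> int" where
  "N_last L \<alpha> \<epsilon> = (GREATEST n. \<epsilon> powr \<alpha> * L * (of_int n + 1) \<le> 1)"

lemma N_last_eq:
  assumes "0 < L" "0 < \<epsilon>"
  shows "N_last L \<alpha> \<epsilon> = \<lfloor>1 / (\<epsilon> powr \<alpha> * L)\<rfloor> - 1"
proof -
  have pos: "0 < \<epsilon> powr \<alpha> * L" using assms by simp
  have "\<epsilon> powr \<alpha> * L * (of_int n + 1) \<le> 1 \<longleftrightarrow> n \<le> \<lfloor>1 / (\<epsilon> powr \<alpha> * L)\<rfloor> - 1" for n :: int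
  proof -
    have "\<epsilon> powr \<alpha> * L * (of_int n + 1) \<le> 1 \<longleftrightarrow> of_int (n + 1) \<le> 1 / (\<epsilon> powr \<alpha> * L)"
      using pos_le_divide_eq[OF pos, of "of_int (n + 1)" 1] by (simp add: mult.commute)
    also have "\<dots> \<longleftrightarrow> n + 1 \<le> \<lfloor>1 / (\<epsilon> powr \<alpha> * L)\<rfloor>"
      by (rule le_floor_iff[symmetric])
    also have "\<dots> \<longleftrightarrow> n \<le> \<lfloor>1 / (\<epsilon> powr \<alpha> * L)\<rfloor> - 1" by linarith
    finally show ?thesis .
  qed
  then show ?thesis
    unfolding N_last_def by (intro Greatest_equality) (simp_all only: order_refl)
qed

definition I_eps :: "real \<Rightarrow> real \<Rightarrow> real \<Rightarrow> real set" where
  "I_eps L \<alpha> \<epsilon> =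
     interior (\<Union>k\<in>{0..N_last L \<alpha> \<epsilon>}.
       {of_int k * L * \<epsilon> powr \<alpha> .. (of_int k + 1) * L * \<epsilon> powr \<alpha>})"

(* Only the values on (0,1) \<times> cell L g are relevant. For vector fields ('b = real \<times> real) this is
   the componentwise operator. *)
definition unfolding_op ::
    "real \<Rightarrow> real \<Rightarrow> real \<Rightarrow> (real \<times> real \<Rightarrow> 'b::zero) \<Rightarrow> real \<times> real \<times> real \<Rightarrow> 'b" where
  "unfolding_op L \<alpha> \<epsilon> \<phi> = (\<lambda>(x, y1, y2).
     if x \<in> I_eps L \<alpha> \<epsilon>
     then \<phi> (\<epsilon> powr \<alpha> * of_int (per_int L (x / \<epsilon> powr \<alpha>)) * L + \<epsilon> powr \<alpha> * y1, \<epsilon> * y2)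
     else 0)"

section \<open>Homogenized problem and corrector\<close>

definition hom_coeff :: "real \<Rightarrow> real \<Rightarrow> real \<Rightarrow> (real \<Rightarrow> real) \<Rightarrow> real" where
  "hom_coeff p q L g =
     1 / (mean L g * mean L (\<lambda>s. 1 / g s powr (q - 1)) powr (p - 1))"

definition cell_average ::
    "real \<Rightarrow> (real \<Rightarrow> real) \<Rightarrow> (real \<times> real \<times> real \<Rightarrow> real) \<Rightarrow> real \<Rightarrow> real" where
  "cell_average L g h x =
     (LINT y|lebesgue_on (cell L g). h (x, y)) / measure lebesgue (cell L g)"

(* The function W_\<epsilon>, for du = \<partial>_x u and d1u1 = \<partial>_{y1} u_1, the latter a function of (x, y1) with
   y1 in [0, L), which per_frac extends L-periodically. *)
definition corrector ::
    "real \<Rightarrow> real \<Rightarrow> (real \<Rightarrow> real) \<Rightarrow> (real \<times> real \<Rightarrow> real) \<Rightarrow> real \<Rightarrow> real \<times> real \<Rightarrow> real \<times> real" where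
  "corrector L \<alpha> du d1u1 \<epsilon> = (\<lambda>(x, y). (du x + d1u1 (x, per_frac L (x / \<epsilon> powr \<alpha>)), 0))"

end

theory Submission
  imports Defs
begin

text \<open>
  The proof is an energy argument. The Bregman gap of the convex function $|x|^p$ is nonnegative and
  controls $|x-y|^p$ up to a small multiple of $|x|^p+|y|^p$. Put
  $v(x,y)=\partial_x u(x)\,/\,(g(y_1)^{p'-1}\langle 1/g^{p'-1}\rangle)$, which is the weak limit of
  $T_\varepsilon\partial_x u_\varepsilon$. Testing the thin equation with $u_\varepsilon$ and the limit
  equation with $u$ shows that the sum of the gaps between $(T_\varepsilon\nabla u_\varepsilon,T_\varepsilon u_\varepsilon)$
  and $((v,0),u)$ is at most a quantity that tends to $0$, as soon as the loads
  $\varepsilon^{-1}\int f^\varepsilon u_\varepsilon$ converge. Both gaps are nonnegative, so the gap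
  of the gradients tends to $0$ and $T_\varepsilon\nabla u_\varepsilon\to(v,0)$ strongly.

  The loads converge because $u_\varepsilon\to u$ strongly in the rescaled $L^p$ norm: the energy
  bound controls the oscillation of $u_\varepsilon$ on the parts of $R^\varepsilon$ over short intervals, and weak convergence
  identifies the averages over these parts. Finally, unfolding turns $W_\varepsilon$ into
  $\partial_x u$ at a point at distance $O(\varepsilon^\alpha)$, times a fixed function of $y_1$; hence
  $T_\varepsilon W_\varepsilon\to(v,0)$ strongly by continuity of translations in $L^p$.
\<close>

section \<open>Powers and their convexity gap\<close>

text \<open>Weak convergence of the unfolded states and of the unfolded loads says nothing about
  their product, and the nonlinear flux of u_\<epsilon> has no known limit. The gap removes the
  second difficulty: apart from norms, its only nonlinear ingredient is |b|^{p-2} b at the limit b,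
  so the sequence enters the cross term linearly. The gap of the states has to be added because the
  energy identity controls only the sum of both energies; unfolding drops the incomplete last cell,
  hence the comparison is an inequality. It closes because |Y| times the homogenized energy of u is
  exactly the L^p energy of the pair (v, u) on (0,1) x Y; this exactness is what fixes the form of
  the homogenized coefficient. The first difficulty is the reason for the oscillation estimates.
  With g merely lower semicontinuous the thin domain offers no boundary regularity, so weak
  derivatives are tested with products of one-variable functions on rectangles inside the domain,
  and an explicit kernel on slices takes the place of extension operators and compact
  embeddings.\<close>

lemma conjugate_exponent:
  fixes p q :: real
  assumes "1 < p" "1 / p + 1 / q = 1"
  shows "1 < q" "(p - 1) * q = p" "(q - 1) * p = q" "1 / q + 1 / p = 1" "p / q = p - 1"
proof -
  have "1 / q = 1 - 1 / p" "0 < 1 / p" "1 / p < 1" using assms by auto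
  then have *: "0 < 1 / q" "1 / q < 1" by auto
  then show q: "1 < q" by (metis divide_less_eq_1_pos zero_less_divide_1_iff)
  have "q + p = p * q" using assms q by (simp add: field_simps)
  then show "(p - 1) * q = p" "(q - 1) * p = q" "1 / q + 1 / p = 1" "p / q = p - 1"
    using q assms by (simp_all add: field_simps)
qed

lemma Holder_inequality:
  fixes f g :: "'a \<Rightarrow> real"
  assumes p: "1 < p" "1 / p + 1 / q = 1"
    and f: "f \<in> borel_measurable M" "integrable M (\<lambda>x. \<bar>f x\<bar> powr p)"
    and g: "g \<in> borel_measurable M" "integrable M (\<lambda>x. \<bar>g x\<bar> powr q)"
  shows "integrable M (\<lambda>x. f x * g x)"
    and "(\<integral>x. \<bar>f x * g x\<bar> \<partial>M) \<le> (\<integral>x. \<bar>f x\<bar> powr p \<partial>M) powr (1 / p) * (\<integral>x. \<bar>g x\<bar> powr q \<partial>M) powr (1 / q)"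
proof -
  note q = conjugate_exponent(1)[OF p]
  have young: "\<bar>f x * g x\<bar> \<le> \<bar>f x\<bar> powr p / p + \<bar>g x\<bar> powr q / q" for x
    using Youngs_inequality[of p q "\<bar>f x\<bar>" "\<bar>g x\<bar>"] p q by (simp add: abs_mult)
  show int: "integrable M (\<lambda>x. f x * g x)"
    by (rule Bochner_Integration.integrable_bound[of _ "\<lambda>x. \<bar>f x\<bar> powr p / p + \<bar>g x\<bar> powr q / q"])
      (use f g young p q in \<open>auto intro!: AE_I2\<close>)
  define A where "A = (\<integral>x. \<bar>f x\<bar> powr p \<partial>M)"
  define B where "B = (\<integral>x. \<bar>g x\<bar> powr q \<partial>M)"
  have AB: "A \<ge> 0" "B \<ge> 0" unfolding A_def B_def by (auto intro!: integral_nonneg_AE)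
  have main: "(\<integral>x. \<bar>f x * g x\<bar> \<partial>M) \<le> A powr (1 / p) * B powr (1 / q)"
  \<comment> \<open>The normalisation below divides by both norms; if one of them is 0, the product
    vanishes almost everywhere.\<close>
  proof (cases "A = 0 \<or> B = 0")
    case True
    have "AE x in M. f x * g x = 0"
    proof (cases "A = 0")
      case True
      then have "AE x in M. \<bar>f x\<bar> powr p = 0"
        using f unfolding A_def by (subst (asm) integral_nonneg_eq_0_iff_AE) auto
      then show ?thesis by eventually_elim auto
    next
      case False
      then have "AE x in M. \<bar>g x\<bar> powr q = 0"
        using g True unfolding B_def by (subst (asm) integral_nonneg_eq_0_iff_AE) auto
      then show ?thesis by eventually_elim auto
    qed
    then have "(\<integral>x. \<bar>f x * g x\<bar> \<partial>M) = (\<integral>x. 0 \<partial>M)"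
      by (intro integral_cong_AE) (use f g in auto)
    then show ?thesis by simp
  next
    case False
    define a where "a = A powr (1 / p)"
    define b where "b = B powr (1 / q)"
    have ab: "a > 0" "b > 0" "a powr p = A" "b powr q = B"
      using False AB p q by (auto simp: a_def b_def powr_powr)
    \<comment> \<open>Young for the functions scaled to unit norm: the right side integrates to 1/p
      + 1/q = 1.\<close>
    have "\<bar>f x * g x\<bar> / (a * b) \<le> \<bar>f x\<bar> powr p / A / p + \<bar>g x\<bar> powr q / B / q" for x
      using Youngs_inequality[of p q "\<bar>f x\<bar> / a" "\<bar>g x\<bar> / b"] p q ab
      by (simp add: abs_mult powr_divide)
    then have "(\<integral>x. \<bar>f x * g x\<bar> / (a * b) \<partial>M) \<le> (\<integral>x. \<bar>f x\<bar> powr p / A / p + \<bar>g x\<bar> powr q / B / q \<partial>M)"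
      by (intro integral_mono) (use f g int in auto)
    also have "\<dots> = 1 / p + 1 / q"
      using f g False by (simp add: A_def[symmetric] B_def[symmetric])
    finally have "(\<integral>x. \<bar>f x * g x\<bar> \<partial>M) / (a * b) \<le> 1" using p by simp
    then show ?thesis using ab by (simp add: a_def b_def divide_le_eq)
  qed
  then show "(\<integral>x. \<bar>f x * g x\<bar> \<partial>M) \<le> (\<integral>x. \<bar>f x\<bar> powr p \<partial>M) powr (1 / p) * (\<integral>x. \<bar>g x\<bar> powr q \<partial>M) powr (1 / q)"
    by (simp add: A_def B_def)
qed

text \<open>Holder against the indicator of \<open>S\<close>, whose measure receives the exponent p
  / q = p - 1. It converts the L^1 bounds on slices and rectangles into L^p bounds with the right
  power of the length or area.\<close>

lemma powr_integral_le:
  fixes f :: "'a \<Rightarrow> real"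
  assumes p: "1 < p" and f: "f \<in> borel_measurable M" "integrable M (\<lambda>x. \<bar>f x\<bar> powr p)"
    and S: "S \<in> sets M" "emeasure M S < \<infinity>"
  shows "integrable M (\<lambda>x. indicator S x * f x)"
    and "(\<integral>x. indicator S x * \<bar>f x\<bar> \<partial>M) powr p \<le> measure M S powr (p - 1) * (\<integral>x. indicator S x * \<bar>f x\<bar> powr p \<partial>M)"
proof -
  define q where "q = p / (p - 1)"
  have pq: "1 / p + 1 / q = 1" using p by (simp add: q_def field_simps)
  note c = conjugate_exponent[OF p pq]
  let ?f = "\<lambda>x. indicator S x * f x"
  have meas: "?f \<in> borel_measurable M" using f S by measurable
  have e: "\<bar>?f x\<bar> powr p = indicator S x * \<bar>f x\<bar> powr p" for x
    using p by (simp add: indicator_def)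
  have e2: "\<bar>indicator S x :: real\<bar> powr q = indicator S x" for x
    using c by (simp add: indicator_def)
  have i1: "integrable M (\<lambda>x. \<bar>?f x\<bar> powr p)"
    unfolding e using integrable_real_mult_indicator[OF S(1) f(2)] by (simp add: mult.commute)
  have i2: "integrable M (\<lambda>x. \<bar>indicator S x :: real\<bar> powr q)"
    unfolding e2 using S by (simp add: less_top)
  have ms: "(indicator S :: 'a \<Rightarrow> real) \<in> borel_measurable M" using S by simp
  note H = Holder_inequality[OF p pq meas i1 ms i2]
  have e3: "?f x * indicator S x = ?f x" for x by (simp add: indicator_def)
  show "integrable M ?f" using H(1) by (simp add: e3)
  have "(\<integral>x. indicator S x * \<bar>f x\<bar> \<partial>M) = (\<integral>x. \<bar>?f x * indicator S x\<bar> \<partial>M)"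
    by (simp add: e3 abs_mult)
  also have "\<dots> \<le> (\<integral>x. indicator S x * \<bar>f x\<bar> powr p \<partial>M) powr (1 / p) * measure M S powr (1 / q)"
    using H(2) S unfolding e e2 by simp
  finally have "(\<integral>x. indicator S x * \<bar>f x\<bar> \<partial>M) powr p \<le> ((\<integral>x. indicator S x * \<bar>f x\<bar> powr p \<partial>M) powr (1 / p) * measure M S powr (1 / q)) powr p"
    using p by (intro powr_mono2) (auto intro!: integral_nonneg_AE)
  also have "\<dots> = measure M S powr (p - 1) * (\<integral>x. indicator S x * \<bar>f x\<bar> powr p \<partial>M)"
    using p c(5) by (subst powr_mult) (auto simp: powr_powr intro!: integral_nonneg_AE)
  finally show "(\<integral>x. indicator S x * \<bar>f x\<bar> \<partial>M) powr p \<le> measure M S powr (p - 1) * (\<integral>x. indicator S x * \<bar>f x\<bar> powr p \<partial>M)" .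
qed

lemma norm_add_powr_le:
  fixes a b :: "'a::real_normed_vector"
  assumes "0 \<le> p"
  shows "norm (a + b) powr p \<le> 2 powr p * (norm a powr p + norm b powr p)"
proof -
  have "norm (a + b) \<le> 2 * max (norm a) (norm b)" using norm_triangle_ineq[of a b] by linarith
  then have "norm (a + b) powr p \<le> (2 * max (norm a) (norm b)) powr p"
    using assms by (intro powr_mono2) auto
  also have "\<dots> = 2 powr p * max (norm a) (norm b) powr p" by (simp add: powr_mult)
  also have "max (norm a) (norm b) powr p \<le> norm a powr p + norm b powr p" by (simp add: max_def)
  finally show ?thesis by simp
qed

lemma norm_diff_powr_le:
  fixes a b :: "'a::real_normed_vector"
  assumes "0 \<le> p"
  shows "norm (a - b) powr p \<le> 2 powr p * (norm a powr p + norm b powr p)"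
  using norm_add_powr_le[OF assms, of a "- b"] by simp

section \<open>Strict convexity of powers and the Bregman gap\<close>

lemma powr_mean_value:
  fixes s t p :: real
  assumes p: "1 < p" and "0 \<le> s" "s < t"
  obtains z where "s < z" "z < t" "t powr p - s powr p = (t - s) * (p * z powr (p - 1))"
proof -
  have c: "continuous_on {s..t} (\<lambda>x. x powr p)"
    using p assms by (intro continuous_on_powr' continuous_on_id continuous_on_const) auto
  have d: "((\<lambda>x. x powr p) has_real_derivative p * x powr (p - 1)) (at x)" if "s < x" for x
    using that assms by (intro has_real_derivative_powr) auto
  obtain l z where z: "s < z" "z < t" "((\<lambda>x. x powr p) has_real_derivative l) (at z)"
      "t powr p - s powr p = (t - s) * l"
    using MVT[OF assms(3) c] d by (metis real_differentiable_def)
  have "l = p * z powr (p - 1)" using DERIV_unique[OF z(3) d[OF z(1)]] .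
  then show ?thesis using z that by blast
qed

text \<open>The mean value theorem replaces the slope of the chord by p z^{p-1} with z strictly
  between \<open>s\<close> and \<open>t\<close>, and z^{p-1} is strictly increasing. Strictness is
  what later identifies the zeros of the gap.\<close>

lemma powr_tangent_strict:
  fixes s t p :: real
  assumes p: "1 < p" and "0 \<le> s" "0 \<le> t" "s \<noteq> t"
  shows "t powr p + p * t powr (p - 1) * (s - t) < s powr p"
proof (cases "s < t")
  case True
  obtain z where z: "s < z" "z < t" "t powr p - s powr p = (t - s) * (p * z powr (p - 1))"
    using powr_mean_value[OF p assms(2) True] .
  have "z powr (p - 1) < t powr (p - 1)" using z assms by (intro powr_less_mono2) auto
  then have "(t - s) * (p * z powr (p - 1)) < (t - s) * (p * t powr (p - 1))" using True p by simp
  then show ?thesis using z(3) by (simp add: algebra_simps)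
next
  case False
  then have ts: "t < s" using assms by simp
  obtain z where z: "t < z" "z < s" "s powr p - t powr p = (s - t) * (p * z powr (p - 1))"
    using powr_mean_value[OF p assms(3) ts] .
  have "t powr (p - 1) < z powr (p - 1)" using z assms by (intro powr_less_mono2) auto
  then have "(s - t) * (p * t powr (p - 1)) < (s - t) * (p * z powr (p - 1))" using ts p by simp
  then show ?thesis using z(3) by (simp add: algebra_simps)
qed

text \<open>The Bregman divergence of $|x|^p$.\<close>

definition powr_gap :: "real \<Rightarrow> 'a::euclidean_space \<Rightarrow> 'a \<Rightarrow> real" where
  "powr_gap p a b = norm a powr p - norm b powr p - p * (norm b powr (p - 2) * (b \<bullet> (a - b)))"

text \<open>Both summands are nonnegative on their own: the first is the tangent-line defect of t^p
  at the norms, the second the Cauchy-Schwarz defect. A vanishing gap therefore forces equal norms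
  and, unless b = 0, equal directions.\<close>

lemma powr_gap_split:
  fixes a b :: "'a::euclidean_space"
  assumes p: "1 < p"
  shows "powr_gap p a b = (norm a powr p - norm b powr p - p * norm b powr (p - 1) * (norm a - norm b))
      + p * norm b powr (p - 2) * (norm b * norm a - b \<bullet> a)"
proof (cases "b = 0")
  case False
  then have "norm b powr (p - 1) = norm b powr (p - 2) * norm b"
    using powr_add[of "norm b" "p - 2" 1] by simp
  moreover have "b \<bullet> b = norm b * norm b" by (simp add: dot_square_norm power2_eq_square)
  ultimately show ?thesis unfolding powr_gap_def by (simp add: inner_diff_right algebra_simps)
qed (auto simp: powr_gap_def)

lemma powr_gap_nonneg:
  assumes p: "1 < p" shows "0 \<le> powr_gap p a b"
proof -
  have "0 \<le> norm a powr p - norm b powr p - p * norm b powr (p - 1) * (norm a - norm b)"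
    using powr_tangent_strict[OF p, of "norm a" "norm b"] by (cases "norm a = norm b") auto
  moreover have "0 \<le> norm b * norm a - b \<bullet> a" using norm_cauchy_schwarz[of b a] by simp
  ultimately show ?thesis unfolding powr_gap_split[OF p] using p by simp
qed

lemma powr_gap_zeroD:
  assumes p: "1 < p" and z: "powr_gap p a b = 0" shows "a = b"
proof -
  have 1: "0 \<le> norm a powr p - norm b powr p - p * norm b powr (p - 1) * (norm a - norm b)"
    using powr_tangent_strict[OF p, of "norm a" "norm b"] by (cases "norm a = norm b") auto
  have 2: "0 \<le> p * norm b powr (p - 2) * (norm b * norm a - b \<bullet> a)"
    using norm_cauchy_schwarz[of b a] p by simp
  have "norm a powr p - norm b powr p - p * norm b powr (p - 1) * (norm a - norm b) = 0"
      and 3: "p * norm b powr (p - 2) * (norm b * norm a - b \<bullet> a) = 0"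
    using 1 2 z unfolding powr_gap_split[OF p] by linarith+
  then have n: "norm a = norm b"
    using powr_tangent_strict[OF p, of "norm a" "norm b"] by (cases "norm a = norm b") auto
  show ?thesis
  proof (cases "b = 0")
    case False
    then have "b \<bullet> a = norm b * norm a" using 3 p by auto
    then have "norm b *\<^sub>R a = norm a *\<^sub>R b" by (simp add: norm_cauchy_schwarz_eq)
    then show ?thesis using n False by simp
  qed (use n in auto)
qed

text \<open>For p < 2 the scalar factor is unbounded near 0, so continuity at the origin is read off
  from the norm of the product, which is |b|^{p-1}.\<close>

lemma continuous_powr_scaleR:
  assumes p: "1 < p" shows "continuous_on UNIV (\<lambda>b::'a::euclidean_space. norm b powr (p - 2) *\<^sub>R b)"
proof -
  have "isCont (\<lambda>b::'a. norm b powr (p - 2) *\<^sub>R b) b" for b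
  proof (cases "b = 0")
    case True
    have "((\<lambda>b::'a. norm b powr (p - 1)) \<longlongrightarrow> 0) (at 0)"
      by (rule tendsto_eq_intros refl | use p in force)+
    moreover have "norm (norm b powr (p - 2) *\<^sub>R b) = norm b powr (p - 1)" for b :: 'a
    proof (cases "b = 0")
      case False
      then show ?thesis using powr_add[of "norm b" "p - 2" 1] by simp
    qed auto
    ultimately have "((\<lambda>b::'a. norm b powr (p - 2) *\<^sub>R b) \<longlongrightarrow> 0) (at 0)"
      by (subst tendsto_norm_zero_iff[symmetric]) simp
    then show ?thesis unfolding True isCont_def by simp
  next
    case False
    then show ?thesis by (intro continuous_intros) auto
  qed
  then show ?thesis by (simp add: continuous_on_eq_continuous_at)
qed

lemma powr_gap_scale:
  assumes "0 < r" shows "powr_gap p (r *\<^sub>R a) (r *\<^sub>R b) = r powr p * powr_gap p a b"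
proof -
  have "r powr (p - 2) * r * r = r powr p"
    using assms powr_add[of r "p - 2" 2] by (simp add: power2_eq_square)
  then show ?thesis using assms
    by (simp add: powr_gap_def powr_mult scaleR_diff_right[symmetric] right_diff_distrib)
qed

lemma continuous_on_norm_powr:
  fixes f :: "'a::topological_space \<Rightarrow> 'b::real_normed_vector"
  assumes "0 < p" "continuous_on S f" shows "continuous_on S (\<lambda>x. norm (f x) powr p)"
  using assms by (intro continuous_on_powr' continuous_intros) auto

text \<open>By homogeneity it suffices to consider $|a|^p+|b|^p=1$; on the compact part of this set where
  $|a-b|^p\geq\eta$ the gap has a positive minimum.\<close>

lemma powr_gap_control:
  fixes p \<eta> :: real
  assumes p: "1 < p" and eta: "0 < \<eta>"
  obtains C where "0 \<le> C"
    "\<And>a b :: 'a::euclidean_space. norm (a - b) powr p \<le> \<eta> * (norm a powr p + norm b powr p) + C * powr_gap p a b"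
proof -
  define K where "K = {z :: 'a \<times> 'a. norm (fst z) powr p + norm (snd z) powr p = 1 \<and> \<eta> \<le> norm (fst z - snd z) powr p}"
  have "closed K" unfolding K_def
    by (intro closed_Collect_conj closed_Collect_eq closed_Collect_le continuous_on_add continuous_on_norm_powr continuous_intros) (use p in auto)
  moreover have "bounded K"
  proof (rule boundedI[where B = 2])
    fix z assume "z \<in> K"
    then have s: "norm (fst z) powr p + norm (snd z) powr p = 1" by (simp add: K_def)
    have "norm (fst z) powr p \<le> 1" "norm (snd z) powr p \<le> 1"
      using s powr_ge_zero[of "norm (fst z)" p] powr_ge_zero[of "norm (snd z)" p] by linarith+
    then have "norm (fst z) \<le> 1" "norm (snd z) \<le> 1"
      using p by (smt (verit) gr_one_powr)+
    then show "norm z \<le> 2" using norm_Pair_le[of "fst z" "snd z"] by simp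
  qed
  ultimately have "compact K" by (simp add: compact_eq_bounded_closed)
  have cont: "continuous_on K (\<lambda>z. powr_gap p (fst z) (snd z))"
  proof -
    have *: "(\<lambda>z. powr_gap p (fst z) (snd z)) = (\<lambda>z::'a\<times>'a. norm (fst z) powr p - norm (snd z) powr p -
       p * ((norm (snd z) powr (p - 2) *\<^sub>R snd z) \<bullet> (fst z - snd z)))"
      by (simp add: powr_gap_def)
    show ?thesis unfolding *
      by (intro continuous_on_diff continuous_on_norm_powr continuous_intros continuous_on_compose2[OF continuous_powr_scaleR[OF p]]) (use p in auto)
  qed
  \<comment> \<open>The gap vanishes only for a = b, which \<open>K\<close> excludes because \<eta>
    > 0. If \<open>K\<close> is empty, any positive \<open>m\<close> serves.\<close>
  obtain m where m: "m > 0" "\<And>z. z \<in> K \<Longrightarrow> m \<le> powr_gap p (fst z) (snd z)"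
  proof (cases "K = {}")
    case True then show ?thesis using that[of 1] by auto
  next
    case False
    obtain z0 where z0: "z0 \<in> K" "\<And>z. z \<in> K \<Longrightarrow> powr_gap p (fst z0) (snd z0) \<le> powr_gap p (fst z) (snd z)"
      using continuous_attains_inf[OF \<open>compact K\<close> False cont] by auto
    have "fst z0 \<noteq> snd z0" using z0(1) eta by (auto simp: K_def)
    then have "powr_gap p (fst z0) (snd z0) > 0"
      using powr_gap_nonneg[OF p, of "fst z0" "snd z0"] powr_gap_zeroD[OF p, of "fst z0" "snd z0"] by fastforce
    then show ?thesis using that z0(2) by blast
  qed
  \<comment> \<open>When |a|^p + |b|^p = 1, the left side is at most 2^p, so \<open>C\<close> times
    the minimal gap \<open>m\<close> already dominates it.\<close>
  define C where "C = 2 powr p / m"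
  have "norm (a - b) powr p \<le> \<eta> * (norm a powr p + norm b powr p) + C * powr_gap p a b" for a b :: 'a
  proof (cases "a = 0 \<and> b = 0")
    case True then show ?thesis by (simp add: powr_gap_def)
  next
    case False
    define s where "s = norm a powr p + norm b powr p"
    have s: "s > 0" using False by (auto simp: s_def add_nonneg_pos add_pos_nonneg)
    define r where "r = s powr (1 / p)"
    have r: "r > 0" "r powr p = s" using s p by (auto simp: r_def powr_powr)
    define a' where "a' = a /\<^sub>R r"
    define b' where "b' = b /\<^sub>R r"
    have ab: "a = r *\<^sub>R a'" "b = r *\<^sub>R b'" using r by (auto simp: a'_def b'_def)
    have "r powr p * (norm a' powr p + norm b' powr p) = s"
      unfolding s_def ab using r by (simp add: powr_mult algebra_simps)
    then have s1: "norm a' powr p + norm b' powr p = 1" using r s by simp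
    have "norm (a' - b') powr p \<le> \<eta> + C * powr_gap p a' b'"
    proof (cases "norm (a' - b') powr p < \<eta>")
      case True
      moreover have "0 \<le> C * powr_gap p a' b'" using powr_gap_nonneg[OF p, of a' b'] m by (simp add: C_def)
      ultimately show ?thesis by linarith
    next
      case False
      then have "m \<le> powr_gap p a' b'" using m(2)[of "(a', b')"] s1 by (simp add: K_def)
      then have "2 powr p \<le> C * powr_gap p a' b'" using m(1) by (simp add: C_def field_simps)
      moreover have "norm (a' - b') powr p \<le> 2 powr p"
        using norm_diff_powr_le[of p a' b'] p s1 by simp
      ultimately show ?thesis using eta by linarith
    qed
    then have "r powr p * norm (a' - b') powr p \<le> r powr p * (\<eta> + C * powr_gap p a' b')"
      by (intro mult_left_mono) auto
    moreover have "norm (a - b) powr p = r powr p * norm (a' - b') powr p"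
      unfolding ab using r by (simp add: powr_mult scaleR_diff_right[symmetric])
    moreover have "powr_gap p a b = r powr p * powr_gap p a' b'"
      unfolding ab using r powr_gap_scale by blast
    ultimately show ?thesis using r(2) by (simp add: s_def algebra_simps)
  qed
  moreover have "C \<ge> 0" using m by (simp add: C_def)
  ultimately show ?thesis using that by blast
qed

section \<open>Smooth test functions\<close>

text \<open>\<open>Ck\<close> refers to \<open>frechet_derivative\<close>; uniqueness of the
  derivative makes it possible to supply any explicit one instead.\<close>

lemma CkI:
  assumes "\<And>x. (f has_derivative f' x) (at x)" "\<And>b. b \<in> Basis \<Longrightarrow> Ck k (\<lambda>x. f' x b)"
  shows "Ck (Suc k) f"
proof -
  have "frechet_derivative f (at x) = f' x" for x
    using frechet_derivative_at[OF assms(1)] by simp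
  then show ?thesis using assms by (auto simp: differentiable_def)
qed

lemma CkD:
  assumes "Ck (Suc k) f"
  shows "(f has_derivative frechet_derivative f (at x)) (at x)"
    "b \<in> Basis \<Longrightarrow> Ck k (\<lambda>x. frechet_derivative f (at x) b)"
  using assms frechet_derivative_works by auto

lemma Ck_continuous: "Ck k f \<Longrightarrow> continuous_on UNIV f"
  by (cases k) (simp_all add: differentiable_imp_continuous_on differentiable_on_def)

lemma Ck_SucD: "Ck (Suc k) f \<Longrightarrow> Ck k f"
proof (induction k arbitrary: f)
  case 0 then show ?case using Ck_continuous by (metis Ck.simps(1))
next
  case (Suc k) then show ?case by (intro CkI[OF CkD(1)[OF Suc.prems]] Suc.IH) (use CkD(2) Suc.prems in blast)
qed

lemma Ck_const: "Ck k (\<lambda>x. c)"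
proof (induction k arbitrary: c)
  case (Suc k) show ?case by (rule CkI[where f' = "\<lambda>x b. 0"]) (auto intro: Suc)
qed simp

lemma Ck_add: "Ck k f \<Longrightarrow> Ck k g \<Longrightarrow> Ck k (\<lambda>x. f x + g x)"
proof (induction k arbitrary: f g)
  case (Suc k)
  show ?case
    by (rule CkI[OF has_derivative_add[OF CkD(1)[OF Suc.prems(1)] CkD(1)[OF Suc.prems(2)]]])
      (intro Suc.IH CkD(2)[OF Suc.prems(1)] CkD(2)[OF Suc.prems(2)])
qed (simp add: continuous_on_add)

lemma Ck_mult: "Ck k f \<Longrightarrow> Ck k g \<Longrightarrow> Ck k (\<lambda>x. f x * g x)"
proof (induction k arbitrary: f g)
  case (Suc k)
  show ?case
    by (rule CkI[OF has_derivative_mult[OF CkD(1)[OF Suc.prems(1)] CkD(1)[OF Suc.prems(2)]]])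
      (intro Ck_add Suc.IH Ck_SucD[OF Suc.prems(1)] Ck_SucD[OF Suc.prems(2)]
          CkD(2)[OF Suc.prems(1)] CkD(2)[OF Suc.prems(2)])
qed (simp add: continuous_on_mult)

lemma Ck_realI:
  fixes f :: "real \<Rightarrow> real"
  assumes "\<And>x. (f has_real_derivative f' x) (at x)" "Ck k f'"
  shows "Ck (Suc k) f"
  by (rule CkI[where f' = "\<lambda>x b. f' x * b"])
    (use assms in \<open>auto simp: has_field_derivative_def mult_commute_abs\<close>)

lemma Ck_realD:
  fixes f :: "real \<Rightarrow> real"
  assumes "Ck (Suc k) f"
  shows "(f has_real_derivative deriv f x) (at x)" "Ck k (deriv f)"
proof -
  have "f field_differentiable at x" for x
    using assms by (simp add: field_differentiable_def real_differentiable_def[symmetric])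
  then have d: "(f has_real_derivative deriv f x) (at x)" for x
    by (rule field_differentiable_derivI)
  then show "(f has_real_derivative deriv f x) (at x)" .
  have "frechet_derivative f (at x) 1 = deriv f x" for x
    using frechet_derivative_at[of f "\<lambda>h. deriv f x * h" x] d[of x]
    by (simp add: has_field_derivative_def) (metis mult.right_neutral)
  then show "Ck k (deriv f)" using assms by simp
qed

text \<open>All test functions are built from functions of one real variable; this carries
  smoothness to shifted and reflected arguments on the line and, through the projections, to the
  plane.\<close>

lemma Ck_compose_affine:
  fixes l :: "'a::euclidean_space \<Rightarrow> real"
  assumes "bounded_linear l" "Ck k f"
  shows "Ck k (\<lambda>z. f (l z + d))"
  using assms(2)
proof (induction k arbitrary: f)
  case 0
  have "continuous_on UNIV l" using assms(1) by (rule linear_continuous_on)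
  then show ?case using 0 by (auto intro!: continuous_on_compose2[of UNIV f] continuous_intros)
next
  case (Suc k)
  have "((\<lambda>z. f (l z + d)) has_derivative (\<lambda>b. deriv f (l z + d) * l b)) (at z)" for z
  proof -
    have l: "((\<lambda>z. l z + d) has_derivative l) (at z)"
      using has_derivative_add[OF bounded_linear_imp_has_derivative[OF assms(1)] has_derivative_const] by simp
    show ?thesis
      using has_derivative_compose[OF l] Ck_realD(1)[OF Suc.prems, of "l z + d"]
      by (auto simp: has_field_derivative_def)
  qed
  then show ?case by (rule CkI) (intro Ck_mult Ck_const Suc.IH Ck_realD(2)[OF Suc.prems])
qed

lemma Ck_exp: "Ck k f \<Longrightarrow> Ck k (\<lambda>x. exp (f x))"
proof (induction k)
  case (Suc k)
  have "((\<lambda>x. exp (f x)) has_derivative (\<lambda>h. frechet_derivative f (at x) h * exp (f x))) (at x)" for x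
    using has_derivative_compose[OF CkD(1)[OF Suc.prems], of exp "(*) (exp (f x))"] DERIV_exp[of "f x"]
    by (simp add: has_field_derivative_def mult.commute)
  then show ?case
    by (rule CkI) (intro Ck_mult CkD(2)[OF Suc.prems] Suc.IH Ck_SucD[OF Suc.prems])
qed (simp add: continuous_on_exp)

lemma smooth_realI:
  fixes f :: "real \<Rightarrow> real"
  assumes "\<And>x. (f has_real_derivative f' x) (at x)" "smooth f'"
  shows "smooth f"
  unfolding smooth_def
proof
  fix k show "Ck k f"
    using Ck_SucD[OF Ck_realI[OF assms(1), of k]] assms(2) by (simp add: smooth_def)
qed

section \<open>Flat exponentials and smooth cutoffs\<close>

text \<open>Differentiating exp(-1/x) x^{-j} gives a combination of the functions with index j + 2
  and j + 1. The whole family is thus closed under differentiation, and its smoothness is one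
  induction with \<open>j\<close> arbitrary.\<close>

definition flat_exp :: "nat \<Rightarrow> real \<Rightarrow> real" where
  "flat_exp j x = (if 0 < x then exp (- 1 / x) / x ^ j else 0)"

lemma flat_exp_tendsto_0: "(flat_exp j \<longlongrightarrow> 0) (at 0)"
proof -
  have "((\<lambda>x::real. x ^ j * exp (- x)) \<longlongrightarrow> 0) at_top"
    using tendsto_power_div_exp_0[of j] by (simp add: exp_minus divide_inverse)
  then have "((\<lambda>x. inverse x ^ j * exp (- inverse x)) \<longlongrightarrow> 0) (at_right (0::real))"
    by (rule filterlim_compose) (rule filterlim_inverse_at_top_right)
  then have r: "(flat_exp j \<longlongrightarrow> 0) (at_right 0)"
    by (rule Lim_transform_eventually)
      (auto simp: flat_exp_def eventually_at_right_less field_simps intro!: eventually_at_rightI[of 0 1])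
  have l: "(flat_exp j \<longlongrightarrow> 0) (at_left 0)"
    by (rule tendsto_eventually) (auto simp: flat_exp_def eventually_at_left_field intro!: exI[of _ "-1"])
  show ?thesis using r l by (simp add: filterlim_at_split)
qed

lemma flat_exp_deriv:
  "(flat_exp j has_real_derivative flat_exp (j + 2) x - real j * flat_exp (j + 1) x) (at x)"
proof -
  consider "x < 0" | "x = 0" | "0 < x" by linarith
  then show ?thesis
  proof cases
    case 1
    have "(flat_exp j has_real_derivative 0) (at x)"
      by (rule has_field_derivative_transform_within_open[where f = "\<lambda>_. 0" and S = "{..<0}"])
        (use 1 in \<open>auto simp: flat_exp_def\<close>)
    then show ?thesis using 1 by (simp add: flat_exp_def)
  next
    \<comment> \<open>At 0 the difference quotient of \<open>flat_exp j\<close> is literally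
      \<open>flat_exp (j + 1)\<close>, whose limit is already known.\<close>
    case 2
    have "((\<lambda>h. flat_exp (j + 1) h) \<longlongrightarrow> 0) (at 0)" by (rule flat_exp_tendsto_0)
    moreover have "(flat_exp j (0 + h) - flat_exp j 0) / h = flat_exp (j + 1) h" for h
      by (simp add: flat_exp_def)
    ultimately have "(flat_exp j has_real_derivative 0) (at 0)"
      by (simp add: DERIV_def)
    then show ?thesis using 2 by (simp add: flat_exp_def)
  next
    case 3
    have "((\<lambda>x. exp (- 1 / x) / x ^ j) has_real_derivative flat_exp (j + 2) x - real j * flat_exp (j + 1) x) (at x)"
      using 3 by (auto intro!: derivative_eq_intros simp: flat_exp_def field_simps power2_eq_square)
        (cases j; simp add: field_simps)
    then show ?thesis
      by (rule has_field_derivative_transform_within_open[where S = "{0<..}"])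
        (use 3 in \<open>auto simp: flat_exp_def\<close>)
  qed
qed

lemma smooth_flat_exp: "smooth (flat_exp j)"
proof -
  have "Ck k (flat_exp j)" for k
  proof (induction k arbitrary: j)
    case 0 then show ?case
      using flat_exp_deriv DERIV_isCont by (fastforce simp: continuous_on_eq_continuous_at)
  next
    case (Suc k)
    have "Ck k (\<lambda>x. flat_exp (j + 2) x + (- real j) * flat_exp (j + 1) x)"
      by (intro Ck_add Ck_mult Ck_const Suc.IH)
    then show ?case by (intro Ck_realI[OF flat_exp_deriv]) simp
  qed
  then show ?thesis by (simp add: smooth_def)
qed

lemma test_function_intervalI:
  assumes "smooth \<phi>" "a < a'" "b' < b" "\<And>x. \<phi> x \<noteq> 0 \<Longrightarrow> a' \<le> x \<and> x \<le> b'"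
  shows "test_function {a<..<b} (\<phi> :: real \<Rightarrow> real)"
proof -
  have s: "closure {x. \<phi> x \<noteq> 0} \<subseteq> {a'..b'}" by (rule closure_minimal) (use assms(4) in auto)
  moreover have "compact (closure {x. \<phi> x \<noteq> 0})"
    using s by (simp add: compact_closure) (meson bounded_closed_interval bounded_subset closure_subset subset_trans)
  ultimately show ?thesis unfolding test_function_def using assms(1-3) by force
qed

text \<open>\<open>\<beta> n\<close> is a product bump, positive exactly on (a + r_n, b - r_n), and
  t -> 1 - exp(-n t) pushes positive values towards 1 while fixing 0. The shrinking margin r_n keeps
  each support compactly inside the interval. Convergence holds at every point, so no exceptional
  null set has to be carried along.\<close>

lemma indicator_smooth_approx:
  fixes a b :: real
  obtains \<kappa> :: "nat \<Rightarrow> real \<Rightarrow> real" where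
    "\<And>n. smooth (\<kappa> n)" "\<And>n x. 0 \<le> \<kappa> n x" "\<And>n x. \<kappa> n x \<le> 1"
    "\<And>n. \<exists>a'>a. \<exists>b'<b. \<forall>x. \<kappa> n x \<noteq> 0 \<longrightarrow> a' \<le> x \<and> x \<le> b'"
    "\<And>x. (\<lambda>n. \<kappa> n x) \<longlonglongrightarrow> indicator {a<..<b} x"
proof -
  define r where "r n = 1 / real (Suc n)" for n
  define \<beta> where "\<beta> n x = flat_exp 0 (x - a - r n) * flat_exp 0 (b - r n - x)" for n x
  define \<kappa> where "\<kappa> n x = 1 - exp (- (real n * \<beta> n x))" for n x
  have r0: "r n > 0" for n by (simp add: r_def)
  have rlim: "r \<longlonglongrightarrow> 0" unfolding r_def by (rule LIMSEQ_Suc[OF lim_1_over_n])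
  have e: "flat_exp 0 x = (if 0 < x then exp (- 1 / x) else 0)" for x by (simp add: flat_exp_def)
  have \<beta>0: "0 \<le> \<beta> n x" for n x by (simp add: \<beta>_def e)
  have sm: "smooth (\<kappa> n)" for n
  proof -
    have "Ck k (\<lambda>x. 1 + (- 1) * exp ((- real n) * (flat_exp 0 (1 * x + (- a - r n)) * flat_exp 0 ((-1) * x + (b - r n)))))" for k
      by (intro Ck_add Ck_mult Ck_const Ck_exp Ck_compose_affine bounded_linear_mult_right)
        (use smooth_flat_exp in \<open>auto simp: smooth_def\<close>)
    moreover have "(\<lambda>x. 1 + (- 1) * exp ((- real n) * (flat_exp 0 (1 * x + (- a - r n)) * flat_exp 0 ((-1) * x + (b - r n))))) = \<kappa> n"
      by (rule ext) (simp add: \<kappa>_def \<beta>_def algebra_simps)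
    ultimately show ?thesis by (simp add: smooth_def)
  qed
  have lim: "(\<lambda>n. \<kappa> n x) \<longlonglongrightarrow> indicator {a<..<b} x" for x
  proof (cases "x \<in> {a<..<b}")
    case False
    then have "\<kappa> n x = 0" for n using r0[of n] by (auto simp: \<kappa>_def \<beta>_def e)
    then show ?thesis using False by simp
  next
    case True
    define c where "c = exp (- 1 / (x - a)) * exp (- 1 / (b - x))"
    have "(\<lambda>n. exp (- 1 / (x - a - r n)) * exp (- 1 / (b - r n - x))) \<longlonglongrightarrow> exp (- 1 / (x - a - 0)) * exp (- 1 / (b - 0 - x))"
      by (intro tendsto_intros rlim) (use True in auto)
    then have l: "(\<lambda>n. exp (- 1 / (x - a - r n)) * exp (- 1 / (b - r n - x))) \<longlonglongrightarrow> c" by (simp add: c_def)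
    have "eventually (\<lambda>n. r n < min (x - a) (b - x)) sequentially"
      by (rule order_tendstoD(2)[OF rlim]) (use True in auto)
    then have ev: "eventually (\<lambda>n. exp (- 1 / (x - a - r n)) * exp (- 1 / (b - r n - x)) = \<beta> n x) sequentially"
      by eventually_elim (auto simp: \<beta>_def e)
    have "(\<lambda>n. \<beta> n x) \<longlonglongrightarrow> c" by (rule Lim_transform_eventually[OF l ev])
    moreover have "c > 0" by (simp add: c_def)
    ultimately have "filterlim (\<lambda>n. \<beta> n x * real n) at_top sequentially"
      by (intro filterlim_tendsto_pos_mult_at_top[OF _ _ filterlim_real_sequentially])
    then have "filterlim (\<lambda>n. - (real n * \<beta> n x)) at_bot sequentially"
      by (simp add: filterlim_uminus_at_bot mult.commute)
    then have "(\<lambda>n. exp (- (real n * \<beta> n x))) \<longlonglongrightarrow> 0"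
      by (rule filterlim_compose[OF exp_at_bot])
    then have "(\<lambda>n. 1 - exp (- (real n * \<beta> n x))) \<longlonglongrightarrow> 1 - 0" by (intro tendsto_intros)
    then show ?thesis using True by (simp add: \<kappa>_def)
  qed
  have supp: "\<exists>a'>a. \<exists>b'<b. \<forall>x. \<kappa> n x \<noteq> 0 \<longrightarrow> a' \<le> x \<and> x \<le> b'" for n
    by (rule exI[of _ "a + r n"], intro conjI, (use r0[of n] in simp), rule exI[of _ "b - r n"])
      (use r0[of n] in \<open>auto simp: \<kappa>_def \<beta>_def e split: if_splits\<close>)
  show ?thesis
    by (rule that[of \<kappa>]) (use sm lim supp \<beta>0 in \<open>auto simp: \<kappa>_def\<close>)
qed

text \<open>Total mass 0 is what makes the antiderivative vanish again to the right of the support,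
  so that it is itself a test function.\<close>

lemma test_function_antiderivative:
  fixes \<psi> :: "real \<Rightarrow> real"
  assumes "smooth \<psi>" and ab: "a < a'" "b' < b" and supp: "\<And>x. \<psi> x \<noteq> 0 \<Longrightarrow> a' \<le> x \<and> x \<le> b'"
    and zero: "(LBINT t. \<psi> t) = 0"
  shows "test_function {a<..<b} (\<lambda>y. LBINT t. indicator {..<y} t * \<psi> t)"
    and "((\<lambda>y. LBINT t. indicator {..<y} t * \<psi> t) has_real_derivative \<psi> y) (at y)"
proof -
  define \<theta> where "\<theta> y = (LBINT t. indicator {..<y} t * \<psi> t)" for y
  have cont: "continuous_on A \<psi>" for A
    using assms(1) Ck_continuous continuous_on_subset unfolding smooth_def by blast
  have [measurable]: "\<psi> \<in> borel_measurable borel" by (rule borel_measurable_continuous_onI[OF cont])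
  have \<theta>0: "\<theta> y = 0" if "y \<le> a'" for y
  proof -
    have "indicator {..<y} t * \<psi> t = 0" for t using supp[of t] that by (cases "\<psi> t = 0") (auto simp: indicator_def)
    then show ?thesis unfolding \<theta>_def by (simp only: lebesgue_integral_const) simp
  qed
  have \<theta>1: "\<theta> y = 0" if "y > b'" for y
  proof -
    have "indicator {..<y} t * \<psi> t = \<psi> t" for t using supp[of t] that by (cases "\<psi> t = 0") (auto simp: indicator_def)
    then show ?thesis unfolding \<theta>_def by (simp only: zero)
  qed
  have eq: "\<theta> y = (LBINT t=ereal a'..ereal y. \<psi> t)" for y
  proof (cases "a' \<le> y")
    case True
    have "indicator {..<y} t * \<psi> t = indicator {a'<..<y} t * \<psi> t" if "t \<noteq> a'" for t
      using supp[of t] that by (cases "\<psi> t = 0") (auto simp: indicator_def)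
    then have "\<theta> y = (LBINT t. indicator {a'<..<y} t * \<psi> t)"
      unfolding \<theta>_def
    proof (intro integral_cong_AE)
      show "AE t in lborel. indicator {..<y} t * \<psi> t = indicator {a'<..<y} t * \<psi> t"
        using AE_lborel_singleton[of a'] by eventually_elim fact
    qed measurable
    also have "\<dots> = (LBINT t=ereal a'..ereal y. \<psi> t)"
      using True by (simp add: interval_lebesgue_integral_def set_lebesgue_integral_def einterval_eq)
    finally show ?thesis .
  next
    case False
    have "indicator {y<..<a'} t * \<psi> t = 0" for t using supp[of t] by (cases "\<psi> t = 0") (auto simp: indicator_def)
    then have "(LBINT t=ereal a'..ereal y. \<psi> t) = 0"
      using False unfolding interval_lebesgue_integral_def set_lebesgue_integral_def einterval_eq real_scaleR_def
      by (simp only: lebesgue_integral_const) simp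
    then show ?thesis using \<theta>0 False by simp
  qed
  have d: "(\<theta> has_real_derivative \<psi> y) (at y)" for y
  proof -
    \<comment> \<open>The interval is padded by 1 on both sides so that \<open>y\<close> is interior
      and the derivative within it is the full derivative.\<close>
    have "((\<lambda>u. LBINT t=ereal a'..ereal u. \<psi> t) has_vector_derivative \<psi> y) (at y within {min a' y - 1..max a' y + 1})"
      by (rule interval_integral_FTC2[OF _ _ cont]) auto
    moreover have "at y within {min a' y - 1..max a' y + 1} = at y"
      by (rule at_within_interior) auto
    ultimately show ?thesis
      unfolding eq[abs_def] by (simp add: has_real_derivative_iff_has_vector_derivative)
  qed
  then show "((\<lambda>y. LBINT t. indicator {..<y} t * \<psi> t) has_real_derivative \<psi> y) (at y)"
    by (simp add: \<theta>_def[abs_def])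
  have "test_function {a<..<b} \<theta>"
    by (rule test_function_intervalI[OF smooth_realI[OF d assms(1)] ab])
      (use \<theta>0 \<theta>1 in \<open>metis linorder_le_cases not_le\<close>)
  then show "test_function {a<..<b} (\<lambda>y. LBINT t. indicator {..<y} t * \<psi> t)"
    by (simp add: \<theta>_def[abs_def])
qed

section \<open>Products of one-variable test functions\<close>

lemma test_function_times:
  fixes \<phi> \<psi> :: "real \<Rightarrow> real"
  assumes "test_function A \<phi>" "test_function B \<psi>"
  shows "test_function (A \<times> B) (\<lambda>z. \<phi> (fst z) * \<psi> (snd z))"
proof -
  let ?S = "closure {x. \<phi> x \<noteq> 0} \<times> closure {x. \<psi> x \<noteq> 0}"
  have sub: "closure {z. \<phi> (fst z) * \<psi> (snd z) \<noteq> 0} \<subseteq> ?S"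
    unfolding closure_Times[symmetric] by (rule closure_mono) auto
  have "compact ?S" using assms by (intro compact_Times) (auto simp: test_function_def)
  then have "compact (closure {z. \<phi> (fst z) * \<psi> (snd z) \<noteq> 0})"
    using compact_Int_closed[of ?S "closure {z. \<phi> (fst z) * \<psi> (snd z) \<noteq> 0}"] Int_absorb1[OF sub]
    by (simp only: closed_closure simp_thms if_True HOL.implies_True_equals)
  moreover have "smooth (\<lambda>z. \<phi> (fst z) * \<psi> (snd z))"
    unfolding smooth_def
  proof
    fix k
    have "Ck k (\<lambda>z::real\<times>real. \<phi> (fst z + 0) * \<psi> (snd z + 0))"
      by (intro Ck_mult Ck_compose_affine bounded_linear_fst bounded_linear_snd)
        (use assms in \<open>auto simp: test_function_def smooth_def\<close>)
    then show "Ck k (\<lambda>z. \<phi> (fst z) * \<psi> (snd z))" by (simp only: add_0_right)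
  qed
  ultimately show ?thesis using sub assms unfolding test_function_def by blast
qed

lemma smooth_deriv: "smooth \<phi> \<Longrightarrow> (\<phi> has_real_derivative deriv \<phi> x) (at x)"
  using Ck_realD(1)[of 0 \<phi> x] by (simp add: smooth_def del: Ck.simps)

lemma frechet_derivative_times:
  fixes \<phi> \<psi> :: "real \<Rightarrow> real"
  assumes "smooth \<phi>" "smooth \<psi>"
  shows "frechet_derivative (\<lambda>z. \<phi> (fst z) * \<psi> (snd z)) (at z) b
    = deriv \<phi> (fst z) * fst b * \<psi> (snd z) + \<phi> (fst z) * (deriv \<psi> (snd z) * snd b)"
proof -
  have f: "((\<lambda>z::real\<times>real. \<phi> (fst z)) has_derivative (\<lambda>b. deriv \<phi> (fst z) * fst b)) (at z)"
    using has_derivative_compose[OF bounded_linear_imp_has_derivative[OF bounded_linear_fst, of "at z"],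
        of \<phi> "(*) (deriv \<phi> (fst z))"] smooth_deriv[OF assms(1), of "fst z"]
    by (simp add: has_field_derivative_def)
  have s: "((\<lambda>z::real\<times>real. \<psi> (snd z)) has_derivative (\<lambda>b. deriv \<psi> (snd z) * snd b)) (at z)"
    using has_derivative_compose[OF bounded_linear_imp_has_derivative[OF bounded_linear_snd, of "at z"],
        of \<psi> "(*) (deriv \<psi> (snd z))"] smooth_deriv[OF assms(2), of "snd z"]
    by (simp add: has_field_derivative_def)
  show ?thesis
    using frechet_derivative_at[OF has_derivative_mult[OF f s]] by (metis (no_types, lifting) add.commute)
qed

section \<open>Weak derivatives on rectangles\<close>

lemma measurable_fst_borel [measurable]:
  "fst \<in> (borel :: ('a::second_countable_topology \<times> 'b::second_countable_topology) measure) \<rightarrow>\<^sub>M borel"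
  by (intro borel_measurable_continuous_onI continuous_intros)

lemma measurable_snd_borel [measurable]:
  "snd \<in> (borel :: ('a::second_countable_topology \<times> 'b::second_countable_topology) measure) \<rightarrow>\<^sub>M borel"
  by (intro borel_measurable_continuous_onI continuous_intros)

lemma integrable_indicator_Ioo [simp]: "integrable lborel (indicator {r<..<s} :: real \<Rightarrow> real)"
  by (cases "r \<le> s") auto

lemma lborel_Fubini:
  fixes f :: "'a::euclidean_space \<times> 'b::euclidean_space \<Rightarrow> real"
  assumes "integrable lborel f"
  shows "AE x in lborel. integrable lborel (\<lambda>y. f (x, y))"
    "integrable lborel (\<lambda>x. LBINT y. f (x, y))"
    "(LBINT x. (LBINT y. f (x, y))) = (LBINT z. f z)"
proof -
  have f: "integrable (lborel \<Otimes>\<^sub>M lborel) f" using assms by (simp add: lborel_prod)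
  show "AE x in lborel. integrable lborel (\<lambda>y. f (x, y))"
    "integrable lborel (\<lambda>x. LBINT y. f (x, y))"
    using lborel_pair.AE_integrable_fst'[OF f] lborel_pair.integrable_fst'[OF f] by auto
  show "(LBINT x. (LBINT y. f (x, y))) = (LBINT z. f z)"
    using lborel_pair.integral_fst'[OF f] by (simp add: lborel_prod)
qed

lemma lborel_Fubini_swap:
  fixes f :: "'a::euclidean_space \<Rightarrow> 'b::euclidean_space \<Rightarrow> real"
  assumes "integrable lborel (\<lambda>z. f (fst z) (snd z))"
  shows "(LBINT x. (LBINT y. f x y)) = (LBINT y. (LBINT x. f x y))"
  using assms by (intro lborel_pair.Fubini_integral[symmetric]) (simp add: lborel_prod case_prod_beta')

lemma integrable_lborel_times:
  fixes f :: "'a::euclidean_space \<Rightarrow> real" and g :: "'b::euclidean_space \<Rightarrow> real"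
  assumes [measurable]: "integrable lborel f" "integrable lborel g"
  shows "integrable lborel (\<lambda>z. f (fst z) * g (snd z))"
proof -
  have [measurable]: "f \<in> borel_measurable borel" "g \<in> borel_measurable borel"
    using assms by (auto dest: borel_measurable_integrable)
  have m: "(\<lambda>z. f (fst z) * g (snd z)) \<in> borel_measurable (lborel \<Otimes>\<^sub>M lborel)" by measurable
  have "integrable (lborel \<Otimes>\<^sub>M lborel) (\<lambda>z. f (fst z) * g (snd z))"
    by (rule lborel_pair.Fubini_integrable[OF m]) (use assms in \<open>auto simp: abs_mult\<close>)
  then show ?thesis by (simp add: lborel_prod)
qed

text \<open>Cylinders over null sets are null, which moves statements about almost every slice to
  almost every point.\<close>

lemma AE_lborel_fst:
  assumes "AE x in (lborel :: 'a::euclidean_space measure). P x"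
  shows "AE z in (lborel :: ('a \<times> 'b::euclidean_space) measure). P (fst z)"
proof -
  obtain N where N: "N \<in> null_sets (lborel :: 'a measure)" "{x. \<not> P x} \<subseteq> N"
    using assms by (auto elim!: AE_E simp: null_sets_def)
  have "emeasure (lborel \<Otimes>\<^sub>M lborel) (N \<times> (UNIV :: 'b set)) = 0"
    using N by (subst lborel.emeasure_pair_measure_Times) (auto simp: null_sets_def)
  moreover have "N \<times> (UNIV :: 'b set) \<in> sets (lborel \<Otimes>\<^sub>M lborel)"
    using N by (intro pair_measureI) (auto simp: null_sets_def)
  ultimately have "N \<times> (UNIV :: 'b set) \<in> null_sets lborel"
    unfolding lborel_prod[symmetric] by (rule null_setsI)
  then show ?thesis by (rule AE_I') (use N in auto)
qed

text \<open>The positive and the negative part of \<open>h\<close>, taken as densities, define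
  measures that agree on boxes. Boxes are stable under intersection and generate the Borel sets, so
  the measures coincide, and densities are unique almost everywhere.\<close>

lemma integral_boxes_eq_0_imp_AE:
  fixes h :: "'a::euclidean_space \<Rightarrow> real"
  assumes h: "integrable lborel h"
    and z: "\<And>a b. (LBINT x. indicator (box a b) x * h x) = 0"
  shows "AE x in lborel. h x = 0"
proof -
  have [measurable]: "h \<in> borel_measurable borel" using h by (auto dest: borel_measurable_integrable)
  let ?P = "density lborel (\<lambda>x. ennreal (max 0 (h x)))"
  let ?N = "density lborel (\<lambda>x. ennreal (max 0 (- h x)))"
  have ip: "integrable lborel (\<lambda>x. max 0 (h x))" "integrable lborel (\<lambda>x. max 0 (- h x))"
    using h by auto
  have ib: "integrable lborel (\<lambda>x. indicator (box a b) x * f x)" if "integrable lborel f" for f :: "'a \<Rightarrow> real" and a b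
    using integrable_real_mult_indicator[OF _ that, of "box a b"] by (simp add: mult.commute)
  have em: "emeasure (density lborel (\<lambda>x. ennreal (f x))) (box a b) = ennreal (LBINT x. indicator (box a b) x * f x)"
    if f: "integrable lborel f" "\<And>x. 0 \<le> f x" for f :: "'a \<Rightarrow> real" and a b
  proof -
    have [measurable]: "f \<in> borel_measurable borel" using f by (auto dest: borel_measurable_integrable)
    have "emeasure (density lborel (\<lambda>x. ennreal (f x))) (box a b) = (\<integral>\<^sup>+x. ennreal (indicator (box a b) x * f x) \<partial>lborel)"
      by (subst emeasure_density) (auto intro!: nn_integral_cong simp: indicator_def)
    also have "\<dots> = ennreal (LBINT x. indicator (box a b) x * f x)"
      by (rule nn_integral_eq_integral[OF ib[OF f(1)]]) (use f in auto)
    finally show ?thesis .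
  qed
  have eq: "emeasure ?P (box a b) = emeasure ?N (box a b)" for a b
  proof -
    have "(LBINT x. indicator (box a b) x * max 0 (h x)) - (LBINT x. indicator (box a b) x * max 0 (- h x))
      = (LBINT x. indicator (box a b) x * h x)"
      by (subst Bochner_Integration.integral_diff[symmetric, OF ib[OF ip(1)] ib[OF ip(2)]])
        (auto intro!: Bochner_Integration.integral_cong simp: indicator_def)
    then show ?thesis using z by (subst (1 2) em) (use ip in auto)
  qed
  have fin: "emeasure ?P (box a b) \<noteq> \<infinity>" for a b
    by (subst em) (use ip in auto)
  have "?P = ?N"
  proof (rule measure_eqI_generator_eq)
    let ?E = "range (\<lambda>(a, b). box a b::'a set)"
    show "Int_stable ?E" by (auto simp: Int_stable_def box_Int_box)
    show "?E \<subseteq> Pow UNIV" "sets ?P = sigma_sets UNIV ?E" "sets ?N = sigma_sets UNIV ?E"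
      by (simp_all add: borel_eq_box)
    let ?A = "\<lambda>n::nat. box (- (real n *\<^sub>R One)) (real n *\<^sub>R One) :: 'a set"
    show "range ?A \<subseteq> ?E" "(\<Union>i. ?A i) = UNIV" unfolding UN_box_eq_UNIV by auto
    show "emeasure ?P (?A i) \<noteq> \<infinity>" for i by (rule fin)
    show "emeasure ?P X = emeasure ?N X" if "X \<in> ?E" for X using that eq by auto
  qed
  moreover have "finite_measure ?P"
    by (rule finite_measureI)
      (use ip(1) in \<open>simp add: emeasure_density nn_integral_eq_integral less_top[symmetric]\<close>)
  then have "sigma_finite_measure ?P" by (rule finite_measure.axioms)
  ultimately have "AE x in lborel. ennreal (max 0 (h x)) = ennreal (max 0 (- h x))"
    by (subst (asm) sigma_finite_density_unique) auto
  then show ?thesis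
    by eventually_elim (auto simp: max_def split: if_splits)
qed

lemma abs_diff_le_add: "0 \<le> x \<Longrightarrow> 0 \<le> y \<Longrightarrow> x \<le> a \<Longrightarrow> y \<le> b \<Longrightarrow> \<bar>x - y\<bar> \<le> a + (b :: real)"
  by linarith

text \<open>Test with $\phi(x)\theta(y)$, where $\theta$ is the antiderivative of a combination of two bumps
  with total mass $0$, and let the bumps tend to indicators of intervals. This gives the identity for
  integrals over all boxes, which determines the integrand almost everywhere.\<close>

lemma weak_derivative_oscillation_interval:
  fixes u G :: "real \<times> real \<Rightarrow> real"
  assumes ui: "integrable lborel u" and Gi: "integrable lborel G"
    and cd: "c \<le> c'" "c' < d'" "d' \<le> d"
    and weak: "\<And>\<phi> \<psi>. test_function {a<..<b} \<phi> \<Longrightarrow> test_function {c<..<d} \<psi> \<Longrightarrow>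
      (LBINT z. u z * (\<phi> (fst z) * deriv \<psi> (snd z))) = - (LBINT z. G z * (\<phi> (fst z) * \<psi> (snd z)))"
  shows "AE z in lborel. z \<in> {a<..<b} \<times> {c<..<d} \<longrightarrow>
    \<bar>u z - (LBINT t. indicator {c'<..<d'} t * u (fst z, t)) / (d' - c')\<bar> \<le> (LBINT y. \<bar>G (fst z, y)\<bar>)"
proof -
  have [measurable]: "u \<in> borel_measurable borel" "G \<in> borel_measurable borel"
    using ui Gi by (auto dest: borel_measurable_integrable)
  define m where "m = d' - c'"
  have m: "m > 0" using cd by (simp add: m_def)
  \<comment> \<open>The antiderivative of the indicator of the averaging interval; it rises from 0
    to \<open>m\<close>.\<close>
  define W :: "real \<Rightarrow> real" where "W y = (LBINT t. indicator {..<y} t * indicator {c'<..<d'} t)" for y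
  have [measurable]: "W \<in> borel_measurable borel"
    unfolding W_def indicator_def lessThan_iff by measurable
  have ii: "integrable lborel (\<lambda>t. indicator A t * indicator {r<..<s} t :: real)" if "A \<in> sets borel" for A :: "real set" and r s
    using integrable_real_mult_indicator[of A lborel "indicator {r<..<s}"] that by (simp add: mult.commute)
  have W: "0 \<le> W y" "W y \<le> m" for y
  proof -
    show "0 \<le> W y" unfolding W_def by (intro integral_nonneg_AE) auto
    have "W y \<le> (LBINT t. indicator {c'<..<d'} t)"
      unfolding W_def by (rule integral_mono[OF ii integrable_indicator_Ioo]) (auto simp: indicator_def)
    also have "\<dots> = m" using cd by (simp add: m_def)
    finally show "W y \<le> m" .
  qed
  \<comment> \<open>Formally m u(x,s) minus the integral of u(x,t) over c' < t < d' is the integral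
    of u(x,s) - u(x,t) over these t, that is of G(x,y) between t and s. Exchanging the integrations
    leaves the kernel W(y) for y \<le> s and W(y) - m for y > s. Its bound \<open>m\<close> is why
    the final estimate, after division by \<open>m\<close>, has constant 1.\<close>
  define k where "k s y = W y - (if s < y then m else 0)" for s y
  have k: "\<bar>k s y\<bar> \<le> m" for s y using W[of y] m by (auto simp: k_def)
  have [measurable]: "(\<lambda>z. k (f z) (g z)) \<in> borel_measurable M"
    if "f \<in> borel_measurable M" "g \<in> borel_measurable M" for f g and M :: "'z measure"
    using that unfolding k_def by measurable

  \<comment> \<open>The kernel identity in weak form, integrated over a rectangle of points
    (x,s).\<close>
  have core: "(LBINT z. u z * (indicator {a1<..<b1} (fst z) * (m * indicator {c1<..<d1} (snd z) - (d1 - c1) * indicator {c'<..<d'} (snd z))))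
    = (LBINT z. G z * (indicator {a1<..<b1} (fst z) * (LBINT s. indicator {c1<..<d1} s * k s (snd z))))"
    if I: "a \<le> a1" "b1 \<le> b" "c \<le> c1" "c1 < d1" "d1 \<le> d" for a1 b1 c1 d1
  proof -
    obtain \<phi> :: "nat \<Rightarrow> real \<Rightarrow> real" where \<phi>: "\<And>n. smooth (\<phi> n)" "\<And>n x. 0 \<le> \<phi> n x" "\<And>n x. \<phi> n x \<le> 1"
      "\<And>n. \<exists>a'>a1. \<exists>b'<b1. \<forall>x. \<phi> n x \<noteq> 0 \<longrightarrow> a' \<le> x \<and> x \<le> b'"
      "\<And>x. (\<lambda>n. \<phi> n x) \<longlonglongrightarrow> indicator {a1<..<b1} x"
      using indicator_smooth_approx[of a1 b1] by blast
    obtain \<beta> :: "nat \<Rightarrow> real \<Rightarrow> real" where \<beta>: "\<And>n. smooth (\<beta> n)" "\<And>n x. 0 \<le> \<beta> n x" "\<And>n x. \<beta> n x \<le> 1"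
      "\<And>n. \<exists>a'>c1. \<exists>b'<d1. \<forall>x. \<beta> n x \<noteq> 0 \<longrightarrow> a' \<le> x \<and> x \<le> b'"
      "\<And>x. (\<lambda>n. \<beta> n x) \<longlonglongrightarrow> indicator {c1<..<d1} x"
      using indicator_smooth_approx[of c1 d1] by blast
    obtain \<gamma> :: "nat \<Rightarrow> real \<Rightarrow> real" where \<gamma>: "\<And>n. smooth (\<gamma> n)" "\<And>n x. 0 \<le> \<gamma> n x" "\<And>n x. \<gamma> n x \<le> 1"
      "\<And>n. \<exists>a'>c'. \<exists>b'<d'. \<forall>x. \<gamma> n x \<noteq> 0 \<longrightarrow> a' \<le> x \<and> x \<le> b'"
      "\<And>x. (\<lambda>n. \<gamma> n x) \<longlonglongrightarrow> indicator {c'<..<d'} x"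
      using indicator_smooth_approx[of c' d'] by blast
    have meas [measurable]: "\<phi> n \<in> borel_measurable borel" "\<beta> n \<in> borel_measurable borel" "\<gamma> n \<in> borel_measurable borel" for n
      using \<phi>(1) \<beta>(1) \<gamma>(1) by (auto simp: smooth_def intro!: borel_measurable_continuous_onI Ck_continuous)
    have \<beta>le: "\<beta> n x \<le> indicator {c1<..<d1} x" for n x
    proof (cases "x \<in> {c1<..<d1}")
      case False
      obtain a' b' where "a' > c1" "b' < d1" "\<forall>x. \<beta> n x \<noteq> 0 \<longrightarrow> a' \<le> x \<and> x \<le> b'" using \<beta>(4) by blast
      then have "\<beta> n x = 0" using False by force
      then show ?thesis by simp
    qed (use \<beta>(3) in auto)
    have \<gamma>le: "\<gamma> n x \<le> indicator {c'<..<d'} x" for n x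
    proof (cases "x \<in> {c'<..<d'}")
      case False
      obtain a' b' where "a' > c'" "b' < d'" "\<forall>x. \<gamma> n x \<noteq> 0 \<longrightarrow> a' \<le> x \<and> x \<le> b'" using \<gamma>(4) by blast
      then have "\<gamma> n x = 0" using False by force
      then show ?thesis by simp
    qed (use \<gamma>(3) in auto)
    have ind: "integrable lborel (indicator {r<..<s} :: real \<Rightarrow> real)" for r s :: real by (rule integrable_indicator_Ioo)
    have i\<beta>: "integrable lborel (\<beta> n)" for n
      by (rule Bochner_Integration.integrable_bound[OF ind[of c1 d1]]) (use \<beta>(2) \<beta>le in auto)
    have i\<gamma>: "integrable lborel (\<gamma> n)" for n
      by (rule Bochner_Integration.integrable_bound[OF ind[of c' d']]) (use \<gamma>(2) \<gamma>le in auto)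
    define p where "p n = (LBINT t. \<beta> n t)" for n
    define q where "q n = (LBINT t. \<gamma> n t)" for n
    have p: "p \<longlonglongrightarrow> d1 - c1"
    proof -
      have "p \<longlonglongrightarrow> (LBINT t. indicator {c1<..<d1} t)" unfolding p_def
        by (rule integral_dominated_convergence[where w = "indicator {c1<..<d1}"]) (use \<beta>(2,5) \<beta>le in auto)
      then show ?thesis using I by simp
    qed
    have q: "q \<longlonglongrightarrow> m"
    proof -
      have "q \<longlonglongrightarrow> (LBINT t. indicator {c'<..<d'} t)" unfolding q_def
        by (rule integral_dominated_convergence[where w = "indicator {c'<..<d'}"]) (use \<gamma>(2,5) \<gamma>le in auto)
      then show ?thesis using cd by (simp add: m_def)
    qed
    have pq: "0 \<le> p n" "p n \<le> d1 - c1" "0 \<le> q n" "q n \<le> m" for n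
    proof -
      show "0 \<le> p n" "0 \<le> q n" unfolding p_def q_def using \<beta>(2) \<gamma>(2) by auto
      have "p n \<le> (LBINT t. indicator {c1<..<d1} t)" unfolding p_def
        by (rule integral_mono[OF i\<beta>]) (use \<beta>le in auto)
      then show "p n \<le> d1 - c1" using I by simp
      have "q n \<le> (LBINT t. indicator {c'<..<d'} t)" unfolding q_def
        by (rule integral_mono[OF i\<gamma>]) (use \<gamma>le in auto)
      then show "q n \<le> m" using cd by (simp add: m_def)
    qed
    \<comment> \<open>Each bump is weighted by the mass of the other one, so the total mass is
      exactly 0 for every n and not only in the limit.\<close>
    define \<psi> where "\<psi> n t = q n * \<beta> n t - p n * \<gamma> n t" for n t
    define \<theta> where "\<theta> n y = (LBINT t. indicator {..<y} t * \<psi> n t)" for n y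
    define \<psi>0 where "\<psi>0 t = m * indicator {c1<..<d1} t - (d1 - c1) * indicator {c'<..<d'} t" for t
    define C where "C = m + (d1 - c1)"
    have C: "C > 0" using m I by (simp add: C_def)
    have [measurable]: "\<psi> n \<in> borel_measurable borel" "\<psi>0 \<in> borel_measurable borel" for n
      unfolding \<psi>_def \<psi>0_def by measurable
    have \<psi>lim: "(\<lambda>n. \<psi> n t) \<longlonglongrightarrow> \<psi>0 t" for t
      unfolding \<psi>_def \<psi>0_def by (intro tendsto_intros p q \<beta>(5) \<gamma>(5))
    have \<psi>bd: "\<bar>\<psi> n t\<bar> \<le> C" for n t
    proof -
      have "0 \<le> q n * \<beta> n t" "0 \<le> p n * \<gamma> n t" using pq[of n] \<beta>(2)[of n t] \<gamma>(2)[of n t] by simp_all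
      moreover have "q n * \<beta> n t \<le> m * 1" by (rule mult_mono) (use pq \<beta> m in auto)
      moreover have "p n * \<gamma> n t \<le> (d1 - c1) * 1" by (rule mult_mono) (use pq \<gamma> I in auto)
      ultimately show ?thesis unfolding \<psi>_def C_def using abs_diff_le_add by fastforce
    qed
    \<comment> \<open>An integrable majorant independent of n; for integrals over the half-lines
      below y the constant bound \<open>C\<close> would not be enough.\<close>
    define w where "w t = m * indicator {c1<..<d1} t + (d1 - c1) * indicator {c'<..<d'} t" for t :: real
    have iw: "integrable lborel w" unfolding w_def by auto
    have \<psi>w: "\<bar>\<psi> n t\<bar> \<le> w t" for n t
    proof -
      have "0 \<le> q n * \<beta> n t" "0 \<le> p n * \<gamma> n t" using pq[of n] \<beta>(2)[of n t] \<gamma>(2)[of n t] by simp_all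
      moreover have "q n * \<beta> n t \<le> m * indicator {c1<..<d1} t" by (rule mult_mono[OF _ \<beta>le]) (use pq \<beta> m in auto)
      moreover have "p n * \<gamma> n t \<le> (d1 - c1) * indicator {c'<..<d'} t" by (rule mult_mono[OF _ \<gamma>le]) (use pq \<gamma> I in auto)
      ultimately show ?thesis unfolding \<psi>_def w_def by (rule abs_diff_le_add)
    qed
    have [measurable]: "\<theta> n \<in> borel_measurable borel" for n
      unfolding \<theta>_def indicator_def lessThan_iff by measurable
    define \<theta>0 where "\<theta>0 y = (LBINT t. indicator {..<y} t * \<psi>0 t)" for y
    have \<theta>lim: "(\<lambda>n. \<theta> n y) \<longlonglongrightarrow> \<theta>0 y" for y
      unfolding \<theta>_def \<theta>0_def
      by (rule integral_dominated_convergence[where w = w])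
        (use iw \<psi>w \<psi>lim in \<open>auto intro!: tendsto_intros simp: indicator_def abs_mult order_trans[OF abs_ge_zero \<psi>w]\<close>)
    define D where "D = (LBINT t. w t)"
    have \<theta>bd: "\<bar>\<theta> n y\<bar> \<le> D" for n y
    proof -
      have "\<bar>\<theta> n y\<bar> \<le> (LBINT t. \<bar>indicator {..<y} t * \<psi> n t\<bar>)" unfolding \<theta>_def by (rule integral_abs_bound)
      also have "\<dots> \<le> D" unfolding D_def
        by (rule integral_mono'[OF iw]) (use \<psi>w in \<open>auto simp: indicator_def abs_mult order_trans[OF abs_ge_zero \<psi>w]\<close>)
      finally show ?thesis .
    qed
    have tf\<phi>: "test_function {a<..<b} (\<phi> n)" for n
    proof -
      obtain a' b' where "a' > a1" "b' < b1" "\<forall>x. \<phi> n x \<noteq> 0 \<longrightarrow> a' \<le> x \<and> x \<le> b'" using \<phi>(4) by blast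
      then show ?thesis using I by (intro test_function_intervalI[OF \<phi>(1), of _ a' b']) auto
    qed
    have sm\<psi>: "smooth (\<psi> n)" for n
    proof -
      have "Ck k (\<lambda>t. q n * \<beta> n t + (- p n) * \<gamma> n t)" for k
        by (intro Ck_add Ck_mult Ck_const) (use \<beta>(1) \<gamma>(1) in \<open>auto simp: smooth_def\<close>)
      then show ?thesis by (simp add: smooth_def \<psi>_def[abs_def])
    qed
    have tf: "test_function {c<..<d} (\<theta> n)" "deriv (\<theta> n) y = \<psi> n y" for n y
    proof -
      obtain a' b' where 1: "a' > c1" "b' < d1" "\<forall>x. \<beta> n x \<noteq> 0 \<longrightarrow> a' \<le> x \<and> x \<le> b'" using \<beta>(4) by blast
      obtain a'' b'' where 2: "a'' > c'" "b'' < d'" "\<forall>x. \<gamma> n x \<noteq> 0 \<longrightarrow> a'' \<le> x \<and> x \<le> b''" using \<gamma>(4) by blast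
      have s: "min a' a'' \<le> x \<and> x \<le> max b' b''" if "\<psi> n x \<noteq> 0" for x
      proof -
        have "\<beta> n x \<noteq> 0 \<or> \<gamma> n x \<noteq> 0" using that by (auto simp: \<psi>_def)
        then show ?thesis using 1(3) 2(3) by fastforce
      qed
      have z: "(LBINT t. \<psi> n t) = 0"
        unfolding \<psi>_def using i\<beta>[of n] i\<gamma>[of n] by (simp add: p_def[symmetric] q_def[symmetric])
      have o: "c < min a' a''" "max b' b'' < d" using 1 2 I cd by auto
      note T = test_function_antiderivative[OF sm\<psi>[of n] o s z]
      show "test_function {c<..<d} (\<theta> n)" using T(1) by (simp add: \<theta>_def[abs_def])
      show "deriv (\<theta> n) y = \<psi> n y" using T(2)[of y] by (intro DERIV_imp_deriv) (simp add: \<theta>_def[abs_def])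
    qed
    have L1: "(\<lambda>n. LBINT z. u z * (\<phi> n (fst z) * \<psi> n (snd z))) \<longlonglongrightarrow>
        (LBINT z. u z * (indicator {a1<..<b1} (fst z) * \<psi>0 (snd z)))"
    proof (rule integral_dominated_convergence[where w = "\<lambda>z. C * \<bar>u z\<bar>"])
      show "AE z in lborel. norm (u z * (\<phi> n (fst z) * \<psi> n (snd z))) \<le> C * \<bar>u z\<bar>" for n
      proof (rule AE_I2)
        fix z :: "real \<times> real"
        have "\<phi> n (fst z) * \<bar>\<psi> n (snd z)\<bar> \<le> 1 * C" by (intro mult_mono \<phi> \<psi>bd) auto
        then have "\<bar>u z\<bar> * (\<phi> n (fst z) * \<bar>\<psi> n (snd z)\<bar>) \<le> \<bar>u z\<bar> * C" by (intro mult_left_mono) auto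
        then show "norm (u z * (\<phi> n (fst z) * \<psi> n (snd z))) \<le> C * \<bar>u z\<bar>"
          using \<phi>(2) by (simp add: abs_mult mult.commute)
      qed
      show "AE z in lborel. (\<lambda>n. u z * (\<phi> n (fst z) * \<psi> n (snd z))) \<longlonglongrightarrow> u z * (indicator {a1<..<b1} (fst z) * \<psi>0 (snd z))"
        by (intro AE_I2 tendsto_intros \<phi>(5) \<psi>lim)
      show "(\<lambda>z. u z * (indicator {a1<..<b1} (fst z) * \<psi>0 (snd z))) \<in> borel_measurable lborel" by measurable
      show "(\<lambda>z. u z * (\<phi> n (fst z) * \<psi> n (snd z))) \<in> borel_measurable lborel" for n by measurable
      show "integrable lborel (\<lambda>z. C * \<bar>u z\<bar>)" using ui by simp
    qed
    have L2: "(\<lambda>n. LBINT z. G z * (\<phi> n (fst z) * \<theta> n (snd z))) \<longlonglongrightarrow>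
        (LBINT z. G z * (indicator {a1<..<b1} (fst z) * \<theta>0 (snd z)))"
    proof (rule integral_dominated_convergence[where w = "\<lambda>z. D * \<bar>G z\<bar>"])
      show "AE z in lborel. norm (G z * (\<phi> n (fst z) * \<theta> n (snd z))) \<le> D * \<bar>G z\<bar>" for n
      proof (rule AE_I2)
        fix z :: "real \<times> real"
        have "\<phi> n (fst z) * \<bar>\<theta> n (snd z)\<bar> \<le> 1 * D" by (intro mult_mono \<phi> \<theta>bd) auto
        then have "\<bar>G z\<bar> * (\<phi> n (fst z) * \<bar>\<theta> n (snd z)\<bar>) \<le> \<bar>G z\<bar> * D" by (intro mult_left_mono) auto
        then show "norm (G z * (\<phi> n (fst z) * \<theta> n (snd z))) \<le> D * \<bar>G z\<bar>"
          using \<phi>(2) by (simp add: abs_mult mult.commute)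
      qed
      show "AE z in lborel. (\<lambda>n. G z * (\<phi> n (fst z) * \<theta> n (snd z))) \<longlonglongrightarrow> G z * (indicator {a1<..<b1} (fst z) * \<theta>0 (snd z))"
        by (intro AE_I2 tendsto_intros \<phi>(5) \<theta>lim)
      have "\<theta>0 \<in> borel_measurable borel" 
        unfolding \<theta>0_def indicator_def lessThan_iff by measurable
      then show "(\<lambda>z. G z * (indicator {a1<..<b1} (fst z) * \<theta>0 (snd z))) \<in> borel_measurable lborel" by measurable
      show "(\<lambda>z. G z * (\<phi> n (fst z) * \<theta> n (snd z))) \<in> borel_measurable lborel" for n by measurable
      show "integrable lborel (\<lambda>z. D * \<bar>G z\<bar>)" using Gi by simp
    qed
    have "(LBINT z. u z * (\<phi> n (fst z) * \<psi> n (snd z))) = - (LBINT z. G z * (\<phi> n (fst z) * \<theta> n (snd z)))" for n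
      using weak[OF tf\<phi> tf(1), of n n] by (simp add: tf(2))
    then have "(LBINT z. u z * (indicator {a1<..<b1} (fst z) * \<psi>0 (snd z)))
      = - (LBINT z. G z * (indicator {a1<..<b1} (fst z) * \<theta>0 (snd z)))"
      using L1 tendsto_minus[OF L2] LIMSEQ_unique by simp
    \<comment> \<open>Integrating the kernel over s gives minus the antiderivative of the limit
      combination; this sign cancels the one of the weak derivative.\<close>
    moreover have "(LBINT s. indicator {c1<..<d1} s * k s y) = - \<theta>0 y" for y
    proof -
      have "indicator {c1<..<d1} s * k s y = W y * indicator {c1<..<d1} s - m * (indicator {..<y} s * indicator {c1<..<d1} s)" for s
        by (simp add: k_def indicator_def)
      then have "(LBINT s. indicator {c1<..<d1} s * k s y) = W y * (d1 - c1) - m * (LBINT s. indicator {..<y} s * indicator {c1<..<d1} s)"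
        using I ii[of "{..<y}" c1 d1] by simp
      moreover have "\<theta>0 y = m * (LBINT s. indicator {..<y} s * indicator {c1<..<d1} s) - (d1 - c1) * W y"
      proof -
        have "indicator {..<y} t * \<psi>0 t = m * (indicator {..<y} t * indicator {c1<..<d1} t) - (d1 - c1) * (indicator {..<y} t * indicator {c'<..<d'} t)" for t
          by (simp add: \<psi>0_def algebra_simps)
        then show ?thesis unfolding \<theta>0_def W_def using ii[of "{..<y}" c1 d1] ii[of "{..<y}" c' d'] by simp
      qed
      ultimately show ?thesis by simp
    qed
    ultimately show ?thesis by (simp add: \<psi>0_def)
  qed

  define P where "P x = (LBINT t. indicator {c'<..<d'} t * u (x, t))" for x
  define K where "K z = (LBINT y. G (fst z, y) * k (snd z) y)" for z
  define N where "N x = (LBINT y. \<bar>G (x, y)\<bar>)" for x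
  have [measurable]: "K \<in> borel_measurable borel" unfolding K_def by measurable
  have uB: "integrable lborel (\<lambda>z. indicator {c'<..<d'} (snd z) * u z)"
    by (rule Bochner_Integration.integrable_bound[OF ui]) (auto simp: indicator_def)
  have iP: "integrable lborel P"
    using lborel_Fubini(2)[OF uB] by (simp add: P_def[abs_def])
  have iN: "integrable lborel N"
    using lborel_Fubini(2)[OF integrable_abs[OF Gi]] by (simp add: N_def[abs_def])
  have Gx: "AE x in lborel. integrable lborel (\<lambda>y. G (x, y))" by (rule lborel_Fubini(1)[OF Gi])
  have Kle: "\<bar>K (x, s)\<bar> \<le> m * N x" if "integrable lborel (\<lambda>y. G (x, y))" for x s
  proof -
    have "\<bar>K (x, s)\<bar> \<le> (LBINT y. \<bar>G (x, y) * k s y\<bar>)" unfolding K_def fst_conv snd_conv by (rule integral_abs_bound)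
    also have "\<dots> \<le> (LBINT y. m * \<bar>G (x, y)\<bar>)"
      by (rule integral_mono') (use that k m in \<open>auto simp: abs_mult mult.commute[of m] intro!: mult_left_mono\<close>)
    finally show ?thesis by (simp add: N_def)
  qed
  have Gz: "AE z in lborel. integrable lborel (\<lambda>y. G (fst z, y))" for z :: "real \<times> real"
    using AE_lborel_fst[OF Gx] .
  define I where "I a1 b1 c1 d1 z = (indicator {a1<..<b1} (fst z) * indicator {c1<..<d1} (snd z) :: real)" for a1 b1 c1 d1 :: real and z
  have [measurable]: "I a1 b1 c1 d1 \<in> borel_measurable borel" for a1 b1 c1 d1 unfolding I_def by measurable
  have iu: "integrable lborel (\<lambda>z. I a1 b1 c1 d1 z * u z)" for a1 b1 c1 d1
    by (rule Bochner_Integration.integrable_bound[OF ui]) (auto simp: I_def indicator_def)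
  have iIP: "integrable lborel (\<lambda>z. I a1 b1 c1 d1 z * P (fst z))" for a1 b1 c1 d1
  proof -
    have "integrable lborel (\<lambda>x. indicator {a1<..<b1} x * P x)"
      using integrable_real_mult_indicator[OF _ iP, of "{a1<..<b1}"] by (simp add: mult.commute)
    from integrable_lborel_times[OF this integrable_indicator_Ioo[of c1 d1]]
    show ?thesis by (simp add: I_def mult_ac)
  qed
  have iIK: "integrable lborel (\<lambda>z. I a1 b1 c1 d1 z * K z)" for a1 b1 c1 d1
  proof (rule Bochner_Integration.integrable_bound)
    have "integrable lborel (\<lambda>x. m * N x)" using iN by simp
    then show "integrable lborel (\<lambda>z. m * N (fst z) * indicator {c1<..<d1} (snd z))"
      by (rule integrable_lborel_times) simp
    show "AE z in lborel. norm (I a1 b1 c1 d1 z * K z) \<le> norm (m * N (fst z) * indicator {c1<..<d1} (snd z))"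
      using Gz
    proof eventually_elim
      case (elim z)
      then have "\<bar>K z\<bar> \<le> m * N (fst z)" using Kle[of "fst z" "snd z"] by simp
      then show ?case by (auto simp: I_def indicator_def)
    qed
  qed measurable
  \<comment> \<open>The defect of the pointwise identity, cut off to the rectangle. Its integral
    over any box is the weak identity on the intersection of the box with the rectangle.\<close>
  define H where "H z = I a b c d z * (m * u z - P (fst z) - K z)" for z
  have iH: "integrable lborel H"
    unfolding H_def right_diff_distrib
    using iu[of a b c d] iIP[of a b c d] iIK[of a b c d] by (simp add: mult.left_commute[of _ m])
  have H0: "AE z in lborel. H z = 0"
  proof (rule integral_boxes_eq_0_imp_AE[OF iH])
    fix l r :: "real \<times> real"
    define a1 b1 c1 d1 where "a1 = max a (fst l)" and "b1 = min b (fst r)" and "c1 = max c (snd l)" and "d1 = min d (snd r)"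
    have box: "z \<in> box l r \<longleftrightarrow> fst l < fst z \<and> fst z < fst r \<and> snd l < snd z \<and> snd z < snd r" for z
      by (auto simp: box_def Basis_prod_def inner_prod_def)
    have e: "indicator (box l r) z * H z = I a1 b1 c1 d1 z * (m * u z - P (fst z) - K z)" for z
      by (auto simp: H_def I_def indicator_def a1_def b1_def c1_def d1_def box)
    show "(LBINT z. indicator (box l r) z * H z) = 0"
    proof (cases "c1 < d1")
      case False
      then show ?thesis unfolding e I_def by simp
    next
      case True
      let ?A = "indicator {a1<..<b1} :: real \<Rightarrow> real" and ?B = "indicator {c1<..<d1} :: real \<Rightarrow> real"
      have "(LBINT z. I a1 b1 c1 d1 z * P (fst z)) = (LBINT x. ?A x * P x * (d1 - c1))"
        using True by (subst lborel_Fubini(3)[OF iIP, symmetric]) (simp add: I_def mult_ac)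
      also have "\<dots> = (d1 - c1) * (LBINT x. ?A x * P x)" by simp
      also have "(LBINT x. ?A x * P x) = (LBINT z. I a1 b1 c' d' z * u z)"
        by (subst lborel_Fubini(3)[OF iu, symmetric]) (simp add: I_def P_def mult.assoc)
      finally have 2: "(LBINT z. I a1 b1 c1 d1 z * P (fst z)) = (d1 - c1) * (LBINT z. I a1 b1 c' d' z * u z)" .
      \<comment> \<open>Fubini on the slice over x moves the s-integral onto the kernel and turns
        the integral of \<open>K\<close> into the pairing with G that occurs in
        \<open>core\<close>.\<close>
      have "(LBINT z. I a1 b1 c1 d1 z * K z) = (LBINT x. (LBINT s. I a1 b1 c1 d1 (x, s) * K (x, s)))"
        by (rule lborel_Fubini(3)[OF iIK, symmetric])
      also have "\<dots> = (LBINT x. (LBINT y. G (x, y) * (?A x * (LBINT s. ?B s * k s y))))"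
      proof (intro integral_cong_AE)
        show "AE x in lborel. (LBINT s. I a1 b1 c1 d1 (x, s) * K (x, s)) = (LBINT y. G (x, y) * (?A x * (LBINT s. ?B s * k s y)))"
          using Gx
        proof eventually_elim
          case (elim x)
          have [measurable]: "(\<lambda>y. G (x, y)) \<in> borel_measurable borel" by measurable
          have ib: "integrable lborel (\<lambda>z. ?A x * ?B (fst z) * (G (x, snd z) * k (fst z) (snd z)))"
          proof (rule Bochner_Integration.integrable_bound)
            show "integrable lborel (\<lambda>z. m * ?B (fst z) * \<bar>G (x, snd z)\<bar>)"
              by (rule integrable_lborel_times) (use elim in auto)
            show "AE z in lborel. norm (?A x * ?B (fst z) * (G (x, snd z) * k (fst z) (snd z))) \<le> norm (m * ?B (fst z) * \<bar>G (x, snd z)\<bar>)"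
            proof (rule AE_I2)
              fix z :: "real \<times> real"
              have "\<bar>G (x, snd z)\<bar> * \<bar>k (fst z) (snd z)\<bar> \<le> \<bar>G (x, snd z)\<bar> * m" by (intro mult_left_mono k) auto
              then show "norm (?A x * ?B (fst z) * (G (x, snd z) * k (fst z) (snd z))) \<le> norm (m * ?B (fst z) * \<bar>G (x, snd z)\<bar>)"
                using m by (auto simp: indicator_def abs_mult mult.commute)
            qed
          qed measurable
          have "(LBINT s. I a1 b1 c1 d1 (x, s) * K (x, s)) = (LBINT s. (LBINT y. ?A x * ?B s * (G (x, y) * k s y)))"
            by (simp add: I_def K_def)
          also have "\<dots> = (LBINT y. (LBINT s. ?A x * ?B s * (G (x, y) * k s y)))"
            by (rule lborel_Fubini_swap[OF ib])
          also have "\<dots> = (LBINT y. (LBINT s. G (x, y) * (?A x * (?B s * k s y))))"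
            by (simp only: mult_ac)
          also have "\<dots> = (LBINT y. G (x, y) * (?A x * (LBINT s. ?B s * k s y)))"
            by (simp only: integral_mult_right_zero)
          finally show ?case .
        qed
      qed (unfold I_def, measurable)
      also have "\<dots> = (LBINT z. G z * (?A (fst z) * (LBINT s. ?B s * k s (snd z))))"
      proof -
        have kb: "\<bar>LBINT s. ?B s * k s y\<bar> \<le> m * (d1 - c1)" for y
        proof -
          have "\<bar>LBINT s. ?B s * k s y\<bar> \<le> (LBINT s. \<bar>?B s * k s y\<bar>)" by (rule integral_abs_bound)
          also have "\<dots> \<le> (LBINT s. m * ?B s)"
          proof (rule integral_mono')
            show "integrable lborel (\<lambda>s. m * ?B s)" by simp
          qed (use k m in \<open>auto simp: abs_mult indicator_def\<close>)
          finally show ?thesis using True by simp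
        qed
        have "integrable lborel (\<lambda>z. G z * (?A (fst z) * (LBINT s. ?B s * k s (snd z))))"
        proof (rule Bochner_Integration.integrable_bound)
          show "integrable lborel (\<lambda>z. m * (d1 - c1) * G z)" using Gi by simp
          show "AE z in lborel. norm (G z * (?A (fst z) * (LBINT s. ?B s * k s (snd z)))) \<le> norm (m * (d1 - c1) * G z)"
          proof (rule AE_I2)
            fix z :: "real \<times> real"
            have "\<bar>G z\<bar> * \<bar>LBINT s. ?B s * k s (snd z)\<bar> \<le> \<bar>G z\<bar> * (m * (d1 - c1))"
              by (intro mult_left_mono kb) auto
            then show "norm (G z * (?A (fst z) * (LBINT s. ?B s * k s (snd z)))) \<le> norm (m * (d1 - c1) * G z)"
              using m True by (simp add: indicator_def abs_mult mult_ac)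
          qed
        qed measurable
        from lborel_Fubini(3)[OF this] show ?thesis by simp
      qed
      also have "\<dots> = (LBINT z. u z * (?A (fst z) * (m * ?B (snd z) - (d1 - c1) * indicator {c'<..<d'} (snd z))))"
        by (rule core[symmetric]) (use True in \<open>auto simp: a1_def b1_def c1_def d1_def\<close>)
      also have "\<dots> = (LBINT z. m * (I a1 b1 c1 d1 z * u z) - (d1 - c1) * (I a1 b1 c' d' z * u z))"
        by (intro Bochner_Integration.integral_cong) (auto simp: I_def algebra_simps)
      also have "\<dots> = m * (LBINT z. I a1 b1 c1 d1 z * u z) - (d1 - c1) * (LBINT z. I a1 b1 c' d' z * u z)"
        using iu by simp
      finally have 3: "(LBINT z. I a1 b1 c1 d1 z * K z) = \<dots>" .
      have "(LBINT z. indicator (box l r) z * H z) = (LBINT z. m * (I a1 b1 c1 d1 z * u z) - I a1 b1 c1 d1 z * P (fst z) - I a1 b1 c1 d1 z * K z)"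
        unfolding e by (simp add: algebra_simps)
      also have "\<dots> = 0" using iu iIP iIK 2 3 by simp
      finally show ?thesis .
    qed
  qed
  show ?thesis
    using H0 Gz
  proof eventually_elim
    case (elim z)
    show ?case
    proof
      assume "z \<in> {a<..<b} \<times> {c<..<d}"
      then have "I a b c d z = 1" by (auto simp: I_def indicator_def)
      then have "m * u z - P (fst z) = K z" using elim(1) by (simp add: H_def)
      moreover have "\<bar>K z\<bar> \<le> m * N (fst z)" using Kle[OF elim(2), of "snd z"] by simp
      moreover have "u z - P (fst z) / m = (m * u z - P (fst z)) / m" using m by (simp add: field_simps)
      ultimately have "\<bar>u z - P (fst z) / m\<bar> \<le> N (fst z)" using m by (simp add: divide_le_eq mult.commute)
      then show "\<bar>u z - (LBINT t. indicator {c'<..<d'} t * u (fst z, t)) / (d' - c')\<bar> \<le> (LBINT y. \<bar>G (fst z, y)\<bar>)"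
        by (simp add: P_def N_def m_def)
    qed
  qed
qed

section \<open>Unfolding of the thin domain\<close>

text \<open>The notions are stated with completed Lebesgue measure on a set, while Fubini and image
  measures are applied to Borel functions on the whole space. A Borel function that vanishes off
  \<open>S\<close> and agrees with \<open>h\<close> almost everywhere on \<open>S\<close> carries
  measurability, integrability and the integral across.\<close>

lemma lebesgue_on_transfer:
  fixes h :: "'a::euclidean_space \<Rightarrow> real"
  assumes S: "S \<in> sets borel" and h': "h' \<in> borel_measurable borel" "\<And>x. x \<notin> S \<Longrightarrow> h' x = 0"
    and ae: "AE x in lborel. x \<in> S \<longrightarrow> h x = h' x"
  shows "h \<in> borel_measurable (lebesgue_on S)"
    and "integrable (lebesgue_on S) h \<longleftrightarrow> integrable lborel h'"
    and "(LINT x|lebesgue_on S. h x) = (LBINT x. h' x)"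
proof -
  have S': "S \<in> sets lebesgue" "S \<inter> space lebesgue \<in> sets lebesgue" using S by auto
  have AE: "AE x in lebesgue. h' x = indicator S x *\<^sub>R h x"
    using AE_completion[OF ae] by eventually_elim (use h'(2) in \<open>auto simp: indicator_def\<close>)
  have m': "h' \<in> borel_measurable lebesgue" using h'(1) by (auto intro: measurable_completion)
  have m: "(\<lambda>x. indicator S x *\<^sub>R h x) \<in> borel_measurable lebesgue"
    using borel_measurable_AE[OF m' AE] .
  then show "h \<in> borel_measurable (lebesgue_on S)"
    using S' borel_measurable_restrict_space_iff[OF S'(2), of h] by simp
  have "integrable (lebesgue_on S) h \<longleftrightarrow> integrable lebesgue (\<lambda>x. indicator S x *\<^sub>R h x)"
    by (rule integrable_restrict_space[OF S'(2)])
  also have "\<dots> \<longleftrightarrow> integrable lebesgue h'" using integrable_cong_AE[OF m' m AE] by simp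
  also have "\<dots> \<longleftrightarrow> integrable lborel h'" by (rule integrable_completion) (use h' in auto)
  finally show "integrable (lebesgue_on S) h \<longleftrightarrow> integrable lborel h'" .
  have "(LINT x|lebesgue_on S. h x) = (\<integral>x. indicator S x *\<^sub>R h x \<partial>lebesgue)"
    by (rule integral_restrict_space[OF S'(2)])
  also have "\<dots> = (\<integral>x. h' x \<partial>lebesgue)" using integral_cong_AE[OF m' m AE] by simp
  also have "\<dots> = (LBINT x. h' x)" by (rule integral_completion) (use h' in auto)
  finally show "(LINT x|lebesgue_on S. h x) = (LBINT x. h' x)" .
qed

lemma borel_representative:
  fixes f :: "'a::euclidean_space \<Rightarrow> real"
  assumes S: "S \<in> sets borel" and f: "f \<in> borel_measurable (lebesgue_on S)"
  obtains f' where "f' \<in> borel_measurable borel" "\<And>x. x \<notin> S \<Longrightarrow> f' x = 0"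
    "AE x in lborel. x \<in> S \<longrightarrow> f x = f' x"
proof -
  have S': "S \<inter> space lebesgue \<in> sets lebesgue" using S by auto
  have "(\<lambda>x. indicator S x *\<^sub>R f x) \<in> borel_measurable lebesgue"
    using f borel_measurable_restrict_space_iff[OF S', of f] by simp
  then obtain g where g: "g \<in> borel_measurable lborel" "AE x in lborel. indicator S x *\<^sub>R f x = g x"
    using completion_ex_borel_measurable_real by metis
  show ?thesis
  proof (rule that[of "\<lambda>x. indicator S x * g x"])
    show "(\<lambda>x. indicator S x * g x) \<in> borel_measurable borel" using g S by simp
    show "AE x in lborel. x \<in> S \<longrightarrow> f x = indicator S x * g x"
      using g(2) by eventually_elim auto
  qed auto
qed

section \<open>Cells and the unfolding change of variables\<close>

text \<open>The left endpoint of the cell of width \<open>a * L\<close> containing \<open>x\<close>,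
  written so as to coincide literally with the argument in \<open>unfolding_op\<close> once
  \<open>per_int\<close> is unfolded.\<close>

definition base_point :: "real \<Rightarrow> real \<Rightarrow> real \<Rightarrow> real" where
  "base_point a L x = a * of_int \<lfloor>x / a / L\<rfloor> * L"

lemma base_point_measurable [measurable]: "base_point a L \<in> borel_measurable borel"
  unfolding base_point_def by measurable

lemma base_point_bounds:
  assumes "0 < a" "0 < L" shows "base_point a L x \<le> x" "x < base_point a L x + a * L"
proof -
  have e: "0 < a * L" using assms by simp
  have "of_int \<lfloor>x / (a * L)\<rfloor> \<le> x / (a * L)" "x / (a * L) < of_int \<lfloor>x / (a * L)\<rfloor> + 1" by linarith+
  then have "of_int \<lfloor>x / (a * L)\<rfloor> * (a * L) \<le> x" "x < (of_int \<lfloor>x / (a * L)\<rfloor> + 1) * (a * L)"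
    using e by (simp_all only: pos_le_divide_eq pos_divide_less_eq)
  then show "base_point a L x \<le> x" "x < base_point a L x + a * L"
    by (simp_all add: base_point_def algebra_simps)
qed

lemma base_point_eq:
  assumes "0 < a" "0 < L" "real j * (a * L) < x" "x < real (Suc j) * (a * L)"
  shows "base_point a L x = real j * (a * L)"
proof -
  have "x / a / L = x / (a * L)" by simp
  moreover have "real j < x / (a * L)" "x / (a * L) < real (Suc j)"
    using assms by (simp_all add: pos_less_divide_eq pos_divide_less_eq)
  ultimately have "\<lfloor>x / a / L\<rfloor> = int j" by (intro floor_unique) auto
  then show ?thesis by (simp add: base_point_def)
qed

text \<open>On one cell the base point is constant, so the outer integral contributes the width a L,
  and the substitution y -> base point + a y contributes 1 / a; the product is L for every cell.
  Cells are added one at a time, the common endpoints being null.\<close>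

lemma nn_integral_unfold_1d:
  fixes k :: "real \<Rightarrow> ennreal"
  assumes a: "0 < a" and L: "0 < L" and [measurable]: "k \<in> borel_measurable borel"
  shows "(\<integral>\<^sup>+x. indicator {0<..<real n * (a * L)} x * (\<integral>\<^sup>+y. indicator {0<..<L} y * k (base_point a L x + a * y) \<partial>lborel) \<partial>lborel)
    = ennreal L * (\<integral>\<^sup>+x. indicator {0<..<real n * (a * L)} x * k x \<partial>lborel)"
proof (induction n)
  case (Suc n)
  let ?e = "a * L"
  let ?J = "{real n * ?e <..< real (Suc n) * ?e}"
  have e: "0 < ?e" using a L by simp
  have split: "(\<integral>\<^sup>+x. indicator {0<..<real (Suc n) * ?e} x * f x \<partial>lborel)
      = (\<integral>\<^sup>+x. indicator {0<..<real n * ?e} x * f x \<partial>lborel) + (\<integral>\<^sup>+x. indicator ?J x * f x \<partial>lborel)"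
    if [measurable]: "f \<in> borel_measurable borel" for f :: "real \<Rightarrow> ennreal"
  proof -
    have "(\<integral>\<^sup>+x. indicator {0<..<real (Suc n) * ?e} x * f x \<partial>lborel)
      = (\<integral>\<^sup>+x. indicator {0<..<real n * ?e} x * f x + indicator ?J x * f x \<partial>lborel)"
    proof (rule nn_integral_cong_AE)
      define t where "t = real n * ?e"
      have n0: "0 \<le> t" "real (Suc n) * ?e = t + ?e"
        unfolding t_def using mult_nonneg_nonneg[of "real n" ?e] e by (simp_all add: algebra_simps)
      show "AE x in lborel. indicator {0<..<real (Suc n) * ?e} x * f x = indicator {0<..<real n * ?e} x * f x + indicator ?J x * f x"
        using AE_lborel_singleton[of "real n * ?e"]
      proof eventually_elim
        case (elim x)
        then show ?case using n0(1) e unfolding n0(2) t_def[symmetric] by (cases "x < t") (auto simp: indicator_def)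
      qed
    qed
    also have "\<dots> = (\<integral>\<^sup>+x. indicator {0<..<real n * ?e} x * f x \<partial>lborel) + (\<integral>\<^sup>+x. indicator ?J x * f x \<partial>lborel)"
      by (rule nn_integral_add) auto
    finally show ?thesis .
  qed
  have "(\<integral>\<^sup>+x. indicator ?J x * (\<integral>\<^sup>+y. indicator {0<..<L} y * k (base_point a L x + a * y) \<partial>lborel) \<partial>lborel)
    = (\<integral>\<^sup>+x. indicator ?J x * (\<integral>\<^sup>+y. indicator {0<..<L} y * k (real n * ?e + a * y) \<partial>lborel) \<partial>lborel)"
    using base_point_eq[OF a L] by (intro nn_integral_cong) (auto simp: indicator_def)
  also have "\<dots> = ennreal ?e * (\<integral>\<^sup>+y. indicator {0<..<L} y * k (real n * ?e + a * y) \<partial>lborel)"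
    using e by (simp add: nn_integral_multc algebra_simps)
  also have "\<dots> = ennreal L * (ennreal a * (\<integral>\<^sup>+y. indicator {0<..<L} y * k (real n * ?e + a * y) \<partial>lborel))"
    using a L by (simp add: ennreal_mult' mult_ac)
  also have "ennreal a * (\<integral>\<^sup>+y. indicator {0<..<L} y * k (real n * ?e + a * y) \<partial>lborel) = (\<integral>\<^sup>+x. indicator ?J x * k x \<partial>lborel)"
  proof -
    have m: "(\<lambda>x. indicator ?J x * k x) \<in> borel_measurable borel" by measurable
    have "indicator ?J (real n * ?e + a * y) = (indicator {0<..<L} y :: ennreal)" for y
      using a by (auto simp: indicator_def algebra_simps zero_less_mult_iff)
    then show ?thesis
      using nn_integral_real_affine[OF m, of a "real n * ?e"] a by simp
  qed
  finally have 1: "(\<integral>\<^sup>+x. indicator ?J x * (\<integral>\<^sup>+y. indicator {0<..<L} y * k (base_point a L x + a * y) \<partial>lborel) \<partial>lborel)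
    = ennreal L * (\<integral>\<^sup>+x. indicator ?J x * k x \<partial>lborel)" .
  have m: "(\<lambda>x. \<integral>\<^sup>+y. indicator {0<..<L} y * k (base_point a L x + a * y) \<partial>lborel) \<in> borel_measurable borel"
    by measurable
  show ?case
    unfolding split[OF m] split[OF assms(3)] Suc.IH 1 distrib_left ..
qed simp

text \<open>The set $I_\varepsilon$ for $a=\varepsilon^\alpha$; the number of cells is $N_\varepsilon+1$.\<close>

definition full_cells :: "real \<Rightarrow> real \<Rightarrow> real set" where
  "full_cells a L = {0<..<real (nat \<lfloor>1 / (a * L)\<rfloor>) * (a * L)}"

lemma full_cells_measurable [measurable]: "full_cells a L \<in> sets borel"
  by (simp add: full_cells_def)

lemma full_cells_bounds:
  assumes "0 < a" "0 < L"
  shows "full_cells a L \<subseteq> {0<..<1}" and "{0<..1 - a * L} \<subseteq> full_cells a L"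
proof -
  let ?n = "nat \<lfloor>1 / (a * L)\<rfloor>"
  have e: "0 < a * L" using assms by simp
  have n: "real ?n \<le> 1 / (a * L)" "1 / (a * L) < real ?n + 1" using e by (simp_all add: le_floor_iff)
  define R where "R = real ?n * (a * L)"
  have "real ?n * (a * L) \<le> 1" "1 < (real ?n + 1) * (a * L)" using n
    using e by (simp_all only: pos_le_divide_eq pos_divide_less_eq)
  then show "full_cells a L \<subseteq> {0<..<1}" "{0<..1 - a * L} \<subseteq> full_cells a L"
    unfolding full_cells_def distrib_right mult_1_left R_def[symmetric] by auto
qed

lemma base_point_in_full_cells:
  assumes a: "0 < a" and L: "0 < L" and x: "x \<in> full_cells a L" and y: "0 < y" "y < L"
  shows "base_point a L x + a * y \<in> full_cells a L"
proof -
  let ?n = "nat \<lfloor>1 / (a * L)\<rfloor>" and ?k = "\<lfloor>x / a / L\<rfloor>"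
  have e: "0 < a * L" using assms by simp
  have b: "base_point a L x = of_int ?k * (a * L)" by (simp add: base_point_def)
  have "0 < x / a / L" using x a L by (simp add: full_cells_def)
  then have k0: "0 \<le> ?k" by simp
  have "x < real ?n * (a * L)" using x by (simp add: full_cells_def)
  then have "x / a / L < real ?n" using e by (simp add: pos_divide_less_eq a L mult_ac)
  then have "?k < int ?n" unfolding floor_less_iff by (simp only: of_int_of_nat_eq)
  then have "?k + 1 \<le> int ?n" by simp
  then have "(of_int ?k + 1) * (a * L) \<le> real ?n * (a * L)"
    using e by (intro mult_right_mono) (metis (no_types) of_int_1 of_int_add of_int_le_iff of_int_of_nat_eq, simp)
  then have "of_int ?k * (a * L) + a * L \<le> real ?n * (a * L)" by (simp only: distrib_right mult_1_left)
  moreover have "0 \<le> of_int ?k * (a * L)" using k0 e mult_nonneg_nonneg[of "of_int ?k" "a * L"] by linarith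
  moreover have "a * y < a * L" "0 < a * y" using a y by simp_all
  ultimately show ?thesis unfolding b full_cells_def greaterThanLessThan_iff by linarith
qed

lemma I_eps_eq:
  assumes "0 < L" "0 < \<epsilon>"
  shows "I_eps L \<alpha> \<epsilon> = full_cells (\<epsilon> powr \<alpha>) L"
proof -
  let ?e = "\<epsilon> powr \<alpha> * L"
  define n where "n = nat \<lfloor>1 / ?e\<rfloor>"
  have e: "0 < ?e" using assms by simp
  have N: "N_last L \<alpha> \<epsilon> = int n - 1" using N_last_eq[OF assms] e by (simp add: n_def)
  define U where "U = (\<Union>k\<in>{0..N_last L \<alpha> \<epsilon>}. {of_int k * L * \<epsilon> powr \<alpha> .. (of_int k + 1) * L * \<epsilon> powr \<alpha>})"
  have U: "U = (\<Union>j<n. {real j * ?e .. (real j + 1) * ?e})"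
  proof -
    have "{0..int n - 1} = int ` {..<n}"
      by (auto simp: image_iff) (metis lessThan_iff nat_0_le nat_less_iff zle_diff1_eq)
    then show ?thesis unfolding U_def N by (simp add: mult_ac)
  qed
  show ?thesis
  \<comment> \<open>If not even one cell fits into (0,1), then \<open>N_last\<close> is -1 and both
    sides are empty.\<close>
  proof (cases "n = 0")
    case True
    then show ?thesis using U by (simp add: I_eps_def U_def[symmetric] full_cells_def n_def[symmetric])
  next
    case False
    have "(\<Union>j<m. {real j * ?e .. (real j + 1) * ?e}) = {0..real m * ?e}" if "m > 0" for m
      using that
    proof (induction m)
      case (Suc m)
      show ?case
      proof (cases "m = 0")
        case False
        have "(\<Union>j<Suc m. {real j * ?e .. (real j + 1) * ?e}) = {0..real m * ?e} \<union> {real m * ?e .. (real m + 1) * ?e}"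
          using Suc.IH False by (simp add: lessThan_Suc Un_commute)
        also have "\<dots> = {0..real (Suc m) * ?e}"
          using e mult_nonneg_nonneg[of "real m" ?e] by (subst ivl_disj_un_two_touch) (auto simp: algebra_simps)
        finally show ?thesis .
      qed (use e in \<open>simp add: lessThan_Suc\<close>)
    qed simp
    then have "U = {0..real n * ?e}" using U False by simp
    then show ?thesis by (simp add: I_eps_def U_def[symmetric] full_cells_def n_def[symmetric])
  qed
qed

lemma lower_semicont_open_superlevel:
  assumes "lower_semicont g" shows "open {x. c < g x}"
proof (rule openI)
  fix x assume "x \<in> {x. c < g x}"
  then have "eventually (\<lambda>y. c < g y) (nhds x)"
    using assms by (auto simp: lower_semicont_def eventually_nhds_conv_at)
  then show "\<exists>e>0. ball x e \<subseteq> {x. c < g x}"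
    unfolding eventually_nhds_metric by (auto simp: ball_def dist_commute)
qed

text \<open>\<open>g0\<close> is a strict lower bound of g rather than its minimum. The strict
  inequality leaves room above the strip of height e g0 over every x, so that rectangles inside the
  domain can reach beyond the strip.\<close>

locale thin_cell =
  fixes g :: "real \<Rightarrow> real" and L g0 g1 :: real
  assumes g0: "0 < g0" and g_lower: "\<And>x. g0 < g x" and g_upper: "\<And>x. g x \<le> g1"
    and lsc: "lower_semicont g" and L: "0 < L" and periodic: "\<And>x. g (x + L) = g x"
begin

lemma g_pos: "0 < g x" using g_lower[of x] g0 by linarith

lemma g1_pos: "0 < g1" using g_pos[of 0] g_upper[of 0] by linarith

lemmas open_superlevel = lower_semicont_open_superlevel[OF lsc]

lemma g_measurable [measurable]: "g \<in> borel_measurable borel"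
proof (rule borel_measurableI_greater)
  fix c show "{x \<in> space borel. c < g x} \<in> sets borel" using open_superlevel[of c] by simp
qed

lemma periodic_int: "g (of_int k * L + x) = g x"
proof (cases k rule: int_cases)
  case (nonneg n)
  have "g (real n * L + x) = g x"
  proof (induction n)
    case (Suc n) then show ?case using periodic[of "real n * L + x"] by (simp add: algebra_simps)
  qed simp
  then show ?thesis using nonneg by simp
next
  case (neg n)
  have "g (- real n * L + x) = g x" for n
  proof (induction n)
    case (Suc n) then show ?case using periodic[of "- real (Suc n) * L + x"] by (simp add: algebra_simps)
  qed simp
  from this[of "Suc n"] show ?thesis using neg by simp
qed

text \<open>The thickness $e=\varepsilon$ and the scale $a=\varepsilon^\alpha$ are independent parameters here.\<close>

definition thin :: "real \<Rightarrow> real \<Rightarrow> (real \<times> real) set" where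
  "thin a e = {z. 0 < fst z \<and> fst z < 1 \<and> 0 < snd z \<and> snd z < e * g (fst z / a)}"

lemma thin_domain_eq: "thin_domain g \<alpha> \<epsilon> = thin (\<epsilon> powr \<alpha>) \<epsilon>"
  by (auto simp: thin_domain_def thin_def)

definition Y :: "(real \<times> real) set" where
  "Y = {z. 0 < fst z \<and> fst z < L \<and> 0 < snd z \<and> snd z < g (fst z)}"

lemma cell_eq: "cell L g = Y" by (auto simp: cell_def Y_def)

lemma thin_measurable [measurable]: "thin a e \<in> sets borel"
proof -
  have "{z \<in> space borel. 0 < fst z \<and> fst z < 1 \<and> 0 < snd z \<and> snd z < e * g (fst z / a)} \<in> sets borel"
    by measurable
  then show ?thesis by (simp add: thin_def)
qed

lemma Y_measurable [measurable]: "Y \<in> sets borel"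
proof -
  have "{z \<in> space borel. 0 < fst z \<and> fst z < L \<and> 0 < snd z \<and> snd z < g (fst z)} \<in> sets borel"
    by measurable
  then show ?thesis by (simp add: Y_def)
qed

lemma Times_Y_measurable [measurable]: "A \<in> sets borel \<Longrightarrow> A \<times> Y \<in> sets borel"
  by (intro borel_Times) auto

lemma Times_UNIV_measurable [measurable]:
  "A \<in> sets borel \<Longrightarrow> A \<times> (UNIV :: real set) \<in> sets (borel :: (real \<times> real) measure)"
  by (intro borel_Times) auto

text \<open>On the full cells the unfolding operator is composition with this map. It depends on x
  only through the cell of x and is far from injective, so its effect on integrals is expressed by
  an image measure.\<close>

definition Phi :: "real \<Rightarrow> real \<Rightarrow> real \<times> real \<times> real \<Rightarrow> real \<times> real" where
  "Phi a e z = (base_point a L (fst z) + a * fst (snd z), e * snd (snd z))"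

lemma Phi_measurable [measurable]: "Phi a e \<in> borel \<rightarrow>\<^sub>M borel"
  unfolding Phi_def by measurable

lemma nn_integral_lborel_prod_iterated:
  fixes F :: "'a::euclidean_space \<times> 'b::euclidean_space \<Rightarrow> ennreal"
  assumes "F \<in> borel_measurable borel"
  shows "(\<integral>\<^sup>+z. F z \<partial>lborel) = (\<integral>\<^sup>+x. \<integral>\<^sup>+y. F (x, y) \<partial>lborel \<partial>lborel)"
  using lborel.nn_integral_fst[of F lborel] assms by (simp add: lborel_prod)

text \<open>The vertical substitution t -> e t contributes 1 / e and the horizontal unfolding
  contributes L. Periodicity of g makes the sections match: over base point + a y the thin domain
  has height e g(y).\<close>

lemma nn_integral_unfold:
  fixes F :: "real \<times> real \<Rightarrow> ennreal"
  assumes a: "0 < a" and e: "0 < e" and [measurable]: "F \<in> borel_measurable borel"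
  shows "(\<integral>\<^sup>+z. indicator (full_cells a L \<times> Y) z * F (Phi a e z) \<partial>lborel)
    = ennreal (L / e) * (\<integral>\<^sup>+z. indicator (thin a e \<inter> full_cells a L \<times> UNIV) z * F z \<partial>lborel)"
proof -
  define k where "k s = (\<integral>\<^sup>+t. indicator {t. 0 < t \<and> t < e * g (s / a)} t * F (s, t) \<partial>lborel)" for s
  have [measurable]: "k \<in> borel_measurable borel"
    unfolding k_def indicator_def mem_Collect_eq by measurable
  have I: "(\<integral>\<^sup>+z. indicator (full_cells a L \<times> Y) z * F (Phi a e z) \<partial>lborel)
    = (\<integral>\<^sup>+x. \<integral>\<^sup>+y. \<integral>\<^sup>+t. indicator (full_cells a L) x * (indicator {0<..<L} y * (indicator {t. 0 < t \<and> t < g y} t * F (base_point a L x + a * y, e * t)))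
        \<partial>lborel \<partial>lborel \<partial>lborel)"
  proof -
    have m1: "(\<lambda>z. indicator (full_cells a L \<times> Y) z * F (Phi a e z)) \<in> borel_measurable borel" by measurable
    have m2: "(\<lambda>w. indicator (full_cells a L \<times> Y) (x, w) * F (Phi a e (x, w))) \<in> borel_measurable borel" for x by measurable
    show ?thesis
      unfolding nn_integral_lborel_prod_iterated[OF m1] nn_integral_lborel_prod_iterated[OF m2]
      by (intro nn_integral_cong) (auto simp: Phi_def Y_def indicator_def)
  qed
  have inner: "(\<integral>\<^sup>+t. indicator {t. 0 < t \<and> t < g y} t * F (base_point a L x + a * y, e * t) \<partial>lborel)
      = ennreal (1 / e) * k (base_point a L x + a * y)" for x y
  proof -
    let ?s = "base_point a L x + a * y"
    have "?s / a = of_int \<lfloor>x / a / L\<rfloor> * L + y" using a by (simp add: base_point_def field_simps)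
    then have gs: "g (?s / a) = g y" by (simp add: periodic_int)
    have m: "(\<lambda>t. indicator {t. 0 < t \<and> t < e * g (?s / a)} t * F (?s, t)) \<in> borel_measurable borel"
      by measurable
    have "k ?s = ennreal e * (\<integral>\<^sup>+t. indicator {t. 0 < t \<and> t < e * g (?s / a)} (0 + e * t) * F (?s, 0 + e * t) \<partial>lborel)"
      unfolding k_def using nn_integral_real_affine[OF m, of e 0] e by simp
    also have "(\<integral>\<^sup>+t. indicator {t. 0 < t \<and> t < e * g (?s / a)} (0 + e * t) * F (?s, 0 + e * t) \<partial>lborel)
      = (\<integral>\<^sup>+t. indicator {t. 0 < t \<and> t < g y} t * F (?s, e * t) \<partial>lborel)"
      using e by (intro nn_integral_cong) (auto simp: indicator_def gs zero_less_mult_iff)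
    finally have "ennreal (1 / e) * k ?s = (ennreal (1 / e) * ennreal e) * (\<integral>\<^sup>+t. indicator {t. 0 < t \<and> t < g y} t * F (?s, e * t) \<partial>lborel)"
      by (simp add: mult.assoc)
    also have "ennreal (1 / e) * ennreal e = 1" using e by (simp add: ennreal_mult[symmetric])
    finally show ?thesis by simp
  qed
  have "(\<integral>\<^sup>+z. indicator (full_cells a L \<times> Y) z * F (Phi a e z) \<partial>lborel)
    = (\<integral>\<^sup>+x. \<integral>\<^sup>+y. indicator (full_cells a L) x * (indicator {0<..<L} y * (ennreal (1 / e) * k (base_point a L x + a * y))) \<partial>lborel \<partial>lborel)"
  proof -
    have m: "(\<lambda>t. indicator {t. 0 < t \<and> t < g y} t * F (base_point a L x + a * y, e * t)) \<in> borel_measurable lborel" for x y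
      by measurable
    have m': "(\<lambda>t. indicator {0<..<L} y * (indicator {t. 0 < t \<and> t < g y} t * F (base_point a L x + a * y, e * t))) \<in> borel_measurable lborel" for x y
      by measurable
    show ?thesis unfolding I nn_integral_cmult[OF m'] nn_integral_cmult[OF m] inner ..
  qed
  also have "\<dots> = (\<integral>\<^sup>+x. indicator (full_cells a L) x * (\<integral>\<^sup>+y. indicator {0<..<L} y * (ennreal (1 / e) * k (base_point a L x + a * y)) \<partial>lborel) \<partial>lborel)"
  proof -
    have "(\<lambda>y. indicator {0<..<L} y * (ennreal (1 / e) * k (base_point a L x + a * y))) \<in> borel_measurable lborel" for x
      by measurable
    then show ?thesis by (simp only: nn_integral_cmult)
  qed
  also have "\<dots> = ennreal L * (\<integral>\<^sup>+x. indicator (full_cells a L) x * (ennreal (1 / e) * k x) \<partial>lborel)"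
    unfolding full_cells_def by (rule nn_integral_unfold_1d[OF a L]) measurable
  also have "(\<integral>\<^sup>+x. indicator (full_cells a L) x * (ennreal (1 / e) * k x) \<partial>lborel) = ennreal (1 / e) * (\<integral>\<^sup>+x. indicator (full_cells a L) x * k x \<partial>lborel)"
  proof -
    have "(\<lambda>x. indicator (full_cells a L) x * k x) \<in> borel_measurable lborel" by measurable
    then show ?thesis by (simp only: nn_integral_cmult[symmetric] mult.left_commute)
  qed
  also have "(\<integral>\<^sup>+x. indicator (full_cells a L) x * k x \<partial>lborel) = (\<integral>\<^sup>+z. indicator (thin a e \<inter> full_cells a L \<times> UNIV) z * F z \<partial>lborel)"
  proof -
    have sub: "full_cells a L \<subseteq> {0<..<1}" using full_cells_bounds[OF a L] by blast
    have "(\<integral>\<^sup>+x. indicator (full_cells a L) x * k x \<partial>lborel)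
      = (\<integral>\<^sup>+x. \<integral>\<^sup>+t. indicator (full_cells a L) x * (indicator {t. 0 < t \<and> t < e * g (x / a)} t * F (x, t)) \<partial>lborel \<partial>lborel)"
    proof -
      have "(\<lambda>t. indicator {t. 0 < t \<and> t < e * g (x / a)} t * F (x, t)) \<in> borel_measurable lborel" for x
        by measurable
      then show ?thesis unfolding k_def by (simp only: nn_integral_cmult)
    qed
    also have "\<dots> = (\<integral>\<^sup>+z. indicator (thin a e \<inter> full_cells a L \<times> UNIV) z * F z \<partial>lborel)"
    proof -
      have m: "(\<lambda>z. indicator (thin a e \<inter> full_cells a L \<times> UNIV) z * F z) \<in> borel_measurable borel" by measurable
      show ?thesis unfolding nn_integral_lborel_prod_iterated[OF m]
        by (intro nn_integral_cong) (use sub in \<open>auto simp: thin_def indicator_def\<close>)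
    qed
    finally show ?thesis .
  qed
  finally show ?thesis using L e by (simp add: mult.assoc[symmetric] ennreal_mult[symmetric])
qed

text \<open>An identity of measures transports integrability, integrals of signed functions and null
  sets alike.\<close>

lemma distr_Phi:
  assumes a: "0 < a" and e: "0 < e"
  shows "distr (density lborel (indicator (full_cells a L \<times> Y))) borel (Phi a e)
    = density lborel (\<lambda>z. ennreal (L / e) * indicator (thin a e \<inter> full_cells a L \<times> UNIV) z)"
proof (rule measure_eqI)
  fix A assume "A \<in> sets (distr (density lborel (indicator (full_cells a L \<times> Y))) borel (Phi a e))"
  then have [measurable]: "A \<in> sets borel" by simp
  have "emeasure (distr (density lborel (indicator (full_cells a L \<times> Y))) borel (Phi a e)) A
    = (\<integral>\<^sup>+z. indicator (full_cells a L \<times> Y) z * indicator (Phi a e -` A) z \<partial>lborel)"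
  proof -
    have "Phi a e -` A \<in> sets borel" using measurable_sets[OF Phi_measurable, of A a e] by simp
    moreover have "(indicator (full_cells a L \<times> Y) :: _ \<Rightarrow> ennreal) \<in> borel_measurable lborel" by measurable
    ultimately show ?thesis by (subst emeasure_distr) (auto simp: emeasure_density)
  qed
  also have "\<dots> = (\<integral>\<^sup>+z. indicator (full_cells a L \<times> Y) z * indicator A (Phi a e z) \<partial>lborel)"
    by (intro nn_integral_cong) (auto simp: indicator_def)
  also have "\<dots> = ennreal (L / e) * (\<integral>\<^sup>+z. indicator (thin a e \<inter> full_cells a L \<times> UNIV) z * indicator A z \<partial>lborel)"
    by (rule nn_integral_unfold[OF a e]) measurable
  also have "\<dots> = emeasure (density lborel (\<lambda>z. ennreal (L / e) * indicator (thin a e \<inter> full_cells a L \<times> UNIV) z)) A"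
  proof -
    have "(\<lambda>z. ennreal (L / e) * indicator (thin a e \<inter> full_cells a L \<times> UNIV) z) \<in> borel_measurable lborel"
      "(\<lambda>z. indicator (thin a e \<inter> full_cells a L \<times> UNIV) z * indicator A z :: ennreal) \<in> borel_measurable lborel"
      by measurable
    then show ?thesis by (simp add: emeasure_density nn_integral_cmult mult.assoc)
  qed
  finally show "emeasure (distr (density lborel (indicator (full_cells a L \<times> Y))) borel (Phi a e)) A
    = emeasure (density lborel (\<lambda>z. ennreal (L / e) * indicator (thin a e \<inter> full_cells a L \<times> UNIV) z)) A" .
qed simp

lemma unfold_integral:
  fixes h :: "real \<times> real \<Rightarrow> real"
  assumes a: "0 < a" and e: "0 < e" and [measurable]: "h \<in> borel_measurable borel"
  shows "integrable lborel (\<lambda>z. indicator (full_cells a L \<times> Y) z * h (Phi a e z))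
      \<longleftrightarrow> integrable lborel (\<lambda>z. indicator (thin a e \<inter> full_cells a L \<times> UNIV) z * h z)"
    and "(LBINT z. indicator (full_cells a L \<times> Y) z * h (Phi a e z))
      = L / e * (LBINT z. indicator (thin a e \<inter> full_cells a L \<times> UNIV) z * h z)"
proof -
  let ?M = "density lborel (\<lambda>z. ennreal (indicator (full_cells a L \<times> Y) z :: real))"
  let ?N = "density lborel (\<lambda>z. ennreal (L / e * indicator (thin a e \<inter> full_cells a L \<times> UNIV) z))"
  have Le: "0 < L / e" using L e by simp
  have eq: "distr ?M borel (Phi a e) = ?N"
  proof -
    have "(\<lambda>z. ennreal (L / e) * indicator (thin a e \<inter> full_cells a L \<times> UNIV) z) = (\<lambda>z. ennreal (L / e * indicator (thin a e \<inter> full_cells a L \<times> UNIV) z))"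
      by (rule ext) (simp add: indicator_def)
    then show ?thesis using distr_Phi[OF a e] by (simp only: ennreal_indicator)
  qed
  have m1: "(indicator (full_cells a L \<times> Y) :: _ \<Rightarrow> real) \<in> borel_measurable lborel" by measurable
  have m2: "(\<lambda>z. L / e * indicator (thin a e \<inter> full_cells a L \<times> UNIV) z :: real) \<in> borel_measurable lborel" by measurable
  have nn: "AE z in lborel. 0 \<le> L / e * indicator (thin a e \<inter> full_cells a L \<times> UNIV) z"
    "AE z in lborel. 0 \<le> (indicator (full_cells a L \<times> Y) z :: real)"
    using Le by (auto intro!: AE_I2 simp del: times_divide_eq_left)
  have m3: "(\<lambda>z. h (Phi a e z)) \<in> borel_measurable lborel" "h \<in> borel_measurable lborel" by measurable
  have "integrable lborel (\<lambda>z. indicator (full_cells a L \<times> Y) z * h (Phi a e z)) \<longleftrightarrow> integrable ?M (\<lambda>z. h (Phi a e z))"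
    using integrable_density[OF m3(1) m1 nn(2)] by simp
  also have "\<dots> \<longleftrightarrow> integrable ?N h"
    unfolding eq[symmetric] by (subst integrable_distr_eq) (use m3 in auto)
  also have "\<dots> \<longleftrightarrow> integrable lborel (\<lambda>z. (L / e) * (indicator (thin a e \<inter> full_cells a L \<times> UNIV) z * h z))"
    using Le integrable_density[OF m3(2) m2 nn(1)] by (simp add: mult.assoc)
  also have "\<dots> \<longleftrightarrow> integrable lborel (\<lambda>z. indicator (thin a e \<inter> full_cells a L \<times> UNIV) z * h z)"
    using Le integrable_mult_left_iff[of lborel "L / e" "\<lambda>z. indicator (thin a e \<inter> full_cells a L \<times> UNIV) z * h z"] by auto
  finally show "integrable lborel (\<lambda>z. indicator (full_cells a L \<times> Y) z * h (Phi a e z))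
      \<longleftrightarrow> integrable lborel (\<lambda>z. indicator (thin a e \<inter> full_cells a L \<times> UNIV) z * h z)" .
  have "(LBINT z. indicator (full_cells a L \<times> Y) z * h (Phi a e z)) = (\<integral>z. h (Phi a e z) \<partial>?M)"
    using integral_density[OF m3(1) m1 nn(2)] by simp
  also have "\<dots> = (\<integral>z. h z \<partial>?N)"
    unfolding eq[symmetric] by (subst integral_distr) (use m3 in auto)
  also have "\<dots> = (LBINT z. (L / e) * (indicator (thin a e \<inter> full_cells a L \<times> UNIV) z * h z))"
    using Le integral_density[OF m3(2) m2 nn(1)] by (simp add: mult.assoc)
  finally show "(LBINT z. indicator (full_cells a L \<times> Y) z * h (Phi a e z))
      = L / e * (LBINT z. indicator (thin a e \<inter> full_cells a L \<times> UNIV) z * h z)" by simp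
qed

text \<open>The image measure under \<open>Phi\<close> has a density, so null sets have null
  preimages in the unfolded set. Hence unfolding is compatible with changes on null sets, although
  it evaluates functions pointwise.\<close>

lemma unfold_AE:
  assumes a: "0 < a" and e: "0 < e" and ae: "AE z in lborel. z \<in> thin a e \<longrightarrow> P z"
  shows "AE z in lborel. z \<in> full_cells a L \<times> Y \<longrightarrow> P (Phi a e z)"
proof -
  obtain N where N: "N \<in> null_sets lborel" "{z. \<not> (z \<in> thin a e \<longrightarrow> P z)} \<subseteq> N"
    using ae by (auto elim!: AE_E simp: null_sets_def)
  have [measurable]: "N \<in> sets borel" using N by (auto simp: null_sets_def)
  let ?M = "density lborel (indicator (full_cells a L \<times> Y))"
  let ?N = "density lborel (\<lambda>z. ennreal (L / e) * indicator (thin a e \<inter> full_cells a L \<times> UNIV) z)"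
  have m1: "(indicator (full_cells a L \<times> Y) :: _ \<Rightarrow> ennreal) \<in> borel_measurable lborel" by measurable
  have m2: "(\<lambda>z. ennreal (L / e) * indicator (thin a e \<inter> full_cells a L \<times> UNIV) z) \<in> borel_measurable lborel" by measurable
  have "AE z in lborel. z \<notin> N" using AE_not_in[OF N(1)] .
  then have "AE z in ?N. z \<notin> N" unfolding AE_density[OF m2] by eventually_elim simp
  moreover have "AE z in ?N. z \<in> thin a e" unfolding AE_density[OF m2]
    by (intro AE_I2) (auto simp: indicator_def split: if_splits)
  ultimately have "AE z in ?N. z \<in> thin a e \<and> z \<notin> N" by eventually_elim auto
  then have "AE z in distr ?M borel (Phi a e). z \<in> thin a e \<and> z \<notin> N" unfolding distr_Phi[OF a e] .
  then have "AE z in ?M. Phi a e z \<in> thin a e \<and> Phi a e z \<notin> N" by (subst (asm) AE_distr_iff) auto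
  then have "AE z in lborel. z \<in> full_cells a L \<times> Y \<longrightarrow> Phi a e z \<in> thin a e \<and> Phi a e z \<notin> N"
    unfolding AE_density[OF m1] by eventually_elim (auto simp: indicator_def)
  then show ?thesis by eventually_elim (use N(2) in auto)
qed

end

section \<open>Density of continuous functions and continuity of translations\<close>

text \<open>Truncation makes \<open>w\<close> bounded. A measurable function is an almost everywhere
  limit of continuous ones, and truncating these at the same level supplies a constant majorant for
  dominated convergence on (0,1).\<close>

lemma continuous_approx_powr:
  fixes w :: "real \<Rightarrow> real"
  assumes r: "0 < r" and [measurable]: "w \<in> borel_measurable borel" and w0: "\<And>x. x \<notin> {0<..<1} \<Longrightarrow> w x = 0"
    and int: "integrable lborel (\<lambda>x. \<bar>w x\<bar> powr r)" and \<rho>: "0 < \<rho>"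
  obtains v where "continuous_on UNIV v"
    "integrable lborel (\<lambda>x. indicator {0<..<1} x * \<bar>w x - v x\<bar> powr r)"
    "(LBINT x. indicator {0<..<1} x * \<bar>w x - v x\<bar> powr r) < \<rho>"
proof -
  define T where "T M x = max (- M) (min M x)" for M x :: real
  have [measurable]: "(\<lambda>x. T M (f x)) \<in> borel_measurable N" if "f \<in> borel_measurable N" for M f and N :: "'z measure"
    using that unfolding T_def by measurable
  have T_le: "\<bar>x - T M x\<bar> \<le> \<bar>x\<bar>" if "0 \<le> M" for x M using that by (auto simp: T_def)
  have T_bd: "\<bar>T M x\<bar> \<le> M" if "0 \<le> M" for x M using that by (auto simp: T_def)
  have T_T: "T M (T M x) = T M x" if "0 \<le> M" for M x using that by (auto simp: T_def)
  have T_lim: "(\<lambda>n. T M (f n)) \<longlonglongrightarrow> T M x" if "f \<longlonglongrightarrow> x" for M x and f :: "nat \<Rightarrow> real"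
    unfolding T_def by (intro tendsto_intros that)
  have i1: "integrable lborel (\<lambda>x. \<bar>w x - T (real n) (w x)\<bar> powr r)" for n
    by (rule Bochner_Integration.integrable_bound[OF int])
      (use T_le r in \<open>auto intro!: powr_mono2 AE_I2\<close>)
  have "(\<lambda>n. LBINT x. \<bar>w x - T (real n) (w x)\<bar> powr r) \<longlonglongrightarrow> (\<integral>x. 0 \<partial>(lborel :: real measure))"
  proof (rule integral_dominated_convergence[OF _ _ int])
    show "AE x in lborel. (\<lambda>n. \<bar>w x - T (real n) (w x)\<bar> powr r) \<longlonglongrightarrow> 0"
    proof (rule AE_I2)
      fix x
      have "eventually (\<lambda>n. \<bar>w x\<bar> \<le> real n) sequentially"
        using filterlim_real_sequentially by (simp add: filterlim_at_top)
      then have "eventually (\<lambda>n. \<bar>w x - T (real n) (w x)\<bar> powr r = 0) sequentially"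
        by eventually_elim (auto simp: T_def)
      then show "(\<lambda>n. \<bar>w x - T (real n) (w x)\<bar> powr r) \<longlonglongrightarrow> 0" by (rule tendsto_eventually)
    qed
    show "AE x in lborel. norm (\<bar>w x - T (real n) (w x)\<bar> powr r) \<le> \<bar>w x\<bar> powr r" for n
      using T_le r by (auto intro!: powr_mono2 AE_I2)
  qed measurable
  \<comment> \<open>Half of \<rho> for each of the two errors, divided by the factor 2^r of
    \<open>norm_add_powr_le\<close>.\<close>
  then have "eventually (\<lambda>n. (LBINT x. \<bar>w x - T (real n) (w x)\<bar> powr r) < \<rho> / (2 * 2 powr r)) sequentially"
    using \<rho> by (intro order_tendstoD(2)[where y = "\<integral>x. 0 \<partial>(lborel::real measure)"]) auto
  then obtain n where n: "(LBINT x. \<bar>w x - T (real n) (w x)\<bar> powr r) < \<rho> / (2 * 2 powr r)"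
    by (auto simp: eventually_sequentially)
  define M where "M = real n"
  have M0: "0 \<le> M" by (simp add: M_def)
  define h where "h x = T M (w x)" for x
  have [measurable]: "h \<in> borel_measurable borel" unfolding h_def by measurable
  have "h \<in> borel_measurable lebesgue"
    by (intro measurable_completion) simp
  then have "h measurable_on {0<..<1}" by (intro lebesgue_measurable_imp_measurable_on) auto
  then obtain N \<gamma> where N: "negligible N" "\<And>k. continuous_on UNIV (\<gamma> k)"
    "\<And>x. x \<notin> N \<Longrightarrow> (\<lambda>k. \<gamma> k x) \<longlonglongrightarrow> (if x \<in> {0<..<1} then h x else 0)"
    unfolding measurable_on_def by blast
  have AEN: "AE x in lborel. x \<notin> N"
  proof -
    have "AE x in lebesgue. x \<notin> N" using N(1) negligible_iff_null_sets AE_not_in by blast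
    then show ?thesis by (simp add: AE_completion_iff)
  qed
  define v where "v k x = T M (\<gamma> k x)" for k x
  have vc: "continuous_on UNIV (v k)" for k
    unfolding v_def T_def by (intro continuous_intros N(2))
  have [measurable]: "v k \<in> borel_measurable borel" for k by (intro borel_measurable_continuous_onI vc)
  let ?I = "indicator {0<..<1} :: real \<Rightarrow> real"
  have bd: "norm (?I x * \<bar>h x - v k x\<bar> powr r) \<le> (2 * M) powr r * ?I x" for x k
  proof -
    have "\<bar>h x - v k x\<bar> \<le> 2 * M" using T_bd[OF M0, of "w x"] T_bd[OF M0, of "\<gamma> k x"] by (simp add: h_def v_def)
    then have "\<bar>h x - v k x\<bar> powr r \<le> (2 * M) powr r" using r by (intro powr_mono2) auto
    then show ?thesis by (simp add: indicator_def)
  qed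
  have iB: "integrable lborel (\<lambda>x. (2 * M) powr r * ?I x)" by simp
  have "(\<lambda>k. LBINT x. ?I x * \<bar>h x - v k x\<bar> powr r) \<longlonglongrightarrow> (\<integral>x. 0 \<partial>(lborel :: real measure))"
  proof (rule integral_dominated_convergence[OF _ _ iB])
    show "AE x in lborel. (\<lambda>k. ?I x * \<bar>h x - v k x\<bar> powr r) \<longlonglongrightarrow> 0"
      using AEN
    proof eventually_elim
      case (elim x)
      show ?case
      proof (cases "x \<in> {0<..<1}")
        case True
        have "(\<lambda>k. v k x) \<longlonglongrightarrow> T M (h x)" unfolding v_def by (rule T_lim) (use N(3)[OF elim] True in simp)
        then have "(\<lambda>k. v k x) \<longlonglongrightarrow> h x" using T_T[OF M0] by (simp add: h_def)
        then have "(\<lambda>k. \<bar>h x - v k x\<bar> powr r) \<longlonglongrightarrow> \<bar>h x - h x\<bar> powr r"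
          using r by (intro tendsto_powr' tendsto_intros) auto
        then show ?thesis using True by simp
      qed simp
    qed
    show "AE x in lborel. norm (?I x * \<bar>h x - v k x\<bar> powr r) \<le> (2 * M) powr r * ?I x" for k
      using bd by (intro AE_I2)
  qed measurable
  then have "eventually (\<lambda>k. (LBINT x. ?I x * \<bar>h x - v k x\<bar> powr r) < \<rho> / (2 * 2 powr r)) sequentially"
    using \<rho> by (intro order_tendstoD(2)[where y = "\<integral>x. 0 \<partial>(lborel::real measure)"]) auto
  then obtain k where k: "(LBINT x. ?I x * \<bar>h x - v k x\<bar> powr r) < \<rho> / (2 * 2 powr r)"
    by (auto simp: eventually_sequentially)
  have i2: "integrable lborel (\<lambda>x. ?I x * \<bar>h x - v k x\<bar> powr r)"
    by (rule Bochner_Integration.integrable_bound[OF iB]) (use bd[of _ k] in \<open>auto intro!: AE_I2\<close>)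
  have i3: "integrable lborel (\<lambda>x. 2 powr r * (\<bar>w x - T M (w x)\<bar> powr r + ?I x * \<bar>h x - v k x\<bar> powr r))"
    using i1[of n] i2 by (simp add: M_def)
  have le: "?I x * \<bar>w x - v k x\<bar> powr r \<le> 2 powr r * (\<bar>w x - T M (w x)\<bar> powr r + ?I x * \<bar>h x - v k x\<bar> powr r)" for x
    using norm_add_powr_le[of r "w x - T M (w x)" "h x - v k x"] r by (auto simp: indicator_def h_def)
  show ?thesis
  proof (rule that[OF vc[of k]])
    show i4: "integrable lborel (\<lambda>x. ?I x * \<bar>w x - v k x\<bar> powr r)"
      by (rule Bochner_Integration.integrable_bound[OF i3]) (use le in \<open>auto intro!: AE_I2 order_trans[OF le]\<close>)
    have "(LBINT x. ?I x * \<bar>w x - v k x\<bar> powr r) \<le> (LBINT x. 2 powr r * (\<bar>w x - T M (w x)\<bar> powr r + ?I x * \<bar>h x - v k x\<bar> powr r))"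
      by (rule integral_mono[OF i4 i3 le])
    also have "\<dots> = 2 powr r * ((LBINT x. \<bar>w x - T M (w x)\<bar> powr r) + (LBINT x. ?I x * \<bar>h x - v k x\<bar> powr r))"
      using i1[of n] i2 by (simp add: M_def)
    also have "\<dots> < 2 powr r * (\<rho> / (2 * 2 powr r) + \<rho> / (2 * 2 powr r))"
      using n k by (intro mult_strict_left_mono add_strict_mono) (auto simp: M_def)
    also have "\<dots> = \<rho>" by simp
    finally show "(LBINT x. ?I x * \<bar>w x - v k x\<bar> powr r) < \<rho>" .
  qed
qed

lemma integral_lborel_times:
  fixes f :: "'a::euclidean_space \<Rightarrow> real" and g :: "'b::euclidean_space \<Rightarrow> real"
  assumes "integrable lborel f" "integrable lborel g"
  shows "(LBINT z. f (fst z) * g (snd z)) = (LBINT x. f x) * (LBINT y. g y)"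
  using lborel_Fubini(3)[OF integrable_lborel_times[OF assms]] by simp

lemma integrable_real_indicator_mult:
  fixes f :: "'a \<Rightarrow> real"
  shows "A \<in> sets M \<Longrightarrow> integrable M f \<Longrightarrow> integrable M (\<lambda>x. indicator A x * f x)"
  using integrable_real_mult_indicator[of A M f] by (simp add: mult.commute)

context thin_cell
begin

lemma integrable_thin:
  fixes k :: "real \<Rightarrow> real"
  assumes e: "0 < e" and k: "integrable lborel k"
  shows "integrable lborel (\<lambda>z. indicator (thin a e) z * k (fst z))"
    and "(LBINT z. indicator (thin a e) z * k (fst z)) = e * (LBINT x. indicator {0<..<1} x * (g (x / a) * k x))"
proof -
  have [measurable]: "k \<in> borel_measurable borel" using k by (auto dest: borel_measurable_integrable)
  show int: "integrable lborel (\<lambda>z. indicator (thin a e) z * k (fst z))"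
  proof (rule Bochner_Integration.integrable_bound)
    show "integrable lborel (\<lambda>z. k (fst z) * indicator {0<..<e * g1} (snd z))"
      by (rule integrable_lborel_times[OF k]) simp
    show "AE z in lborel. norm (indicator (thin a e) z * k (fst z)) \<le> norm (k (fst z) * indicator {0<..<e * g1} (snd z))"
    proof (rule AE_I2)
      fix z :: "real \<times> real"
      have "e * g (fst z / a) \<le> e * g1" using e g_upper by simp
      then show "norm (indicator (thin a e) z * k (fst z)) \<le> norm (k (fst z) * indicator {0<..<e * g1} (snd z))"
        by (auto simp: thin_def indicator_def)
    qed
  qed measurable
  have "(LBINT y. indicator (thin a e) (x, y) * k x) = e * (indicator {0<..<1} x * (g (x / a) * k x))" for x
  proof -
    have "indicator (thin a e) (x, y) * k x = (indicator {0<..<1} x * k x) * indicator {0<..<e * g (x / a)} y" for y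
      by (auto simp: thin_def indicator_def)
    then have "(LBINT y. indicator (thin a e) (x, y) * k x) = (indicator {0<..<1} x * k x) * (LBINT y. indicator {0<..<e * g (x / a)} y)"
      by (simp only: integral_mult_right_zero)
    also have "(LBINT y. indicator {0<..<e * g (x / a)} y) = e * g (x / a)"
      using e g_pos[of "x / a"] by simp
    finally show ?thesis by (simp only: mult_ac)
  qed
  then show "(LBINT z. indicator (thin a e) z * k (fst z)) = e * (LBINT x. indicator {0<..<1} x * (g (x / a) * k x))"
    using lborel_Fubini(3)[OF int] by (simp only: fst_conv integral_mult_right_zero)
qed

lemma integral_thin_le:
  fixes k :: "real \<Rightarrow> real"
  assumes e: "0 < e" and k: "integrable lborel k" "\<And>x. 0 \<le> k x"
  shows "(LBINT z. indicator (thin a e) z * k (fst z)) \<le> e * g1 * (LBINT x. indicator {0<..<1} x * k x)"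
proof -
  have i: "integrable lborel (\<lambda>x. g1 * (indicator {0<..<1} x * k x))"
    using integrable_real_indicator_mult[OF _ k(1), of "{0<..<1}"] by simp
  have "(LBINT x. indicator {0<..<1} x * (g (x / a) * k x)) \<le> (LBINT x. g1 * (indicator {0<..<1} x * k x))"
    by (rule integral_mono'[OF i]) (use k g_upper g1_pos in \<open>auto simp: indicator_def intro!: mult_right_mono\<close>)
  then show ?thesis unfolding integrable_thin(2)[OF e k(1)] using e by (simp add: mult.assoc)
qed

lemma integrable_Y: "integrable lborel (indicator Y :: _ \<Rightarrow> real)"
proof (rule Bochner_Integration.integrable_bound)
  show "integrable lborel (\<lambda>z::real\<times>real. indicator {0<..<L} (fst z) * indicator {0<..<g1} (snd z) :: real)"
    by (rule integrable_lborel_times) auto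
  show "AE z in lborel. norm (indicator Y z :: real) \<le> norm (indicator {0<..<L} (fst z) * indicator {0<..<g1} (snd z) :: real)"
    using g_upper order.strict_trans2 by (fastforce simp: Y_def indicator_def)
qed measurable

definition area :: real where "area = (LBINT z. indicator Y z)"

lemma area_nonneg: "0 \<le> area"
  unfolding area_def by (intro integral_nonneg_AE) auto

lemma integral_Y_fst:
  fixes k :: "real \<Rightarrow> real"
  assumes k: "integrable lborel (\<lambda>y. indicator {0<..<L} y * k y)" and [measurable]: "k \<in> borel_measurable borel"
  shows "integrable lborel (\<lambda>z. indicator Y z * k (fst z))"
    and "(LBINT z. indicator Y z * k (fst z)) = (LBINT y. indicator {0<..<L} y * (g y * k y))"
proof -
  show int: "integrable lborel (\<lambda>z. indicator Y z * k (fst z))"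
  proof (rule Bochner_Integration.integrable_bound)
    show "integrable lborel (\<lambda>z. indicator {0<..<L} (fst z) * k (fst z) * indicator {0<..<g1} (snd z))"
      by (rule integrable_lborel_times[OF k]) simp
    show "AE z in lborel. norm (indicator Y z * k (fst z)) \<le> norm (indicator {0<..<L} (fst z) * k (fst z) * indicator {0<..<g1} (snd z))"
      using g_upper order.strict_trans2 by (fastforce simp: Y_def indicator_def)
  qed measurable
  have "(LBINT t. indicator Y (y, t) * k y) = indicator {0<..<L} y * (g y * k y)" for y
  proof -
    have "indicator Y (y, t) * k y = (indicator {0<..<L} y * k y) * indicator {0<..<g y} t" for t
      by (auto simp: Y_def indicator_def)
    then have "(LBINT t. indicator Y (y, t) * k y) = (indicator {0<..<L} y * k y) * (LBINT t. indicator {0<..<g y} t)"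
      by (simp only: integral_mult_right_zero)
    also have "(LBINT t. indicator {0<..<g y} t) = g y" using g_pos[of y] by simp
    finally show ?thesis by (simp only: mult_ac)
  qed
  then show "(LBINT z. indicator Y z * k (fst z)) = (LBINT y. indicator {0<..<L} y * (g y * k y))"
    using lborel_Fubini(3)[OF int] by (simp only: fst_conv)
qed

lemma area_eq: "area = (LBINT y. indicator {0<..<L} y * g y)"
  using integral_Y_fst(2)[of "\<lambda>_. 1"] by (simp add: area_def)

lemma area_le: "area \<le> L * g1"
proof -
  have "area \<le> (LBINT y. g1 * indicator {0<..<L} y)"
    unfolding area_eq
  proof (rule integral_mono')
    show "integrable lborel (\<lambda>y. g1 * indicator {0<..<L} y)" by simp
  qed (use g_upper g1_pos in \<open>auto simp: indicator_def\<close>)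
  then show ?thesis using L by (simp add: mult.commute)
qed

lemma fst_Phi_in:
  assumes "0 < a" "z \<in> full_cells a L \<times> Y"
  shows "fst (Phi a e z) \<in> full_cells a L" "\<bar>fst (Phi a e z) - fst z\<bar> \<le> a * L"
proof -
  have z: "fst z \<in> full_cells a L" "0 < fst (snd z)" "fst (snd z) < L" using assms by (auto simp: Y_def)
  show "fst (Phi a e z) \<in> full_cells a L"
    using base_point_in_full_cells[OF assms(1) L z] by (simp add: Phi_def)
  have "0 < a * fst (snd z)" "a * fst (snd z) < a * L" using z assms by auto
  then show "\<bar>fst (Phi a e z) - fst z\<bar> \<le> a * L"
    using base_point_bounds[OF assms(1) L, of "fst z"] by (simp add: Phi_def)
qed

text \<open>The factor L / e of the change of variables cancels the thickness of the thin domain, so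
  the bound is independent of \<open>a\<close> and \<open>e\<close>. Together with the same bound
  for the unshifted function it makes approximation errors uniform along the sequence.\<close>

lemma unfold_fst_le:
  fixes k :: "real \<Rightarrow> real"
  assumes a: "0 < a" and e: "0 < e" and k: "integrable lborel k" "\<And>x. 0 \<le> k x"
  shows "integrable lborel (\<lambda>z. indicator (full_cells a L \<times> Y) z * k (fst (Phi a e z)))"
    and "(LBINT z. indicator (full_cells a L \<times> Y) z * k (fst (Phi a e z))) \<le> L * g1 * (LBINT x. indicator {0<..<1} x * k x)"
proof -
  have [measurable]: "k \<in> borel_measurable borel" using k by (auto dest: borel_measurable_integrable)
  have k': "integrable lborel (\<lambda>x. indicator (full_cells a L) x * k x)"
    using k by (intro integrable_real_indicator_mult) auto
  have eq: "indicator (thin a e \<inter> full_cells a L \<times> UNIV) z * k (fst z) = indicator (thin a e) z * (indicator (full_cells a L) (fst z) * k (fst z))" for z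
    by (cases z) (auto simp: indicator_def)
  have i: "integrable lborel (\<lambda>z. indicator (thin a e \<inter> full_cells a L \<times> UNIV) z * k (fst z))"
    unfolding eq by (rule integrable_thin(1)[OF e k'])
  note U = unfold_integral[OF a e, of "\<lambda>z. k (fst z)"]
  show "integrable lborel (\<lambda>z. indicator (full_cells a L \<times> Y) z * k (fst (Phi a e z)))"
    using U(1) i by simp
  have "(LBINT z. indicator (full_cells a L \<times> Y) z * k (fst (Phi a e z))) = L / e * (LBINT z. indicator (thin a e) z * (indicator (full_cells a L) (fst z) * k (fst z)))"
    using U(2) unfolding eq by simp
  also have "\<dots> \<le> L / e * (e * g1 * (LBINT x. indicator {0<..<1} x * (indicator (full_cells a L) x * k x)))"
    using L e k(2) by (intro mult_left_mono integral_thin_le[OF e k']) auto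
  also have "\<dots> = L * g1 * (LBINT x. indicator {0<..<1} x * (indicator (full_cells a L) x * k x))"
    using e by simp
  also have "\<dots> \<le> L * g1 * (LBINT x. indicator {0<..<1} x * k x)"
    using L g1_pos k
    by (intro mult_left_mono integral_mono' integrable_real_indicator_mult) (auto simp: indicator_def)
  finally show "(LBINT z. indicator (full_cells a L \<times> Y) z * k (fst (Phi a e z))) \<le> L * g1 * (LBINT x. indicator {0<..<1} x * k x)" .
qed

lemma cell_fst_le:
  fixes k :: "real \<Rightarrow> real"
  assumes a: "0 < a" and k: "integrable lborel k" "\<And>x. 0 \<le> k x"
  shows "integrable lborel (\<lambda>z. indicator (full_cells a L \<times> Y) z * k (fst z))"
    and "(LBINT z. indicator (full_cells a L \<times> Y) z * k (fst z)) \<le> L * g1 * (LBINT x. indicator {0<..<1} x * k x)"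
proof -
  have k': "integrable lborel (\<lambda>x. indicator (full_cells a L) x * k x)"
    using k by (intro integrable_real_indicator_mult) auto
  have eq: "indicator (full_cells a L \<times> Y) z * k (fst z) = (indicator (full_cells a L) (fst z) * k (fst z)) * indicator Y (snd z)" for z
    by (cases z) (auto simp: indicator_def)
  show "integrable lborel (\<lambda>z. indicator (full_cells a L \<times> Y) z * k (fst z))"
    unfolding eq by (rule integrable_lborel_times[OF k' integrable_Y])
  have "(LBINT z. indicator (full_cells a L \<times> Y) z * k (fst z)) = (LBINT x. indicator (full_cells a L) x * k x) * area"
    unfolding eq area_def by (rule integral_lborel_times[OF k' integrable_Y])
  also have "\<dots> \<le> (LBINT x. indicator {0<..<1} x * k x) * (L * g1)"
  proof (rule mult_mono[OF _ area_le])
    show "(LBINT x. indicator (full_cells a L) x * k x) \<le> (LBINT x. indicator {0<..<1} x * k x)"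
    proof (rule integral_mono')
      show "integrable lborel (\<lambda>x. indicator {0<..<1} x * k x)" using k by (intro integrable_real_indicator_mult) auto
      show "indicator (full_cells a L) x * k x \<le> indicator {0<..<1} x * k x" for x
        using full_cells_bounds(1)[OF a L] k(2) by (auto simp: indicator_def)
    qed (use k in auto)
    show "0 \<le> (LBINT x. indicator {0<..<1} x * k x)" using k(2) by (intro integral_nonneg_AE) auto
  qed (rule area_nonneg)
  finally show "(LBINT z. indicator (full_cells a L \<times> Y) z * k (fst z)) \<le> L * g1 * (LBINT x. indicator {0<..<1} x * k x)"
    by (simp add: mult.commute)
qed

lemma unfold_shift_integrable:
  fixes w :: "real \<Rightarrow> real"
  assumes a: "0 < a" and e: "0 < e" and r: "0 < r" and [measurable]: "w \<in> borel_measurable borel"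
    and int: "integrable lborel (\<lambda>x. \<bar>w x\<bar> powr r)"
  shows "integrable lborel (\<lambda>z. indicator (full_cells a L \<times> Y) z * \<bar>w (fst (Phi a e z)) - w (fst z)\<bar> powr r)"
proof (rule Bochner_Integration.integrable_bound)
  show "integrable lborel (\<lambda>z. 2 powr r * (indicator (full_cells a L \<times> Y) z * \<bar>w (fst (Phi a e z))\<bar> powr r
      + indicator (full_cells a L \<times> Y) z * \<bar>w (fst z)\<bar> powr r))"
    using unfold_fst_le(1)[OF a e int] cell_fst_le(1)[OF a int] by simp
  show "AE z in lborel. norm (indicator (full_cells a L \<times> Y) z * \<bar>w (fst (Phi a e z)) - w (fst z)\<bar> powr r)
    \<le> norm (2 powr r * (indicator (full_cells a L \<times> Y) z * \<bar>w (fst (Phi a e z))\<bar> powr r + indicator (full_cells a L \<times> Y) z * \<bar>w (fst z)\<bar> powr r))"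
  proof (rule AE_I2)
    fix z show "norm (indicator (full_cells a L \<times> Y) z * \<bar>w (fst (Phi a e z)) - w (fst z)\<bar> powr r)
      \<le> norm (2 powr r * (indicator (full_cells a L \<times> Y) z * \<bar>w (fst (Phi a e z))\<bar> powr r + indicator (full_cells a L \<times> Y) z * \<bar>w (fst z)\<bar> powr r))"
      using norm_diff_powr_le[of r "w (fst (Phi a e z))" "w (fst z)"] r
      by (cases "z \<in> full_cells a L \<times> Y") (simp_all del: mem_Times_iff)
  qed
qed measurable

text \<open>\<open>Phi\<close> moves the first coordinate by at most one cell width. Replacing
  \<open>w\<close> by a continuous function costs an error uniform in n, and the continuous function
  is uniformly continuous on [0,1].\<close>

lemma unfold_shift_tendsto:
  fixes w :: "real \<Rightarrow> real" and a e :: "nat \<Rightarrow> real"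
  assumes a: "\<And>n. 0 < a n" "a \<longlonglongrightarrow> 0" and e: "\<And>n. 0 < e n"
    and r: "0 < r" and [measurable]: "w \<in> borel_measurable borel" and w0: "\<And>x. x \<notin> {0<..<1} \<Longrightarrow> w x = 0"
    and int: "integrable lborel (\<lambda>x. \<bar>w x\<bar> powr r)"
  shows "(\<lambda>n. LBINT z. indicator (full_cells (a n) L \<times> Y) z * \<bar>w (fst (Phi (a n) (e n) z)) - w (fst z)\<bar> powr r) \<longlonglongrightarrow> 0"
    (is "?J \<longlonglongrightarrow> 0")
proof (rule tendstoI)
  fix \<rho> :: real assume \<rho>: "0 < \<rho>"
  \<comment> \<open>The factor 4^r = 2^r 2^r comes from splitting the difference twice; the two
    approximation errors and the modulus of continuity contribute at most L g1 \<sigma>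
    each.\<close>
  define K where "K = 4 powr r * (3 * (L * g1))"
  have K: "0 < K" using L g1_pos by (simp add: K_def)
  define \<sigma> where "\<sigma> = \<rho> / (2 * K)"
  have \<sigma>: "0 < \<sigma>" using \<rho> K by (simp add: \<sigma>_def)
  let ?I = "indicator {0<..<1} :: real \<Rightarrow> real"
  obtain v where v: "continuous_on UNIV v" "integrable lborel (\<lambda>x. ?I x * \<bar>w x - v x\<bar> powr r)"
    "(LBINT x. ?I x * \<bar>w x - v x\<bar> powr r) < \<sigma>"
    using continuous_approx_powr[OF r _ w0 int \<sigma>] by auto
  have [measurable]: "v \<in> borel_measurable borel" by (rule borel_measurable_continuous_onI[OF v(1)])
  define d where "d x = ?I x * \<bar>w x - v x\<bar> powr r" for x
  have "uniformly_continuous_on {0..1} v"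
    by (rule compact_uniformly_continuous[OF continuous_on_subset[OF v(1)]]) auto
  moreover have "0 < \<sigma> powr (1 / r)" using \<sigma> by simp
  ultimately obtain \<delta> where \<delta>: "0 < \<delta>"
    "\<And>x x'. x \<in> {0..1} \<Longrightarrow> x' \<in> {0..1} \<Longrightarrow> dist x' x < \<delta> \<Longrightarrow> dist (v x') (v x) < \<sigma> powr (1 / r)"
    unfolding uniformly_continuous_on_def by metis
  have "eventually (\<lambda>n. a n < \<delta> / L) sequentially"
    by (rule order_tendstoD(2)[OF a(2)]) (use \<delta> L in simp)
  then show "eventually (\<lambda>n. dist (?J n) 0 < \<rho>) sequentially"
  proof eventually_elim
    case (elim n)
    let ?X = "indicator (full_cells (a n) L \<times> Y) :: _ \<Rightarrow> real" and ?P = "\<lambda>z. fst (Phi (a n) (e n) z)"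
    have aL: "a n * L < \<delta>" using elim L by (simp add: pos_less_divide_eq)
    have dint: "integrable lborel d" unfolding d_def by (rule v(2))
    note d1 = unfold_fst_le[OF a(1)[of n] e[of n] dint] and d2 = cell_fst_le[OF a(1)[of n] dint]
    have d0: "0 \<le> d x" for x by (simp add: d_def)
    have le: "?X z * \<bar>w (?P z) - w (fst z)\<bar> powr r \<le> 4 powr r * (?X z * d (?P z) + ?X z * d (fst z) + \<sigma> * ?X z)" for z
    proof (cases "z \<in> full_cells (a n) L \<times> Y")
      case True
      have P: "?P z \<in> {0<..<1}" "fst z \<in> {0<..<1}"
        using subsetD[OF full_cells_bounds(1)[OF a(1)[of n] L] fst_Phi_in(1)[OF a(1) True]]
          subsetD[OF full_cells_bounds(1)[OF a(1)[of n] L], of "fst z"] True by (auto simp del: greaterThanLessThan_iff)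
      have "dist (?P z) (fst z) < \<delta>" using fst_Phi_in(2)[OF a(1) True, of "e n"] aL by (simp add: dist_real_def)
      then have "\<bar>v (?P z) - v (fst z)\<bar> < \<sigma> powr (1 / r)"
        using \<delta>(2)[of "fst z" "?P z"] P by (simp add: dist_real_def)
      then have "\<bar>v (?P z) - v (fst z)\<bar> powr r \<le> (\<sigma> powr (1 / r)) powr r"
        using r by (intro powr_mono2) auto
      then have vs: "\<bar>v (?P z) - v (fst z)\<bar> powr r \<le> \<sigma>" using r \<sigma> by (simp add: powr_powr)
      have "\<bar>w (?P z) - w (fst z)\<bar> powr r \<le> 2 powr r * (\<bar>(w (?P z) - v (?P z)) - (w (fst z) - v (fst z))\<bar> powr r + \<bar>v (?P z) - v (fst z)\<bar> powr r)"
        using norm_add_powr_le[of r "(w (?P z) - v (?P z)) - (w (fst z) - v (fst z))" "v (?P z) - v (fst z)"] r by simp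
      also have "\<dots> \<le> 2 powr r * (2 powr r * (\<bar>w (?P z) - v (?P z)\<bar> powr r + \<bar>w (fst z) - v (fst z)\<bar> powr r) + 2 powr r * \<sigma>)"
      proof (intro mult_left_mono add_mono)
        show "\<bar>(w (?P z) - v (?P z)) - (w (fst z) - v (fst z))\<bar> powr r \<le> 2 powr r * (\<bar>w (?P z) - v (?P z)\<bar> powr r + \<bar>w (fst z) - v (fst z)\<bar> powr r)"
          using norm_diff_powr_le[of r "w (?P z) - v (?P z)" "w (fst z) - v (fst z)"] r by simp
        have "1 * \<sigma> \<le> 2 powr r * \<sigma>" using r \<sigma> by (intro mult_right_mono ge_one_powr_ge_zero) auto
        then show "\<bar>v (?P z) - v (fst z)\<bar> powr r \<le> 2 powr r * \<sigma>" using vs by simp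
      qed simp
      also have "\<dots> = 4 powr r * (d (?P z) + d (fst z) + \<sigma>)"
        using P powr_mult[of 2 2 r] by (simp add: d_def algebra_simps)
      finally show ?thesis using True by simp
    qed simp
    have X: "?X z * ?I (fst z) = ?X z" for z
      using full_cells_bounds(1)[OF a(1)[of n] L] by (auto simp: indicator_def)
    have "integrable lborel (\<lambda>z. ?X z * ?I (fst z))"
      by (rule cell_fst_le(1)[OF a(1)]) auto
    then have iX: "integrable lborel ?X" by (simp only: X)
    have i: "integrable lborel (\<lambda>z. 4 powr r * (?X z * d (?P z) + ?X z * d (fst z) + \<sigma> * ?X z))"
    proof -
      show ?thesis using iX d1(1) d2(1) d0 by simp
    qed
    have "?J n \<le> (LBINT z. 4 powr r * (?X z * d (?P z) + ?X z * d (fst z) + \<sigma> * ?X z))"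
      by (rule integral_mono'[OF i le]) (use \<sigma> d0 in auto)
    also have "\<dots> = 4 powr r * ((LBINT z. ?X z * d (?P z)) + (LBINT z. ?X z * d (fst z)) + \<sigma> * (LBINT z. ?X z * ?I (fst z)))"
      unfolding X using iX d1(1) d2(1) d0 by simp
    also have "\<dots> \<le> 4 powr r * (L * g1 * (LBINT x. ?I x * d x) + L * g1 * (LBINT x. ?I x * d x) + \<sigma> * (L * g1 * (LBINT x. ?I x * ?I x)))"
      using \<sigma> d0 by (intro mult_left_mono add_mono d1(2) d2(2) cell_fst_le(2)[OF a(1)]) auto
    also have "(LBINT x. ?I x * ?I x) = 1" by (simp add: indicator_inter_arith[symmetric])
    also have "(LBINT x. ?I x * d x) = (LBINT x. d x)"
      by (intro Bochner_Integration.integral_cong) (auto simp: d_def indicator_def)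
    also have "4 powr r * (L * g1 * (LBINT x. d x) + L * g1 * (LBINT x. d x) + \<sigma> * (L * g1 * 1))
      \<le> 4 powr r * (L * g1 * \<sigma> + L * g1 * \<sigma> + \<sigma> * (L * g1 * 1))"
      using v(3) L g1_pos \<sigma> by (intro mult_left_mono add_mono) (auto simp: d_def)
    also have "\<dots> = K * \<sigma>" by (simp add: K_def algebra_simps)
    also have "\<dots> < \<rho>" using K \<rho> by (simp add: \<sigma>_def)
    finally have "?J n < \<rho>" .
    moreover have "0 \<le> ?J n" by (intro integral_nonneg_AE) auto
    ultimately show ?case by (simp add: dist_real_def)
  qed
qed

text \<open>A point of (0,1) belongs to \<open>full_cells\<close> as soon as the cell width is
  smaller than its distance to 1; dominated convergence does the rest.\<close>

lemma integral_boundary_tendsto: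
  fixes k :: "real \<Rightarrow> real" and a :: "nat \<Rightarrow> real"
  assumes a: "\<And>n. 0 < a n" "a \<longlonglongrightarrow> 0" and k: "integrable lborel k"
  shows "(\<lambda>n. LBINT x. indicator ({0<..<1} - full_cells (a n) L) x * k x) \<longlonglongrightarrow> 0"
proof -
  have [measurable]: "k \<in> borel_measurable borel" using k by (auto dest: borel_measurable_integrable)
  have "(\<lambda>n. LBINT x. indicator ({0<..<1} - full_cells (a n) L) x * k x) \<longlonglongrightarrow> (\<integral>x. 0 \<partial>(lborel :: real measure))"
  proof (rule integral_dominated_convergence)
    show "integrable lborel (\<lambda>x. \<bar>k x\<bar>)" using k by simp
    show "AE x in lborel. norm (indicator ({0<..<1} - full_cells (a n) L) x * k x) \<le> \<bar>k x\<bar>" for n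
      by (auto simp: indicator_def)
    show "AE x in lborel. (\<lambda>n. indicator ({0<..<1} - full_cells (a n) L) x * k x) \<longlonglongrightarrow> 0"
    proof (rule AE_I2)
      fix x :: real
      have "eventually (\<lambda>n. indicator ({0<..<1} - full_cells (a n) L) x * k x = 0) sequentially"
      proof (cases "x \<in> {0<..<1}")
        case True
        have "eventually (\<lambda>n. a n < (1 - x) / L) sequentially"
          by (rule order_tendstoD(2)[OF a(2)]) (use True L in simp)
        then show ?thesis
        proof eventually_elim
          case (elim n)
          then have "x \<in> {0<..1 - a n * L}" using True L by (simp add: pos_less_divide_eq)
          then have "x \<in> full_cells (a n) L" using full_cells_bounds(2)[OF a(1)[of n] L] by blast
          then show ?case by simp
        qed
      next
        case False
        then have z: "indicator ({0<..<1} - full_cells (a n) L) x * k x = 0" for n by auto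
        show ?thesis by (intro always_eventually allI z)
      qed
      then show "(\<lambda>n. indicator ({0<..<1} - full_cells (a n) L) x * k x) \<longlonglongrightarrow> 0" by (rule tendsto_eventually)
    qed
  qed measurable
  then show ?thesis by simp
qed

text \<open>Exact unfolding differs from the claimed pairing in two ways only: the incomplete last
  cell is missing, and \<open>w\<close> is evaluated at the shifted point. Both errors are estimated
  by Holder, where e^{1/s} e^{1/r} = e absorbs the thickness. The height cut \<open>b\<close>
  selects the strip for b = g0 and the whole domain for b = g1.\<close>

lemma unfold_pairing_tendsto:
  fixes F :: "nat \<Rightarrow> real \<times> real \<Rightarrow> real" and w :: "real \<Rightarrow> real" and a e :: "nat \<Rightarrow> real"
  assumes a: "\<And>n. 0 < a n" "a \<longlonglongrightarrow> 0" and e: "\<And>n. 0 < e n"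
    and s: "1 < s" "1 / s + 1 / r = 1"
    and [measurable]: "\<And>n. F n \<in> borel_measurable borel" and F0: "\<And>n z. z \<notin> thin (a n) (e n) \<Longrightarrow> F n z = 0"
    and F: "\<And>n. integrable lborel (\<lambda>z. \<bar>F n z\<bar> powr s)" "\<And>n. (LBINT z. \<bar>F n z\<bar> powr s) / e n \<le> C"
    and [measurable]: "w \<in> borel_measurable borel" and w0: "\<And>x. x \<notin> {0<..<1} \<Longrightarrow> w x = 0"
    and int: "integrable lborel (\<lambda>x. \<bar>w x\<bar> powr r)"
  shows "(\<lambda>n. (LBINT z. F n z * (w (fst z) * indicator {..<e n * b} (snd z))) / e n
    - (LBINT z. indicator (full_cells (a n) L \<times> Y) z * (F n (Phi (a n) (e n) z) * (w (fst z) * indicator {..<b} (snd (snd z))))) / L) \<longlonglongrightarrow> 0"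
proof -
  note r = conjugate_exponent[OF s]
  have C: "0 \<le> C"
  proof (rule order_trans[OF _ F(2)[of 0]])
    show "0 \<le> (LBINT z. \<bar>F 0 z\<bar> powr s) / e 0"
      using e[of 0] by (intro divide_nonneg_nonneg integral_nonneg_AE) auto
  qed
  let ?X = "\<lambda>n. indicator (full_cells (a n) L \<times> Y) :: _ \<Rightarrow> real" and ?P = "\<lambda>n z. fst (Phi (a n) (e n) z)"
  define J where "J n = (LBINT z. ?X n z * \<bar>w (?P n z) - w (fst z)\<bar> powr r)" for n
  define B where "B n = (LBINT x. indicator ({0<..<1} - full_cells (a n) L) x * \<bar>w x\<bar> powr r)" for n
  have J: "J \<longlonglongrightarrow> 0" unfolding J_def
    by (rule unfold_shift_tendsto[OF a e _ _ w0 int]) (use r(1) in auto)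
  have B: "B \<longlonglongrightarrow> 0" unfolding B_def by (rule integral_boundary_tendsto[OF a int])
  have J0: "0 \<le> J n" "0 \<le> B n" for n unfolding J_def B_def by (auto intro!: integral_nonneg_AE)
  \<comment> \<open>The first summand belongs to the part of the domain over the incomplete cell,
    the second to the shift of \<open>w\<close>.\<close>
  define bound where "bound n = C powr (1 / s) * (g1 * B n) powr (1 / r) + (L * C) powr (1 / s) * J n powr (1 / r) / L" for n
  have "bound \<longlonglongrightarrow> C powr (1 / s) * (g1 * 0) powr (1 / r) + (L * C) powr (1 / s) * 0 powr (1 / r) / L"
    unfolding bound_def using J0 g1_pos r(1) L
    by (intro tendsto_intros tendsto_powr' J B) (auto intro!: always_eventually)
  then have lim: "bound \<longlonglongrightarrow> 0" by simp
  show ?thesis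
  proof (rule Lim_null_comparison[OF always_eventually lim], rule allI)
    fix n
    note an = a(1)[of n] and en = e[of n]
    let ?I = "indicator (thin (a n) (e n) \<inter> full_cells (a n) L \<times> UNIV) :: _ \<Rightarrow> real"
    let ?D = "indicator (thin (a n) (e n)) :: _ \<Rightarrow> real"
    define W where "W z = w (fst z) * indicator {..<e n * b} (snd z)" for z :: "real \<times> real"
    have [measurable]: "W \<in> borel_measurable borel" unfolding W_def by measurable
    define V where "V z = indicator ({0<..<1} - full_cells (a n) L) (fst z) * w (fst z)" for z :: "real \<times> real"
    have [measurable]: "V \<in> borel_measurable borel" unfolding V_def by measurable
    have thinI: "z \<in> thin (a n) (e n) \<Longrightarrow> fst z \<in> {0<..<1}" for z by (auto simp: thin_def)
    have ir: "integrable lborel (\<lambda>z. \<bar>?D z * W z\<bar> powr r)"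
    proof (rule Bochner_Integration.integrable_bound[OF integrable_thin(1)[OF en int]])
      show "AE z in lborel. norm (\<bar>?D z * W z\<bar> powr r) \<le> norm (?D z * \<bar>w (fst z)\<bar> powr r)"
        using r(1) by (auto simp: W_def indicator_def)
    qed measurable
    have FW: "integrable lborel (\<lambda>z. F n z * (?D z * W z))"
      by (rule Holder_inequality(1)[OF s _ F(1) _ ir]) measurable
    have iV: "integrable lborel (\<lambda>x. indicator ({0<..<1} - full_cells (a n) L) x * \<bar>w x\<bar> powr r)"
      by (rule integrable_real_indicator_mult[OF _ int]) measurable
    have eV: "\<bar>?D z * V z\<bar> powr r = ?D z * (indicator ({0<..<1} - full_cells (a n) L) (fst z) * \<bar>w (fst z)\<bar> powr r)" for z
      using r(1) by (auto simp: V_def indicator_def)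
    have irV: "integrable lborel (\<lambda>z. \<bar>?D z * V z\<bar> powr r)"
      unfolding eV by (rule integrable_thin(1)[OF en iV])
    note HV = Holder_inequality[OF s _ F(1)[of n] _ irV]
    have split: "(LBINT z. F n z * W z) = (LBINT z. ?I z * (F n z * W z)) + (LBINT z. F n z * (?D z * V z) * indicator {..<e n * b} (snd z))"
    proof -
      have eI: "?I z * (F n z * (?D z * W z)) = ?I z * (F n z * W z)" for z by (auto simp: indicator_def)
      have e: "F n z * W z = ?I z * (F n z * W z) + F n z * (?D z * V z) * indicator {..<e n * b} (snd z)" for z
        using F0[of z n] thinI[of z] by (cases z) (auto simp: W_def V_def indicator_def)
      have iA: "integrable lborel (\<lambda>z. ?I z * (F n z * W z))"
        unfolding eI[symmetric] by (rule integrable_real_indicator_mult[OF _ FW]) measurable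
      have iB: "integrable lborel (\<lambda>z. F n z * (?D z * V z) * indicator {..<e n * b} (snd z))"
      proof (rule Bochner_Integration.integrable_bound)
        show "integrable lborel (\<lambda>z. F n z * (?D z * V z))" by (rule HV(1)) measurable
      qed (auto simp: indicator_def)
      show ?thesis
        by (subst Bochner_Integration.integral_add[OF iA iB, symmetric]) (intro Bochner_Integration.integral_cong refl e)
    qed
    have T1: "\<bar>LBINT z. F n z * (?D z * V z) * indicator {..<e n * b} (snd z)\<bar> / e n \<le> C powr (1 / s) * (g1 * B n) powr (1 / r)"
    proof -
      have iF: "integrable lborel (\<lambda>z. F n z * (?D z * V z))" by (rule HV(1)) measurable
      have "\<bar>LBINT z. F n z * (?D z * V z) * indicator {..<e n * b} (snd z)\<bar> \<le> (LBINT z. \<bar>F n z * (?D z * V z) * indicator {..<e n * b} (snd z)\<bar>)"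
        by (rule integral_abs_bound)
      also have "\<dots> \<le> (LBINT z. \<bar>F n z * (?D z * V z)\<bar>)"
        by (rule integral_mono'[OF integrable_abs[OF iF]]) (auto simp: indicator_def)
      also have "\<dots> \<le> (LBINT z. \<bar>F n z\<bar> powr s) powr (1 / s) * (LBINT z. \<bar>?D z * V z\<bar> powr r) powr (1 / r)"
        by (rule HV(2)) measurable
      also have "\<dots> \<le> (e n * C) powr (1 / s) * (e n * (g1 * B n)) powr (1 / r)"
      proof (intro mult_mono powr_mono2)
        show "(LBINT z. \<bar>F n z\<bar> powr s) \<le> e n * C" using F(2)[of n] en by (simp add: pos_divide_le_eq mult.commute)
        have "(LBINT z. \<bar>?D z * V z\<bar> powr r) \<le> e n * g1 * (LBINT x. indicator {0<..<1} x * (indicator ({0<..<1} - full_cells (a n) L) x * \<bar>w x\<bar> powr r))"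
          unfolding eV by (rule integral_thin_le[OF en iV]) auto
        also have "(LBINT x. indicator {0<..<1} x * (indicator ({0<..<1} - full_cells (a n) L) x * \<bar>w x\<bar> powr r)) = B n"
          unfolding B_def by (intro Bochner_Integration.integral_cong) (auto simp: indicator_def)
        finally show "(LBINT z. \<bar>?D z * V z\<bar> powr r) \<le> e n * (g1 * B n)" by (simp add: mult.assoc)
      qed (use s r(1) in \<open>auto intro!: integral_nonneg_AE\<close>)
      also have "\<dots> = (e n powr (1 / s) * e n powr (1 / r)) * (C powr (1 / s) * (g1 * B n) powr (1 / r))"
        using en C g1_pos J0(2)[of n] by (simp add: powr_mult mult_ac)
      also have "e n powr (1 / s) * e n powr (1 / r) = e n" using s(2) en by (simp add: powr_add[symmetric])
      finally show ?thesis using en by (simp add: pos_divide_le_eq mult.commute)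
    qed
    have U: "(LBINT z. ?I z * (F n z * W z)) / e n = (LBINT z. ?X n z * (F n (Phi (a n) (e n) z) * W (Phi (a n) (e n) z))) / L"
      using unfold_integral(2)[OF an en, of "\<lambda>z. F n z * W z"] L en by (simp add: field_simps)
    have iU: "integrable lborel (\<lambda>z. ?X n z * (F n (Phi (a n) (e n) z) * W (Phi (a n) (e n) z)))"
    proof -
      have "integrable lborel (\<lambda>z. ?I z * (F n z * (?D z * W z)))"
        by (rule integrable_real_indicator_mult[OF _ FW]) measurable
      moreover have "?I z * (F n z * (?D z * W z)) = ?I z * (F n z * W z)" for z by (auto simp: indicator_def)
      ultimately show ?thesis using unfold_integral(1)[OF an en, of "\<lambda>z. F n z * W z"] by simp
    qed
    let ?G = "\<lambda>z. ?X n z * F n (Phi (a n) (e n) z)"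
    have eG: "\<bar>?G z\<bar> powr s = ?X n z * \<bar>F n (Phi (a n) (e n) z)\<bar> powr s" for z using s by (simp add: indicator_def)
    have iFs: "integrable lborel (\<lambda>z. ?I z * \<bar>F n z\<bar> powr s)"
      by (rule integrable_real_indicator_mult[OF _ F(1)]) measurable
    have iG: "integrable lborel (\<lambda>z. \<bar>?G z\<bar> powr s)"
      unfolding eG using unfold_integral(1)[OF an en, of "\<lambda>z. \<bar>F n z\<bar> powr s"] iFs by simp
    have GC: "(LBINT z. \<bar>?G z\<bar> powr s) \<le> L * C"
    proof -
      have "(LBINT z. \<bar>?G z\<bar> powr s) = L / e n * (LBINT z. ?I z * \<bar>F n z\<bar> powr s)"
        unfolding eG by (rule unfold_integral(2)[OF an en]) measurable
      also have "\<dots> \<le> L / e n * (LBINT z. \<bar>F n z\<bar> powr s)"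
        using L en by (intro mult_left_mono integral_mono'[OF F(1)]) (auto simp: indicator_def)
      also have "\<dots> \<le> L * C" using mult_left_mono[OF F(2)[of n], of L] L by simp
      finally show ?thesis .
    qed
    let ?H = "\<lambda>z. ?X n z * (w (?P n z) - w (fst z))"
    have eH: "\<bar>?H z\<bar> powr r = ?X n z * \<bar>w (?P n z) - w (fst z)\<bar> powr r" for z using r(1) by (simp add: indicator_def)
    have iH: "integrable lborel (\<lambda>z. \<bar>?H z\<bar> powr r)"
      unfolding eH by (rule unfold_shift_integrable[OF an en _ _ int]) (use r(1) in auto)
    have mG: "?G \<in> borel_measurable lborel" and mH: "?H \<in> borel_measurable lborel" by measurable
    note HG = Holder_inequality[OF s mG iG mH iH]
    let ?b = "\<lambda>z. indicator {..<b} (snd (snd z)) :: real"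
    have WP: "W (Phi (a n) (e n) z) = w (?P n z) * ?b z" for z
      using en by (auto simp: W_def Phi_def indicator_def)
    have T2: "\<bar>LBINT z. ?G z * ?H z * ?b z\<bar> \<le> (L * C) powr (1 / s) * J n powr (1 / r)"
    proof -
      have "\<bar>LBINT z. ?G z * ?H z * ?b z\<bar> \<le> (LBINT z. \<bar>?G z * ?H z * ?b z\<bar>)" by (rule integral_abs_bound)
      also have "\<dots> \<le> (LBINT z. \<bar>?G z * ?H z\<bar>)"
        by (rule integral_mono'[OF integrable_abs[OF HG(1)]]) (auto simp: indicator_def)
      also have "\<dots> \<le> (LBINT z. \<bar>?G z\<bar> powr s) powr (1 / s) * (LBINT z. \<bar>?H z\<bar> powr r) powr (1 / r)" by (rule HG(2))
      also have "\<dots> \<le> (L * C) powr (1 / s) * J n powr (1 / r)"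
        using GC s unfolding eH J_def by (intro mult_right_mono powr_mono2) (auto intro!: integral_nonneg_AE)
      finally show ?thesis .
    qed
    have iw: "integrable lborel (\<lambda>z. ?G z * ?H z * ?b z)"
      by (rule Bochner_Integration.integrable_bound[OF HG(1)]) (auto simp: indicator_def)
    have eq: "?X n z * (F n (Phi (a n) (e n) z) * (w (fst z) * ?b z)) = ?X n z * (F n (Phi (a n) (e n) z) * W (Phi (a n) (e n) z)) - ?G z * ?H z * ?b z" for z
      by (simp add: WP indicator_def algebra_simps)
    have d: "(LBINT z. ?X n z * (F n (Phi (a n) (e n) z) * (w (fst z) * ?b z)))
      = (LBINT z. ?X n z * (F n (Phi (a n) (e n) z) * W (Phi (a n) (e n) z))) - (LBINT z. ?G z * ?H z * ?b z)"
      unfolding eq by (rule Bochner_Integration.integral_diff[OF iU iw])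
    have "norm ((LBINT z. F n z * W z) / e n - (LBINT z. ?X n z * (F n (Phi (a n) (e n) z) * (w (fst z) * ?b z))) / L)
      = norm ((LBINT z. F n z * (?D z * V z) * indicator {..<e n * b} (snd z)) / e n + (LBINT z. ?G z * ?H z * ?b z) / L)"
      unfolding split d add_divide_distrib diff_divide_distrib U by simp
    also have "\<dots> \<le> \<bar>(LBINT z. F n z * (?D z * V z) * indicator {..<e n * b} (snd z)) / e n\<bar> + \<bar>(LBINT z. ?G z * ?H z * ?b z) / L\<bar>"
      unfolding real_norm_def by (rule abs_triangle_ineq)
    also have "\<dots> \<le> bound n" unfolding bound_def
    proof (rule add_mono)
      show "\<bar>(LBINT z. F n z * (?D z * V z) * indicator {..<e n * b} (snd z)) / e n\<bar> \<le> C powr (1 / s) * (g1 * B n) powr (1 / r)"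
      using T1 en by (simp add: abs_divide)
      show "\<bar>(LBINT z. ?G z * ?H z * ?b z) / L\<bar> \<le> (L * C) powr (1 / s) * J n powr (1 / r) / L"
      using T2 L by (simp add: abs_divide divide_right_mono)
    qed
    finally show "norm ((LBINT z. F n z * (w (fst z) * indicator {..<e n * b} (snd z))) / e n
      - (LBINT z. ?X n z * (F n (Phi (a n) (e n) z) * (w (fst z) * ?b z))) / L) \<le> bound n"
      unfolding W_def .
  qed
qed

end

section \<open>Oscillation estimates and strong convergence of the states\<close>

lemma test_function_eq_0:
  fixes \<psi> :: "real \<Rightarrow> real"
  assumes "test_function B \<psi>" "y \<notin> B"
  shows "\<psi> y = 0" "deriv \<psi> y = 0"
proof -
  let ?S = "closure {x. \<psi> x \<noteq> 0}"
  have y: "y \<in> - ?S" "open (- ?S)" using assms by (auto simp: test_function_def)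
  have z: "\<psi> x = 0" if "x \<in> - ?S" for x
    using that closure_subset[of "{x. \<psi> x \<noteq> 0}"] by blast
  show "\<psi> y = 0" using y z by blast
  have "((\<lambda>_. 0) has_real_derivative 0) (at y)" by simp
  then have "(\<psi> has_real_derivative 0) (at y)"
    by (rule has_field_derivative_transform_within_open[OF _ y(2,1)]) (erule z[symmetric])
  then show "deriv \<psi> y = 0" by (rule DERIV_imp_deriv)
qed

lemma AE_lborel_pair:
  assumes "AE z in (lborel :: ('a::euclidean_space \<times> 'b::euclidean_space) measure). P z"
  shows "AE x in lborel. AE y in lborel. P (x, y)"
proof -
  have "AE z in lborel \<Otimes>\<^sub>M lborel. P z" using assms unfolding lborel_prod .
  then show ?thesis by (rule lborel_pair.AE_pair)
qed

text \<open>Exchanging the coordinates lets the slice estimate, proved for the second variable,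
  serve for the first one as well.\<close>

lemma lborel_swap: "distr lborel borel (\<lambda>z. (snd z, fst z)) = (lborel :: ('a::euclidean_space \<times> 'b::euclidean_space) measure)"
proof -
  have "(lborel :: ('a \<times> 'b) measure) = distr (lborel \<Otimes>\<^sub>M lborel) (lborel \<Otimes>\<^sub>M lborel) (\<lambda>(x, y). (y, x))"
    using lborel_pair.distr_pair_swap[where ?'a = 'a and ?'b = 'b] by (simp add: lborel_prod)
  also have "\<dots> = distr lborel borel (\<lambda>z. (snd z, fst z))"
    unfolding lborel_prod by (intro distr_cong) (auto simp: case_prod_beta)
  finally show ?thesis by simp
qed

lemma AE_lborel_swap:
  assumes "AE z in (lborel :: ('a::euclidean_space \<times> 'b::euclidean_space) measure). P z"
  shows "AE z in lborel. P (snd z, fst z)"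
proof -
  obtain N where N: "N \<in> null_sets (lborel :: ('a \<times> 'b) measure)" "{z. \<not> P z} \<subseteq> N"
    using assms by (auto elim!: AE_E simp: null_sets_def)
  have N': "N \<in> sets borel" using N by (auto simp: null_sets_def)
  have m: "(\<lambda>z. (snd z, fst z)) \<in> (lborel :: ('b \<times> 'a) measure) \<rightarrow>\<^sub>M (borel :: ('a \<times> 'b) measure)" by measurable
  have "AE z in lborel. z \<notin> N" by (rule AE_not_in[OF N(1)])
  then have "AE z in distr (lborel :: ('b \<times> 'a) measure) borel (\<lambda>z. (snd z, fst z)). z \<notin> N"
    unfolding lborel_swap .
  then have "AE z in (lborel :: ('b \<times> 'a) measure). (snd z, fst z) \<notin> N"
    by (subst (asm) AE_distr_iff[OF m]) (use N' in auto)
  then show ?thesis by eventually_elim (use N(2) in auto)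
qed

lemma integral_lborel_swap:
  fixes f :: "'a::euclidean_space \<times> 'b::euclidean_space \<Rightarrow> real"
  assumes [measurable]: "f \<in> borel_measurable borel"
  shows "(LBINT z. f (snd z, fst z)) = (LBINT z. f z)"
    and "integrable lborel (\<lambda>z. f (snd z, fst z)) \<longleftrightarrow> integrable lborel f"
proof -
  have m: "(\<lambda>z. (snd z, fst z)) \<in> (lborel :: ('b \<times> 'a) measure) \<rightarrow>\<^sub>M (borel :: ('a \<times> 'b) measure)" by measurable
  show "(LBINT z. f (snd z, fst z)) = (LBINT z. f z)"
    using integral_distr[OF m, of f] by (simp add: lborel_swap)
  show "integrable lborel (\<lambda>z. f (snd z, fst z)) \<longleftrightarrow> integrable lborel f"
    using integrable_distr_eq[OF m, of f] by (simp add: lborel_swap)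
qed

text \<open>Rational endpoints keep the family of rectangles countable, so that their exceptional
  null sets can be united.\<close>

lemma Rats_interval_within_open:
  fixes x :: real
  assumes "open S" "x \<in> S"
  obtains r s where "r \<in> \<rat>" "s \<in> \<rat>" "r < x" "x < s" "{r<..<s} \<subseteq> S"
proof -
  obtain d where d: "0 < d" "ball x d \<subseteq> S" using assms openE by blast
  obtain r where r: "r \<in> \<rat>" "x - d < r" "r < x" using Rats_dense_in_real[of "x - d" x] d by auto
  obtain s where s: "s \<in> \<rat>" "x < s" "s < x + d" using Rats_dense_in_real[of x "x + d"] d by auto
  have "{r<..<s} \<subseteq> ball x d" using r s by (auto simp: dist_real_def)
  then show ?thesis using that r s d by blast
qed

context thin_cell
begin

lemma integrable_indicator_thin: "0 < e \<Longrightarrow> integrable lborel (indicator (thin a e) :: _ \<Rightarrow> real)"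
proof -
  assume e: "0 < e"
  have "integrable lborel (\<lambda>z. indicator (thin a e) z * indicator {0<..<1} (fst z) :: real)"
    by (rule integrable_thin(1)[OF e]) simp
  moreover have "indicator (thin a e) z * indicator {0<..<1} (fst z) = (indicator (thin a e) z :: real)" for z
    by (auto simp: thin_def indicator_def)
  ultimately show ?thesis by simp
qed

lemma integrable_of_powr:
  fixes F :: "real \<times> real \<Rightarrow> real"
  assumes e: "0 < e" and p: "1 < p" and F: "F \<in> borel_measurable borel" "integrable lborel (\<lambda>z. \<bar>F z\<bar> powr p)"
    and F0: "\<And>z. z \<notin> thin a e \<Longrightarrow> F z = 0"
  shows "integrable lborel F"
proof -
  have "emeasure lborel (thin a e) < \<infinity>"
    using integrable_indicator_thin[OF e, of a] by (simp add: integrable_indicator_iff)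
  then have "integrable lborel (\<lambda>z. indicator (thin a e) z * F z)"
    using F by (intro powr_integral_le(1)[OF p]) auto
  moreover have "indicator (thin a e) z * F z = F z" for z using F0[of z] by (auto simp: indicator_def)
  ultimately show ?thesis by simp
qed

section \<open>Vertical and horizontal oscillation on the thin domain\<close>

text \<open>Lower semicontinuity makes the set of x with g(x / a) above a level open. Hence every
  point of the thin domain lies in a rectangle inside the domain that starts at height 0 and passes
  the strip. On each such rectangle the slice estimate compares with the same strip average, and
  countably many rectangles suffice.\<close>

lemma vertical_oscillation:
  fixes u G :: "real \<times> real \<Rightarrow> real"
  assumes a: "0 < a" and e: "0 < e"
    and ui: "integrable lborel u" and Gi: "integrable lborel G"
    and weak: "\<And>a1 b1 c1 d1 \<phi> \<psi>. {a1<..<b1} \<times> {c1<..<d1} \<subseteq> thin a e \<Longrightarrow> test_function {a1<..<b1} \<phi> \<Longrightarrow>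
      test_function {c1<..<d1} \<psi> \<Longrightarrow>
      (LBINT z. u z * (\<phi> (fst z) * deriv \<psi> (snd z))) = - (LBINT z. G z * (\<phi> (fst z) * \<psi> (snd z)))"
  shows "AE z in lborel. z \<in> thin a e \<longrightarrow>
    \<bar>u z - (LBINT t. indicator {0<..<e * g0} t * u (fst z, t)) / (e * g0)\<bar> \<le> (LBINT y. \<bar>G (fst z, y)\<bar>)"
proof -
  have m: "0 < e * g0" using e g0 by simp
  define Good where "Good = {(r, s, d). r \<in> \<rat> \<and> s \<in> \<rat> \<and> d \<in> \<rat> \<and> e * g0 < d \<and> {r<..<s} \<times> {0<..<d} \<subseteq> thin a e}"
  have cG: "countable Good"
    by (rule countable_subset[of _ "\<rat> \<times> \<rat> \<times> \<rat>"]) (auto simp: Good_def intro!: countable_SIGMA countable_rat)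
  have Gx: "AE z in (lborel :: (real \<times> real) measure). integrable lborel (\<lambda>y. G (fst z, y))"
    by (rule AE_lborel_fst[OF lborel_Fubini(1)[OF Gi]])
  let ?good = "\<lambda>z. \<bar>u z - (LBINT t. indicator {0<..<e * g0} t * u (fst z, t)) / (e * g0)\<bar> \<le> (LBINT y. \<bar>G (fst z, y)\<bar>)"
  have one: "AE z in lborel. z \<in> {r<..<s} \<times> {0<..<d} \<longrightarrow> ?good z" if "(r, s, d) \<in> Good" for r s d
  proof -
    have d: "e * g0 < d" "{r<..<s} \<times> {0<..<d} \<subseteq> thin a e" using that by (auto simp: Good_def)
    define Q where "Q = {r<..<s} \<times> {0<..<d}"
    have [measurable]: "Q \<in> sets borel" unfolding Q_def by (intro borel_Times) auto
    have w: "(LBINT z. indicator Q z * u z * (\<phi> (fst z) * deriv \<psi> (snd z)))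
      = - (LBINT z. indicator Q z * G z * (\<phi> (fst z) * \<psi> (snd z)))"
      if t: "test_function {r<..<s} \<phi>" "test_function {0<..<d} \<psi>" for \<phi> \<psi>
    proof -
      have eqs: "indicator Q z * u z * (\<phi> (fst z) * deriv \<psi> (snd z)) = u z * (\<phi> (fst z) * deriv \<psi> (snd z))"
        "indicator Q z * G z * (\<phi> (fst z) * \<psi> (snd z)) = G z * (\<phi> (fst z) * \<psi> (snd z))" for z
        using test_function_eq_0[OF t(1), of "fst z"] test_function_eq_0[OF t(2), of "snd z"]
        by (cases z; auto simp: Q_def indicator_def)+
      show ?thesis unfolding eqs by (rule weak[OF d(2) t])
    qed
    have "AE z in lborel. z \<in> {r<..<s} \<times> {0<..<d} \<longrightarrow>
      \<bar>indicator Q z * u z - (LBINT t. indicator {0<..<e * g0} t * (indicator Q (fst z, t) * u (fst z, t))) / (e * g0 - 0)\<bar>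
        \<le> (LBINT y. \<bar>indicator Q (fst z, y) * G (fst z, y)\<bar>)"
      by (rule weak_derivative_oscillation_interval[where c = 0 and d = d])
        (use d m w in \<open>auto intro!: integrable_real_indicator_mult ui Gi\<close>)
    then show ?thesis using Gx
    proof eventually_elim
      case (elim z)
      show ?case
      proof
        assume z: "z \<in> {r<..<s} \<times> {0<..<d}"
        \<comment> \<open>The rectangle is higher than the strip, so cutting u off to it does not
          change the strip average.\<close>
        have eA: "indicator {0<..<e * g0} t * (indicator Q (fst z, t) * u (fst z, t)) = indicator {0<..<e * g0} t * u (fst z, t)" for t
          using z d by (auto simp: Q_def indicator_def)
        have eB: "indicator Q z * u z = u z" using z by (simp add: Q_def)
        have "(LBINT y. \<bar>indicator Q (fst z, y) * G (fst z, y)\<bar>) \<le> (LBINT y. \<bar>G (fst z, y)\<bar>)"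
          by (rule integral_mono'[OF integrable_abs[OF elim(2)]]) (auto simp: indicator_def)
        with elim(1) z show "?good z" unfolding eA eB diff_zero by (blast intro: order_trans)
      qed
    qed
  qed
  have "AE z in lborel. \<forall>(r, s, d)\<in>Good. z \<in> {r<..<s} \<times> {0<..<d} \<longrightarrow> ?good z"
    by (subst AE_ball_countable[OF cG]) (use one in auto)
  then show ?thesis
  proof eventually_elim
    case (elim z)
    show ?case
    proof
      assume z: "z \<in> thin a e"
      \<comment> \<open>The strict bound g0 < g enters here: the top \<open>d\<close> has to lie
        above both the point and the strip, yet below the ceiling over the point.\<close>
      have "max (snd z) (e * g0) < e * g (fst z / a)" using z e g_lower[of "fst z / a"] by (auto simp: thin_def)
      then obtain d where d: "d \<in> \<rat>" "max (snd z) (e * g0) < d" "d < e * g (fst z / a)"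
        using Rats_dense_in_real by blast
      have "open ((\<lambda>x. x / a) -` {x. d / e < g x} \<inter> {0<..<1})"
        by (intro open_Int open_vimage open_superlevel continuous_intros) (use a in auto)
      moreover have "fst z \<in> (\<lambda>x. x / a) -` {x. d / e < g x} \<inter> {0<..<1}"
        using d z e by (auto simp: thin_def pos_divide_less_eq mult.commute)
      ultimately obtain r s where rs: "r \<in> \<rat>" "s \<in> \<rat>" "r < fst z" "fst z < s"
          "{r<..<s} \<subseteq> (\<lambda>x. x / a) -` {x. d / e < g x} \<inter> {0<..<1}"
        by (rule Rats_interval_within_open)
      have "{r<..<s} \<times> {0<..<d} \<subseteq> thin a e"
      proof
        fix z' assume z': "z' \<in> {r<..<s} \<times> {0<..<d}"
        then have "d / e < g (fst z' / a)" "0 < fst z'" "fst z' < 1" using subsetD[OF rs(5), of "fst z'"] by auto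
        then have "d < e * g (fst z' / a)" using e by (simp add: pos_divide_less_eq mult.commute)
        then show "z' \<in> thin a e" using z' \<open>0 < fst z'\<close> \<open>fst z' < 1\<close> by (auto simp: thin_def)
      qed
      then have "(r, s, d) \<in> Good" using rs d by (auto simp: Good_def)
      moreover have "z \<in> {r<..<s} \<times> {0<..<d}" using rs d z by (cases z) (auto simp: thin_def)
      ultimately show "?good z" using elim by blast
    qed
  qed
qed

text \<open>The strip over (s,t) is a full rectangle inside the domain, whatever g does above it.
  The slice estimate in the x direction bounds the deviation from the row mean for almost every row;
  integrating over the rows compares a column average with the average over the rectangle.\<close>

lemma horizontal_oscillation:
  fixes u G :: "real \<times> real \<Rightarrow> real"
  assumes a: "0 < a" and e: "0 < e"
    and ui: "integrable lborel u" and Gi: "integrable lborel G"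
    and J: "0 \<le> s" "s < t" "t \<le> 1"
    and weak: "\<And>a1 b1 c1 d1 \<phi> \<psi>. {a1<..<b1} \<times> {c1<..<d1} \<subseteq> thin a e \<Longrightarrow> test_function {a1<..<b1} \<phi> \<Longrightarrow>
      test_function {c1<..<d1} \<psi> \<Longrightarrow>
      (LBINT z. u z * (deriv \<phi> (fst z) * \<psi> (snd z))) = - (LBINT z. G z * (\<phi> (fst z) * \<psi> (snd z)))"
  defines "Q \<equiv> {s<..<t} \<times> {0<..<e * g0}"
  shows "AE x in lborel. x \<in> {s<..<t} \<longrightarrow>
    \<bar>(LBINT y. indicator {0<..<e * g0} y * u (x, y)) / (e * g0) - (LBINT z. indicator Q z * u z) / ((t - s) * (e * g0))\<bar>
      \<le> (LBINT z. indicator Q z * \<bar>G z\<bar>) / (e * g0)"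
proof -
  define m where "m = e * g0"
  have m: "0 < m" using e g0 by (simp add: m_def)
  have [measurable]: "Q \<in> sets borel" unfolding Q_def by (intro borel_Times) auto
  have Qthin: "Q \<subseteq> thin a e"
  proof
    fix z assume z: "z \<in> Q"
    have "e * g0 < e * g (fst z / a)" using e g_lower by simp
    then show "z \<in> thin a e" using z J by (auto simp: Q_def thin_def)
  qed
  define v where "v z = indicator Q z * u z" for z
  define H where "H z = indicator Q z * G z" for z
  have vi: "integrable lborel v" and Hi: "integrable lborel H"
    unfolding v_def H_def by (auto intro!: integrable_real_indicator_mult ui Gi)
  have [measurable]: "v \<in> borel_measurable borel" "H \<in> borel_measurable borel"
    using vi Hi by (auto dest: borel_measurable_integrable)
  have vi': "integrable lborel (\<lambda>z. v (snd z, fst z))" and Hi': "integrable lborel (\<lambda>z. H (snd z, fst z))"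
    using vi Hi integral_lborel_swap(2)[of v] integral_lborel_swap(2)[of H] by auto
  have w: "(LBINT z. v (snd z, fst z) * (\<phi> (fst z) * deriv \<psi> (snd z))) = - (LBINT z. H (snd z, fst z) * (\<phi> (fst z) * \<psi> (snd z)))"
    if tf: "test_function {0<..<m} \<phi>" "test_function {s<..<t} \<psi>" for \<phi> \<psi>
  proof -
    have sm: "smooth \<phi>" "smooth \<psi>" using tf by (auto simp: test_function_def)
    have [measurable]: "\<phi> \<in> borel_measurable borel" "\<psi> \<in> borel_measurable borel" "deriv \<psi> \<in> borel_measurable borel"
      using sm Ck_continuous Ck_realD(2)[of 0 \<psi>]
      by (auto simp: smooth_def simp del: Ck.simps intro!: borel_measurable_continuous_onI)
    have 1: "(LBINT z. v (snd z, fst z) * (\<phi> (fst z) * deriv \<psi> (snd z))) = (LBINT z. v z * (deriv \<psi> (fst z) * \<phi> (snd z)))"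
      using integral_lborel_swap(1)[of "\<lambda>z. v z * (deriv \<psi> (fst z) * \<phi> (snd z))"] by (simp add: mult_ac)
    have 2: "(LBINT z. H (snd z, fst z) * (\<phi> (fst z) * \<psi> (snd z))) = (LBINT z. H z * (\<psi> (fst z) * \<phi> (snd z)))"
      using integral_lborel_swap(1)[of "\<lambda>z. H z * (\<psi> (fst z) * \<phi> (snd z))"] by (simp add: mult_ac)
    have eqs: "v z * (deriv \<psi> (fst z) * \<phi> (snd z)) = u z * (deriv \<psi> (fst z) * \<phi> (snd z))"
      "H z * (\<psi> (fst z) * \<phi> (snd z)) = G z * (\<psi> (fst z) * \<phi> (snd z))" for z
      using test_function_eq_0[OF tf(1), of "snd z"] test_function_eq_0[OF tf(2), of "fst z"]
      by (cases z; auto simp: Q_def v_def H_def m_def indicator_def)+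
    show ?thesis unfolding 1 2 eqs
      by (rule weak[OF _ tf(2) tf(1)]) (use Qthin in \<open>simp add: Q_def m_def\<close>)
  qed
  \<comment> \<open>The coordinates are exchanged, and the averaging interval fills the whole of
    (s,t).\<close>
  have "AE z in lborel. z \<in> {0<..<m} \<times> {s<..<t} \<longrightarrow>
      \<bar>v (snd z, fst z) - (LBINT x. indicator {s<..<t} x * v (x, fst z)) / (t - s)\<bar> \<le> (LBINT x. \<bar>H (x, fst z)\<bar>)"
    using weak_derivative_oscillation_interval[OF vi' Hi', of s s t t 0 m] J w by simp
  from AE_lborel_pair[OF AE_lborel_swap[OF this]]
  have AE1: "AE x in lborel. AE y in lborel. y \<in> {0<..<m} \<and> x \<in> {s<..<t} \<longrightarrow>
    \<bar>v (x, y) - (LBINT x. indicator {s<..<t} x * v (x, y)) / (t - s)\<bar> \<le> (LBINT x. \<bar>H (x, y)\<bar>)"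
    by simp
  define P where "P y = (LBINT x. v (x, y))" for y
  have vP: "(LBINT x. indicator {s<..<t} x * v (x, y)) = P y" for y
    unfolding P_def by (intro Bochner_Integration.integral_cong) (auto simp: v_def Q_def indicator_def)
  define N where "N y = (LBINT x. \<bar>H (x, y)\<bar>)" for y
  have Pi: "integrable lborel P" and Pint: "(LBINT y. P y) = (LBINT z. v z)"
    using lborel_Fubini(2,3)[OF vi'] integral_lborel_swap(1)[of v] by (auto simp: P_def[abs_def])
  have Habs: "integrable lborel (\<lambda>z. \<bar>H (snd z, fst z)\<bar>)" using Hi' by simp
  have Ni: "integrable lborel N" and Nint: "(LBINT y. N y) = (LBINT z. \<bar>H z\<bar>)"
    using lborel_Fubini(2,3)[OF Habs] integral_lborel_swap(1)[of "\<lambda>z. \<bar>H z\<bar>"] by (auto simp: N_def[abs_def])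
  have vx: "AE x in lborel. integrable lborel (\<lambda>y. v (x, y))" by (rule lborel_Fubini(1)[OF vi])
  show ?thesis
    using AE1 vx
  proof eventually_elim
    case (elim x)
    show ?case
    proof
      assume x: "x \<in> {s<..<t}"
      have e1: "indicator {0<..<m} y * u (x, y) = v (x, y)" for y
        using x by (auto simp: v_def Q_def m_def indicator_def)
      have le: "AE y in lborel. \<bar>v (x, y) - P y / (t - s)\<bar> \<le> N y"
        using elim(1)
      proof eventually_elim
        case (elim y)
        show ?case
        proof (cases "y \<in> {0<..<m}")
          case True then show ?thesis using elim x by (simp add: vP N_def)
        next
          case False
          then have "v (x, y) = 0" for x by (auto simp: v_def Q_def m_def)
          then show ?thesis by (simp add: P_def N_def)
        qed
      qed
      have di: "integrable lborel (\<lambda>y. v (x, y) - P y / (t - s))" using elim(2) Pi by simp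
      have "\<bar>(LBINT y. v (x, y) - P y / (t - s))\<bar> \<le> (LBINT y. \<bar>v (x, y) - P y / (t - s)\<bar>)"
        by (rule integral_abs_bound)
      also have "\<dots> \<le> (LBINT y. N y)"
        by (rule integral_mono_AE[OF integrable_abs[OF di] Ni le])
      finally have "\<bar>(LBINT y. v (x, y)) - (LBINT z. v z) / (t - s)\<bar> \<le> (LBINT z. \<bar>H z\<bar>)"
        using elim(2) Pi by (simp add: Pint Nint)
      then have "\<bar>((LBINT y. v (x, y)) - (LBINT z. v z) / (t - s)) / m\<bar> \<le> (LBINT z. \<bar>H z\<bar>) / m"
        using m by (simp add: abs_divide divide_right_mono)
      moreover have eH: "\<bar>H z\<bar> = indicator Q z * \<bar>G z\<bar>" for z by (simp add: H_def abs_mult)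
      ultimately show "\<bar>(LBINT y. indicator {0<..<e * g0} y * u (x, y)) / (e * g0) - (LBINT z. indicator Q z * u z) / ((t - s) * (e * g0))\<bar>
        \<le> (LBINT z. indicator Q z * \<bar>G z\<bar>) / (e * g0)"
        unfolding m_def[symmetric] e1 v_def[symmetric] eH by (simp add: diff_divide_distrib)
    qed
  qed
qed

text \<open>The strip $y<e g_0$ lies in the thin domain over every $x$: a point above it is compared with
  the strip vertically, and only points of the strip are compared horizontally.\<close>

lemma thin_oscillation_powr:
  fixes u G1 G2 :: "real \<times> real \<Rightarrow> real"
  assumes a: "0 < a" and e: "0 < e" and p: "1 < p"
    and meas [measurable]: "u \<in> borel_measurable borel" "G1 \<in> borel_measurable borel" "G2 \<in> borel_measurable borel"
    and zero: "\<And>z. z \<notin> thin a e \<Longrightarrow> u z = 0" "\<And>z. z \<notin> thin a e \<Longrightarrow> G1 z = 0" "\<And>z. z \<notin> thin a e \<Longrightarrow> G2 z = 0"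
    and int: "integrable lborel (\<lambda>z. \<bar>u z\<bar> powr p)" "integrable lborel (\<lambda>z. \<bar>G1 z\<bar> powr p)" "integrable lborel (\<lambda>z. \<bar>G2 z\<bar> powr p)"
    and weak1: "\<And>a1 b1 c1 d1 \<phi> \<psi>. {a1<..<b1} \<times> {c1<..<d1} \<subseteq> thin a e \<Longrightarrow> test_function {a1<..<b1} \<phi> \<Longrightarrow>
      test_function {c1<..<d1} \<psi> \<Longrightarrow>
      (LBINT z. u z * (deriv \<phi> (fst z) * \<psi> (snd z))) = - (LBINT z. G1 z * (\<phi> (fst z) * \<psi> (snd z)))"
    and weak2: "\<And>a1 b1 c1 d1 \<phi> \<psi>. {a1<..<b1} \<times> {c1<..<d1} \<subseteq> thin a e \<Longrightarrow> test_function {a1<..<b1} \<phi> \<Longrightarrow>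
      test_function {c1<..<d1} \<psi> \<Longrightarrow>
      (LBINT z. u z * (\<phi> (fst z) * deriv \<psi> (snd z))) = - (LBINT z. G2 z * (\<phi> (fst z) * \<psi> (snd z)))"
    and J: "0 \<le> s" "s < t" "t \<le> 1"
  defines "A \<equiv> (LBINT z. u z * (indicator {s<..<t} (fst z) * indicator {..<e * g0} (snd z))) / ((t - s) * (e * g0))"
  shows "integrable lborel (\<lambda>z. indicator (thin a e) z * (indicator {s<..<t} (fst z) * \<bar>u z - A\<bar> powr p))" (is ?int)
    and "(LBINT z. indicator (thin a e) z * (indicator {s<..<t} (fst z) * \<bar>u z - A\<bar> powr p))
      \<le> 2 powr p * ((e * g1) powr p * (LBINT z. indicator {s<..<t} (fst z) * \<bar>G2 z\<bar> powr p)
          + g1 / g0 * (t - s) powr p * (LBINT z. indicator {s<..<t} (fst z) * \<bar>G1 z\<bar> powr p))" (is "?lhs \<le> ?rhs")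
proof -
  define m where "m = e * g0"
  have m: "0 < m" using e g0 by (simp add: m_def)
  note ui = integrable_of_powr[OF e p meas(1) int(1) zero(1)]
    and G1i = integrable_of_powr[OF e p meas(2) int(2) zero(2)]
    and G2i = integrable_of_powr[OF e p meas(3) int(3) zero(3)]
  define Q where "Q = {s<..<t} \<times> {0<..<m}"
  have [measurable]: "Q \<in> sets borel" unfolding Q_def by (intro borel_Times) auto
  let ?J = "indicator {s<..<t} :: real \<Rightarrow> real"
  \<comment> \<open>In \<open>A\<close> the half-line below e g0 may stand for the strip, because u
    vanishes off the thin domain.\<close>
  have uQ: "indicator Q z * u z = u z * (?J (fst z) * indicator {..<m} (snd z))" for z
    using zero(1)[of z] by (cases z) (auto simp: Q_def thin_def indicator_def)
  have A: "A = (LBINT z. indicator Q z * u z) / ((t - s) * m)"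
    unfolding A_def uQ m_def ..
  define KV where "KV x = (LBINT y. \<bar>G2 (x, y)\<bar>)" for x
  define KH where "KH = (LBINT z. indicator Q z * \<bar>G1 z\<bar>) / m"
  have [measurable]: "KV \<in> borel_measurable borel" unfolding KV_def by measurable
  have KV0: "0 \<le> KV x" for x unfolding KV_def by (intro integral_nonneg_AE) auto
  have KH0: "0 \<le> KH" unfolding KH_def using m by (intro divide_nonneg_nonneg integral_nonneg_AE) auto
  have V: "AE z in lborel. z \<in> thin a e \<longrightarrow> \<bar>u z - (LBINT t. indicator {0<..<m} t * u (fst z, t)) / m\<bar> \<le> KV (fst z)"
    using vertical_oscillation[OF a e ui G2i weak2] by (simp add: m_def KV_def)
  have H: "AE x in lborel. x \<in> {s<..<t} \<longrightarrow> \<bar>(LBINT y. indicator {0<..<m} y * u (x, y)) / m - A\<bar> \<le> KH"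
    using horizontal_oscillation[OF a e ui G1i J weak1] unfolding A KH_def Q_def m_def by simp
  have osc: "AE z in lborel. z \<in> thin a e \<and> fst z \<in> {s<..<t} \<longrightarrow> \<bar>u z - A\<bar> \<le> KV (fst z) + KH"
    using V AE_lborel_fst[OF H, where ?'b = real]
  proof eventually_elim
    case (elim z)
    then show ?case by auto
  qed
  define k where "k x = ?J x * (KV x powr p)" for x
  define B where "B x = (LBINT y. \<bar>G2 (x, y)\<bar> powr p)" for x
  have Bi: "integrable lborel B" using lborel_Fubini(2)[OF int(3)] by (simp add: B_def[abs_def])
  \<comment> \<open>Holder on a vertical line, where G2 lives on an interval of length at most e g1.
    The thickness bound later supplies one more factor e g1 and completes the power p.\<close>
  have KVp: "AE x in lborel. KV x powr p \<le> (e * g1) powr (p - 1) * B x"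
    using lborel_Fubini(1)[OF int(3)]
  proof eventually_elim
    case (elim x)
    have S: "indicator {0<..<e * g1} y * \<bar>G2 (x, y)\<bar> = \<bar>G2 (x, y)\<bar>"
      "indicator {0<..<e * g1} y * \<bar>G2 (x, y)\<bar> powr p = \<bar>G2 (x, y)\<bar> powr p" for y
    proof -
      have "y \<in> {0<..<e * g1}" if "G2 (x, y) \<noteq> 0"
      proof -
        have "(x, y) \<in> thin a e" using that zero(3) by blast
        moreover have "e * g (x / a) \<le> e * g1" using e g_upper by simp
        ultimately show ?thesis by (auto simp: thin_def)
      qed
      then show "indicator {0<..<e * g1} y * \<bar>G2 (x, y)\<bar> = \<bar>G2 (x, y)\<bar>"
        "indicator {0<..<e * g1} y * \<bar>G2 (x, y)\<bar> powr p = \<bar>G2 (x, y)\<bar> powr p"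
        by (cases "G2 (x, y) = 0"; simp)+
    qed
    have "measure lborel {0<..<e * g1} = e * g1" using e g1_pos by simp
    then show ?case
      using powr_integral_le(2)[OF p _ elim, of "{0<..<e * g1}"] e g1_pos unfolding S
      by (simp add: KV_def B_def)
  qed
  have ki: "integrable lborel k"
  proof (rule Bochner_Integration.integrable_bound)
    show "integrable lborel (\<lambda>x. (e * g1) powr (p - 1) * B x)" using Bi by simp
    show "AE x in lborel. norm (k x) \<le> norm ((e * g1) powr (p - 1) * B x)"
      using KVp by eventually_elim (auto simp: k_def indicator_def B_def)
  qed (unfold k_def, measurable)
  have Ji: "integrable lborel (\<lambda>x. ?J x * KH powr p)" by simp
  let ?D = "indicator (thin a e) :: _ \<Rightarrow> real"
  have Ii: "integrable lborel (\<lambda>z. 2 powr p * (?D z * k (fst z) + ?D z * (?J (fst z) * KH powr p)))"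
    using integrable_thin(1)[OF e ki] integrable_thin(1)[OF e Ji] by simp
  have le: "AE z in lborel. ?D z * (?J (fst z) * \<bar>u z - A\<bar> powr p) \<le> 2 powr p * (?D z * k (fst z) + ?D z * (?J (fst z) * KH powr p))"
    using osc
  proof eventually_elim
    case (elim z)
    show ?case
    proof (cases "z \<in> thin a e \<and> fst z \<in> {s<..<t}")
      case True
      have "\<bar>u z - A\<bar> powr p \<le> \<bar>KV (fst z) + KH\<bar> powr p" using elim True p by (intro powr_mono2) auto
      also have "\<dots> \<le> 2 powr p * (\<bar>KV (fst z)\<bar> powr p + \<bar>KH\<bar> powr p)"
        using norm_add_powr_le[of p "KV (fst z)" KH] p by simp
      finally show ?thesis using True KV0 KH0 by (simp add: k_def)
    qed (auto simp: k_def)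
  qed
  show I: ?int
    by (rule Bochner_Integration.integrable_bound[OF Ii]) (use le in \<open>auto elim!: eventually_mono simp: k_def\<close>)
  have "?lhs \<le> (LBINT z. 2 powr p * (?D z * k (fst z) + ?D z * (?J (fst z) * KH powr p)))"
    by (rule integral_mono_AE[OF I Ii le])
  also have "\<dots> = 2 powr p * ((LBINT z. ?D z * k (fst z)) + (LBINT z. ?D z * (?J (fst z) * KH powr p)))"
    using integrable_thin(1)[OF e ki] integrable_thin(1)[OF e Ji] by simp
  also have "\<dots> \<le> ?rhs"
  proof (intro mult_left_mono add_mono)
    have Bs: "integrable lborel (\<lambda>x. ?J x * B x)" by (rule integrable_real_indicator_mult[OF _ Bi]) simp
    have "(LBINT z. ?D z * k (fst z)) \<le> e * g1 * (LBINT x. indicator {0<..<1} x * k x)"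
      by (rule integral_thin_le[OF e ki]) (simp add: k_def)
    also have "(LBINT x. indicator {0<..<1} x * k x) \<le> (LBINT x. (e * g1) powr (p - 1) * (?J x * B x))"
    proof (rule integral_mono_AE)
      show "integrable lborel (\<lambda>x. indicator {0<..<1} x * k x)" by (rule integrable_real_indicator_mult[OF _ ki]) simp
      show "AE x in lborel. indicator {0<..<1} x * k x \<le> (e * g1) powr (p - 1) * (?J x * B x)"
        using KVp by eventually_elim (auto simp: k_def indicator_def B_def)
    qed (use Bs in simp)
    also have "(LBINT x. (e * g1) powr (p - 1) * (?J x * B x)) = (e * g1) powr (p - 1) * (LBINT z. ?J (fst z) * \<bar>G2 z\<bar> powr p)"
    proof -
      have "integrable lborel (\<lambda>z. ?J (fst z) * \<bar>G2 z\<bar> powr p)"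
        by (rule Bochner_Integration.integrable_bound[OF int(3)]) (auto simp: indicator_def)
      from lborel_Fubini(3)[OF this] show ?thesis by (simp add: B_def)
    qed
    also have "e * g1 * ((e * g1) powr (p - 1) * (LBINT z. ?J (fst z) * \<bar>G2 z\<bar> powr p)) = (e * g1) powr p * (LBINT z. ?J (fst z) * \<bar>G2 z\<bar> powr p)"
      using powr_add[of "e * g1" 1 "p - 1"] e g1_pos by simp
    finally show "(LBINT z. ?D z * k (fst z)) \<le> (e * g1) powr p * (LBINT z. ?J (fst z) * \<bar>G2 z\<bar> powr p)"
      using e g1_pos by (simp add: mult_left_mono)
    have "(LBINT z. ?D z * (?J (fst z) * KH powr p)) \<le> e * g1 * (LBINT x. indicator {0<..<1} x * (?J x * KH powr p))"
      by (rule integral_thin_le[OF e Ji]) simp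
    also have "(LBINT x. indicator {0<..<1} x * (?J x * KH powr p)) = (t - s) * KH powr p"
    proof -
      have eq: "indicator {0<..<1} x * (?J x * KH powr p) = ?J x * KH powr p" for x using J by (auto simp: indicator_def)
      show ?thesis unfolding eq using J by simp
    qed
    \<comment> \<open>Holder on the rectangle \<open>Q\<close>, whose area is (t - s) m.\<close>
    also have "KH powr p \<le> ((t - s) * m) powr (p - 1) * (LBINT z. ?J (fst z) * \<bar>G1 z\<bar> powr p) / m powr p"
    proof -
      have iQ: "integrable lborel (indicator Q :: _ \<Rightarrow> real)" and mQ: "measure lborel Q = (t - s) * m"
      proof -
        have eQ: "(indicator Q z :: real) = ?J (fst z) * indicator {0<..<m} (snd z)" for z
          by (cases z) (auto simp: Q_def indicator_def)
        show iQ: "integrable lborel (indicator Q :: _ \<Rightarrow> real)"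
          unfolding eQ[abs_def] by (rule integrable_lborel_times) auto
        have "measure lborel Q = (LBINT z. indicator Q z)" by simp
        also have "\<dots> = (t - s) * m" unfolding eQ using J m by (subst integral_lborel_times) auto
        finally show "measure lborel Q = (t - s) * m" .
      qed
      have "(LBINT z. indicator Q z * \<bar>G1 z\<bar>) powr p \<le> measure lborel Q powr (p - 1) * (LBINT z. indicator Q z * \<bar>G1 z\<bar> powr p)"
        by (rule powr_integral_le(2)[OF p _ int(2)]) (use iQ in \<open>auto simp: integrable_indicator_iff\<close>)
      also have "\<dots> \<le> measure lborel Q powr (p - 1) * (LBINT z. ?J (fst z) * \<bar>G1 z\<bar> powr p)"
      proof (intro mult_left_mono integral_mono')
        show "integrable lborel (\<lambda>z. ?J (fst z) * \<bar>G1 z\<bar> powr p)"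
          by (rule Bochner_Integration.integrable_bound[OF int(2)]) (auto simp: indicator_def)
      qed (auto simp: Q_def indicator_def)
      finally show ?thesis unfolding KH_def mQ
        using m by (subst powr_divide) (auto intro!: integral_nonneg_AE divide_right_mono)
    qed
    \<comment> \<open>The powers of m cancel up to one factor 1 / m, which meets the thickness e g1.
      The horizontal term is thus of order (t - s)^p with the constant g1 / g0, uniformly in
      e.\<close>
    also have "e * g1 * ((t - s) * (((t - s) * m) powr (p - 1) * (LBINT z. ?J (fst z) * \<bar>G1 z\<bar> powr p) / m powr p))
      = g1 / g0 * (t - s) powr p * (LBINT z. ?J (fst z) * \<bar>G1 z\<bar> powr p)"
    proof -
      have 1: "((t - s) * m) powr (p - 1) = (t - s) powr p / (t - s) * (m powr p / m)"
        using J m powr_diff[of "t - s" p 1] powr_diff[of m p 1] by (simp add: powr_mult)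
      have 2: "e * g1 / m = g1 / g0" using e g0 by (simp add: m_def)
      have "e * g1 * ((t - s) * (((t - s) * m) powr (p - 1) * X / m powr p)) = (e * g1 / m) * (t - s) powr p * X" for X
        unfolding 1 using J m by simp
      then show ?thesis unfolding 2 .
    qed
    finally show "(LBINT z. ?D z * (?J (fst z) * KH powr p)) \<le> g1 / g0 * (t - s) powr p * (LBINT z. ?J (fst z) * \<bar>G1 z\<bar> powr p)"
      using e g1_pos J by (simp add: mult_left_mono)
  qed simp
  finally show "?lhs \<le> ?rhs" .
qed

end

section \<open>Oscillation on the line, and a grid of short intervals\<close>

lemma AE_lborel_ex:
  fixes s t :: real
  assumes "AE x in lborel. P x" "s < t"
  obtains x where "x \<in> {s<..<t}" "P x"
proof -
  have "\<exists>x\<in>{s<..<t}. P x"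
  proof (rule ccontr)
    assume "\<not> (\<exists>x\<in>{s<..<t}. P x)"
    then have "AE x in lborel. x \<notin> {s<..<t}" using assms(1) by (auto elim!: eventually_mono)
    then have "{s<..<t} \<in> null_sets lborel" by (subst AE_iff_null_sets) auto
    then have "emeasure lborel {s<..<t} = 0" by (rule null_setsD1)
    then show False using assms(2) by simp
  qed
  then show ?thesis using that by blast
qed

lemma test_function_bounded:
  fixes \<psi> :: "real \<Rightarrow> real"
  assumes "test_function {a<..<b} \<psi>"
  obtains C where "\<And>x. \<bar>\<psi> x\<bar> \<le> C" "\<And>x. \<bar>deriv \<psi> x\<bar> \<le> C"
    "\<psi> \<in> borel_measurable borel" "deriv \<psi> \<in> borel_measurable borel"
proof -
  have sm: "Ck 1 \<psi>" using assms by (simp add: test_function_def smooth_def)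
  then have c: "continuous_on UNIV \<psi>" "continuous_on UNIV (deriv \<psi>)"
    using Ck_continuous[OF sm] Ck_realD(2)[of 0 \<psi>] by (auto simp del: Ck.simps(2) simp: numeral_nat)
  have "\<exists>C. \<forall>x. \<bar>f x\<bar> \<le> C" if f: "continuous_on UNIV f" "\<And>x. x \<notin> {a<..<b} \<Longrightarrow> f x = 0" for f :: "real \<Rightarrow> real"
  proof -
    have "compact (f ` {a..b})" by (rule compact_continuous_image[OF continuous_on_subset[OF f(1)]]) auto
    then obtain C where C: "\<And>x. x \<in> {a..b} \<Longrightarrow> \<bar>f x\<bar> \<le> C"
      using compact_imp_bounded bounded_iff by (metis imageI real_norm_def)
    have "\<bar>f x\<bar> \<le> max 0 C" for x
    proof (cases "x \<in> {a<..<b}")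
      case True then show ?thesis using C[of x] by auto
    qed (use f(2) in auto)
    then show ?thesis by blast
  qed
  note B = this
  obtain C1 where C1: "\<And>x. \<bar>\<psi> x\<bar> \<le> C1" using B[OF c(1) test_function_eq_0(1)[OF assms]] by blast
  obtain C2 where C2: "\<And>x. \<bar>deriv \<psi> x\<bar> \<le> C2" using B[OF c(2) test_function_eq_0(2)[OF assms]] by blast
  show ?thesis
    by (rule that[of "max C1 C2"]) (use C1 C2 c borel_measurable_continuous_onI le_max_iff_disj in blast)+
qed

lemma integrable_bounded_mult:
  fixes f g :: "'a::euclidean_space \<Rightarrow> real"
  assumes f: "integrable lborel f" and [measurable]: "g \<in> borel_measurable borel" and g: "\<And>x. \<bar>g x\<bar> \<le> C"
  shows "integrable lborel (\<lambda>x. f x * g x)"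
proof (rule Bochner_Integration.integrable_bound)
  have [measurable]: "f \<in> borel_measurable borel" using f by (auto dest: borel_measurable_integrable)
  show "integrable lborel (\<lambda>x. C * \<bar>f x\<bar>)" using f by simp
  have C: "0 \<le> C" using g[of undefined] by linarith
  show "AE x in lborel. norm (f x * g x) \<le> norm (C * \<bar>f x\<bar>)"
    using mult_left_mono[OF g, of "\<bar>f x\<bar>" x for x] C by (auto simp: abs_mult mult.commute)
  show "(\<lambda>x. f x * g x) \<in> borel_measurable lborel" by measurable
qed

text \<open>The two-variable slice estimate is reused: \<open>w\<close> becomes a function on (0,1)
  x (s,t) that is constant in the first variable, and a single good slice is selected.\<close>

lemma interval_oscillation_powr:
  fixes w dw :: "real \<Rightarrow> real"
  assumes p: "1 < p" and st: "s < t"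
    and [measurable]: "w \<in> borel_measurable borel" "dw \<in> borel_measurable borel"
    and int: "integrable lborel (\<lambda>x. \<bar>w x\<bar> powr p)" "integrable lborel (\<lambda>x. \<bar>dw x\<bar> powr p)"
    and weak: "\<And>\<psi>. test_function {s<..<t} \<psi> \<Longrightarrow> (LBINT x. w x * deriv \<psi> x) = - (LBINT x. dw x * \<psi> x)"
  defines "b \<equiv> (LBINT x. indicator {s<..<t} x * w x) / (t - s)"
  shows "integrable lborel (\<lambda>x. indicator {s<..<t} x * \<bar>w x - b\<bar> powr p)" (is ?int)
    and "(LBINT x. indicator {s<..<t} x * \<bar>w x - b\<bar> powr p) \<le> (t - s) powr p * (LBINT x. indicator {s<..<t} x * \<bar>dw x\<bar> powr p)"
      (is "?lhs \<le> ?rhs")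
proof -
  let ?J = "indicator {s<..<t} :: real \<Rightarrow> real" and ?I = "indicator {0<..<1} :: real \<Rightarrow> real"
  have S: "{s<..<t} \<in> sets lborel" "emeasure lborel {s<..<t} < \<infinity>" "measure lborel {s<..<t} = t - s" using st by auto
  have wi: "integrable lborel (\<lambda>x. ?J x * w x)" and di: "integrable lborel (\<lambda>x. ?J x * dw x)"
    using powr_integral_le(1)[OF p _ int(1) S(1,2)] powr_integral_le(1)[OF p _ int(2) S(1,2)] by auto
  define D where "D = (LBINT x. ?J x * \<bar>dw x\<bar>)"
  define u where "u z = ?I (fst z) * (?J (snd z) * w (snd z))" for z
  define G where "G z = ?I (fst z) * (?J (snd z) * dw (snd z))" for z
  have ui: "integrable lborel u" and Gi: "integrable lborel G"
    unfolding u_def G_def by (rule integrable_lborel_times[OF _ wi], simp, rule integrable_lborel_times[OF _ di], simp)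
  have wk: "(LBINT z. u z * (\<phi> (fst z) * deriv \<psi> (snd z))) = - (LBINT z. G z * (\<phi> (fst z) * \<psi> (snd z)))"
    if t: "test_function {0<..<1} \<phi>" "test_function {s<..<t} \<psi>" for \<phi> \<psi>
  proof -
    obtain C where C: "\<And>x. \<bar>\<phi> x\<bar> \<le> C" "\<phi> \<in> borel_measurable borel" using test_function_bounded[OF t(1)] by metis
    obtain C' where C': "\<And>x. \<bar>\<psi> x\<bar> \<le> C'" "\<And>x. \<bar>deriv \<psi> x\<bar> \<le> C'" "\<psi> \<in> borel_measurable borel" "deriv \<psi> \<in> borel_measurable borel"
      using test_function_bounded[OF t(2)] by metis
    have i0: "integrable lborel (\<lambda>x. ?I x * \<phi> x)" by (rule integrable_bounded_mult[OF _ C(2,1)]) simp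
    have i1: "integrable lborel (\<lambda>x. ?J x * w x * deriv \<psi> x)" by (rule integrable_bounded_mult[OF wi C'(4,2)])
    have i2: "integrable lborel (\<lambda>x. ?J x * dw x * \<psi> x)" by (rule integrable_bounded_mult[OF di C'(3,1)])
    have j: "?J x * w x * deriv \<psi> x = w x * deriv \<psi> x" "?J x * dw x * \<psi> x = dw x * \<psi> x" for x
      using test_function_eq_0[OF t(2), of x] by (auto simp: indicator_def)
    have "(LBINT z. u z * (\<phi> (fst z) * deriv \<psi> (snd z))) = (LBINT z. (?I (fst z) * \<phi> (fst z)) * (?J (snd z) * w (snd z) * deriv \<psi> (snd z)))"
      by (simp add: u_def mult_ac)
    also have "\<dots> = (LBINT x. ?I x * \<phi> x) * (LBINT x. w x * deriv \<psi> x)"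
      using integral_lborel_times[OF i0 i1] unfolding j .
    also have "\<dots> = - ((LBINT x. ?I x * \<phi> x) * (LBINT x. dw x * \<psi> x))" using weak[OF t(2)] by simp
    also have "(LBINT x. ?I x * \<phi> x) * (LBINT x. dw x * \<psi> x) = (LBINT z. (?I (fst z) * \<phi> (fst z)) * (?J (snd z) * dw (snd z) * \<psi> (snd z)))"
      using integral_lborel_times[OF i0 i2, symmetric] unfolding j .
    also have "\<dots> = (LBINT z. G z * (\<phi> (fst z) * \<psi> (snd z)))" by (simp add: G_def mult_ac)
    finally show ?thesis .
  qed
  have "AE z in lborel. z \<in> {0<..<1} \<times> {s<..<t} \<longrightarrow>
    \<bar>u z - (LBINT y. ?J y * u (fst z, y)) / (t - s)\<bar> \<le> (LBINT y. \<bar>G (fst z, y)\<bar>)"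
    by (rule weak_derivative_oscillation_interval[OF ui Gi]) (use st wk in auto)
  from AE_lborel_pair[OF this] obtain x :: real where x: "x \<in> {0<..<1}"
    "AE y in lborel. (x, y) \<in> {0<..<1} \<times> {s<..<t} \<longrightarrow> \<bar>u (x, y) - (LBINT y. ?J y * u (x, y)) / (t - s)\<bar> \<le> (LBINT y. \<bar>G (x, y)\<bar>)"
    by (rule AE_lborel_ex[of _ 0 1]) auto
  have ux: "?J y * u (x, y) = ?J y * w y" "\<bar>G (x, y)\<bar> = ?J y * \<bar>dw y\<bar>" for y
    using x(1) by (auto simp: u_def G_def indicator_def)
  have osc: "AE y in lborel. y \<in> {s<..<t} \<longrightarrow> \<bar>w y - b\<bar> \<le> D"
    using x(2) unfolding ux b_def D_def
    by eventually_elim (use x(1) in \<open>auto simp: u_def\<close>)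
  have Ii: "integrable lborel (\<lambda>x. ?J x * D powr p)" by simp
  have le: "AE x in lborel. ?J x * \<bar>w x - b\<bar> powr p \<le> ?J x * D powr p"
    using osc by eventually_elim (use p in \<open>auto simp: indicator_def intro!: powr_mono2\<close>)
  show I: ?int
    by (rule Bochner_Integration.integrable_bound[OF Ii]) (use le in auto)
  have "?lhs \<le> (LBINT x. ?J x * D powr p)" by (rule integral_mono_AE[OF I Ii le])
  also have "\<dots> = (t - s) * D powr p" using st by simp
  also have "D powr p \<le> (t - s) powr (p - 1) * (LBINT x. ?J x * \<bar>dw x\<bar> powr p)"
    unfolding D_def using powr_integral_le(2)[OF p _ int(2) S(1,2)] S(3) by simp
  also have "(t - s) * ((t - s) powr (p - 1) * (LBINT x. ?J x * \<bar>dw x\<bar> powr p)) = ?rhs"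
    using st powr_diff[of "t - s" p 1] by simp
  finally show "?lhs \<le> ?rhs" using st by (simp add: mult_left_mono)
qed

text \<open>The open grid intervals are disjoint, which gives the inequality at every point;
  equality can fail only at grid points, a null set. The first form bounds sums of local integrals,
  the second recovers the global integral.\<close>

lemma grid_indicators:
  assumes N: "0 < N"
  shows "(\<Sum>i<N. indicator {real i / real N<..<real (Suc i) / real N} x) \<le> (indicator {0<..<1} x :: real)"
    and "AE x in lborel. (\<Sum>i<N. indicator {real i / real N<..<real (Suc i) / real N} x) = (indicator {0<..<1} x :: real)"
proof -
  let ?J = "\<lambda>i. {real i / real N<..<real (Suc i) / real N}"
  have sub: "?J i \<subseteq> {0<..<1}" if "i < N" for i
  proof -
    have "real (Suc i) / real N \<le> 1" "0 \<le> real i / real N" using that N by auto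
    then show ?thesis unfolding greaterThanLessThan_subseteq_greaterThanLessThan by blast
  qed
  have mem: "x \<in> ?J i \<longleftrightarrow> real i < x * N \<and> x * N < real (Suc i)" for x i
    using N by (simp add: pos_divide_less_eq pos_less_divide_eq)
  have one: "(\<Sum>i<N. indicator (?J i) x) = (1 :: real)" if "i0 < N" "x \<in> ?J i0" for i0 x
  proof -
    have "indicator (?J i) x = (if i = i0 then 1 else 0 :: real)" for i
    proof (cases "i = i0")
      case False
      have "x \<notin> ?J i"
      proof
        assume "x \<in> ?J i"
        then have "real i < real (Suc i0)" "real i0 < real (Suc i)" using that(2) unfolding mem by linarith+
        then show False using False by linarith
      qed
      then show ?thesis using False by simp
    qed (use that in simp)
    then show ?thesis using that(1) by simp
  qed
  have zero: "(\<Sum>i<N. indicator (?J i) x) = (0 :: real)" if "\<And>i. i < N \<Longrightarrow> x \<notin> ?J i" for x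
    by (rule sum.neutral) (use that in auto)
  show "(\<Sum>i<N. indicator (?J i) x) \<le> (indicator {0<..<1} x :: real)"
  proof (cases "\<exists>i<N. x \<in> ?J i")
    case True
    then obtain i where i: "i < N" "x \<in> ?J i" by blast
    then have "x \<in> {0<..<1}" using sub by blast
    then show ?thesis using one[OF i] by simp
  next
    case False
    then show ?thesis using zero[of x] by simp
  qed
  have "AE x in lborel. \<forall>i\<in>{..N}. x \<noteq> real i / real N"
    by (subst AE_ball_countable) (auto intro: AE_lborel_singleton countable_finite)
  then show "AE x in lborel. (\<Sum>i<N. indicator (?J i) x) = (indicator {0<..<1} x :: real)"
  proof eventually_elim
    case (elim x)
    show ?case
    proof (cases "x \<in> {0<..<1}")
      case True
      define k where "k = nat \<lfloor>x * N\<rfloor>"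
      have xN: "0 < x * N" "x * N < N" using True N by auto
      have k: "real k \<le> x * N" "x * N < real (Suc k)" using xN by (auto simp: k_def) linarith+
      have kN: "k < N" using k(1) xN by linarith
      then have "x \<noteq> real k / real N" using elim by auto
      then have "real k \<noteq> x * N" using N by (auto simp: field_simps)
      then have "x \<in> ?J k" unfolding mem using k by linarith
      then show ?thesis using one[OF kN] True by simp
    next
      case False
      then have "x \<notin> ?J i" if "i < N" for i using sub[OF that] by blast
      then have "(\<Sum>i<N. indicator (?J i) x) = (0 :: real)" by (rule zero)
      then show ?thesis using False by simp
    qed
  qed
qed

context thin_cell
begin

text \<open>On a fixed grid of N intervals u_n is compared with its strip mean, this with the mean
  of \<open>w\<close>, and that with \<open>w\<close>. The mean differences vanish as n grows
  because the grid is finite, and the vertical oscillation vanishes with e^p; the other two errors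
  are of order N^{-p} by the gradient bounds, so N is chosen before n.\<close>

lemma thin_strong_convergence:
  fixes u G1 G2 :: "nat \<Rightarrow> real \<times> real \<Rightarrow> real" and w dw :: "real \<Rightarrow> real" and a e :: "nat \<Rightarrow> real"
  assumes a: "\<And>n. 0 < a n" and e: "\<And>n. 0 < e n" "e \<longlonglongrightarrow> 0" and p: "1 < p"
    and meas [measurable]: "\<And>n. u n \<in> borel_measurable borel" "\<And>n. G1 n \<in> borel_measurable borel" "\<And>n. G2 n \<in> borel_measurable borel"
    and zero: "\<And>n z. z \<notin> thin (a n) (e n) \<Longrightarrow> u n z = 0" "\<And>n z. z \<notin> thin (a n) (e n) \<Longrightarrow> G1 n z = 0" "\<And>n z. z \<notin> thin (a n) (e n) \<Longrightarrow> G2 n z = 0"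
    and int: "\<And>n. integrable lborel (\<lambda>z. \<bar>u n z\<bar> powr p)" "\<And>n. integrable lborel (\<lambda>z. \<bar>G1 n z\<bar> powr p)" "\<And>n. integrable lborel (\<lambda>z. \<bar>G2 n z\<bar> powr p)"
    and C: "\<And>n. (LBINT z. \<bar>G1 n z\<bar> powr p) / e n \<le> C" "\<And>n. (LBINT z. \<bar>G2 n z\<bar> powr p) / e n \<le> C"
    and weak1: "\<And>n a1 b1 c1 d1 \<phi> \<psi>. {a1<..<b1} \<times> {c1<..<d1} \<subseteq> thin (a n) (e n) \<Longrightarrow> test_function {a1<..<b1} \<phi> \<Longrightarrow>
      test_function {c1<..<d1} \<psi> \<Longrightarrow>
      (LBINT z. u n z * (deriv \<phi> (fst z) * \<psi> (snd z))) = - (LBINT z. G1 n z * (\<phi> (fst z) * \<psi> (snd z)))"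
    and weak2: "\<And>n a1 b1 c1 d1 \<phi> \<psi>. {a1<..<b1} \<times> {c1<..<d1} \<subseteq> thin (a n) (e n) \<Longrightarrow> test_function {a1<..<b1} \<phi> \<Longrightarrow>
      test_function {c1<..<d1} \<psi> \<Longrightarrow>
      (LBINT z. u n z * (\<phi> (fst z) * deriv \<psi> (snd z))) = - (LBINT z. G2 n z * (\<phi> (fst z) * \<psi> (snd z)))"
    and wmeas [measurable]: "w \<in> borel_measurable borel" "dw \<in> borel_measurable borel"
    and wint: "integrable lborel (\<lambda>x. \<bar>w x\<bar> powr p)" "integrable lborel (\<lambda>x. \<bar>dw x\<bar> powr p)"
    and wweak: "\<And>s t \<psi>. 0 \<le> s \<Longrightarrow> s < t \<Longrightarrow> t \<le> 1 \<Longrightarrow> test_function {s<..<t} \<psi> \<Longrightarrow>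
      (LBINT x. w x * deriv \<psi> x) = - (LBINT x. dw x * \<psi> x)"
    and avg: "\<And>s t. 0 \<le> s \<Longrightarrow> s < t \<Longrightarrow> t \<le> 1 \<Longrightarrow>
      (\<lambda>n. (LBINT z. u n z * (indicator {s<..<t} (fst z) * indicator {..<e n * g0} (snd z))) / e n)
        \<longlonglongrightarrow> g0 * (LBINT x. indicator {s<..<t} x * w x)"
  shows "(\<lambda>n. (LBINT z. indicator (thin (a n) (e n)) z * \<bar>u n z - w (fst z)\<bar> powr p) / e n) \<longlonglongrightarrow> 0"
proof (rule tendstoI)
  fix \<rho> :: real assume \<rho>: "0 < \<rho>"
  have C0: "0 \<le> C"
  proof (rule order_trans[OF _ C(1)[of 0]])
    show "0 \<le> (LBINT z. \<bar>G1 0 z\<bar> powr p) / e 0"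
      using e(1)[of 0] by (intro divide_nonneg_nonneg integral_nonneg_AE) auto
  qed
  define D where "D = (LBINT x. \<bar>dw x\<bar> powr p)"
  have D0: "0 \<le> D" unfolding D_def by (intro integral_nonneg_AE) auto
  \<comment> \<open>As n tends to infinity the bound becomes K N^{-p}: horizontal oscillation of u_n
    with constant g1 / g0, and oscillation of \<open>w\<close> multiplied by the thickness bound
    g1.\<close>
  define K where "K = 4 powr p * (2 powr p * (g1 / g0 * C) + g1 * D)"
  define A where "A n s t = (LBINT z. u n z * (indicator {s<..<t} (fst z) * indicator {..<e n * g0} (snd z))) / ((t - s) * (e n * g0))" for n s t
  define b where "b s t = (LBINT x. indicator {s<..<t} x * w x) / (t - s)" for s t
  have Ab: "(\<lambda>n. A n s t) \<longlonglongrightarrow> b s t" if "0 \<le> s" "s < t" "t \<le> 1" for s t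
  proof -
    have "(\<lambda>n. (LBINT z. u n z * (indicator {s<..<t} (fst z) * indicator {..<e n * g0} (snd z))) / e n / ((t - s) * g0)) \<longlonglongrightarrow> g0 * (LBINT x. indicator {s<..<t} x * w x) / ((t - s) * g0)"
      by (intro tendsto_divide avg that tendsto_const) (use that g0 in auto)
    then show ?thesis using g0 by (simp add: A_def b_def mult_ac)
  qed
  have local: "integrable lborel (\<lambda>z. indicator (thin (a n) (e n)) z * (indicator {s<..<t} (fst z) * \<bar>u n z - w (fst z)\<bar> powr p))"
    "(LBINT z. indicator (thin (a n) (e n)) z * (indicator {s<..<t} (fst z) * \<bar>u n z - w (fst z)\<bar> powr p)) \<le>
      4 powr p * (2 powr p * ((e n * g1) powr p * (LBINT z. indicator {s<..<t} (fst z) * \<bar>G2 n z\<bar> powr p)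
          + g1 / g0 * (t - s) powr p * (LBINT z. indicator {s<..<t} (fst z) * \<bar>G1 n z\<bar> powr p))
        + e n * g1 * ((t - s) * \<bar>A n s t - b s t\<bar> powr p) + e n * g1 * ((t - s) powr p * (LBINT x. indicator {s<..<t} x * \<bar>dw x\<bar> powr p)))"
    if J: "0 \<le> s" "s < t" "t \<le> 1" for n s t
  proof -
    let ?T = "indicator (thin (a n) (e n)) :: _ \<Rightarrow> real" and ?J = "indicator {s<..<t} :: real \<Rightarrow> real"
    have P: "integrable lborel (\<lambda>z. ?T z * (?J (fst z) * \<bar>u n z - A n s t\<bar> powr p))"
      "(LBINT z. ?T z * (?J (fst z) * \<bar>u n z - A n s t\<bar> powr p))
        \<le> 2 powr p * ((e n * g1) powr p * (LBINT z. ?J (fst z) * \<bar>G2 n z\<bar> powr p)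
          + g1 / g0 * (t - s) powr p * (LBINT z. ?J (fst z) * \<bar>G1 n z\<bar> powr p))"
      unfolding A_def
      by (rule thin_oscillation_powr[OF a[of n] e(1)[of n] p]; (rule meas zero int weak1 weak2 J; assumption?))+
    have W: "integrable lborel (\<lambda>x. ?J x * \<bar>w x - b s t\<bar> powr p)"
      "(LBINT x. ?J x * \<bar>w x - b s t\<bar> powr p) \<le> (t - s) powr p * (LBINT x. ?J x * \<bar>dw x\<bar> powr p)"
      unfolding b_def
      by (rule interval_oscillation_powr[OF p J(2) wmeas wint]; rule wweak[OF J]; assumption)+
    have ii: "integrable lborel (\<lambda>x. ?J x * \<bar>A n s t - b s t\<bar> powr p)" by simp
    let ?R = "\<lambda>z. 4 powr p * (?T z * (?J (fst z) * \<bar>u n z - A n s t\<bar> powr p) + ?T z * (?J (fst z) * \<bar>A n s t - b s t\<bar> powr p)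
      + ?T z * (?J (fst z) * \<bar>w (fst z) - b s t\<bar> powr p))"
    have Ri: "integrable lborel ?R"
      using P(1) integrable_thin(1)[OF e(1)[of n] ii, of "a n"] integrable_thin(1)[OF e(1)[of n] W(1), of "a n"] by simp
    have le: "?T z * (?J (fst z) * \<bar>u n z - w (fst z)\<bar> powr p) \<le> ?R z" for z
    proof (cases "z \<in> thin (a n) (e n) \<and> fst z \<in> {s<..<t}")
      case True
      have "\<bar>u n z - w (fst z)\<bar> powr p \<le> 2 powr p * (\<bar>u n z - A n s t\<bar> powr p + \<bar>(A n s t - b s t) - (w (fst z) - b s t)\<bar> powr p)"
        using norm_add_powr_le[of p "u n z - A n s t" "(A n s t - b s t) - (w (fst z) - b s t)"] p by simp
      also have "\<dots> \<le> 2 powr p * (2 powr p * \<bar>u n z - A n s t\<bar> powr p + 2 powr p * (\<bar>A n s t - b s t\<bar> powr p + \<bar>w (fst z) - b s t\<bar> powr p))"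
      proof (intro mult_left_mono add_mono)
        show "\<bar>(A n s t - b s t) - (w (fst z) - b s t)\<bar> powr p \<le> 2 powr p * (\<bar>A n s t - b s t\<bar> powr p + \<bar>w (fst z) - b s t\<bar> powr p)"
          using norm_diff_powr_le[of p "A n s t - b s t" "w (fst z) - b s t"] p by simp
        have "1 \<le> 2 powr p" using p by (intro ge_one_powr_ge_zero) auto
        then show "\<bar>u n z - A n s t\<bar> powr p \<le> 2 powr p * \<bar>u n z - A n s t\<bar> powr p"
          by (simp add: mult_le_cancel_right1)
      qed simp
      also have "\<dots> = 4 powr p * (\<bar>u n z - A n s t\<bar> powr p + \<bar>A n s t - b s t\<bar> powr p + \<bar>w (fst z) - b s t\<bar> powr p)"
        using powr_mult[of 2 2 p] by (simp add: algebra_simps)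
      finally show ?thesis using True by simp
    qed auto
    show I: "integrable lborel (\<lambda>z. ?T z * (?J (fst z) * \<bar>u n z - w (fst z)\<bar> powr p))"
    proof (rule Bochner_Integration.integrable_bound[OF Ri])
      show "AE z in lborel. norm (?T z * (?J (fst z) * \<bar>u n z - w (fst z)\<bar> powr p)) \<le> norm (?R z)"
        by (intro AE_I2) (use le in \<open>auto intro!: order_trans[OF le]\<close>)
    qed measurable
    have "(LBINT z. ?T z * (?J (fst z) * \<bar>u n z - w (fst z)\<bar> powr p)) \<le> (LBINT z. ?R z)"
      by (rule integral_mono[OF I Ri le])
    also have "\<dots> = 4 powr p * ((LBINT z. ?T z * (?J (fst z) * \<bar>u n z - A n s t\<bar> powr p)) + (LBINT z. ?T z * (?J (fst z) * \<bar>A n s t - b s t\<bar> powr p))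
      + (LBINT z. ?T z * (?J (fst z) * \<bar>w (fst z) - b s t\<bar> powr p)))"
      using P(1) integrable_thin(1)[OF e(1)[of n] ii, of "a n"] integrable_thin(1)[OF e(1)[of n] W(1), of "a n"] by simp
    also have "\<dots> \<le> 4 powr p * (2 powr p * ((e n * g1) powr p * (LBINT z. ?J (fst z) * \<bar>G2 n z\<bar> powr p)
          + g1 / g0 * (t - s) powr p * (LBINT z. ?J (fst z) * \<bar>G1 n z\<bar> powr p))
        + e n * g1 * ((t - s) * \<bar>A n s t - b s t\<bar> powr p) + e n * g1 * ((t - s) powr p * (LBINT x. ?J x * \<bar>dw x\<bar> powr p)))"
    proof (intro mult_left_mono add_mono P(2))
      have j: "indicator {0<..<1} x * (?J x * y) = ?J x * y" for x y using J by (auto simp: indicator_def)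
      have "(LBINT z. ?T z * (?J (fst z) * \<bar>A n s t - b s t\<bar> powr p)) \<le> e n * g1 * (LBINT x. ?J x * \<bar>A n s t - b s t\<bar> powr p)"
        using integral_thin_le[OF e(1)[of n] ii, of "a n"] unfolding j by simp
      also have "(LBINT x. ?J x * \<bar>A n s t - b s t\<bar> powr p) = (t - s) * \<bar>A n s t - b s t\<bar> powr p" using J by simp
      finally show "(LBINT z. ?T z * (?J (fst z) * \<bar>A n s t - b s t\<bar> powr p)) \<le> e n * g1 * ((t - s) * \<bar>A n s t - b s t\<bar> powr p)" .
      have "(LBINT z. ?T z * (?J (fst z) * \<bar>w (fst z) - b s t\<bar> powr p)) \<le> e n * g1 * (LBINT x. ?J x * \<bar>w x - b s t\<bar> powr p)"
        using integral_thin_le[OF e(1)[of n] W(1), of "a n"] unfolding j by simp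
      also have "\<dots> \<le> e n * g1 * ((t - s) powr p * (LBINT x. ?J x * \<bar>dw x\<bar> powr p))"
        using e(1)[of n] g1_pos by (intro mult_left_mono W(2)) auto
      finally show "(LBINT z. ?T z * (?J (fst z) * \<bar>w (fst z) - b s t\<bar> powr p)) \<le> e n * g1 * ((t - s) powr p * (LBINT x. ?J x * \<bar>dw x\<bar> powr p))" .
    qed (rule powr_ge_zero)
    finally show "(LBINT z. ?T z * (?J (fst z) * \<bar>u n z - w (fst z)\<bar> powr p)) \<le> \<dots>" .
  qed
  have "(\<lambda>N. K * (1 / real (Suc N)) powr p) \<longlonglongrightarrow> K * 0 powr p"
    by (intro tendsto_intros tendsto_powr' LIMSEQ_Suc[OF lim_1_over_n]) (use p in auto)
  then have "eventually (\<lambda>N. K * (1 / real (Suc N)) powr p < \<rho>) sequentially"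
    using \<rho> by (intro order_tendstoD(2)[where y = "K * 0 powr p"]) auto
  then obtain N' where N': "K * (1 / real (Suc N')) powr p < \<rho>"
    by (auto simp: eventually_sequentially simp del: of_nat_Suc)
  define N where "N = Suc N'"
  have N: "0 < N" "K * (1 / real N) powr p < \<rho>" using N' by (simp_all add: N_def)
  define s where "s i = real i / real N" for i
  have st: "0 \<le> s i" "s i < s (Suc i)" "s (Suc i) - s i = 1 / N" for i
    using N by (auto simp: s_def field_simps)
  have s1: "s (Suc i) \<le> 1" if "i < N" for i using that N by (auto simp: s_def)
  let ?J = "\<lambda>i. indicator {s i<..<s (Suc i)} :: real \<Rightarrow> real"
  have grid: "(\<Sum>i<N. ?J i x) \<le> indicator {0<..<1} x" "AE x in lborel. (\<Sum>i<N. ?J i x) = indicator {0<..<1} x" for x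
    using grid_indicators[OF N(1)] unfolding s_def by auto
  define R where "R n = 4 powr p * (2 powr p * ((e n * g1) powr p * C + g1 / g0 * (1 / N) powr p * C)
      + g1 / N * (\<Sum>i<N. \<bar>A n (s i) (s (Suc i)) - b (s i) (s (Suc i))\<bar> powr p) + g1 * (1 / N) powr p * D)" for n
  \<comment> \<open>Local energies over disjoint intervals add up to at most the global energy, so
    the constants do not grow with N.\<close>
  have sumG: "(\<Sum>i<N. (\<integral>z. ?J i (f z) * k z \<partial>M)) \<le> (\<integral>z. k z \<partial>M)"
    if k: "integrable M k" "\<And>z. 0 \<le> k z" and f: "f \<in> borel_measurable M" for k :: "'z \<Rightarrow> real" and M f
  proof -
    have i: "integrable M (\<lambda>z. ?J i (f z) * k z)" for i
      by (rule Bochner_Integration.integrable_bound[OF k(1)])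
        (use f borel_measurable_integrable[OF k(1)] in \<open>auto simp: indicator_def\<close>)
    have "(\<Sum>i<N. (\<integral>z. ?J i (f z) * k z \<partial>M)) = (\<integral>z. (\<Sum>i<N. ?J i (f z) * k z) \<partial>M)"
      by (rule Bochner_Integration.integral_sum[symmetric]) (rule i)
    also have "\<dots> \<le> (\<integral>z. k z \<partial>M)"
    proof (rule integral_mono[OF _ k(1)])
      show "integrable M (\<lambda>z. \<Sum>i<N. ?J i (f z) * k z)" by (intro Bochner_Integration.integrable_sum i)
      show "(\<Sum>i<N. ?J i (f z) * k z) \<le> k z" for z
      proof -
        have "(\<Sum>i<N. ?J i (f z)) \<le> 1" by (rule order_trans[OF grid(1)]) simp
        then have "(\<Sum>i<N. ?J i (f z)) * k z \<le> 1 * k z" using k(2) by (intro mult_right_mono) auto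
        then show ?thesis by (simp add: sum_distrib_right)
      qed
    qed
    finally show ?thesis .
  qed
  have bound: "(LBINT z. indicator (thin (a n) (e n)) z * \<bar>u n z - w (fst z)\<bar> powr p) / e n \<le> R n" for n
  proof -
    let ?T = "indicator (thin (a n) (e n)) :: _ \<Rightarrow> real"
    let ?S = "\<lambda>i z. ?T z * (?J i (fst z) * \<bar>u n z - w (fst z)\<bar> powr p)"
    define q where "q i = \<bar>A n (s i) (s (Suc i)) - b (s i) (s (Suc i))\<bar> powr p" for i
    define x2 where "x2 i = (LBINT z. ?J i (fst z) * \<bar>G2 n z\<bar> powr p)" for i
    define x1 where "x1 i = (LBINT z. ?J i (fst z) * \<bar>G1 n z\<bar> powr p)" for i
    define x0 where "x0 i = (LBINT x. ?J i x * \<bar>dw x\<bar> powr p)" for i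
    have X: "(\<Sum>i<N. x2 i) \<le> e n * C" "(\<Sum>i<N. x1 i) \<le> e n * C" "(\<Sum>i<N. x0 i) \<le> D"
    proof -
      have "(\<Sum>i<N. x2 i) \<le> (LBINT z. \<bar>G2 n z\<bar> powr p)" unfolding x2_def by (rule sumG[OF int(3)]) auto
      also have "\<dots> \<le> e n * C" using C(2)[of n] e(1)[of n] by (simp add: pos_divide_le_eq mult.commute)
      finally show "(\<Sum>i<N. x2 i) \<le> e n * C" .
      have "(\<Sum>i<N. x1 i) \<le> (LBINT z. \<bar>G1 n z\<bar> powr p)" unfolding x1_def by (rule sumG[OF int(2)]) auto
      also have "\<dots> \<le> e n * C" using C(1)[of n] e(1)[of n] by (simp add: pos_divide_le_eq mult.commute)
      finally show "(\<Sum>i<N. x1 i) \<le> e n * C" .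
      show "(\<Sum>i<N. x0 i) \<le> D" unfolding x0_def D_def
        using sumG[OF wint(2), of "\<lambda>x. x"] by simp
    qed
    have iS: "integrable lborel (?S i)" if "i < N" for i by (rule local(1)[OF st(1,2) s1[OF that]])
    have "(LBINT z. ?T z * \<bar>u n z - w (fst z)\<bar> powr p) = (LBINT z. (\<Sum>i<N. ?S i z))"
    proof (rule integral_cong_AE)
      show "AE z in lborel. ?T z * \<bar>u n z - w (fst z)\<bar> powr p = (\<Sum>i<N. ?S i z)"
        using AE_lborel_fst[OF grid(2), where ?'b = real]
      proof eventually_elim
        case (elim z)
        have "(\<Sum>i<N. ?S i z) = ?T z * ((\<Sum>i<N. ?J i (fst z)) * \<bar>u n z - w (fst z)\<bar> powr p)"
          by (simp only: sum_distrib_left sum_distrib_right)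
        also have "\<dots> = ?T z * \<bar>u n z - w (fst z)\<bar> powr p"
          unfolding elim by (auto simp: thin_def indicator_def)
        finally show ?case ..
      qed
    qed measurable
    also have "\<dots> = (\<Sum>i<N. (LBINT z. ?S i z))"
      by (rule Bochner_Integration.integral_sum) (use iS in auto)
    also have "\<dots> \<le> (\<Sum>i<N. 4 powr p * (2 powr p * ((e n * g1) powr p * x2 i + g1 / g0 * (1 / N) powr p * x1 i)
        + e n * g1 * ((1 / N) * q i) + e n * g1 * ((1 / N) powr p * x0 i)))"
    proof (rule sum_mono)
      fix i assume "i \<in> {..<N}"
      then have "i < N" by simp
      from local(2)[OF st(1,2) s1[OF this], of n] show "(LBINT z. ?S i z) \<le> 4 powr p * (2 powr p * ((e n * g1) powr p * x2 i + g1 / g0 * (1 / N) powr p * x1 i)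
        + e n * g1 * ((1 / N) * q i) + e n * g1 * ((1 / N) powr p * x0 i))"
        unfolding st(3) q_def x0_def x1_def x2_def .
    qed
    also have "\<dots> = 4 powr p * (2 powr p * ((e n * g1) powr p * (\<Sum>i<N. x2 i) + g1 / g0 * (1 / N) powr p * (\<Sum>i<N. x1 i))
        + e n * g1 * ((1 / N) * (\<Sum>i<N. q i)) + e n * g1 * ((1 / N) powr p * (\<Sum>i<N. x0 i)))"
      by (simp only: sum.distrib sum_distrib_left[symmetric])
    also have "\<dots> \<le> 4 powr p * (2 powr p * ((e n * g1) powr p * (e n * C) + g1 / g0 * (1 / N) powr p * (e n * C))
        + e n * g1 * ((1 / N) * (\<Sum>i<N. q i)) + e n * g1 * ((1 / N) powr p * D))"
      using e(1)[of n] g0 g1_pos by (intro mult_left_mono add_mono order_refl X) auto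
    also have "\<dots> = e n * R n"
      unfolding R_def q_def by (simp add: algebra_simps)
    finally show ?thesis using e(1)[of n] by (simp add: pos_divide_le_eq mult.commute)
  qed
  let ?R = "4 powr p * (2 powr p * ((0 * g1) powr p * C + g1 / g0 * (1 / N) powr p * C)
      + g1 / N * (\<Sum>i<N. \<bar>b (s i) (s (Suc i)) - b (s i) (s (Suc i))\<bar> powr p) + g1 * (1 / N) powr p * D)"
  have "R \<longlonglongrightarrow> ?R"
    unfolding R_def
    by (intro tendsto_add tendsto_mult tendsto_const tendsto_sum tendsto_powr' tendsto_rabs tendsto_diff Ab st(1,2) s1 e(2))
      (use p e(1) g1_pos in \<open>auto intro!: always_eventually less_imp_le mult_pos_pos\<close>)
  moreover have "?R = K * (1 / real N) powr p" unfolding K_def by (simp add: algebra_simps)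
  ultimately have "eventually (\<lambda>n. R n < \<rho>) sequentially" using N(2) by (intro order_tendstoD(2)[where y = ?R]) auto
  then show "eventually (\<lambda>n. dist ((LBINT z. indicator (thin (a n) (e n)) z * \<bar>u n z - w (fst z)\<bar> powr p) / e n) 0 < \<rho>) sequentially"
  proof eventually_elim
    case (elim n)
    have "0 \<le> (LBINT z. indicator (thin (a n) (e n)) z * \<bar>u n z - w (fst z)\<bar> powr p) / e n"
      using e(1)[of n] by (intro divide_nonneg_nonneg integral_nonneg_AE) auto
    then show ?case using bound[of n] elim by (simp add: dist_real_def)
  qed
qed

end

section \<open>Strong convergence of gradients and correctors\<close>

text \<open>The duality map v -> |v|^{p-2} v takes L^p into L^q because (p - 1) q = p, and its
  pairing with v returns |v|^p. Both identities include v = 0, since \<open>0 powr s = 0\<close> for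
  every exponent.\<close>

lemma powr_dual:
  fixes v p q :: real
  assumes p: "1 < p" "1 / p + 1 / q = 1"
  shows "\<bar>\<bar>v\<bar> powr (p - 2) * v\<bar> powr q = \<bar>v\<bar> powr p" "\<bar>v\<bar> powr (p - 2) * (v * v) = \<bar>v\<bar> powr p"
proof -
  have "\<bar>v\<bar> powr (p - 2) * \<bar>v\<bar> = \<bar>v\<bar> powr (p - 1)"
    using powr_add[of "\<bar>v\<bar>" "p - 2" 1] by (cases "v = 0") auto
  then show "\<bar>\<bar>v\<bar> powr (p - 2) * v\<bar> powr q = \<bar>v\<bar> powr p"
    using conjugate_exponent(2)[OF p] by (simp add: abs_mult powr_powr)
  show "\<bar>v\<bar> powr (p - 2) * (v * v) = \<bar>v\<bar> powr p"
  proof (cases "v = 0")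
    case False
    have "\<bar>v\<bar> powr p = \<bar>v\<bar> powr (p - 2) * \<bar>v\<bar> powr 2" using powr_add[of "\<bar>v\<bar>" "p - 2" 2] by simp
    also have "\<bar>v\<bar> powr 2 = v * v" using False by (simp add: power2_eq_square)
    finally show ?thesis ..
  qed simp
qed

text \<open>Young splits the load term into |u|^p / p + |f|^q / q. Absorbing the first part leaves
  the factor 1 - 1/p = 1/q on both sides, so the a priori bound has constant 1.\<close>

lemma energy_bound:
  fixes f u E :: "'a \<Rightarrow> real"
  assumes p: "1 < p" "1 / p + 1 / q = 1"
    and f: "f \<in> borel_measurable M" "integrable M (\<lambda>z. \<bar>f z\<bar> powr q)"
    and u: "u \<in> borel_measurable M" "integrable M (\<lambda>z. \<bar>u z\<bar> powr p)"
    and E: "integrable M E" "\<And>z. 0 \<le> E z"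
    and eq: "(\<integral>z. E z + \<bar>u z\<bar> powr p \<partial>M) = (\<integral>z. f z * u z \<partial>M)"
  shows "(\<integral>z. E z + \<bar>u z\<bar> powr p \<partial>M) \<le> (\<integral>z. \<bar>f z\<bar> powr q \<partial>M)"
proof -
  note q = conjugate_exponent[OF p]
  let ?T = "\<integral>z. E z + \<bar>u z\<bar> powr p \<partial>M" and ?F = "\<integral>z. \<bar>f z\<bar> powr q \<partial>M"
  have fu: "integrable M (\<lambda>z. f z * u z)"
    using Holder_inequality(1)[OF q(1,4) f u] .
  have "?T \<le> (\<integral>z. \<bar>u z\<bar> powr p / p + \<bar>f z\<bar> powr q / q \<partial>M)"
    unfolding eq
  proof (rule integral_mono[OF fu])
    show "f z * u z \<le> \<bar>u z\<bar> powr p / p + \<bar>f z\<bar> powr q / q" for z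
      using Youngs_inequality[of p q "\<bar>u z\<bar>" "\<bar>f z\<bar>"] p q(1) abs_ge_self[of "f z * u z"]
      by (simp add: abs_mult mult.commute)
  qed (use f u in auto)
  also have "\<dots> = (\<integral>z. \<bar>u z\<bar> powr p \<partial>M) / p + ?F / q" using f u by simp
  also have "\<dots> \<le> ?T / p + ?F / q"
  proof -
    have "(\<integral>z. \<bar>u z\<bar> powr p \<partial>M) \<le> ?T" by (rule integral_mono) (use u E in auto)
    then show ?thesis using p by (simp add: divide_right_mono)
  qed
  finally have "?T * (1 - 1 / p) \<le> ?F * (1 / q)" by (simp add: algebra_simps)
  moreover have "1 - 1 / p = 1 / q" using p by simp
  ultimately show ?thesis using q(1) by (simp add: divide_le_cancel)
qed

context thin_cell
begin

text \<open>Expanding the gaps leaves norms of the unfolded sequence, constants, and two pairings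
  with the fixed elements |v|^{p-2} v and |u0|^{p-2} u0, to which weak convergence applies. The
  second component of the limit is 0, so the vertical derivative occurs only through the norm and
  tends to 0 as a by-product.\<close>

lemma gradient_strong_convergence:
  fixes f u G1 G2 :: "nat \<Rightarrow> real \<times> real \<Rightarrow> real" and u0 :: "real \<Rightarrow> real" and v :: "real \<times> real \<times> real \<Rightarrow> real"
    and a e :: "nat \<Rightarrow> real" and C \<Lambda> :: real
  defines "X \<equiv> (\<lambda>n. indicator (full_cells (a n) L \<times> Y) :: real \<times> real \<times> real \<Rightarrow> real)"
  assumes a: "\<And>n. 0 < a n" and e: "\<And>n. 0 < e n"
    and p: "1 < p" "1 / p + 1 / q = 1"
    and meas [measurable]: "\<And>n. f n \<in> borel_measurable borel" "\<And>n. u n \<in> borel_measurable borel"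
      "\<And>n. G1 n \<in> borel_measurable borel" "\<And>n. G2 n \<in> borel_measurable borel"
    and f0: "\<And>n z. z \<notin> thin (a n) (e n) \<Longrightarrow> f n z = 0"
    and int: "\<And>n. integrable lborel (\<lambda>z. \<bar>f n z\<bar> powr q)" "\<And>n. integrable lborel (\<lambda>z. \<bar>u n z\<bar> powr p)"
      "\<And>n. integrable lborel (\<lambda>z. norm (G1 n z, G2 n z) powr p)"
    and C: "\<And>n. (LBINT z. \<bar>f n z\<bar> powr q) / e n \<le> C"
    and energy: "\<And>n. (LBINT z. norm (G1 n z, G2 n z) powr p + \<bar>u n z\<bar> powr p) = (LBINT z. f n z * u n z)"
    and strong: "(\<lambda>n. (LBINT z. indicator (thin (a n) (e n)) z * \<bar>u n z - u0 (fst z)\<bar> powr p) / e n) \<longlonglongrightarrow> 0"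
    and load: "(\<lambda>n. (LBINT z. f n z * u0 (fst z)) / e n) \<longlonglongrightarrow> \<Lambda> / L"
    and u0: "u0 \<in> borel_measurable borel" "integrable lborel (\<lambda>x. \<bar>u0 x\<bar> powr p)"
    and v [measurable]: "v \<in> borel_measurable borel" and vint: "integrable lborel (\<lambda>z. \<bar>v z\<bar> powr p)"
    and WG: "(\<lambda>n. LBINT z. X n z * G1 n (Phi (a n) (e n) z) * (\<bar>v z\<bar> powr (p - 2) * v z)) \<longlonglongrightarrow> (LBINT z. \<bar>v z\<bar> powr p)"
    and Wu: "(\<lambda>n. LBINT z. X n z * u n (Phi (a n) (e n) z) * (indicator Y (snd z) * (\<bar>u0 (fst z)\<bar> powr (p - 2) * u0 (fst z))))
      \<longlonglongrightarrow> area * (LBINT x. \<bar>u0 x\<bar> powr p)"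
    and hom: "\<Lambda> = (LBINT z. \<bar>v z\<bar> powr p) + area * (LBINT x. \<bar>u0 x\<bar> powr p)"
  shows "\<And>n. integrable lborel (\<lambda>z. norm (X n z * G1 n (Phi (a n) (e n) z) - v z, X n z * G2 n (Phi (a n) (e n) z)) powr p)"
    and "(\<lambda>n. LBINT z. norm (X n z * G1 n (Phi (a n) (e n) z) - v z, X n z * G2 n (Phi (a n) (e n) z)) powr p) \<longlonglongrightarrow> 0"
proof -
  note q = conjugate_exponent[OF p]
  note [measurable] = u0(1)
  have [measurable]: "X n \<in> borel_measurable borel" for n unfolding X_def by measurable
  let ?Ph = "\<lambda>n. Phi (a n) (e n)" and ?T = "\<lambda>n. indicator (thin (a n) (e n)) :: _ \<Rightarrow> real"
  define E where "E n z = norm (G1 n z, G2 n z) powr p" for n z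
  have [measurable]: "E n \<in> borel_measurable borel" for n unfolding E_def by measurable
  have E0: "0 \<le> E n z" for n z by (simp add: E_def)
  have Ei: "integrable lborel (E n)" for n using int(3)[of n] by (simp add: E_def[abs_def])
  define F where "F n = (LBINT z. f n z * u n z) / e n" for n
  have fu: "integrable lborel (\<lambda>z. f n z * u n z)" for n
    by (rule Holder_inequality(1)[OF q(1,4) _ int(1) _ int(2)]) measurable
  have FE: "(LBINT z. E n z + \<bar>u n z\<bar> powr p) / e n = F n" for n
    using energy[of n] by (simp add: F_def E_def)
  have FC: "F n \<le> C" for n
  proof -
    have "(LBINT z. E n z + \<bar>u n z\<bar> powr p) \<le> (LBINT z. \<bar>f n z\<bar> powr q)"
      by (rule energy_bound[OF p _ int(1) _ int(2) Ei E0]) (use energy in \<open>simp_all add: E_def\<close>)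
    then have "F n \<le> (LBINT z. \<bar>f n z\<bar> powr q) / e n"
      unfolding FE[symmetric] using e[of n] by (simp add: divide_right_mono)
    then show ?thesis using C[of n] by linarith
  qed
  have C0: "0 \<le> C"
  proof (rule order_trans[OF _ C[of 0]])
    show "0 \<le> (LBINT z. \<bar>f 0 z\<bar> powr q) / e 0"
      using e[of 0] by (intro divide_nonneg_nonneg integral_nonneg_AE) auto
  qed

  \<comment> \<open>The bounded loads f_n are paired with u_n - u0, which is small in the rescaled
    norm, so that only their pairing with u0 remains.\<close>
  have Flim: "F \<longlonglongrightarrow> \<Lambda> / L"
  proof -
    define S where "S n = (LBINT z. ?T n z * \<bar>u n z - u0 (fst z)\<bar> powr p) / e n" for n
    have S0: "0 \<le> S n" for n unfolding S_def using e[of n] by (intro divide_nonneg_nonneg integral_nonneg_AE) auto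
    have "(\<lambda>n. F n - (LBINT z. f n z * u0 (fst z)) / e n) \<longlonglongrightarrow> 0"
    proof (rule Lim_null_comparison[OF always_eventually])
      have "(\<lambda>n. C powr (1 / q) * S n powr (1 / p)) \<longlonglongrightarrow> C powr (1 / q) * 0 powr (1 / p)"
        using strong S0 p by (intro tendsto_intros tendsto_powr') (auto simp: S_def intro!: always_eventually)
      then show "(\<lambda>n. C powr (1 / q) * S n powr (1 / p)) \<longlonglongrightarrow> 0" by simp
      show "\<forall>n. norm (F n - (LBINT z. f n z * u0 (fst z)) / e n) \<le> C powr (1 / q) * S n powr (1 / p)"
      proof
        fix n
        let ?d = "\<lambda>z. ?T n z * (u n z - u0 (fst z))"
        have ed: "\<bar>?d z\<bar> powr p = ?T n z * \<bar>u n z - u0 (fst z)\<bar> powr p" for z using p by (simp add: indicator_def)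
        have iT0: "integrable lborel (\<lambda>z. ?T n z * \<bar>u0 (fst z)\<bar> powr p)" by (rule integrable_thin(1)[OF e u0(2)])
        have iTu: "integrable lborel (\<lambda>z. ?T n z * \<bar>u n z\<bar> powr p)"
          by (rule integrable_real_indicator_mult[OF _ int(2)]) measurable
        have id: "integrable lborel (\<lambda>z. \<bar>?d z\<bar> powr p)" unfolding ed
        proof (rule Bochner_Integration.integrable_bound)
          show "integrable lborel (\<lambda>z. 2 powr p * (?T n z * \<bar>u n z\<bar> powr p + ?T n z * \<bar>u0 (fst z)\<bar> powr p))"
            using iT0 iTu by simp
          show "AE z in lborel. norm (?T n z * \<bar>u n z - u0 (fst z)\<bar> powr p) \<le> norm (2 powr p * (?T n z * \<bar>u n z\<bar> powr p + ?T n z * \<bar>u0 (fst z)\<bar> powr p))"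
          proof (rule AE_I2)
            fix z show "norm (?T n z * \<bar>u n z - u0 (fst z)\<bar> powr p) \<le> norm (2 powr p * (?T n z * \<bar>u n z\<bar> powr p + ?T n z * \<bar>u0 (fst z)\<bar> powr p))"
              using norm_diff_powr_le[of p "u n z" "u0 (fst z)"] p by (cases "z \<in> thin (a n) (e n)") simp_all
          qed
        qed measurable
        have md: "?d \<in> borel_measurable lborel" by measurable
        have mf: "f n \<in> borel_measurable lborel" by measurable
        note H = Holder_inequality[OF q(1,4) mf int(1) md id]
        have fu0: "integrable lborel (\<lambda>z. f n z * u0 (fst z))"
        proof -
          have e1: "f n z * u0 (fst z) = f n z * u n z - f n z * ?d z" for z
            using f0[of z n] by (cases "z \<in> thin (a n) (e n)") (auto simp: algebra_simps)
          show ?thesis unfolding e1 using fu[of n] H(1) by auto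
        qed
        have e2: "f n z * ?d z = f n z * u n z - f n z * u0 (fst z)" for z
          using f0[of z n] by (cases "z \<in> thin (a n) (e n)") (auto simp: algebra_simps)
        have d: "(LBINT z. f n z * u n z) - (LBINT z. f n z * u0 (fst z)) = (LBINT z. f n z * ?d z)"
          unfolding e2 by (rule Bochner_Integration.integral_diff[OF fu fu0, symmetric])
        have "\<bar>LBINT z. f n z * ?d z\<bar> \<le> (LBINT z. \<bar>f n z * ?d z\<bar>)" by (rule integral_abs_bound)
        also have "\<dots> \<le> (LBINT z. \<bar>f n z\<bar> powr q) powr (1 / q) * (LBINT z. \<bar>?d z\<bar> powr p) powr (1 / p)" by (rule H(2))
        also have "\<dots> \<le> (e n * C) powr (1 / q) * (e n * S n) powr (1 / p)"
        proof (intro mult_mono powr_mono2)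
          show "(LBINT z. \<bar>f n z\<bar> powr q) \<le> e n * C" using C[of n] e[of n] by (simp add: pos_divide_le_eq mult.commute)
          show "(LBINT z. \<bar>?d z\<bar> powr p) \<le> e n * S n" unfolding ed S_def using e[of n] by simp
        qed (use p q(1) in \<open>auto intro!: integral_nonneg_AE\<close>)
        also have "\<dots> = (e n powr (1 / q) * e n powr (1 / p)) * (C powr (1 / q) * S n powr (1 / p))"
          using e[of n] C0 S0[of n] by (simp add: powr_mult mult_ac)
        also have "e n powr (1 / q) * e n powr (1 / p) = e n" using q(4) e[of n] by (simp add: powr_add[symmetric])
        finally have "\<bar>LBINT z. f n z * ?d z\<bar> / e n \<le> C powr (1 / q) * S n powr (1 / p)"
          using e[of n] by (simp add: pos_divide_le_eq mult.commute)
        then show "norm (F n - (LBINT z. f n z * u0 (fst z)) / e n) \<le> C powr (1 / q) * S n powr (1 / p)"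
          unfolding F_def diff_divide_distrib[symmetric] d using e[of n] by (simp add: abs_divide)
      qed
    qed
    from tendsto_add[OF this load] show ?thesis by simp
  qed

  \<comment> \<open>An inequality, because the contribution over the incomplete last cell is
    dropped.\<close>
  have unfold_le: "integrable lborel (\<lambda>z. X n z * k (?Ph n z))"
    "(LBINT z. X n z * k (?Ph n z)) \<le> L * ((LBINT z. k z) / e n)"
    if k: "integrable lborel k" "\<And>z. 0 \<le> k z" for k n
  proof -
    have km [measurable]: "k \<in> borel_measurable borel" using k by (auto dest: borel_measurable_integrable)
    let ?I = "indicator (thin (a n) (e n) \<inter> full_cells (a n) L \<times> UNIV) :: _ \<Rightarrow> real"
    have i: "integrable lborel (\<lambda>z. ?I z * k z)"
      by (rule integrable_real_indicator_mult[OF _ k(1)]) measurable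
    show "integrable lborel (\<lambda>z. X n z * k (?Ph n z))"
      unfolding X_def using unfold_integral(1)[OF a e km] i by simp
    have "(LBINT z. X n z * k (?Ph n z)) = L / e n * (LBINT z. ?I z * k z)"
      unfolding X_def by (rule unfold_integral(2)[OF a e km])
    also have "\<dots> \<le> L / e n * (LBINT z. k z)"
      using L e[of n] k by (intro mult_left_mono integral_mono'[OF k(1)]) (auto simp: indicator_def)
    finally show "(LBINT z. X n z * k (?Ph n z)) \<le> L * ((LBINT z. k z) / e n)" by simp
  qed

  define V where "V = (LBINT z. \<bar>v z\<bar> powr p)"
  define U where "U z = indicator Y (snd z) * u0 (fst z)" for z :: "real \<times> real \<times> real"
  have [measurable]: "U \<in> borel_measurable borel" unfolding U_def by measurable
  have Up: "\<bar>U z\<bar> powr p = \<bar>u0 (fst z)\<bar> powr p * indicator Y (snd z)" for z using p by (simp add: U_def indicator_def)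
  have Ui: "integrable lborel (\<lambda>z. \<bar>U z\<bar> powr p)"
    unfolding Up by (rule integrable_lborel_times[OF u0(2) integrable_Y])
  have UW: "(LBINT z. \<bar>U z\<bar> powr p) = area * (LBINT x. \<bar>u0 x\<bar> powr p)"
    unfolding Up integral_lborel_times[OF u0(2) integrable_Y] area_def by simp
  define ga where "ga n z = powr_gap p (X n z * G1 n (?Ph n z), X n z * G2 n (?Ph n z)) (v z, 0)" for n z
  define gb where "gb n z = powr_gap p (X n z * u n (?Ph n z)) (U z)" for n z
  have na: "norm (X n z * G1 n (?Ph n z), X n z * G2 n (?Ph n z)) powr p = X n z * E n (?Ph n z)" for n z
    by (simp add: X_def E_def indicator_def)
  have nb: "\<bar>X n z * u n (?Ph n z)\<bar> powr p = X n z * \<bar>u n (?Ph n z)\<bar> powr p" for n z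
    by (simp add: X_def indicator_def)
  have Ai: "integrable lborel (\<lambda>z. X n z * E n (?Ph n z))" for n by (rule unfold_le(1)[OF Ei E0])
  have Bi: "integrable lborel (\<lambda>z. X n z * \<bar>u n (?Ph n z)\<bar> powr p)" for n by (rule unfold_le(1)[OF int(2)]) simp
  have G1i: "integrable lborel (\<lambda>z. \<bar>X n z * G1 n (?Ph n z)\<bar> powr p)" for n
  proof (rule Bochner_Integration.integrable_bound[OF Ai])
    show "AE z in lborel. norm (\<bar>X n z * G1 n (?Ph n z)\<bar> powr p) \<le> norm (X n z * E n (?Ph n z))"
    proof (rule AE_I2)
      fix z
      have "\<bar>X n z * G1 n (?Ph n z)\<bar> \<le> norm (X n z * G1 n (?Ph n z), X n z * G2 n (?Ph n z))"
        using norm_fst_le[of "X n z * G1 n (?Ph n z)" "X n z * G2 n (?Ph n z)"] by simp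
      then have "\<bar>X n z * G1 n (?Ph n z)\<bar> powr p \<le> X n z * E n (?Ph n z)"
        unfolding na[symmetric] using p by (intro powr_mono2) auto
      then show "norm (\<bar>X n z * G1 n (?Ph n z)\<bar> powr p) \<le> norm (X n z * E n (?Ph n z))" by simp
    qed
  qed measurable
  define IG where "IG n = (LBINT z. X n z * G1 n (?Ph n z) * (\<bar>v z\<bar> powr (p - 2) * v z))" for n
  define IU where "IU n = (LBINT z. X n z * u n (?Ph n z) * (\<bar>U z\<bar> powr (p - 2) * U z))" for n
  have mv: "(\<lambda>z. \<bar>v z\<bar> powr (p - 2) * v z) \<in> borel_measurable lborel" and mU: "(\<lambda>z. \<bar>U z\<bar> powr (p - 2) * U z) \<in> borel_measurable lborel"
    by measurable
  have mG: "(\<lambda>z. X n z * G1 n (?Ph n z)) \<in> borel_measurable lborel" and mu: "(\<lambda>z. X n z * u n (?Ph n z)) \<in> borel_measurable lborel" for n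
    by measurable
  have iIG: "integrable lborel (\<lambda>z. X n z * G1 n (?Ph n z) * (\<bar>v z\<bar> powr (p - 2) * v z))" for n
    by (rule Holder_inequality(1)[OF p mG G1i mv]) (simp add: powr_dual(1)[OF p] vint)
  have iIU: "integrable lborel (\<lambda>z. X n z * u n (?Ph n z) * (\<bar>U z\<bar> powr (p - 2) * U z))" for n
    by (rule Holder_inequality(1)[OF p mu _ mU]) (simp_all only: powr_dual(1)[OF p] Ui nb Bi)
  have ga: "ga n z = X n z * E n (?Ph n z) - \<bar>v z\<bar> powr p - p * (X n z * G1 n (?Ph n z) * (\<bar>v z\<bar> powr (p - 2) * v z) - \<bar>v z\<bar> powr p)" for n z
  proof -
    have "ga n z = norm (X n z * G1 n (?Ph n z), X n z * G2 n (?Ph n z)) powr p - \<bar>v z\<bar> powr p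
      - p * (\<bar>v z\<bar> powr (p - 2) * (v z * (X n z * G1 n (?Ph n z) - v z)))"
      by (simp add: ga_def powr_gap_def norm_Pair)
    also have "\<bar>v z\<bar> powr (p - 2) * (v z * (X n z * G1 n (?Ph n z) - v z)) = X n z * G1 n (?Ph n z) * (\<bar>v z\<bar> powr (p - 2) * v z) - \<bar>v z\<bar> powr p"
      unfolding powr_dual(2)[OF p, of "v z", symmetric] by (simp add: algebra_simps)
    finally show ?thesis unfolding na .
  qed
  have gb: "gb n z = X n z * \<bar>u n (?Ph n z)\<bar> powr p - \<bar>U z\<bar> powr p - p * (X n z * u n (?Ph n z) * (\<bar>U z\<bar> powr (p - 2) * U z) - \<bar>U z\<bar> powr p)" for n z
  proof -
    have "gb n z = \<bar>X n z * u n (?Ph n z)\<bar> powr p - \<bar>U z\<bar> powr p - p * (\<bar>U z\<bar> powr (p - 2) * (U z * (X n z * u n (?Ph n z) - U z)))"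
      by (simp add: gb_def powr_gap_def)
    also have "\<bar>U z\<bar> powr (p - 2) * (U z * (X n z * u n (?Ph n z) - U z)) = X n z * u n (?Ph n z) * (\<bar>U z\<bar> powr (p - 2) * U z) - \<bar>U z\<bar> powr p"
      unfolding powr_dual(2)[OF p, of "U z", symmetric] by (simp add: algebra_simps)
    finally show ?thesis unfolding nb .
  qed
  have gai: "integrable lborel (ga n)" for n
    unfolding ga using Ai[of n] vint iIG[of n]
    by (auto intro!: Bochner_Integration.integrable_diff)
  have gaI: "(LBINT z. ga n z) = (LBINT z. X n z * E n (?Ph n z)) - V - p * (IG n - V)" for n
    unfolding ga IG_def V_def using Ai[of n] vint iIG[of n] by simp
  define W where "W = (LBINT z. \<bar>U z\<bar> powr p)"
  have gbI: "(LBINT z. gb n z) = (LBINT z. X n z * \<bar>u n (?Ph n z)\<bar> powr p) - W - p * (IU n - W)" for n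
    unfolding gb IU_def W_def using Bi[of n] Ui iIU[of n] by simp
  have ga0: "0 \<le> ga n z" and gb0: "0 \<le> gb n z" for n z
    unfolding ga_def gb_def using powr_gap_nonneg[OF p(1)] by auto
  \<comment> \<open>The energy identity bounds only the sum of the gradient and state energies,
    which is why both gaps are treated together.\<close>
  have AB: "(LBINT z. X n z * E n (?Ph n z)) + (LBINT z. X n z * \<bar>u n (?Ph n z)\<bar> powr p) \<le> L * F n" for n
  proof -
    have "(LBINT z. X n z * E n (?Ph n z)) + (LBINT z. X n z * \<bar>u n (?Ph n z)\<bar> powr p) = (LBINT z. X n z * (E n (?Ph n z) + \<bar>u n (?Ph n z)\<bar> powr p))"
      using Ai[of n] Bi[of n] by (simp add: distrib_left)
    also have "\<dots> \<le> L * ((LBINT z. E n z + \<bar>u n z\<bar> powr p) / e n)"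
      by (rule unfold_le(2)) (use Ei int(2) E0 in auto)
    finally show ?thesis unfolding FE .
  qed
  \<comment> \<open>Both gaps added, with the unfolded energies replaced by their bound L F n. The
    assumption \<open>hom\<close> says exactly that the limit of this quantity is 0.\<close>
  define rem where "rem n = L * F n - V - W - p * (IG n - V) - p * (IU n - W)" for n
  have ga_rem: "(LBINT z. ga n z) \<le> rem n" for n
  proof -
    have "0 \<le> (LBINT z. gb n z)" using gb0 by (intro integral_nonneg_AE) auto
    then show ?thesis using AB[of n] unfolding gaI gbI rem_def by linarith
  qed
  have IGlim: "IG \<longlonglongrightarrow> V" using WG by (simp add: IG_def[abs_def] V_def)
  have IUlim: "IU \<longlonglongrightarrow> W"
  proof -
    have "\<bar>U z\<bar> powr (p - 2) * U z = indicator Y (snd z) * (\<bar>u0 (fst z)\<bar> powr (p - 2) * u0 (fst z))" for z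
      by (simp add: U_def indicator_def)
    then show ?thesis using Wu unfolding IU_def[abs_def] W_def UW by (simp only:)
  qed
  have "rem \<longlonglongrightarrow> L * (\<Lambda> / L) - V - W - p * (V - V) - p * (W - W)"
    unfolding rem_def by (intro tendsto_intros Flim IGlim IUlim)
  also have "L * (\<Lambda> / L) - V - W - p * (V - V) - p * (W - W) = 0" using L hom by (simp add: V_def W_def UW)
  finally have rem: "rem \<longlonglongrightarrow> 0" .
  have galim: "(\<lambda>n. LBINT z. ga n z) \<longlonglongrightarrow> 0"
    by (rule Lim_null_comparison[OF always_eventually rem])
      (use ga_rem ga0 in \<open>auto intro!: integral_nonneg_AE simp: abs_of_nonneg\<close>)

  let ?N = "\<lambda>n z. norm (X n z * G1 n (?Ph n z) - v z, X n z * G2 n (?Ph n z)) powr p"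
  have Ni: "integrable lborel (?N n)" for n
  proof (rule Bochner_Integration.integrable_bound)
    show "integrable lborel (\<lambda>z. 2 powr p * (X n z * E n (?Ph n z) + \<bar>v z\<bar> powr p))" using Ai[of n] vint by simp
    show "AE z in lborel. norm (?N n z) \<le> norm (2 powr p * (X n z * E n (?Ph n z) + \<bar>v z\<bar> powr p))"
    proof (rule AE_I2)
      fix z show "norm (?N n z) \<le> norm (2 powr p * (X n z * E n (?Ph n z) + \<bar>v z\<bar> powr p))"
        using norm_diff_powr_le[of p "(X n z * G1 n (?Ph n z), X n z * G2 n (?Ph n z))" "(v z, 0)"] p unfolding na
        by (simp add: norm_Pair)
    qed
  qed measurable
  then show "\<And>n. integrable lborel (?N n)" .
  show "(\<lambda>n. LBINT z. ?N n z) \<longlonglongrightarrow> 0"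
  proof (rule tendstoI)
    fix \<rho> :: real assume \<rho>: "0 < \<rho>"
    have V0: "0 \<le> V" unfolding V_def by (intro integral_nonneg_AE) auto
    \<comment> \<open>\<open>K\<close> bounds the p-th powers of the norms of the sequence and of
      the limit together. The choice of \<eta> makes \<eta> (K + 1) = \<rho> / 2; the added 1 covers
      K = 0.\<close>
    define K where "K = L * C + V"
    have K0: "0 \<le> K" using C0 V0 L by (simp add: K_def)
    define \<eta> where "\<eta> = \<rho> / (2 * (K + 1))"
    have \<eta>: "0 < \<eta>" using \<rho> K0 by (simp add: \<eta>_def)
    obtain D where D: "0 \<le> D" "\<And>x y :: real \<times> real. norm (x - y) powr p \<le> \<eta> * (norm x powr p + norm y powr p) + D * powr_gap p x y"
      using powr_gap_control[OF p(1) \<eta>] by blast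
    have "(\<lambda>n. D * (LBINT z. ga n z)) \<longlonglongrightarrow> D * 0" by (intro tendsto_intros galim)
    then have "eventually (\<lambda>n. D * (LBINT z. ga n z) < \<rho> / 2) sequentially"
      using \<rho> by (intro order_tendstoD(2)[where y = "D * 0"]) auto
    then show "eventually (\<lambda>n. dist (LBINT z. ?N n z) 0 < \<rho>) sequentially"
    proof eventually_elim
      case (elim n)
      have "(LBINT z. ?N n z) \<le> (LBINT z. \<eta> * (X n z * E n (?Ph n z) + \<bar>v z\<bar> powr p) + D * ga n z)"
      proof (rule integral_mono[OF Ni])
        show "integrable lborel (\<lambda>z. \<eta> * (X n z * E n (?Ph n z) + \<bar>v z\<bar> powr p) + D * ga n z)"
          using Ai[of n] vint gai[of n] by simp
        show "?N n z \<le> \<eta> * (X n z * E n (?Ph n z) + \<bar>v z\<bar> powr p) + D * ga n z" for z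
          using D(2)[of "(X n z * G1 n (?Ph n z), X n z * G2 n (?Ph n z))" "(v z, 0)"] unfolding na ga_def
          by (simp add: norm_Pair)
      qed
      also have "\<dots> = \<eta> * ((LBINT z. X n z * E n (?Ph n z)) + V) + D * (LBINT z. ga n z)"
        using Ai[of n] vint gai[of n] by (simp add: V_def)
      also have "\<dots> \<le> \<eta> * (L * C + V) + D * (LBINT z. ga n z)"
      proof -
        have "0 \<le> (LBINT z. X n z * \<bar>u n (?Ph n z)\<bar> powr p)"
          by (intro integral_nonneg_AE) (auto simp: X_def)
        then have "(LBINT z. X n z * E n (?Ph n z)) \<le> L * F n" using AB[of n] by linarith
        also have "\<dots> \<le> L * C" using FC[of n] L by simp
        finally show ?thesis using \<eta> by simp
      qed
      also have "\<eta> * (L * C + V) \<le> \<rho> / 2"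
      proof -
        have "\<eta> * K \<le> \<eta> * (K + 1)" using \<eta> by simp
        also have "\<dots> = \<rho> / 2" using K0 by (simp add: \<eta>_def field_simps)
        finally show ?thesis by (simp add: K_def)
      qed
      finally have "(LBINT z. ?N n z) < \<rho>" using elim by linarith
      moreover have "0 \<le> (LBINT z. ?N n z)" by (intro integral_nonneg_AE) auto
      ultimately show ?case by (simp add: dist_real_def)
    qed
  qed
qed

text \<open>On the full cells the factor \<open>h\<close> is the same in both terms, so only the
  shift of \<open>du\<close> is left; off them only the limit survives, over a set of x shrinking to
  nothing. Boundedness of \<open>h\<close> reduces both parts to integrals of
  \<open>du\<close>.\<close>

lemma corrector_strong_convergence:
  fixes du h :: "real \<Rightarrow> real" and a e :: "nat \<Rightarrow> real"
  assumes a: "\<And>n. 0 < a n" "a \<longlonglongrightarrow> 0" and e: "\<And>n. 0 < e n" and p: "1 < p"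
    and [measurable]: "du \<in> borel_measurable borel" "h \<in> borel_measurable borel"
    and du0: "\<And>x. x \<notin> {0<..<1} \<Longrightarrow> du x = 0" and int: "integrable lborel (\<lambda>x. \<bar>du x\<bar> powr p)"
    and h: "\<And>y. \<bar>h y\<bar> \<le> H"
  shows "\<And>n. integrable lborel (\<lambda>z. \<bar>indicator (full_cells (a n) L \<times> Y) z * (du (fst (Phi (a n) (e n) z)) * h (fst (snd z)))
      - indicator Y (snd z) * (du (fst z) * h (fst (snd z)))\<bar> powr p)" (is "\<And>n. integrable lborel (?R n)")
    and "(\<lambda>n. LBINT z. \<bar>indicator (full_cells (a n) L \<times> Y) z * (du (fst (Phi (a n) (e n) z)) * h (fst (snd z)))
      - indicator Y (snd z) * (du (fst z) * h (fst (snd z)))\<bar> powr p) \<longlonglongrightarrow> 0"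
proof -
  have H: "0 \<le> H" using h[of 0] by linarith
  define J where "J n z = indicator (full_cells (a n) L \<times> Y) z * \<bar>du (fst (Phi (a n) (e n) z)) - du (fst z)\<bar> powr p" for n z
  define B where "B n x = indicator ({0<..<1} - full_cells (a n) L) x * \<bar>du x\<bar> powr p" for n x
  have Ji: "integrable lborel (J n)" for n
    unfolding J_def by (rule unfold_shift_integrable[OF a(1) e _ _ int]) (use p in auto)
  have Bi: "integrable lborel (B n)" for n
    unfolding B_def by (rule integrable_real_indicator_mult[OF _ int]) measurable
  have BYi: "integrable lborel (\<lambda>z. B n (fst z) * indicator Y (snd z))" for n
    by (rule integrable_lborel_times[OF Bi integrable_Y])
  have le: "?R n z \<le> H powr p * (J n z + B n (fst z) * indicator Y (snd z))" for n z
  proof (cases "snd z \<in> Y \<and> fst z \<in> {0<..<1}")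
    case True
    have hp: "\<bar>h (fst (snd z))\<bar> powr p \<le> H powr p" using h p by (intro powr_mono2) auto
    show ?thesis
    proof (cases "fst z \<in> full_cells (a n) L")
      case True
      then have "?R n z = \<bar>du (fst (Phi (a n) (e n) z)) - du (fst z)\<bar> powr p * \<bar>h (fst (snd z))\<bar> powr p"
        using \<open>snd z \<in> Y \<and> _\<close> by (cases z) (auto simp: left_diff_distrib[symmetric] abs_mult powr_mult)
      also have "\<dots> \<le> \<bar>du (fst (Phi (a n) (e n) z)) - du (fst z)\<bar> powr p * H powr p" using hp by (intro mult_left_mono) auto
      finally show ?thesis using True \<open>snd z \<in> Y \<and> _\<close> by (cases z) (auto simp: J_def B_def mult.commute)
    next
      case False
      then have "?R n z = \<bar>du (fst z)\<bar> powr p * \<bar>h (fst (snd z))\<bar> powr p"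
        using \<open>snd z \<in> Y \<and> _\<close> by (cases z) (auto simp: abs_mult powr_mult)
      also have "\<dots> \<le> \<bar>du (fst z)\<bar> powr p * H powr p" using hp by (intro mult_left_mono) auto
      finally show ?thesis using False \<open>snd z \<in> Y \<and> _\<close> by (cases z) (auto simp: J_def B_def mult.commute)
    qed
  next
    case False
    have "full_cells (a n) L \<subseteq> {0<..<1}" by (rule full_cells_bounds(1)[OF a(1) L])
    then have R0: "?R n z = 0" using False du0[of "fst z"] by (cases z) (auto simp: indicator_def)
    have "0 \<le> J n z" "0 \<le> B n (fst z)" by (auto simp: J_def B_def)
    then show ?thesis unfolding R0 by simp
  qed
  have Ri: "integrable lborel (\<lambda>z. H powr p * (J n z + B n (fst z) * indicator Y (snd z)))" for n
    using Ji[of n] BYi[of n] by simp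
  have Rint: "integrable lborel (?R n)" for n
  proof (rule Bochner_Integration.integrable_bound[OF Ri])
    show "AE z in lborel. norm (?R n z) \<le> norm (H powr p * (J n z + B n (fst z) * indicator Y (snd z)))"
    proof (rule AE_I2)
      fix z
      have "norm (?R n z) = ?R n z" by (simp only: real_norm_def abs_of_nonneg powr_ge_zero)
      then show "norm (?R n z) \<le> norm (H powr p * (J n z + B n (fst z) * indicator Y (snd z)))"
        using order_trans[OF le[of n z] abs_ge_self] by (simp only: real_norm_def)
    qed
  qed measurable
  then show "\<And>n. integrable lborel (?R n)" .
  have up: "(LBINT z. ?R n z) \<le> H powr p * ((LBINT z. J n z) + (LBINT x. B n x) * area)" for n
  proof -
    have "(LBINT z. ?R n z) \<le> (LBINT z. H powr p * (J n z + B n (fst z) * indicator Y (snd z)))"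
      by (rule integral_mono[OF Rint Ri le])
    also have "\<dots> = H powr p * ((LBINT z. J n z) + (LBINT z. B n (fst z) * indicator Y (snd z)))"
      using Ji[of n] BYi[of n] by simp
    finally show ?thesis unfolding integral_lborel_times[OF Bi integrable_Y] area_def .
  qed
  have "(\<lambda>n. LBINT z. J n z) \<longlonglongrightarrow> 0"
    unfolding J_def by (rule unfold_shift_tendsto[OF a e _ _ du0 int]) (use p in auto)
  moreover have "(\<lambda>n. LBINT x. B n x) \<longlonglongrightarrow> 0"
    unfolding B_def by (rule integral_boundary_tendsto[OF a int])
  ultimately have "(\<lambda>n. H powr p * ((LBINT z. J n z) + (LBINT x. B n x) * area)) \<longlonglongrightarrow> H powr p * (0 + 0 * area)"
    by (intro tendsto_intros)
  then have lim: "(\<lambda>n. H powr p * ((LBINT z. J n z) + (LBINT x. B n x) * area)) \<longlonglongrightarrow> 0" by simp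
  show "(\<lambda>n. LBINT z. ?R n z) \<longlonglongrightarrow> 0"
  proof (rule Lim_null_comparison[OF always_eventually lim], rule allI)
    fix n
    have "0 \<le> (LBINT z. ?R n z)" by (intro integral_nonneg_AE) auto
    then show "norm (LBINT z. ?R n z) \<le> H powr p * ((LBINT z. J n z) + (LBINT x. B n x) * area)"
      using up[of n] by simp
  qed
qed

end

section \<open>Bounded functionals on $L^p$ and Bochner spaces\<close>

text \<open>Completeness of Lebesgue measure. It is applied to the inner integrals of Bochner
  functions, which are identified only almost everywhere.\<close>

lemma measurable_AE_lebesgue_on:
  fixes f h :: "'a::euclidean_space \<Rightarrow> real"
  assumes S: "S \<in> sets lebesgue" and f: "f \<in> borel_measurable (lebesgue_on S)" and ae: "AE x in lebesgue_on S. f x = h x"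
  shows "h \<in> borel_measurable (lebesgue_on S)"
proof -
  have S': "S \<inter> space lebesgue \<in> sets lebesgue" using S by simp
  have f': "(\<lambda>x. indicator S x *\<^sub>R f x) \<in> borel_measurable lebesgue"
    using f borel_measurable_restrict_space_iff[OF S', of f] by simp
  have "AE x in lebesgue. x \<in> S \<longrightarrow> f x = h x" using ae AE_restrict_space_iff[OF S'] by simp
  then have "AE x in lebesgue. indicator S x *\<^sub>R f x = indicator S x *\<^sub>R h x"
    by eventually_elim (auto simp: indicator_def)
  then have "(\<lambda>x. indicator S x *\<^sub>R h x) \<in> borel_measurable lebesgue" by (rule borel_measurable_AE[OF f'])
  then show ?thesis using borel_measurable_restrict_space_iff[OF S', of h] by simp
qed

lemma bounded_functional_Lp:
  fixes \<psi> :: "'a::euclidean_space \<Rightarrow> real"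
  assumes s: "1 < s" "1 / s + 1 / r = 1"
    and \<psi>: "\<psi> \<in> borel_measurable (lebesgue_on S)" "integrable (lebesgue_on S) (\<lambda>x. \<bar>\<psi> x\<bar> powr r)"
  shows "bounded_functional (Lp s S) (Lp_norm s S) (\<lambda>w. LINT x|lebesgue_on S. w x * \<psi> x)"
proof -
  have H: "integrable (lebesgue_on S) (\<lambda>x. w x * \<psi> x)"
    "(LINT x|lebesgue_on S. \<bar>w x * \<psi> x\<bar>) \<le> Lp_norm s S w * (LINT x|lebesgue_on S. \<bar>\<psi> x\<bar> powr r) powr (1 / r)"
    if "w \<in> Lp s S" for w :: "'a \<Rightarrow> real"
    using Holder_inequality[OF s _ _ \<psi>, of w] that by (auto simp: Lp_def Lp_norm_def)
  show ?thesis
    unfolding bounded_functional_def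
  proof (intro conjI ballI allI)
    fix v w :: "'a \<Rightarrow> real" assume "v \<in> Lp s S" "w \<in> Lp s S"
    then show "(LINT x|lebesgue_on S. (v x + w x) * \<psi> x) = (LINT x|lebesgue_on S. v x * \<psi> x) + (LINT x|lebesgue_on S. w x * \<psi> x)"
      using H(1) by (simp add: distrib_right)
  next
    fix c and v :: "'a \<Rightarrow> real" assume "v \<in> Lp s S"
    show "(LINT x|lebesgue_on S. c * v x * \<psi> x) = c * (LINT x|lebesgue_on S. v x * \<psi> x)"
      by (simp add: mult.assoc)
  next
    show "\<exists>C. \<forall>w\<in>Lp s S. \<bar>LINT x|lebesgue_on S. w x * \<psi> x\<bar> \<le> C * Lp_norm s S w"
      using order_trans[OF integral_abs_bound H(2)] by (metis mult.commute)
  qed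
qed

lemma Lp_diff:
  fixes f h :: "'a::euclidean_space \<Rightarrow> real"
  assumes "0 \<le> p" "f \<in> Lp p S" "h \<in> Lp p S"
  shows "(\<lambda>x. f x - h x) \<in> Lp p S"
proof -
  have m: "f \<in> borel_measurable (lebesgue_on S)" "h \<in> borel_measurable (lebesgue_on S)"
    and i: "integrable (lebesgue_on S) (\<lambda>x. norm (f x) powr p)" "integrable (lebesgue_on S) (\<lambda>x. norm (h x) powr p)"
    using assms by (auto simp: Lp_def)
  have "integrable (lebesgue_on S) (\<lambda>x. norm (f x - h x) powr p)"
  proof (rule Bochner_Integration.integrable_bound)
    show "integrable (lebesgue_on S) (\<lambda>x. 2 powr p * (norm (f x) powr p + norm (h x) powr p))" using i by simp
    show "AE x in lebesgue_on S. norm (norm (f x - h x) powr p) \<le> norm (2 powr p * (norm (f x) powr p + norm (h x) powr p))"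
      using norm_diff_powr_le[OF assms(1), of "f x" "h x" for x] by (intro AE_I2) simp
  qed (use m in measurable)
  then show ?thesis using m by (simp add: Lp_def)
qed

lemma W1p_subset_Lp: "W1p p S \<subseteq> Lp p S"
  by (auto simp: W1p_def W1p_grad_def)

text \<open>The L^p part of the Sobolev norm already dominates the pairing; the gradient part is
  nonnegative and is discarded.\<close>

lemma integral_le_W1p_norm:
  fixes h \<beta> :: "'a::euclidean_space \<Rightarrow> real"
  assumes p: "1 < p" "1 / p + 1 / q = 1"
    and h: "h \<in> Lp p S" and \<beta>: "\<beta> \<in> borel_measurable (lebesgue_on S)" "integrable (lebesgue_on S) (\<lambda>y. \<bar>\<beta> y\<bar> powr q)"
  shows "\<bar>LINT y|lebesgue_on S. h y * \<beta> y\<bar> \<le> (LINT y|lebesgue_on S. \<bar>\<beta> y\<bar> powr q) powr (1 / q) * W1p_norm p S h"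
proof -
  have m: "h \<in> borel_measurable (lebesgue_on S)" and i: "integrable (lebesgue_on S) (\<lambda>x. \<bar>h x\<bar> powr p)"
    using h by (auto simp: Lp_def)
  have "(LINT y|lebesgue_on S. \<bar>h y\<bar> powr p) powr (1 / p) \<le> W1p_norm p S h"
    unfolding W1p_norm_def using p by (intro powr_mono2) (auto intro!: integral_nonneg_AE)
  then have "(LINT y|lebesgue_on S. \<bar>h y\<bar> powr p) powr (1 / p) * (LINT y|lebesgue_on S. \<bar>\<beta> y\<bar> powr q) powr (1 / q)
    \<le> W1p_norm p S h * (LINT y|lebesgue_on S. \<bar>\<beta> y\<bar> powr q) powr (1 / q)"
    by (intro mult_right_mono) auto
  then show ?thesis
    using order_trans[OF integral_abs_bound Holder_inequality(2)[OF p m i \<beta>]] by (simp add: mult.commute)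
qed

lemma W1p_norm_nonneg: "0 \<le> W1p_norm p S h"
  by (simp add: W1p_norm_def)

text \<open>The point that needs an argument is measurability in x of the inner integral. It is the
  limit of the integrals of the finitely valued maps provided by strong measurability, because the
  pairing with \<beta> is continuous in the Sobolev norm. The bound is Holder in y and then in
  x.\<close>

lemma bounded_functional_Bochner:
  fixes \<psi> :: "'a::euclidean_space \<Rightarrow> real" and \<beta> :: "'b::euclidean_space \<Rightarrow> real"
  assumes p: "1 < p" "1 / p + 1 / q = 1" and I: "I \<in> sets lebesgue"
    and \<psi>: "\<psi> \<in> borel_measurable (lebesgue_on I)" "integrable (lebesgue_on I) (\<lambda>x. \<bar>\<psi> x\<bar> powr q)"
    and \<beta>: "\<beta> \<in> borel_measurable (lebesgue_on S)" "integrable (lebesgue_on S) (\<lambda>y. \<bar>\<beta> y\<bar> powr q)"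
  shows "bounded_functional (Bochner_Lp p I (W1p p S) (W1p_norm p S)) (Bochner_norm p I (W1p_norm p S))
    (\<lambda>v. LINT x|lebesgue_on I. (LINT y|lebesgue_on S. v (x, y) * \<beta> y) * \<psi> x)"
proof -
  note q = conjugate_exponent[OF p]
  let ?V = "Bochner_Lp p I (W1p p S) (W1p_norm p S)" and ?N = "W1p_norm p S"
  define j where "j h = (LINT y|lebesgue_on S. h y * \<beta> y)" for h
  define K where "K = (LINT y|lebesgue_on S. \<bar>\<beta> y\<bar> powr q) powr (1 / q)"
  have K0: "0 \<le> K" by (simp add: K_def)
  have jle: "\<bar>j h\<bar> \<le> K * ?N h" if "h \<in> Lp p S" for h
    unfolding j_def K_def by (rule integral_le_W1p_norm[OF p that \<beta>])
  have ji: "integrable (lebesgue_on S) (\<lambda>y. h y * \<beta> y)" if "h \<in> Lp p S" for h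
    using Holder_inequality(1)[OF p _ _ \<beta>, of h] that by (auto simp: Lp_def)
  have jdiff: "j (\<lambda>y. h y - k y) = j h - j k" if "h \<in> Lp p S" "k \<in> Lp p S" for h k
    unfolding j_def using ji[OF that(1)] ji[OF that(2)] by (simp add: left_diff_distrib)
  have jadd: "j (\<lambda>y. h y + k y) = j h + j k" if "h \<in> Lp p S" "k \<in> Lp p S" for h k
    unfolding j_def using ji[OF that(1)] ji[OF that(2)] by (simp add: distrib_right)
  have V: "AE x in lebesgue_on I. (\<lambda>y. v (x, y)) \<in> Lp p S"
    "integrable (lebesgue_on I) (\<lambda>x. ?N (\<lambda>y. v (x, y)) powr p)"
    "(\<lambda>x. j (\<lambda>y. v (x, y))) \<in> borel_measurable (lebesgue_on I)" if v: "v \<in> ?V" for v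
  proof -
    show A: "AE x in lebesgue_on I. (\<lambda>y. v (x, y)) \<in> Lp p S"
      using v W1p_subset_Lp[of p S] by (auto simp: Bochner_Lp_def elim!: eventually_mono)
    show "integrable (lebesgue_on I) (\<lambda>x. ?N (\<lambda>y. v (x, y)) powr p)"
      using v by (simp add: Bochner_Lp_def)
    obtain s :: "nat \<Rightarrow> 'a \<Rightarrow> 'b \<Rightarrow> real" where s: "\<And>n. finite (s n ` I)" "\<And>n. s n ` I \<subseteq> W1p p S"
        "\<And>n h. {x\<in>I. s n x = h} \<in> sets lebesgue"
        "AE x in lebesgue_on I. (\<lambda>n. ?N (\<lambda>y. s n x y - v (x, y))) \<longlonglongrightarrow> 0"
      using v unfolding Bochner_Lp_def strongly_measurable_def by blast
    have sm: "(\<lambda>x. j (s n x)) \<in> borel_measurable (lebesgue_on I)" for n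
    proof -
      have "(\<lambda>x. \<Sum>h\<in>s n ` I. j h * indicator {x\<in>I. s n x = h} x) \<in> borel_measurable (lebesgue_on I)"
        using s(3)[of n] I by (intro borel_measurable_sum borel_measurable_times borel_measurable_const borel_measurable_indicator)
          (auto simp: sets_restrict_space_iff)
      moreover have "j (s n x) = (\<Sum>h\<in>s n ` I. j h * indicator {x\<in>I. s n x = h} x)" if "x \<in> space (lebesgue_on I)" for x
      proof -
        have x: "x \<in> I" using that by simp
        have "(\<Sum>h\<in>s n ` I. j h * indicator {x\<in>I. s n x = h} x) = (\<Sum>h\<in>s n ` I. if h = s n x then j h else 0)"
          using x by (intro sum.cong) (auto simp: indicator_def)
        also have "\<dots> = j (s n x)" using x s(1)[of n] by (simp add: sum.delta)
        finally show ?thesis ..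
      qed
      ultimately show ?thesis by (subst measurable_cong) auto
    qed
    have "(\<lambda>x. lim (\<lambda>n. j (s n x))) \<in> borel_measurable (lebesgue_on I)"
      by (rule borel_measurable_lim_metric[OF sm])
    moreover have "AE x in lebesgue_on I. lim (\<lambda>n. j (s n x)) = j (\<lambda>y. v (x, y))"
      using A s(4) AE_space
    proof eventually_elim
      case (elim x)
      have sx: "s n x \<in> Lp p S" for n using elim(3) s(2)[of n] W1p_subset_Lp[of p S] by auto
      have "(\<lambda>n. K * ?N (\<lambda>y. s n x y - v (x, y))) \<longlonglongrightarrow> K * 0" by (intro tendsto_intros elim(2))
      then have z: "(\<lambda>n. K * ?N (\<lambda>y. s n x y - v (x, y))) \<longlonglongrightarrow> 0" by simp
      have "(\<lambda>n. j (s n x) - j (\<lambda>y. v (x, y))) \<longlonglongrightarrow> 0"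
      proof (rule Lim_null_comparison[OF always_eventually z], rule allI)
        fix n
        show "norm (j (s n x) - j (\<lambda>y. v (x, y))) \<le> K * ?N (\<lambda>y. s n x y - v (x, y))"
          using jle[OF Lp_diff[OF _ sx[of n] elim(1)]] p jdiff[OF sx[of n] elim(1)] by simp
      qed
      then have "(\<lambda>n. j (s n x)) \<longlonglongrightarrow> j (\<lambda>y. v (x, y))" by (simp add: LIM_zero_iff)
      then show ?case by (rule limI)
    qed
    ultimately show "(\<lambda>x. j (\<lambda>y. v (x, y))) \<in> borel_measurable (lebesgue_on I)"
      by (rule measurable_AE_lebesgue_on[OF I])
  qed
  have bound: "integrable (lebesgue_on I) (\<lambda>x. j (\<lambda>y. v (x, y)) * \<psi> x)"
    "\<bar>LINT x|lebesgue_on I. j (\<lambda>y. v (x, y)) * \<psi> x\<bar> \<le> K * (LINT x|lebesgue_on I. \<bar>\<psi> x\<bar> powr q) powr (1 / q) * Bochner_norm p I ?N v"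
    if v: "v \<in> ?V" for v
  proof -
    define n where "n x = ?N (\<lambda>y. v (x, y))" for x
    have n0: "0 \<le> n x" for x by (simp add: n_def W1p_norm_nonneg)
    have [measurable]: "(\<lambda>x. n x powr p) \<in> borel_measurable (lebesgue_on I)"
      using borel_measurable_integrable[OF V(2)[OF v]] by (simp add: n_def)
    have "(\<lambda>x. (n x powr p) powr (1 / p)) \<in> borel_measurable (lebesgue_on I)" by measurable
    moreover have "(n x powr p) powr (1 / p) = n x" for x using n0[of x] p by (simp add: powr_powr)
    ultimately have nm: "n \<in> borel_measurable (lebesgue_on I)" by simp
    have ni: "integrable (lebesgue_on I) (\<lambda>x. \<bar>n x\<bar> powr p)" using V(2)[OF v] n0 by (simp add: n_def)
    note H = Holder_inequality[OF p nm ni \<psi>]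
    have le: "AE x in lebesgue_on I. \<bar>j (\<lambda>y. v (x, y)) * \<psi> x\<bar> \<le> K * \<bar>n x * \<psi> x\<bar>"
      using V(1)[OF v]
    proof eventually_elim
      case (elim x)
      have "\<bar>j (\<lambda>y. v (x, y))\<bar> * \<bar>\<psi> x\<bar> \<le> K * n x * \<bar>\<psi> x\<bar>"
        using jle[OF elim] by (intro mult_right_mono) (auto simp: n_def)
      then show ?case using n0[of x] by (simp add: abs_mult mult.assoc)
    qed
    have Ki: "integrable (lebesgue_on I) (\<lambda>x. K * \<bar>n x * \<psi> x\<bar>)" using H(1) by simp
    show int: "integrable (lebesgue_on I) (\<lambda>x. j (\<lambda>y. v (x, y)) * \<psi> x)"
      by (rule Bochner_Integration.integrable_bound[OF Ki])
        (use le V(3)[OF v] \<psi>(1) K0 in \<open>auto intro!: borel_measurable_times elim!: eventually_mono\<close>)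
    have "\<bar>LINT x|lebesgue_on I. j (\<lambda>y. v (x, y)) * \<psi> x\<bar> \<le> (LINT x|lebesgue_on I. \<bar>j (\<lambda>y. v (x, y)) * \<psi> x\<bar>)"
      by (rule integral_abs_bound)
    also have "\<dots> \<le> (LINT x|lebesgue_on I. K * \<bar>n x * \<psi> x\<bar>)"
      by (rule integral_mono_AE[OF integrable_abs[OF int] Ki le])
    also have "\<dots> = K * (LINT x|lebesgue_on I. \<bar>n x * \<psi> x\<bar>)" by simp
    also have "\<dots> \<le> K * ((LINT x|lebesgue_on I. \<bar>n x\<bar> powr p) powr (1 / p) * (LINT x|lebesgue_on I. \<bar>\<psi> x\<bar> powr q) powr (1 / q))"
      by (intro mult_left_mono H(2) K0)
    also have "(LINT x|lebesgue_on I. \<bar>n x\<bar> powr p) powr (1 / p) = Bochner_norm p I ?N v"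
      using n0 by (simp add: Bochner_norm_def n_def)
    finally show "\<bar>LINT x|lebesgue_on I. j (\<lambda>y. v (x, y)) * \<psi> x\<bar> \<le> K * (LINT x|lebesgue_on I. \<bar>\<psi> x\<bar> powr q) powr (1 / q) * Bochner_norm p I ?N v"
      by (simp add: mult_ac)
  qed
  have "bounded_functional ?V (Bochner_norm p I ?N) (\<lambda>v. LINT x|lebesgue_on I. j (\<lambda>y. v (x, y)) * \<psi> x)"
    unfolding bounded_functional_def
  proof (intro conjI ballI allI)
    fix v w assume vw: "v \<in> ?V" "w \<in> ?V"
    have ae: "AE x in lebesgue_on I. j (\<lambda>y. v (x, y)) + j (\<lambda>y. w (x, y)) = j (\<lambda>y. v (x, y) + w (x, y))"
      using V(1)[OF vw(1)] V(1)[OF vw(2)] by eventually_elim (simp add: jadd)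
    have m: "(\<lambda>x. j (\<lambda>y. v (x, y) + w (x, y))) \<in> borel_measurable (lebesgue_on I)"
      by (rule measurable_AE_lebesgue_on[OF I _ ae]) (intro borel_measurable_add V(3) vw)
    have "(LINT x|lebesgue_on I. j (\<lambda>y. v (x, y) + w (x, y)) * \<psi> x) = (LINT x|lebesgue_on I. j (\<lambda>y. v (x, y)) * \<psi> x + j (\<lambda>y. w (x, y)) * \<psi> x)"
    proof (rule integral_cong_AE)
      show "AE x in lebesgue_on I. j (\<lambda>y. v (x, y) + w (x, y)) * \<psi> x = j (\<lambda>y. v (x, y)) * \<psi> x + j (\<lambda>y. w (x, y)) * \<psi> x"
        using ae by eventually_elim (simp add: distrib_right[symmetric])
    qed (intro borel_measurable_times borel_measurable_add m V(3) vw \<psi>(1))+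
    then show "(LINT x|lebesgue_on I. j (\<lambda>y. v (x, y) + w (x, y)) * \<psi> x)
      = (LINT x|lebesgue_on I. j (\<lambda>y. v (x, y)) * \<psi> x) + (LINT x|lebesgue_on I. j (\<lambda>y. w (x, y)) * \<psi> x)"
      using bound(1)[OF vw(1)] bound(1)[OF vw(2)] by simp
  next
    fix c v assume "v \<in> ?V"
    show "(LINT x|lebesgue_on I. j (\<lambda>y. c * v (x, y)) * \<psi> x) = c * (LINT x|lebesgue_on I. j (\<lambda>y. v (x, y)) * \<psi> x)"
      by (simp add: j_def mult.assoc)
  next
    show "\<exists>C. \<forall>v\<in>?V. \<bar>LINT x|lebesgue_on I. j (\<lambda>y. v (x, y)) * \<psi> x\<bar> \<le> C * Bochner_norm p I ?N v"
      using bound(2) by blast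
  qed
  then show ?thesis by (simp add: j_def)
qed

text \<open>The functionals on the Bochner space are iterated integrals. For almost every x the
  slice of \<open>w\<close> agrees almost everywhere with that of the Borel function
  \<open>Z\<close>, and to the latter Fubini applies.\<close>

lemma integral_lebesgue_on_iterated:
  fixes w :: "'a::euclidean_space \<times> 'b::euclidean_space \<Rightarrow> real"
  assumes IS: "I \<in> sets borel" "S \<in> sets borel"
    and ae: "AE z in lborel. z \<in> I \<times> S \<longrightarrow> w z = Z z"
    and Z: "Z \<in> borel_measurable borel"
    and \<psi>: "\<psi> \<in> borel_measurable borel" "AE x in lborel. x \<in> I \<longrightarrow> \<psi>' x = \<psi> x"
    and \<beta>: "\<beta> \<in> borel_measurable borel"
    and int: "integrable lborel (\<lambda>z. indicator (I \<times> S) z * (Z z * (\<psi> (fst z) * \<beta> (snd z))))"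
  shows "(LINT x|lebesgue_on I. (LINT y|lebesgue_on S. w (x, y) * \<beta> y) * \<psi>' x)
    = (LBINT z. indicator (I \<times> S) z * (Z z * (\<psi> (fst z) * \<beta> (snd z))))"
proof -
  note [measurable] = Z \<psi>(1) \<beta> IS
  define k where "k x = indicator I x * (LBINT y. indicator S y * (Z (x, y) * \<beta> y)) * \<psi> x" for x
  have km: "k \<in> borel_measurable borel" unfolding k_def by measurable
  have "AE x in lborel. x \<in> I \<longrightarrow> (LINT y|lebesgue_on S. w (x, y) * \<beta> y) * \<psi>' x = k x"
    using AE_lborel_pair[OF ae] \<psi>(2)
  proof eventually_elim
    case (elim x)
    show ?case
    proof
      assume x: "x \<in> I"
      have "(LINT y|lebesgue_on S. w (x, y) * \<beta> y) = (LBINT y. indicator S y * (Z (x, y) * \<beta> y))"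
      proof (rule lebesgue_on_transfer(3)[OF IS(2)])
        show "AE y in lborel. y \<in> S \<longrightarrow> w (x, y) * \<beta> y = indicator S y * (Z (x, y) * \<beta> y)"
          using elim(1) by eventually_elim (use x in auto)
        show "(\<lambda>y. indicator S y * (Z (x, y) * \<beta> y)) \<in> borel_measurable borel" by measurable
      qed simp
      then show "(LINT y|lebesgue_on S. w (x, y) * \<beta> y) * \<psi>' x = k x" using x elim(2) by (simp add: k_def)
    qed
  qed
  then have "(LINT x|lebesgue_on I. (LINT y|lebesgue_on S. w (x, y) * \<beta> y) * \<psi>' x) = (LBINT x. k x)"
    by (intro lebesgue_on_transfer(3)[OF IS(1) km]) (auto simp: k_def)
  also have "\<dots> = (LBINT x. (LBINT y. indicator (I \<times> S) (x, y) * (Z (x, y) * (\<psi> x * \<beta> y))))"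
  proof (intro Bochner_Integration.integral_cong refl)
    fix x
    have "k x = (indicator I x * \<psi> x) * (LBINT y. indicator S y * (Z (x, y) * \<beta> y))" by (simp add: k_def)
    also have "\<dots> = (LBINT y. (indicator I x * \<psi> x) * (indicator S y * (Z (x, y) * \<beta> y)))"
      by (rule integral_mult_right_zero[symmetric])
    also have "\<dots> = (LBINT y. indicator (I \<times> S) (x, y) * (Z (x, y) * (\<psi> x * \<beta> y)))"
      by (intro Bochner_Integration.integral_cong) (auto simp: indicator_def)
    finally show "k x = (LBINT y. indicator (I \<times> S) (x, y) * (Z (x, y) * (\<psi> x * \<beta> y)))" .
  qed
  also have "\<dots> = (LBINT z. indicator (I \<times> S) z * (Z z * (\<psi> (fst z) * \<beta> (snd z))))"
    using lborel_Fubini(3)[OF int] by (simp only: fst_conv snd_conv)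
  finally show ?thesis .
qed

text \<open>The increasing open sets where g exceeds 1 / (n + 1) cover the compact period [0, L], so
  finitely many of them, and hence the largest of these, cover it. Periodicity spreads the bound to
  the line.\<close>

lemma lower_semicont_periodic_lower_bound:
  fixes g :: "real \<Rightarrow> real"
  assumes lsc: "lower_semicont g" and pos: "\<And>x. 0 < g x" and L: "0 < L" and per: "\<And>x. g (x + L) = g x"
  obtains g0 where "0 < g0" "\<And>x. g0 < g x"
proof -
  define U where "U n = {x. 1 / real (Suc n) < g x}" for n
  have "{0..L} \<subseteq> (\<Union>n. U n)"
  proof
    fix x
    obtain n where "1 / real (Suc n) < g x" using reals_Archimedean[OF pos[of x]] by (auto simp: inverse_eq_divide)
    then show "x \<in> (\<Union>n. U n)" by (auto simp: U_def)
  qed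
  then obtain C where C: "finite C" "{0..L} \<subseteq> (\<Union>n\<in>C. U n)"
    using compactE_image[of "{0..L}" UNIV U] lower_semicont_open_superlevel[OF lsc] by (auto simp: U_def)
  define N where "N = Max (insert 0 C)"
  have base: "1 / real (Suc N) < g x" if x: "x \<in> {0..L}" for x
  proof -
    obtain n where n: "n \<in> C" "1 / real (Suc n) < g x" using x C(2) by (auto simp: U_def)
    have "n \<le> N" unfolding N_def using n C(1) by (intro Max_ge) auto
    then have "1 / real (Suc N) \<le> 1 / real (Suc n)" by (intro divide_left_mono) auto
    then show ?thesis using n by linarith
  qed
  have shift: "g (x + real n * L) = g x" for x n
  proof (induction n)
    case (Suc n) then show ?case using per[of "x + real n * L"] by (simp add: algebra_simps)
  qed simp
  have "1 / real (Suc N) < g x" for x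
  proof -
    define k where "k = \<lfloor>x / L\<rfloor>"
    have "of_int k \<le> x / L" "x / L < of_int k + 1" unfolding k_def by linarith+
    then have k: "of_int k * L \<le> x" "x < (of_int k + 1) * L"
      using L by (simp_all only: pos_le_divide_eq pos_divide_less_eq)
    then have y: "x - of_int k * L \<in> {0..L}" by (auto simp: algebra_simps)
    have "g x = g (x - of_int k * L)"
    proof (cases "0 \<le> k")
      case True
      then show ?thesis using shift[of "x - of_int k * L" "nat k"] by simp
    next
      case False
      then show ?thesis using shift[of x "nat (- k)"] by simp
    qed
    then show ?thesis using base[OF y] by simp
  qed
  then show ?thesis using that[of "1 / real (Suc N)"] by simp
qed

section \<open>Borel representatives of weak solutions\<close>

text \<open>A choice function rather than an existence statement, so that the representatives of a
  whole sequence can be named by one definition in the index.\<close>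

definition borel_rep :: "'a::euclidean_space set \<Rightarrow> ('a \<Rightarrow> real) \<Rightarrow> 'a \<Rightarrow> real" where
  "borel_rep S f = (SOME f'. f' \<in> borel_measurable borel \<and> (\<forall>x. x \<notin> S \<longrightarrow> f' x = 0) \<and> (AE x in lborel. x \<in> S \<longrightarrow> f x = f' x))"

lemma borel_rep:
  assumes "S \<in> sets borel" "f \<in> borel_measurable (lebesgue_on S)"
  shows "borel_rep S f \<in> borel_measurable borel" "\<And>x. x \<notin> S \<Longrightarrow> borel_rep S f x = 0"
    "AE x in lborel. x \<in> S \<longrightarrow> f x = borel_rep S f x"
proof -
  have "\<exists>f'. f' \<in> borel_measurable borel \<and> (\<forall>x. x \<notin> S \<longrightarrow> f' x = 0) \<and> (AE x in lborel. x \<in> S \<longrightarrow> f x = f' x)"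
    using borel_representative[OF assms] by metis
  from someI_ex[OF this]
  show "borel_rep S f \<in> borel_measurable borel" "\<And>x. x \<notin> S \<Longrightarrow> borel_rep S f x = 0"
    "AE x in lborel. x \<in> S \<longrightarrow> f x = borel_rep S f x"
    unfolding borel_rep_def by auto
qed

lemma Lp_borel_rep:
  fixes f :: "'a::euclidean_space \<Rightarrow> real"
  assumes S: "S \<in> sets borel" and f: "f \<in> Lp r S"
  shows "borel_rep S f \<in> borel_measurable borel" "\<And>x. x \<notin> S \<Longrightarrow> borel_rep S f x = 0"
    "AE x in lborel. x \<in> S \<longrightarrow> f x = borel_rep S f x"
    "integrable lborel (\<lambda>x. \<bar>borel_rep S f x\<bar> powr r)"
    "(LINT x|lebesgue_on S. norm (f x) powr r) = (LBINT x. \<bar>borel_rep S f x\<bar> powr r)"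
proof -
  have m: "f \<in> borel_measurable (lebesgue_on S)" and i: "integrable (lebesgue_on S) (\<lambda>x. norm (f x) powr r)"
    using f by (auto simp: Lp_def)
  note B = borel_rep[OF S m]
  show "borel_rep S f \<in> borel_measurable borel" "\<And>x. x \<notin> S \<Longrightarrow> borel_rep S f x = 0"
    "AE x in lborel. x \<in> S \<longrightarrow> f x = borel_rep S f x" by fact+
  note [measurable] = B(1)
  have "AE x in lborel. x \<in> S \<longrightarrow> norm (f x) powr r = \<bar>borel_rep S f x\<bar> powr r"
    using B(3) by eventually_elim auto
  note T = lebesgue_on_transfer[OF S _ _ this]
  show "integrable lborel (\<lambda>x. \<bar>borel_rep S f x\<bar> powr r)"
    using T(2) i B(2) by simp
  show "(LINT x|lebesgue_on S. norm (f x) powr r) = (LBINT x. \<bar>borel_rep S f x\<bar> powr r)"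
    using T(3) B(2) by simp
qed

lemma inner_powr:
  fixes D :: "'a::real_inner"
  shows "norm D powr (p - 2) * (D \<bullet> D) = norm D powr p"
proof (cases "D = 0")
  case False
  then have "norm D powr p = norm D powr (p - 2) * norm D powr 2" using powr_add[of "norm D" "p - 2" 2] by simp
  also have "norm D powr 2 = D \<bullet> D" using False by (simp add: dot_square_norm)
  finally show ?thesis ..
qed simp

lemma test_function_mono: "test_function A \<phi> \<Longrightarrow> A \<subseteq> B \<Longrightarrow> test_function B \<phi>"
  by (auto simp: test_function_def)

text \<open>The bridge from the distributional definition to the hypotheses of the oscillation
  estimates: the test function is a product, and the two basis vectors of the plane select the two
  partial derivatives.\<close>

lemma weak_gradient_product:
  fixes u :: "real \<times> real \<Rightarrow> real"
  assumes S: "S \<in> sets borel" and w: "has_weak_gradient S u D" and sub: "A \<times> B \<subseteq> S"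
    and AB: "A = {a1<..<b1}" "B = {c1<..<d1}"
    and t: "test_function A \<phi>" "test_function B \<psi>"
    and u: "uB \<in> borel_measurable borel" "\<And>z. z \<notin> S \<Longrightarrow> uB z = 0" "AE z in lborel. z \<in> S \<longrightarrow> u z = uB z"
    and G1: "G1 \<in> borel_measurable borel" "\<And>z. z \<notin> S \<Longrightarrow> G1 z = 0" "AE z in lborel. z \<in> S \<longrightarrow> fst (D z) = G1 z"
    and G2: "G2 \<in> borel_measurable borel" "\<And>z. z \<notin> S \<Longrightarrow> G2 z = 0" "AE z in lborel. z \<in> S \<longrightarrow> snd (D z) = G2 z"
  shows "(LBINT z. uB z * (deriv \<phi> (fst z) * \<psi> (snd z))) = - (LBINT z. G1 z * (\<phi> (fst z) * \<psi> (snd z)))"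
    and "(LBINT z. uB z * (\<phi> (fst z) * deriv \<psi> (snd z))) = - (LBINT z. G2 z * (\<phi> (fst z) * \<psi> (snd z)))"
proof -
  let ?\<zeta> = "\<lambda>z. \<phi> (fst z) * \<psi> (snd z)"
  have [measurable]: "\<phi> \<in> borel_measurable borel" "deriv \<phi> \<in> borel_measurable borel"
    "\<psi> \<in> borel_measurable borel" "deriv \<psi> \<in> borel_measurable borel"
    using test_function_bounded t unfolding AB by metis+
  note [measurable] = u(1) G1(1) G2(1)
  have sm: "smooth \<phi>" "smooth \<psi>" using t by (auto simp: test_function_def)
  have \<zeta>: "test_function S ?\<zeta>" by (rule test_function_mono[OF test_function_times[OF t] sub])
  have W: "(LINT z|lebesgue_on S. u z * frechet_derivative ?\<zeta> (at z) b) = - (LINT z|lebesgue_on S. (D z \<bullet> b) * ?\<zeta> z)"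
    if "b \<in> Basis" for b using w \<zeta> that unfolding has_weak_gradient_def by blast
  have b1: "(1, 0) \<in> (Basis :: (real \<times> real) set)" and b2: "(0, 1) \<in> (Basis :: (real \<times> real) set)" by (auto simp: Basis_prod_def)
  have "(LINT z|lebesgue_on S. u z * frechet_derivative ?\<zeta> (at z) (1, 0)) = (LBINT z. uB z * (deriv \<phi> (fst z) * \<psi> (snd z)))"
    by (rule lebesgue_on_transfer(3)[OF S]) (use u(2,3) in \<open>auto simp: frechet_derivative_times[OF sm] elim!: eventually_mono\<close>)
  moreover have "(LINT z|lebesgue_on S. (D z \<bullet> (1, 0)) * ?\<zeta> z) = (LBINT z. G1 z * (\<phi> (fst z) * \<psi> (snd z)))"
    by (rule lebesgue_on_transfer(3)[OF S]) (use G1(2,3) in \<open>auto simp: inner_prod_def elim!: eventually_mono\<close>)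
  ultimately show "(LBINT z. uB z * (deriv \<phi> (fst z) * \<psi> (snd z))) = - (LBINT z. G1 z * (\<phi> (fst z) * \<psi> (snd z)))"
    using W[OF b1] by simp
  have "(LINT z|lebesgue_on S. u z * frechet_derivative ?\<zeta> (at z) (0, 1)) = (LBINT z. uB z * (\<phi> (fst z) * deriv \<psi> (snd z)))"
    by (rule lebesgue_on_transfer(3)[OF S]) (use u(2,3) in \<open>auto simp: frechet_derivative_times[OF sm] elim!: eventually_mono\<close>)
  moreover have "(LINT z|lebesgue_on S. (D z \<bullet> (0, 1)) * ?\<zeta> z) = (LBINT z. G2 z * (\<phi> (fst z) * \<psi> (snd z)))"
    by (rule lebesgue_on_transfer(3)[OF S]) (use G2(2,3) in \<open>auto simp: inner_prod_def elim!: eventually_mono\<close>)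
  ultimately show "(LBINT z. uB z * (\<phi> (fst z) * deriv \<psi> (snd z))) = - (LBINT z. G2 z * (\<phi> (fst z) * \<psi> (snd z)))"
    using W[OF b2] by simp
qed

lemma weak_gradient_interval:
  fixes u D :: "real \<Rightarrow> real"
  assumes w: "has_weak_gradient {0<..<1} u D" and st: "0 \<le> s" "t \<le> 1" and t: "test_function {s<..<t} \<psi>"
    and u: "uB \<in> borel_measurable borel" "\<And>z. z \<notin> {0<..<1} \<Longrightarrow> uB z = 0" "AE z in lborel. z \<in> {0<..<1} \<longrightarrow> u z = uB z"
    and G: "G \<in> borel_measurable borel" "\<And>z. z \<notin> {0<..<1} \<Longrightarrow> G z = 0" "AE z in lborel. z \<in> {0<..<1} \<longrightarrow> D z = G z"
  shows "(LBINT x. uB x * deriv \<psi> x) = - (LBINT x. G x * \<psi> x)"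
proof -
  have [measurable]: "\<psi> \<in> borel_measurable borel" "deriv \<psi> \<in> borel_measurable borel"
    using test_function_bounded t by metis+
  note [measurable] = u(1) G(1)
  have sm: "smooth \<psi>" using t by (auto simp: test_function_def)
  have fd: "frechet_derivative \<psi> (at x) 1 = deriv \<psi> x" for x
    using frechet_derivative_at[of \<psi> "(*) (deriv \<psi> x)" x] smooth_deriv[OF sm, of x]
    by (simp add: has_field_derivative_def) (metis mult.right_neutral)
  have \<psi>: "test_function {0<..<1} \<psi>" by (rule test_function_mono[OF t]) (use st in auto)
  have W: "(LINT z|lebesgue_on {0<..<1}. u z * frechet_derivative \<psi> (at z) 1) = - (LINT z|lebesgue_on {0<..<1}. (D z \<bullet> 1) * \<psi> z)"
    using w \<psi> unfolding has_weak_gradient_def by auto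
  have "(LINT z|lebesgue_on {0<..<1}. u z * frechet_derivative \<psi> (at z) 1) = (LBINT x. uB x * deriv \<psi> x)"
    by (rule lebesgue_on_transfer(3)) (use u(2,3) in \<open>auto simp: fd elim!: eventually_mono\<close>)
  moreover have "(LINT z|lebesgue_on {0<..<1}. (D z \<bullet> 1) * \<psi> z) = (LBINT x. G x * \<psi> x)"
    by (rule lebesgue_on_transfer(3)) (use G(2,3) in \<open>auto elim!: eventually_mono\<close>)
  ultimately show ?thesis using W by simp
qed

context thin_cell
begin

lemma unfolding_op_eq:
  assumes "0 < \<epsilon>"
  shows "unfolding_op L \<alpha> \<epsilon> \<phi> z = (if fst z \<in> full_cells (\<epsilon> powr \<alpha>) L then \<phi> (Phi (\<epsilon> powr \<alpha>) \<epsilon> z) else 0)"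
  by (cases z) (simp add: unfolding_op_def I_eps_eq[OF L assms] Phi_def base_point_def per_int_def)

text \<open>\<open>unfold_AE\<close> allows the Borel representative to be unfolded in place of the
  function; outside the full cells both sides are 0.\<close>

lemma unfolding_op_AE:
  fixes \<phi> :: "real \<times> real \<Rightarrow> real"
  assumes e: "0 < \<epsilon>" and ae: "AE z in lborel. z \<in> thin (\<epsilon> powr \<alpha>) \<epsilon> \<longrightarrow> \<phi> z = \<phi>B z"
  shows "AE z in lborel. z \<in> {0<..<1} \<times> Y \<longrightarrow>
    unfolding_op L \<alpha> \<epsilon> \<phi> z = indicator (full_cells (\<epsilon> powr \<alpha>) L \<times> Y) z * \<phi>B (Phi (\<epsilon> powr \<alpha>) \<epsilon> z)"
proof -
  have "0 < \<epsilon> powr \<alpha>" using e by simp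
  from unfold_AE[OF this e ae] show ?thesis
    by eventually_elim (auto simp: unfolding_op_eq[OF e] indicator_def)
qed

lemma I_Y_measurable [measurable]: "{0<..<1::real} \<times> Y \<in> sets borel"
  by measurable

text \<open>Besides collecting representatives this records the energy identity, obtained by testing
  the equation with its own solution.\<close>

lemma thin_solution_rep:
  assumes e: "0 < e" and p: "1 < p" "1 / p + 1 / q = 1"
    and sol: "plaplace_solution p 1 (thin a e) f u Du" and f: "f \<in> Lp q (thin a e)"
  defines "fB \<equiv> borel_rep (thin a e) f" and "uB \<equiv> borel_rep (thin a e) u"
    and "G1 \<equiv> borel_rep (thin a e) (\<lambda>z. fst (Du z))" and "G2 \<equiv> borel_rep (thin a e) (\<lambda>z. snd (Du z))"
  shows "fB \<in> borel_measurable borel" "uB \<in> borel_measurable borel" "G1 \<in> borel_measurable borel" "G2 \<in> borel_measurable borel"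
    and "\<And>z. z \<notin> thin a e \<Longrightarrow> fB z = 0" "\<And>z. z \<notin> thin a e \<Longrightarrow> uB z = 0"
      "\<And>z. z \<notin> thin a e \<Longrightarrow> G1 z = 0" "\<And>z. z \<notin> thin a e \<Longrightarrow> G2 z = 0"
    and "AE z in lborel. z \<in> thin a e \<longrightarrow> f z = fB z" "AE z in lborel. z \<in> thin a e \<longrightarrow> u z = uB z"
      "AE z in lborel. z \<in> thin a e \<longrightarrow> fst (Du z) = G1 z" "AE z in lborel. z \<in> thin a e \<longrightarrow> snd (Du z) = G2 z"
    and "integrable lborel (\<lambda>z. \<bar>fB z\<bar> powr q)" "integrable lborel (\<lambda>z. \<bar>uB z\<bar> powr p)"
      "integrable lborel (\<lambda>z. norm (G1 z, G2 z) powr p)" "integrable lborel (\<lambda>z. \<bar>G1 z\<bar> powr p)" "integrable lborel (\<lambda>z. \<bar>G2 z\<bar> powr p)"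
    and "(LINT z|lebesgue_on (thin a e). norm (f z) powr q) = (LBINT z. \<bar>fB z\<bar> powr q)"
    and "(LBINT z. norm (G1 z, G2 z) powr p + \<bar>uB z\<bar> powr p) = (LBINT z. fB z * uB z)"
    and "has_weak_gradient (thin a e) u Du"
proof -
  have S: "thin a e \<in> sets borel" by measurable
  have W: "W1p_grad p (thin a e) u Du" using sol by (simp add: plaplace_solution_def)
  then have u: "u \<in> Lp p (thin a e)" and Du: "Du \<in> Lp p (thin a e)" and wg: "has_weak_gradient (thin a e) u Du"
    by (auto simp: W1p_grad_def)
  have Dm: "Du \<in> borel_measurable (lebesgue_on (thin a e))" and Di: "integrable (lebesgue_on (thin a e)) (\<lambda>z. norm (Du z) powr p)"
    using Du by (auto simp: Lp_def)
  have D12: "(\<lambda>z. fst (Du z)) \<in> borel_measurable (lebesgue_on (thin a e))" "(\<lambda>z. snd (Du z)) \<in> borel_measurable (lebesgue_on (thin a e))"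
    using Dm by measurable
  note F = Lp_borel_rep[OF S f, folded fB_def] and U = Lp_borel_rep[OF S u, folded uB_def]
    and A = borel_rep[OF S D12(1), folded G1_def] and B = borel_rep[OF S D12(2), folded G2_def]
  note [measurable] = F(1) U(1) A(1) B(1)
  show "fB \<in> borel_measurable borel" "uB \<in> borel_measurable borel" "G1 \<in> borel_measurable borel" "G2 \<in> borel_measurable borel"
    "\<And>z. z \<notin> thin a e \<Longrightarrow> fB z = 0" "\<And>z. z \<notin> thin a e \<Longrightarrow> uB z = 0"
    "\<And>z. z \<notin> thin a e \<Longrightarrow> G1 z = 0" "\<And>z. z \<notin> thin a e \<Longrightarrow> G2 z = 0"
    "AE z in lborel. z \<in> thin a e \<longrightarrow> f z = fB z" "AE z in lborel. z \<in> thin a e \<longrightarrow> u z = uB z"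
    "AE z in lborel. z \<in> thin a e \<longrightarrow> fst (Du z) = G1 z" "AE z in lborel. z \<in> thin a e \<longrightarrow> snd (Du z) = G2 z"
    "integrable lborel (\<lambda>z. \<bar>fB z\<bar> powr q)" "integrable lborel (\<lambda>z. \<bar>uB z\<bar> powr p)"
    "(LINT z|lebesgue_on (thin a e). norm (f z) powr q) = (LBINT z. \<bar>fB z\<bar> powr q)" "has_weak_gradient (thin a e) u Du"
    by fact+
  have DG: "AE z in lborel. z \<in> thin a e \<longrightarrow> Du z = (G1 z, G2 z)"
    using A(3) B(3) by eventually_elim (auto simp: prod_eq_iff)
  have Gm: "(\<lambda>z. norm (G1 z, G2 z) powr p) \<in> borel_measurable borel" by measurable
  have ae1: "AE z in lborel. z \<in> thin a e \<longrightarrow> norm (Du z) powr p = norm (G1 z, G2 z) powr p"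
    using DG by eventually_elim auto
  show Gi: "integrable lborel (\<lambda>z. norm (G1 z, G2 z) powr p)"
    using lebesgue_on_transfer(2)[OF S Gm _ ae1] Di A(2) B(2) by (simp add: zero_prod_def[symmetric])
  show "integrable lborel (\<lambda>z. \<bar>G1 z\<bar> powr p)"
  proof (rule Bochner_Integration.integrable_bound[OF Gi])
    show "AE z in lborel. norm (\<bar>G1 z\<bar> powr p) \<le> norm (norm (G1 z, G2 z) powr p)"
      using norm_fst_le[of "G1 z" "G2 z" for z] p by (intro AE_I2) (auto intro!: powr_mono2)
  qed measurable
  show "integrable lborel (\<lambda>z. \<bar>G2 z\<bar> powr p)"
  proof (rule Bochner_Integration.integrable_bound[OF Gi])
    show "AE z in lborel. norm (\<bar>G2 z\<bar> powr p) \<le> norm (norm (G1 z, G2 z) powr p)"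
      using norm_snd_le[of "G2 z" "G1 z" for z] p by (intro AE_I2) (auto intro!: powr_mono2)
  qed measurable
  have eq: "(LINT z|lebesgue_on (thin a e). 1 * (norm (Du z) powr (p - 2) * (Du z \<bullet> Du z)) + \<bar>u z\<bar> powr (p - 2) * u z * u z)
    = (LINT z|lebesgue_on (thin a e). f z * u z)"
    using sol W unfolding plaplace_solution_def by blast
  have "(LINT z|lebesgue_on (thin a e). 1 * (norm (Du z) powr (p - 2) * (Du z \<bullet> Du z)) + \<bar>u z\<bar> powr (p - 2) * u z * u z)
    = (LBINT z. norm (G1 z, G2 z) powr p + \<bar>uB z\<bar> powr p)"
  proof (rule lebesgue_on_transfer(3)[OF S])
    show "AE z in lborel. z \<in> thin a e \<longrightarrow> 1 * (norm (Du z) powr (p - 2) * (Du z \<bullet> Du z)) + \<bar>u z\<bar> powr (p - 2) * u z * u z = norm (G1 z, G2 z) powr p + \<bar>uB z\<bar> powr p"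
      using DG U(3)
    proof eventually_elim
      case (elim z)
      show ?case
      proof
        assume z: "z \<in> thin a e"
        have "Du z = (G1 z, G2 z)" "u z = uB z" using elim z by auto
        then show "1 * (norm (Du z) powr (p - 2) * (Du z \<bullet> Du z)) + \<bar>u z\<bar> powr (p - 2) * u z * u z = norm (G1 z, G2 z) powr p + \<bar>uB z\<bar> powr p"
          by (simp only: inner_powr mult_1_left mult.assoc powr_dual(2)[OF p])
      qed
    qed
    show "(\<lambda>z. norm (G1 z, G2 z) powr p + \<bar>uB z\<bar> powr p) \<in> borel_measurable borel" by measurable
  qed (simp add: A(2) B(2) U(2) zero_prod_def[symmetric])
  moreover have "(LINT z|lebesgue_on (thin a e). f z * u z) = (LBINT z. fB z * uB z)"
  proof (rule lebesgue_on_transfer(3)[OF S])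
    show "AE z in lborel. z \<in> thin a e \<longrightarrow> f z * u z = fB z * uB z"
      using F(3) U(3) by eventually_elim auto
    show "(\<lambda>z. fB z * uB z) \<in> borel_measurable borel" by measurable
  qed (simp add: F(2))
  ultimately show "(LBINT z. norm (G1 z, G2 z) powr p + \<bar>uB z\<bar> powr p) = (LBINT z. fB z * uB z)"
    using eq by simp
qed

text \<open>The counterpart for the homogenized equation; the last claim comes from testing with
  \<open>u\<close> itself.\<close>

lemma interval_solution_rep:
  assumes p: "1 < p" "1 / p + 1 / q = 1"
    and sol: "plaplace_solution p \<kappa> {0<..<1} F u du"
  defines "uB \<equiv> borel_rep {0<..<1} u" and "dB \<equiv> borel_rep {0<..<1} du"
  shows "uB \<in> borel_measurable borel" "dB \<in> borel_measurable borel"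
    and "\<And>x. x \<notin> {0<..<1} \<Longrightarrow> uB x = 0" "\<And>x. x \<notin> {0<..<1} \<Longrightarrow> dB x = 0"
    and "AE x in lborel. x \<in> {0<..<1} \<longrightarrow> u x = uB x" "AE x in lborel. x \<in> {0<..<1} \<longrightarrow> du x = dB x"
    and "integrable lborel (\<lambda>x. \<bar>uB x\<bar> powr p)" "integrable lborel (\<lambda>x. \<bar>dB x\<bar> powr p)"
    and "has_weak_gradient {0<..<1} u du"
    and "\<kappa> * (LBINT x. \<bar>dB x\<bar> powr p) + (LBINT x. \<bar>uB x\<bar> powr p) = (LINT x|lebesgue_on {0<..<1}. F x * u x)"
proof -
  have S: "{0<..<1::real} \<in> sets borel" by simp
  have W: "W1p_grad p {0<..<1} u du" using sol by (simp add: plaplace_solution_def)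
  then have u: "u \<in> Lp p {0<..<1}" and du: "du \<in> Lp p {0<..<1}" and wg: "has_weak_gradient {0<..<1} u du"
    by (auto simp: W1p_grad_def)
  note U = Lp_borel_rep[OF S u, folded uB_def] and D = Lp_borel_rep[OF S du, folded dB_def]
  note [measurable] = U(1) D(1)
  show "uB \<in> borel_measurable borel" "dB \<in> borel_measurable borel"
    "\<And>x. x \<notin> {0<..<1} \<Longrightarrow> uB x = 0" "\<And>x. x \<notin> {0<..<1} \<Longrightarrow> dB x = 0"
    "AE x in lborel. x \<in> {0<..<1} \<longrightarrow> u x = uB x" "AE x in lborel. x \<in> {0<..<1} \<longrightarrow> du x = dB x"
    "integrable lborel (\<lambda>x. \<bar>uB x\<bar> powr p)" "integrable lborel (\<lambda>x. \<bar>dB x\<bar> powr p)" "has_weak_gradient {0<..<1} u du"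
    by fact+
  have eq: "(LINT x|lebesgue_on {0<..<1}. \<kappa> * (norm (du x) powr (p - 2) * (du x \<bullet> du x)) + \<bar>u x\<bar> powr (p - 2) * u x * u x)
    = (LINT x|lebesgue_on {0<..<1}. F x * u x)"
    using sol W unfolding plaplace_solution_def by blast
  have "(LINT x|lebesgue_on {0<..<1}. \<kappa> * (norm (du x) powr (p - 2) * (du x \<bullet> du x)) + \<bar>u x\<bar> powr (p - 2) * u x * u x)
    = (LBINT x. \<kappa> * \<bar>dB x\<bar> powr p + \<bar>uB x\<bar> powr p)"
  proof (rule lebesgue_on_transfer(3)[OF S])
    show "AE x in lborel. x \<in> {0<..<1} \<longrightarrow> \<kappa> * (norm (du x) powr (p - 2) * (du x \<bullet> du x)) + \<bar>u x\<bar> powr (p - 2) * u x * u x = \<kappa> * \<bar>dB x\<bar> powr p + \<bar>uB x\<bar> powr p"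
      using D(3) U(3) by eventually_elim (auto simp: powr_dual(2)[OF p] mult.assoc)
    show "(\<lambda>x. \<kappa> * \<bar>dB x\<bar> powr p + \<bar>uB x\<bar> powr p) \<in> borel_measurable borel" by measurable
  qed (simp add: D(2) U(2))
  also have "\<dots> = \<kappa> * (LBINT x. \<bar>dB x\<bar> powr p) + (LBINT x. \<bar>uB x\<bar> powr p)"
    using U(4) D(4) by simp
  finally show "\<kappa> * (LBINT x. \<bar>dB x\<bar> powr p) + (LBINT x. \<bar>uB x\<bar> powr p) = (LINT x|lebesgue_on {0<..<1}. F x * u x)"
    using eq by simp
qed

end

section \<open>The corrector\<close>

locale thin_corrector = thin_cell +
  fixes \<alpha> p q c :: real
    and f :: "real \<Rightarrow> real \<times> real \<Rightarrow> real"
    and fhat :: "real \<times> real \<times> real \<Rightarrow> real"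
    and ueps :: "real \<Rightarrow> real \<times> real \<Rightarrow> real"
    and Dueps :: "real \<Rightarrow> real \<times> real \<Rightarrow> real \<times> real"
    and u du :: "real \<Rightarrow> real"
    and d1u1 :: "real \<times> real \<Rightarrow> real"
  assumes alpha: "0 < \<alpha>"
    and p: "1 < p" "1 / p + 1 / q = 1"
    and f_Lq: "\<And>\<epsilon>. 0 < \<epsilon> \<Longrightarrow> f \<epsilon> \<in> Lp q (thin_domain g \<alpha> \<epsilon>)"
    and f_bound: "\<And>\<epsilon>. 0 < \<epsilon> \<Longrightarrow> \<epsilon> powr (- 1 / q) * Lp_norm q (thin_domain g \<alpha> \<epsilon>) (f \<epsilon>) \<le> c"
    and f_conv:
      "weakly_converges (Lp q ({0<..<1} \<times> cell L g)) (Lp_norm q ({0<..<1} \<times> cell L g))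
         (\<lambda>\<epsilon>. unfolding_op L \<alpha> \<epsilon> (f \<epsilon>)) fhat (at_right 0)"
    and ueps: "\<And>\<epsilon>. 0 < \<epsilon> \<Longrightarrow>
      plaplace_solution p 1 (thin_domain g \<alpha> \<epsilon>) (f \<epsilon>) (ueps \<epsilon>) (Dueps \<epsilon>)"
    and u: "plaplace_solution p (hom_coeff p q L g) {0<..<1} (cell_average L g fhat) u du"
    and d1u1: "\<And>x t. x \<in> {0<..<1} \<Longrightarrow> t \<in> {0..<L} \<Longrightarrow>
      d1u1 (x, t) = du x / (g t powr (q - 1) * mean L (\<lambda>s. 1 / g s powr (q - 1))) - du x"
    and ueps_conv:
      "weakly_converges
         (Bochner_Lp p {0<..<1} (W1p p (cell L g)) (W1p_norm p (cell L g)))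
         (Bochner_norm p {0<..<1} (W1p_norm p (cell L g)))
         (\<lambda>\<epsilon>. unfolding_op L \<alpha> \<epsilon> (ueps \<epsilon>)) (\<lambda>(x, y). u x) (at_right 0)"
    and Dueps_conv:
      "weakly_converges (Lp p ({0<..<1} \<times> cell L g)) (Lp_norm p ({0<..<1} \<times> cell L g))
         (\<lambda>\<epsilon>. unfolding_op L \<alpha> \<epsilon> (\<lambda>z. fst (Dueps \<epsilon> z)))
         (\<lambda>(x, y1, y2). du x + d1u1 (x, y1)) (at_right 0)"
begin

section \<open>The limit gradient and its energy\<close>

lemmas q = conjugate_exponent[OF p]

definition u0 where "u0 = borel_rep {0<..<1} u"
definition du0 where "du0 = borel_rep {0<..<1} du"

lemmas u0_rep = interval_solution_rep[OF p u, folded u0_def du0_def]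

lemmas u0_measurable [measurable] = u0_rep(1,2)

definition M where "M = mean L (\<lambda>s. 1 / g s powr (q - 1))"

text \<open>The oscillating factor of the limit gradient: the formula for \<open>d1u1\<close>
  amounts to du(x) + d1u1(x, y) = du(x) h(y) on the cell.\<close>

definition h where "h y = 1 / (g y powr (q - 1) * M)"

lemma mean_eq: "k \<in> borel_measurable borel \<Longrightarrow> mean L k = (LBINT y. indicator {0<..<L} y * k y) / L"
  unfolding mean_def by (subst lebesgue_on_transfer(3)[where h' = "\<lambda>y. indicator {0<..<L} y * k y"]) auto

lemma g_powr_bounds: "g0 powr (q - 1) \<le> g y powr (q - 1)" "g y powr (q - 1) \<le> g1 powr (q - 1)"
  using q(1) g0 g_lower[of y] g_upper[of y] g_pos[of y] by (auto intro!: powr_mono2)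

lemma integrable_g_powr: "integrable lborel (\<lambda>y. indicator {0<..<L} y * (1 / g y powr (q - 1)))"
proof (rule Bochner_Integration.integrable_bound)
  show "integrable lborel (\<lambda>y. 1 / g0 powr (q - 1) * indicator {0<..<L} y)" by simp
  show "AE y in lborel. norm (indicator {0<..<L} y * (1 / g y powr (q - 1))) \<le> norm (1 / g0 powr (q - 1) * indicator {0<..<L} y)"
  proof (rule AE_I2)
    fix y
    have "1 / g y powr (q - 1) \<le> 1 / g0 powr (q - 1)" using g_powr_bounds(1)[of y] g0 g_pos[of y] by (intro divide_left_mono mult_pos_pos) auto
    then show "norm (indicator {0<..<L} y * (1 / g y powr (q - 1))) \<le> norm (1 / g0 powr (q - 1) * indicator {0<..<L} y)"
      by (simp add: indicator_def)
  qed
qed measurable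

lemma M_eq: "M = (LBINT y. indicator {0<..<L} y * (1 / g y powr (q - 1))) / L"
  unfolding M_def by (rule mean_eq) measurable

lemma M_pos: "0 < M"
proof -
  have "1 / g1 powr (q - 1) * L = (LBINT y. 1 / g1 powr (q - 1) * indicator {0<..<L} y)"
    using L by simp
  also have "\<dots> \<le> (LBINT y. indicator {0<..<L} y * (1 / g y powr (q - 1)))"
  proof (rule integral_mono[OF _ integrable_g_powr])
    show "1 / g1 powr (q - 1) * indicator {0<..<L} y \<le> indicator {0<..<L} y * (1 / g y powr (q - 1))" for y
      using g_powr_bounds(2)[of y] g_pos[of y] g1_pos by (auto simp: indicator_def intro!: divide_left_mono mult_pos_pos)
  qed simp
  also have "\<dots> = M * L" using L by (simp add: M_eq)
  finally have "1 / g1 powr (q - 1) \<le> M" using L by (rule mult_right_le_imp_le)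
  then show ?thesis using g1_pos by (smt (verit) divide_pos_pos powr_gt_zero)
qed

lemma h_measurable [measurable]: "h \<in> borel_measurable borel"
  unfolding h_def by measurable

lemma h_bound: "\<bar>h y\<bar> \<le> 1 / (g0 powr (q - 1) * M)"
proof -
  have "1 / (g y powr (q - 1) * M) \<le> 1 / (g0 powr (q - 1) * M)"
    using M_pos g0 g_powr_bounds(1)[of y] g_pos[of y] by (intro divide_left_mono mult_right_mono mult_pos_pos) auto
  then show ?thesis using M_pos by (simp add: h_def)
qed

text \<open>Since (q - 1) p = q, the weight g cancels one power of g, and what remains is a multiple
  of the function whose mean is \<open>M\<close>.\<close>

lemma h_powr: "g y * \<bar>h y\<bar> powr p = M powr (- p) * (1 / g y powr (q - 1))"
proof -
  have "(g y powr (q - 1) * M) powr p = g y powr q * M powr p"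
    using M_pos q(3) by (simp add: powr_mult powr_powr)
  then have "\<bar>h y\<bar> powr p = 1 / (g y powr q * M powr p)"
    using M_pos by (simp add: h_def powr_divide)
  moreover have "g y powr q = g y powr (q - 1) * g y"
    using g_pos[of y] powr_add[of "g y" "q - 1" 1] by simp
  ultimately show ?thesis using g_pos[of y] M_pos by (simp add: powr_minus field_simps)
qed

definition v :: "real \<times> real \<times> real \<Rightarrow> real" where
  "v z = indicator Y (snd z) * (du0 (fst z) * h (fst (snd z)))"

lemma v_measurable [measurable]: "v \<in> borel_measurable borel"
  unfolding v_def by measurable

lemma v_powr: "\<bar>v z\<bar> powr p = \<bar>du0 (fst z)\<bar> powr p * (indicator Y (snd z) * \<bar>h (fst (snd z))\<bar> powr p)"
  using p by (simp add: v_def abs_mult powr_mult indicator_def)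

text \<open>Integrating out the second cell variable produces the weight g of \<open>h_powr\<close>;
  what is left is M^{-p} times L M.\<close>

lemma integral_h_powr:
  "integrable lborel (\<lambda>y. indicator Y y * \<bar>h (fst y)\<bar> powr p)"
  "(LBINT y. indicator Y y * \<bar>h (fst y)\<bar> powr p) = L / M powr (p - 1)"
proof -
  have i: "integrable lborel (\<lambda>y. indicator {0<..<L} y * \<bar>h y\<bar> powr p)"
  proof (rule Bochner_Integration.integrable_bound)
    show "integrable lborel (\<lambda>y. (1 / (g0 powr (q - 1) * M)) powr p * indicator {0<..<L} y)" by simp
    show "AE y in lborel. norm (indicator {0<..<L} y * \<bar>h y\<bar> powr p) \<le> norm ((1 / (g0 powr (q - 1) * M)) powr p * indicator {0<..<L} y)"
    proof (rule AE_I2)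
      fix y have "\<bar>h y\<bar> powr p \<le> (1 / (g0 powr (q - 1) * M)) powr p" using h_bound p by (intro powr_mono2) auto
      then show "norm (indicator {0<..<L} y * \<bar>h y\<bar> powr p) \<le> norm ((1 / (g0 powr (q - 1) * M)) powr p * indicator {0<..<L} y)"
        by (simp add: indicator_def)
    qed
  qed measurable
  have m: "(\<lambda>y. \<bar>h y\<bar> powr p) \<in> borel_measurable borel" by measurable
  show "integrable lborel (\<lambda>y. indicator Y y * \<bar>h (fst y)\<bar> powr p)" by (rule integral_Y_fst(1)[OF i m])
  have "(LBINT y. indicator Y y * \<bar>h (fst y)\<bar> powr p) = (LBINT y. M powr (- p) * (indicator {0<..<L} y * (1 / g y powr (q - 1))))"
    unfolding integral_Y_fst(2)[OF i m] h_powr by (simp add: mult_ac)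
  also have "\<dots> = M powr (- p) * (LBINT y. indicator {0<..<L} y * (1 / g y powr (q - 1)))"
    by (rule integral_mult_right_zero)
  also have "(LBINT y. indicator {0<..<L} y * (1 / g y powr (q - 1))) = M * L" using L by (simp add: M_eq)
  also have "M powr (- p) * (M * L) = L / M powr (p - 1)" using M_pos by (simp add: powr_minus powr_diff field_simps)
  finally show "(LBINT y. indicator Y y * \<bar>h (fst y)\<bar> powr p) = L / M powr (p - 1)" .
qed

lemma v_integrable: "integrable lborel (\<lambda>z. \<bar>v z\<bar> powr p)"
  unfolding v_powr by (rule integrable_lborel_times[OF u0_rep(8) integral_h_powr(1)])

lemma integral_v: "(LBINT z. \<bar>v z\<bar> powr p) = (LBINT x. \<bar>du0 x\<bar> powr p) * (L / M powr (p - 1))"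
  unfolding v_powr integral_lborel_times[OF u0_rep(8) integral_h_powr(1)] integral_h_powr(2) ..

lemma area_pos: "0 < area"
proof -
  have "g0 * L = (LBINT y. g0 * indicator {0<..<L} y)" using L by simp
  also have "\<dots> \<le> area" unfolding area_eq
  proof (rule integral_mono)
    show "integrable lborel (\<lambda>y. indicator {0<..<L} y * g y)"
    proof (rule Bochner_Integration.integrable_bound)
      show "integrable lborel (\<lambda>y. g1 * indicator {0<..<L} y)" by simp
      show "AE y in lborel. norm (indicator {0<..<L} y * g y) \<le> norm (g1 * indicator {0<..<L} y)"
      proof (rule AE_I2)
        fix y show "norm (indicator {0<..<L} y * g y) \<le> norm (g1 * indicator {0<..<L} y)"
          using g_upper[of y] g_pos[of y] by (simp add: indicator_def)
      qed
    qed measurable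
    show "g0 * indicator {0<..<L} y \<le> indicator {0<..<L} y * g y" for y
      using g_lower[of y] by (simp add: indicator_def)
  qed simp
  finally show ?thesis using g0 L by (smt (verit) mult_pos_pos)
qed

text \<open>The origin of the homogenized coefficient: multiplied by |Y| it is the cell integral of
  |h|^p, so |Y| times the homogenized gradient energy is the L^p energy of \<open>v\<close>.\<close>

lemma hom_coeff_area: "area * hom_coeff p q L g = L / M powr (p - 1)"
proof -
  have "mean L g = area / L" by (subst mean_eq) (simp_all add: area_eq)
  then show ?thesis using area_pos L by (simp add: hom_coeff_def M_def[symmetric])
qed

abbreviation S :: "(real \<times> real \<times> real) set" where "S \<equiv> {0<..<1} \<times> Y"

lemma fhat_Lq: "fhat \<in> Lp q S"
  using f_conv by (simp add: weakly_converges_def cell_eq)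

definition load where "load = (LINT z|lebesgue_on S. fhat z * u0 (fst z))"

text \<open>The homogenized equation tested with its solution and multiplied by |Y|, which undoes
  the averaging of \<open>fhat\<close> over the cell. This identity makes the remainder of the gap
  argument vanish in the limit.\<close>

lemma load_eq: "load = (LBINT z. \<bar>v z\<bar> powr p) + area * (LBINT x. \<bar>u0 x\<bar> powr p)"
proof -
  define F where "F = borel_rep S fhat"
  note F = Lp_borel_rep[OF I_Y_measurable fhat_Lq, folded F_def]
  note [measurable] = F(1)
  have load1: "load = (LBINT z. F z * u0 (fst z))"
    unfolding load_def
  proof (rule lebesgue_on_transfer(3)[OF I_Y_measurable])
    show "AE z in lborel. z \<in> S \<longrightarrow> fhat z * u0 (fst z) = F z * u0 (fst z)" using F(3) by eventually_elim auto
    show "(\<lambda>z. F z * u0 (fst z)) \<in> borel_measurable borel" by measurable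
  qed (use F(2) in simp)
  have Ui: "integrable lborel (\<lambda>z. \<bar>u0 (fst z) * indicator Y (snd z)\<bar> powr p)"
  proof -
    have "\<bar>u0 (fst z) * indicator Y (snd z)\<bar> powr p = \<bar>u0 (fst z)\<bar> powr p * indicator Y (snd z)" for z :: "real \<times> real \<times> real"
      using p by (simp add: indicator_def)
    then show ?thesis using integrable_lborel_times[OF u0_rep(7) integrable_Y] by simp
  qed
  have FS: "indicator S z * (F z * (u0 (fst z) * 1)) = F z * (u0 (fst z) * indicator Y (snd z))" for z
    using F(2)[of z] by (cases z) (auto simp: indicator_def)
  have int: "integrable lborel (\<lambda>z. indicator S z * (F z * (u0 (fst z) * 1)))"
    unfolding FS by (rule Holder_inequality(1)[OF q(1,4) _ F(4) _ Ui]) measurable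
  have YB: "Y \<in> sets borel" by measurable
  \<comment> \<open>The right side of the homogenized equation contains a cell average for each x,
    so Fubini is needed to reach the double integral in \<open>load\<close>.\<close>
  have "(LINT x|lebesgue_on {0<..<1}. (LINT y|lebesgue_on Y. fhat (x, y) * 1) * u x) = (LBINT z. indicator S z * (F z * (u0 (fst z) * 1)))"
    by (rule integral_lebesgue_on_iterated[OF _ YB F(3) F(1) _ u0_rep(5) _ int]) auto
  also have "\<dots> = load"
    unfolding load1 using F(2) by (intro Bochner_Integration.integral_cong) (auto simp: indicator_def)
  finally have it: "(LINT x|lebesgue_on {0<..<1}. (LINT y|lebesgue_on Y. fhat (x, y)) * u x) = load" by simp
  have mY: "measure lebesgue Y = area" using YB by (simp add: area_def)
  have "(LINT x|lebesgue_on {0<..<1}. cell_average L g fhat x * u x) = load / area"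
    unfolding cell_average_def cell_eq mY it[symmetric] times_divide_eq_left by (rule integral_divide_zero)
  then have "hom_coeff p q L g * (LBINT x. \<bar>du0 x\<bar> powr p) + (LBINT x. \<bar>u0 x\<bar> powr p) = load / area"
    using u0_rep(10) by simp
  then have "load = area * hom_coeff p q L g * (LBINT x. \<bar>du0 x\<bar> powr p) + area * (LBINT x. \<bar>u0 x\<bar> powr p)"
    using area_pos by (simp add: field_simps)
  then show ?thesis unfolding hom_coeff_area integral_v by (simp add: mult.commute)
qed

end

section \<open>Limits along a sequence of thicknesses\<close>

text \<open>The limit is taken along an arbitrary positive sequence tending to 0, to which dominated
  convergence applies; the one-sided limit at 0 is determined by such sequences.\<close>

locale thin_sequence = thin_corrector +
  fixes e :: "nat \<Rightarrow> real"
  assumes e: "\<And>n. 0 < e n" "e \<longlonglongrightarrow> 0"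
begin

definition a where "a n = e n powr \<alpha>"

lemma cell_width: "\<And>n. 0 < a n" "a \<longlonglongrightarrow> 0"
proof -
  show "0 < a n" for n using e(1)[of n] by (simp add: a_def)
  have "(\<lambda>n. e n powr \<alpha>) \<longlonglongrightarrow> 0 powr \<alpha>"
    using e alpha by (intro tendsto_powr' tendsto_intros) (auto intro!: always_eventually less_imp_le)
  then show "a \<longlonglongrightarrow> 0" by (simp add: a_def[abs_def])
qed

lemma e_filterlim: "filterlim e (at_right 0) sequentially"
  using e(2) e(1) less_imp_neq[OF e(1)] by (auto simp: filterlim_at intro!: always_eventually)

definition fB where "fB n = borel_rep (thin (a n) (e n)) (f (e n))"
definition uB where "uB n = borel_rep (thin (a n) (e n)) (ueps (e n))"
definition G1 where "G1 n = borel_rep (thin (a n) (e n)) (\<lambda>z. fst (Dueps (e n) z))"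
definition G2 where "G2 n = borel_rep (thin (a n) (e n)) (\<lambda>z. snd (Dueps (e n) z))"

lemma thin_solution: "plaplace_solution p 1 (thin (a n) (e n)) (f (e n)) (ueps (e n)) (Dueps (e n))"
  using ueps[OF e(1)] by (simp add: thin_domain_eq a_def)

lemma load_Lq: "f (e n) \<in> Lp q (thin (a n) (e n))"
  using f_Lq[OF e(1)] by (simp add: thin_domain_eq a_def)

lemmas rep = thin_solution_rep[OF e(1) p thin_solution load_Lq, folded fB_def uB_def G1_def G2_def]

lemmas rep_measurable [measurable] = rep(1-4)

abbreviation X :: "nat \<Rightarrow> real \<times> real \<times> real \<Rightarrow> real" where "X n \<equiv> indicator (full_cells (a n) L \<times> Y)"

lemma X_outside: "z \<notin> S \<Longrightarrow> X n z = 0"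
  using full_cells_bounds(1)[OF cell_width(1)[of n] L] by (cases z) (auto simp: indicator_def)

lemma load_bound: "(LBINT z. \<bar>fB n z\<bar> powr q) / e n \<le> c powr q"
proof -
  let ?I = "LBINT z. \<bar>fB n z\<bar> powr q"
  have I0: "0 \<le> ?I" by (intro integral_nonneg_AE) auto
  have "e n powr (- 1 / q) * ?I powr (1 / q) \<le> c"
    using f_bound[OF e(1)[of n]] rep(18)[of n] by (simp add: Lp_norm_def thin_domain_eq a_def)
  then have "(e n powr (- 1 / q) * ?I powr (1 / q)) powr q \<le> c powr q"
    using q(1) by (intro powr_mono2) auto
  moreover have "(e n powr (- 1 / q) * ?I powr (1 / q)) powr q = ?I / e n"
  proof -
    have 1: "(e n powr (- 1 / q)) powr q = 1 / e n" "(?I powr (1 / q)) powr q = ?I"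
      using q(1) e(1)[of n] I0 by (simp_all only: powr_powr) (simp_all add: powr_minus_divide)
    show ?thesis by (subst powr_mult) (simp_all only: 1, simp_all)
  qed
  ultimately show ?thesis by simp
qed

lemma energy_bounds:
  "(LBINT z. \<bar>uB n z\<bar> powr p) / e n \<le> c powr q"
  "(LBINT z. \<bar>G1 n z\<bar> powr p) / e n \<le> c powr q"
  "(LBINT z. \<bar>G2 n z\<bar> powr p) / e n \<le> c powr q"
proof -
  let ?T = "LBINT z. norm (G1 n z, G2 n z) powr p + \<bar>uB n z\<bar> powr p"
  have Ti: "integrable lborel (\<lambda>z. norm (G1 n z, G2 n z) powr p + \<bar>uB n z\<bar> powr p)"
    using rep(14,15) by simp
  have "?T \<le> (LBINT z. \<bar>fB n z\<bar> powr q)"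
    by (rule energy_bound[OF p _ rep(13) _ rep(14) rep(15) _ rep(19)]) auto
  then have "?T / e n \<le> (LBINT z. \<bar>fB n z\<bar> powr q) / e n" using e(1)[of n] by (simp add: divide_right_mono)
  then have T: "?T / e n \<le> c powr q" using load_bound[of n] by linarith
  have le: "(LBINT z. k z) / e n \<le> c powr q"
    if "integrable lborel k" "\<And>z. k z \<le> norm (G1 n z, G2 n z) powr p + \<bar>uB n z\<bar> powr p" for k
  proof -
    have "(LBINT z. k z) \<le> ?T" by (rule integral_mono[OF that(1) Ti that(2)])
    then have "(LBINT z. k z) / e n \<le> ?T / e n" using e(1)[of n] by (simp add: divide_right_mono)
    then show ?thesis using T by linarith
  qed
  show "(LBINT z. \<bar>uB n z\<bar> powr p) / e n \<le> c powr q" by (rule le[OF rep(14)]) simp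
  show "(LBINT z. \<bar>G1 n z\<bar> powr p) / e n \<le> c powr q"
  proof (rule le[OF rep(16)])
    fix z
    have "\<bar>G1 n z\<bar> powr p \<le> norm (G1 n z, G2 n z) powr p" using norm_fst_le[of "G1 n z" "G2 n z"] p by (intro powr_mono2) auto
    then show "\<bar>G1 n z\<bar> powr p \<le> norm (G1 n z, G2 n z) powr p + \<bar>uB n z\<bar> powr p" by (simp add: add_increasing2)
  qed
  show "(LBINT z. \<bar>G2 n z\<bar> powr p) / e n \<le> c powr q"
  proof (rule le[OF rep(17)])
    fix z
    have "\<bar>G2 n z\<bar> powr p \<le> norm (G1 n z, G2 n z) powr p" using norm_snd_le[of "G2 n z" "G1 n z"] p by (intro powr_mono2) auto
    then show "\<bar>G2 n z\<bar> powr p \<le> norm (G1 n z, G2 n z) powr p + \<bar>uB n z\<bar> powr p" by (simp add: add_increasing2)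
  qed
qed

lemma integral_unfolding_op:
  assumes ae: "AE z in lborel. z \<in> thin (a n) (e n) \<longrightarrow> \<phi> z = \<phi>B z"
    and [measurable]: "\<phi>B \<in> borel_measurable borel" "\<psi> \<in> borel_measurable borel"
  shows "(LINT z|lebesgue_on S. unfolding_op L \<alpha> (e n) \<phi> z * \<psi> z) = (LBINT z. X n z * \<phi>B (Phi (a n) (e n) z) * \<psi> z)"
proof (rule lebesgue_on_transfer(3)[OF I_Y_measurable])
  show "AE z in lborel. z \<in> S \<longrightarrow> unfolding_op L \<alpha> (e n) \<phi> z * \<psi> z = X n z * \<phi>B (Phi (a n) (e n) z) * \<psi> z"
    using unfolding_op_AE[OF e(1) ae[unfolded a_def]] by eventually_elim (simp add: a_def)
  show "(\<lambda>z. X n z * \<phi>B (Phi (a n) (e n) z) * \<psi> z) \<in> borel_measurable borel" by measurable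
qed (simp add: X_outside)

text \<open>Weak convergence along the filter at 0 is restricted to the sequence and rewritten with
  Borel representatives.\<close>

lemma Lp_functional_tendsto:
  assumes s: "1 < s" "1 / s + 1 / r = 1"
    and w: "weakly_converges (Lp s ({0<..<1} \<times> cell L g)) (Lp_norm s ({0<..<1} \<times> cell L g))
         (\<lambda>\<epsilon>. unfolding_op L \<alpha> \<epsilon> (k \<epsilon>)) k0 (at_right 0)"
    and [measurable]: "\<psi> \<in> borel_measurable borel" and \<psi>: "\<And>z. z \<notin> S \<Longrightarrow> \<psi> z = 0" "integrable lborel (\<lambda>z. \<bar>\<psi> z\<bar> powr r)"
    and kB: "\<And>n. AE z in lborel. z \<in> thin (a n) (e n) \<longrightarrow> k (e n) z = kB n z" "\<And>n. kB n \<in> borel_measurable borel"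
  shows "(\<lambda>n. LBINT z. X n z * kB n (Phi (a n) (e n) z) * \<psi> z) \<longlonglongrightarrow> (LINT z|lebesgue_on S. k0 z * \<psi> z)"
proof -
  have r: "1 < r" using conjugate_exponent[OF s] by simp
  have m: "\<psi> \<in> borel_measurable (lebesgue_on S)"
    by (rule lebesgue_on_transfer(1)[OF I_Y_measurable, of \<psi>]) (use \<psi> in auto)
  have i: "integrable (lebesgue_on S) (\<lambda>z. \<bar>\<psi> z\<bar> powr r)"
    using lebesgue_on_transfer(2)[OF I_Y_measurable, of "\<lambda>z. \<bar>\<psi> z\<bar> powr r" "\<lambda>z. \<bar>\<psi> z\<bar> powr r"] \<psi> by simp
  have "((\<lambda>\<epsilon>. LINT z|lebesgue_on S. unfolding_op L \<alpha> \<epsilon> (k \<epsilon>) z * \<psi> z) \<longlongrightarrow> (LINT z|lebesgue_on S. k0 z * \<psi> z)) (at_right 0)"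
    using w bounded_functional_Lp[OF s m i] unfolding weakly_converges_def cell_eq by blast
  from filterlim_compose[OF this e_filterlim] show ?thesis
    using integral_unfolding_op[OF kB] by simp
qed

lemma load_tendsto: "(\<lambda>n. (LBINT z. fB n z * u0 (fst z)) / e n) \<longlonglongrightarrow> load / L"
proof -
  define \<psi> where "\<psi> z = u0 (fst z) * indicator Y (snd z)" for z :: "real \<times> real \<times> real"
  have [measurable]: "\<psi> \<in> borel_measurable borel" unfolding \<psi>_def by measurable
  have \<psi>p: "\<bar>\<psi> z\<bar> powr p = \<bar>u0 (fst z)\<bar> powr p * indicator Y (snd z)" for z using p by (simp add: \<psi>_def indicator_def)
  have "(\<lambda>n. LBINT z. X n z * fB n (Phi (a n) (e n) z) * \<psi> z) \<longlonglongrightarrow> (LINT z|lebesgue_on S. fhat z * \<psi> z)"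
  proof (rule Lp_functional_tendsto[OF q(1,4) f_conv _ _ _ rep(9)])
    show "\<psi> z = 0" if "z \<notin> S" for z using that u0_rep(3)[of "fst z"] by (cases z) (auto simp: \<psi>_def)
    show "integrable lborel (\<lambda>z. \<bar>\<psi> z\<bar> powr p)" unfolding \<psi>p by (rule integrable_lborel_times[OF u0_rep(7) integrable_Y])
  qed measurable
  moreover have "(LINT z|lebesgue_on S. fhat z * \<psi> z) = load"
    unfolding load_def by (rule Bochner_Integration.integral_cong) (auto simp: \<psi>_def)
  ultimately have 1: "(\<lambda>n. (LBINT z. X n z * fB n (Phi (a n) (e n) z) * \<psi> z) / L) \<longlonglongrightarrow> load / L"
    using L by (intro tendsto_divide) auto
  \<comment> \<open>With the height cut g1 nothing is cut off, neither in the thin domain nor in the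
    cell.\<close>
  have "(\<lambda>n. (LBINT z. fB n z * (u0 (fst z) * indicator {..<e n * g1} (snd z))) / e n
    - (LBINT z. X n z * (fB n (Phi (a n) (e n) z) * (u0 (fst z) * indicator {..<g1} (snd (snd z))))) / L) \<longlonglongrightarrow> 0"
    by (rule unfold_pairing_tendsto[OF cell_width e(1) q(1,4) rep(1) rep(5) rep(13) load_bound u0_rep(1,3,7)])
  moreover have "fB n z * (u0 (fst z) * indicator {..<e n * g1} (snd z)) = fB n z * u0 (fst z)" for n z
  proof (cases "z \<in> thin (a n) (e n)")
    case True
    have "e n * g (fst z / a n) \<le> e n * g1" using e(1)[of n] g_upper by simp
    then have "snd z < e n * g1" using True by (auto simp: thin_def)
    then show ?thesis by simp
  qed (simp add: rep(5))
  moreover have "X n z * (fB n (Phi (a n) (e n) z) * (u0 (fst z) * indicator {..<g1} (snd (snd z)))) = X n z * fB n (Phi (a n) (e n) z) * \<psi> z" for n z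
  proof (cases "snd z \<in> Y")
    case True
    then have "snd (snd z) < g1" using g_upper[of "fst (snd z)"] by (auto simp: Y_def)
    then show ?thesis using True by (simp add: \<psi>_def)
  next
    case False then show ?thesis by (cases z) (simp add: \<psi>_def)
  qed
  ultimately have "(\<lambda>n. (LBINT z. fB n z * u0 (fst z)) / e n - (LBINT z. X n z * fB n (Phi (a n) (e n) z) * \<psi> z) / L) \<longlonglongrightarrow> 0"
    by (simp only:)
  from tendsto_add[OF this 1] show ?thesis by simp
qed

lemma XuB_integrable: "integrable lborel (\<lambda>z. \<bar>X n z * uB n (Phi (a n) (e n) z)\<bar> powr p)"
proof -
  have 1: "\<bar>X n z * uB n (Phi (a n) (e n) z)\<bar> powr p = X n z * \<bar>uB n (Phi (a n) (e n) z)\<bar> powr p" for z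
    using p by (simp add: indicator_def)
  have 2: "integrable lborel (\<lambda>z. indicator (thin (a n) (e n) \<inter> full_cells (a n) L \<times> UNIV) z * \<bar>uB n z\<bar> powr p)"
    by (rule integrable_real_indicator_mult[OF _ rep(14)]) measurable
  show ?thesis unfolding 1
    using unfold_integral(1)[OF cell_width(1)[of n] e(1)[of n], of "\<lambda>z. \<bar>uB n z\<bar> powr p"] 2 by simp
qed

text \<open>The limit state depends on x only, so its double integral factorises; the test function
  \<beta> can single out a part of the cell.\<close>

lemma Bochner_functional_tendsto:
  assumes [measurable]: "\<psi> \<in> borel_measurable borel" "\<beta> \<in> borel_measurable borel"
    and \<psi>: "\<And>x. x \<notin> {0<..<1} \<Longrightarrow> \<psi> x = 0" "integrable lborel (\<lambda>x. \<bar>\<psi> x\<bar> powr q)"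
    and \<beta>: "\<And>y. \<bar>\<beta> y\<bar> \<le> 1"
  shows "(\<lambda>n. LBINT z. X n z * uB n (Phi (a n) (e n) z) * (\<psi> (fst z) * \<beta> (snd z)))
    \<longlonglongrightarrow> (LBINT x. u0 x * \<psi> x) * (LBINT y. indicator Y y * \<beta> y)"
proof -
  have I: "{0<..<1::real} \<in> sets borel" and YB: "Y \<in> sets borel" by measurable
  have m1: "\<psi> \<in> borel_measurable (lebesgue_on {0<..<1})"
    by (rule lebesgue_on_transfer(1)[OF I, of \<psi>]) (use \<psi> in auto)
  have i1: "integrable (lebesgue_on {0<..<1}) (\<lambda>x. \<bar>\<psi> x\<bar> powr q)"
    using lebesgue_on_transfer(2)[OF I, of "\<lambda>x. \<bar>\<psi> x\<bar> powr q" "\<lambda>x. \<bar>\<psi> x\<bar> powr q"] \<psi> by simp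
  have m2: "\<beta> \<in> borel_measurable (lebesgue_on Y)"
    by (rule lebesgue_on_transfer(1)[OF YB, of "\<lambda>y. indicator Y y * \<beta> y"]) auto
  have \<beta>1: "\<bar>\<beta> y\<bar> powr q \<le> 1" for y using \<beta>[of y] q(1) powr_mono2[of q "\<bar>\<beta> y\<bar>" 1] by simp
  have Y\<beta>: "integrable lborel (\<lambda>y. indicator Y y * \<bar>\<beta> y\<bar> powr q)"
    by (rule Bochner_Integration.integrable_bound[OF integrable_Y]) (use \<beta>1 in \<open>auto simp: indicator_def\<close>)
  have i2: "integrable (lebesgue_on Y) (\<lambda>y. \<bar>\<beta> y\<bar> powr q)"
    using lebesgue_on_transfer(2)[OF YB, of "\<lambda>y. indicator Y y * \<bar>\<beta> y\<bar> powr q" "\<lambda>y. \<bar>\<beta> y\<bar> powr q"] Y\<beta> by simp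
  let ?l = "\<lambda>w. LINT x|lebesgue_on {0<..<1}. (LINT y|lebesgue_on Y. w (x, y) * \<beta> y) * \<psi> x"
  have "((\<lambda>\<epsilon>. ?l (unfolding_op L \<alpha> \<epsilon> (ueps \<epsilon>))) \<longlongrightarrow> ?l (\<lambda>(x, y). u x)) (at_right 0)"
    using ueps_conv bounded_functional_Bochner[OF p _ m1 i1 m2 i2] unfolding weakly_converges_def cell_eq by auto
  from filterlim_compose[OF this e_filterlim]
  have lim: "(\<lambda>n. ?l (unfolding_op L \<alpha> (e n) (ueps (e n)))) \<longlonglongrightarrow> ?l (\<lambda>(x, y). u x)" .
  define w where "w z = indicator S z * (\<psi> (fst z) * \<beta> (snd z))" for z
  have [measurable]: "w \<in> borel_measurable borel" unfolding w_def by measurable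
  have wi: "integrable lborel (\<lambda>z. \<bar>w z\<bar> powr q)"
  proof (rule Bochner_Integration.integrable_bound[OF integrable_lborel_times[OF \<psi>(2) Y\<beta>]])
    show "AE z in lborel. norm (\<bar>w z\<bar> powr q) \<le> norm (\<bar>\<psi> (fst z)\<bar> powr q * (indicator Y (snd z) * \<bar>\<beta> (snd z)\<bar> powr q))"
      using q(1) by (auto simp: w_def indicator_def abs_mult powr_mult)
  qed measurable
  have sw: "indicator S z * (k * (\<psi> (fst z) * \<beta> (snd z))) = k * w z" for z k by (simp add: w_def)
  have un: "?l (unfolding_op L \<alpha> (e n) (ueps (e n))) = (LBINT z. X n z * uB n (Phi (a n) (e n) z) * (\<psi> (fst z) * \<beta> (snd z)))" for n
  proof -
    have int: "integrable lborel (\<lambda>z. indicator S z * (X n z * uB n (Phi (a n) (e n) z) * (\<psi> (fst z) * \<beta> (snd z))))"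
      unfolding sw by (rule Holder_inequality(1)[OF p _ XuB_integrable _ wi]) measurable
    have "?l (unfolding_op L \<alpha> (e n) (ueps (e n))) = (LBINT z. indicator S z * (X n z * uB n (Phi (a n) (e n) z) * (\<psi> (fst z) * \<beta> (snd z))))"
    proof (rule integral_lebesgue_on_iterated[OF I YB _ _ assms(1) _ assms(2) int])
      show "AE z in lborel. z \<in> S \<longrightarrow> unfolding_op L \<alpha> (e n) (ueps (e n)) z = X n z * uB n (Phi (a n) (e n) z)"
        using unfolding_op_AE[OF e(1) rep(10)[unfolded a_def]] by (simp add: a_def)
      show "(\<lambda>z. X n z * uB n (Phi (a n) (e n) z)) \<in> borel_measurable borel" by measurable
    qed simp
    also have "\<dots> = (LBINT z. X n z * uB n (Phi (a n) (e n) z) * (\<psi> (fst z) * \<beta> (snd z)))"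
    proof (intro Bochner_Integration.integral_cong refl)
      fix z show "indicator S z * (X n z * uB n (Phi (a n) (e n) z) * (\<psi> (fst z) * \<beta> (snd z))) = X n z * uB n (Phi (a n) (e n) z) * (\<psi> (fst z) * \<beta> (snd z))"
        using X_outside[of z n] by (cases "z \<in> S") simp_all
    qed
    finally show ?thesis .
  qed
  have u0Y: "integrable lborel (\<lambda>z. \<bar>u0 (fst z) * indicator Y (snd z)\<bar> powr p)"
  proof -
    have "\<bar>u0 (fst z) * indicator Y (snd z)\<bar> powr p = \<bar>u0 (fst z)\<bar> powr p * indicator Y (snd z)" for z :: "real \<times> real \<times> real"
      using p by (simp add: indicator_def)
    then show ?thesis using integrable_lborel_times[OF u0_rep(7) integrable_Y] by simp
  qed
  have lim0: "?l (\<lambda>(x, y). u x) = (LBINT x. u0 x * \<psi> x) * (LBINT y. indicator Y y * \<beta> y)"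
  proof -
    have e0: "indicator S z * (u0 (fst z) * (\<psi> (fst z) * \<beta> (snd z))) = u0 (fst z) * indicator Y (snd z) * w z" for z
      by (cases z) (auto simp: w_def indicator_def)
    have int: "integrable lborel (\<lambda>z. indicator S z * (u0 (fst z) * (\<psi> (fst z) * \<beta> (snd z))))"
      unfolding e0 by (rule Holder_inequality(1)[OF p _ u0Y _ wi]) measurable
    have "?l (\<lambda>(x, y). u x) = (LBINT z. indicator S z * (u0 (fst z) * (\<psi> (fst z) * \<beta> (snd z))))"
    proof (rule integral_lebesgue_on_iterated[OF I YB _ _ assms(1) _ assms(2) int])
      show "AE z in lborel. z \<in> S \<longrightarrow> (case z of (x, y) \<Rightarrow> u x) = u0 (fst z)"
        using AE_lborel_fst[OF u0_rep(5), where ?'b = "real \<times> real"] by eventually_elim auto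
      show "(\<lambda>z. u0 (fst z)) \<in> borel_measurable (borel :: (real \<times> real \<times> real) measure)" by measurable
    qed (simp add: u0_rep(1))
    also have "\<dots> = (LBINT z. (u0 (fst z) * \<psi> (fst z)) * (indicator Y (snd z) * \<beta> (snd z)))"
    proof (intro Bochner_Integration.integral_cong refl)
      fix z :: "real \<times> real \<times> real"
      show "indicator S z * (u0 (fst z) * (\<psi> (fst z) * \<beta> (snd z))) = u0 (fst z) * \<psi> (fst z) * (indicator Y (snd z) * \<beta> (snd z))"
        using u0_rep(3)[of "fst z"] by (cases "fst z \<in> {0<..<1}") (cases z, simp add: indicator_def)+
    qed
    also have "\<dots> = (LBINT x. u0 x * \<psi> x) * (LBINT y. indicator Y y * \<beta> y)"
    proof (rule integral_lborel_times)
      show "integrable lborel (\<lambda>x. u0 x * \<psi> x)" by (rule Holder_inequality(1)[OF p _ u0_rep(7) _ \<psi>(2)]) measurable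
      show "integrable lborel (\<lambda>y. indicator Y y * \<beta> y)"
        by (rule Bochner_Integration.integrable_bound[OF integrable_Y]) (use \<beta> in \<open>auto simp: indicator_def\<close>)
    qed
    finally show ?thesis .
  qed
  show ?thesis using lim unfolding un lim0 .
qed

text \<open>Here \<beta> is the indicator of y2 < g0. Its part of the cell has area L g0 because g0
  lies below g everywhere, and division by L leaves the factor g0.\<close>

lemma average_tendsto:
  assumes st: "0 \<le> s" "s < t" "t \<le> 1"
  shows "(\<lambda>n. (LBINT z. uB n z * (indicator {s<..<t} (fst z) * indicator {..<e n * g0} (snd z))) / e n)
    \<longlonglongrightarrow> g0 * (LBINT x. indicator {s<..<t} x * u0 x)"
proof -
  let ?J = "indicator {s<..<t} :: real \<Rightarrow> real"
  have J0: "?J x = 0" if "x \<notin> {0<..<1}" for x using that st by (auto simp: indicator_def)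
  have "\<bar>?J x\<bar> powr q = ?J x" for x using q(1) by (simp add: indicator_def)
  then have Ji: "integrable lborel (\<lambda>x. \<bar>?J x\<bar> powr q)" by simp
  have Jm: "?J \<in> borel_measurable borel" by simp
  have bm: "(\<lambda>y::real \<times> real. indicator {..<g0} (snd y) :: real) \<in> borel_measurable borel" by measurable
  have YB: "(LBINT y. indicator Y y * indicator {..<g0} (snd y)) = L * g0"
  proof -
    have "indicator Y y * indicator {..<g0} (snd y) = (indicator {0<..<L} (fst y) * indicator {0<..<g0} (snd y) :: real)" for y
      using g_lower[of "fst y"] by (cases y) (auto simp: Y_def indicator_def)
    then have "(LBINT y. indicator Y y * indicator {..<g0} (snd y)) = (\<integral>y. indicator {0<..<L} (fst y) * indicator {0<..<g0} (snd y) \<partial>(lborel :: (real \<times> real) measure) :: real)"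
      by (simp only:)
    also have "\<dots> = L * g0" using L g0 by (subst integral_lborel_times) auto
    finally show ?thesis .
  qed
  have "(\<lambda>n. LBINT z. X n z * uB n (Phi (a n) (e n) z) * (?J (fst z) * indicator {..<g0} (snd (snd z))))
    \<longlonglongrightarrow> (LBINT x. u0 x * ?J x) * (LBINT y. indicator Y y * indicator {..<g0} (snd y))"
    by (rule Bochner_functional_tendsto[OF Jm bm J0 Ji]) (simp_all add: indicator_def)
  then have 1: "(\<lambda>n. (LBINT z. X n z * uB n (Phi (a n) (e n) z) * (?J (fst z) * indicator {..<g0} (snd (snd z)))) / L)
    \<longlonglongrightarrow> (LBINT x. u0 x * ?J x) * (L * g0) / L"
    unfolding YB using L by (intro tendsto_divide) auto
  have "(\<lambda>n. (LBINT z. uB n z * (?J (fst z) * indicator {..<e n * g0} (snd z))) / e n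
    - (LBINT z. X n z * (uB n (Phi (a n) (e n) z) * (?J (fst z) * indicator {..<g0} (snd (snd z))))) / L) \<longlonglongrightarrow> 0"
    by (rule unfold_pairing_tendsto[OF cell_width e(1) p rep(2) rep(6) rep(14) energy_bounds(1) Jm J0 Ji])
  from tendsto_add[OF this 1] show ?thesis using L by (simp add: mult_ac)
qed

lemma strong: "(\<lambda>n. (LBINT z. indicator (thin (a n) (e n)) z * \<bar>uB n z - u0 (fst z)\<bar> powr p) / e n) \<longlonglongrightarrow> 0"
proof (rule thin_strong_convergence[OF cell_width(1) e p(1) rep(2,3,4,6,7,8) rep(14,16,17) energy_bounds(2,3) _ _ u0_rep(1,2,7,8) _ average_tendsto])
  have B: "thin (a n) (e n) \<in> sets borel" for n by measurable
  show "(LBINT z. uB n z * (deriv \<phi> (fst z) * \<psi> (snd z))) = - (LBINT z. G1 n z * (\<phi> (fst z) * \<psi> (snd z)))"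
    if "{a1<..<b1} \<times> {c1<..<d1} \<subseteq> thin (a n) (e n)" "test_function {a1<..<b1} \<phi>" "test_function {c1<..<d1} \<psi>" for n a1 b1 c1 d1 \<phi> \<psi>
    by (rule weak_gradient_product(1)[OF B rep(20) that(1) refl refl that(2,3) rep(2,6,10) rep(3,7,11) rep(4,8,12)])
  show "(LBINT z. uB n z * (\<phi> (fst z) * deriv \<psi> (snd z))) = - (LBINT z. G2 n z * (\<phi> (fst z) * \<psi> (snd z)))"
    if "{a1<..<b1} \<times> {c1<..<d1} \<subseteq> thin (a n) (e n)" "test_function {a1<..<b1} \<phi>" "test_function {c1<..<d1} \<psi>" for n a1 b1 c1 d1 \<phi> \<psi>
    by (rule weak_gradient_product(2)[OF B rep(20) that(1) refl refl that(2,3) rep(2,6,10) rep(3,7,11) rep(4,8,12)])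
  show "(LBINT x. u0 x * deriv \<psi> x) = - (LBINT x. du0 x * \<psi> x)"
    if "0 \<le> s" "s < t" "t \<le> 1" "test_function {s<..<t} \<psi>" for s t \<psi>
    by (rule weak_gradient_interval[OF u0_rep(9) that(1,3,4) u0_rep(1,3,5) u0_rep(2,4,6)])
qed

text \<open>The weak limit is tested against its own dual element, so the pairing tends to the p-th
  power of its norm. The explicit formula for \<open>d1u1\<close> identifies this limit with
  \<open>v\<close>.\<close>

lemma gradient_pairing:
  "(\<lambda>n. LBINT z. X n z * G1 n (Phi (a n) (e n) z) * (\<bar>v z\<bar> powr (p - 2) * v z)) \<longlonglongrightarrow> (LBINT z. \<bar>v z\<bar> powr p)"
proof -
  have v0: "v z = 0" if "z \<notin> S" for z using that u0_rep(4)[of "fst z"] by (cases z) (auto simp: v_def)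
  have "(\<lambda>n. LBINT z. X n z * G1 n (Phi (a n) (e n) z) * (\<bar>v z\<bar> powr (p - 2) * v z))
    \<longlonglongrightarrow> (LINT z|lebesgue_on S. (case z of (x, y1, y2) \<Rightarrow> du x + d1u1 (x, y1)) * (\<bar>v z\<bar> powr (p - 2) * v z))"
  proof (rule Lp_functional_tendsto[OF p Dueps_conv _ _ _ rep(11)])
    show "integrable lborel (\<lambda>z. \<bar>\<bar>v z\<bar> powr (p - 2) * v z\<bar> powr q)" by (simp add: powr_dual(1)[OF p] v_integrable)
  qed (simp_all add: v0 rep(3))
  moreover have "(LINT z|lebesgue_on S. (case z of (x, y1, y2) \<Rightarrow> du x + d1u1 (x, y1)) * (\<bar>v z\<bar> powr (p - 2) * v z)) = (LBINT z. \<bar>v z\<bar> powr p)"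
  proof (rule lebesgue_on_transfer(3)[OF I_Y_measurable])
    show "AE z in lborel. z \<in> S \<longrightarrow> (case z of (x, y1, y2) \<Rightarrow> du x + d1u1 (x, y1)) * (\<bar>v z\<bar> powr (p - 2) * v z) = \<bar>v z\<bar> powr p"
      using AE_lborel_fst[OF u0_rep(6), where ?'b = "real \<times> real"]
    proof eventually_elim
      case (elim z)
      show ?case
      proof
        assume z: "z \<in> S"
        obtain x y1 y2 where zz: "z = (x, y1, y2)" by (cases z) auto
        have x: "x \<in> {0<..<1}" "y1 \<in> {0..<L}" "(y1, y2) \<in> Y" using z by (auto simp: zz Y_def)
        have "du x + d1u1 (x, y1) = v z"
          using d1u1[OF x(1,2)] elim x by (simp add: zz v_def h_def M_def)
        then show "(case z of (x, y1, y2) \<Rightarrow> du x + d1u1 (x, y1)) * (\<bar>v z\<bar> powr (p - 2) * v z) = \<bar>v z\<bar> powr p"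
          using powr_dual(2)[OF p, of "v z"] by (simp add: zz mult_ac)
      qed
    qed
    show "(\<lambda>z. \<bar>v z\<bar> powr p) \<in> borel_measurable borel" by measurable
  qed (simp add: v0)
  ultimately show ?thesis by simp
qed

text \<open>The same device for the state, with \<beta> = 1. The factor \<open>indicator Y\<close>
  changes nothing, since \<open>X n\<close> already vanishes off the cell.\<close>

lemma state_pairing:
  "(\<lambda>n. LBINT z. X n z * uB n (Phi (a n) (e n) z) * (indicator Y (snd z) * (\<bar>u0 (fst z)\<bar> powr (p - 2) * u0 (fst z))))
    \<longlonglongrightarrow> area * (LBINT x. \<bar>u0 x\<bar> powr p)"
proof -
  have "(\<lambda>n. LBINT z. X n z * uB n (Phi (a n) (e n) z) * ((\<bar>u0 (fst z)\<bar> powr (p - 2) * u0 (fst z)) * 1))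
    \<longlonglongrightarrow> (LBINT x. u0 x * (\<bar>u0 x\<bar> powr (p - 2) * u0 x)) * (LBINT y. indicator Y y * 1)"
    by (rule Bochner_functional_tendsto[of "\<lambda>x. \<bar>u0 x\<bar> powr (p - 2) * u0 x" "\<lambda>_. 1"])
      (use u0_rep(3) in \<open>simp_all add: powr_dual(1)[OF p] u0_rep(7)\<close>)
  moreover have "u0 x * (\<bar>u0 x\<bar> powr (p - 2) * u0 x) = \<bar>u0 x\<bar> powr p" for x
    using powr_dual(2)[OF p, of "u0 x"] by (simp add: mult_ac)
  moreover have "X n z * uB n (Phi (a n) (e n) z) * ((\<bar>u0 (fst z)\<bar> powr (p - 2) * u0 (fst z)) * 1)
    = X n z * uB n (Phi (a n) (e n) z) * (indicator Y (snd z) * (\<bar>u0 (fst z)\<bar> powr (p - 2) * u0 (fst z)))" for n z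
    by (cases z) (auto simp: indicator_def)
  moreover have "(LBINT y. indicator Y y * 1) = area" using integrable_Y by (simp add: area_def)
  ultimately show ?thesis by (simp only: mult.commute[of area])
qed

lemma gradient_limit:
  "integrable lborel (\<lambda>z. norm (X n z * G1 n (Phi (a n) (e n) z) - v z, X n z * G2 n (Phi (a n) (e n) z)) powr p)"
  "(\<lambda>n. LBINT z. norm (X n z * G1 n (Phi (a n) (e n) z) - v z, X n z * G2 n (Phi (a n) (e n) z)) powr p) \<longlonglongrightarrow> 0"
proof -
  note G = gradient_strong_convergence[OF cell_width(1) e(1) p rep(1-4) rep(5) rep(13,14,15) load_bound rep(19) strong load_tendsto
        u0_rep(1,7) v_measurable v_integrable gradient_pairing state_pairing load_eq]
  show "integrable lborel (\<lambda>z. norm (X n z * G1 n (Phi (a n) (e n) z) - v z, X n z * G2 n (Phi (a n) (e n) z)) powr p)" by (rule G(1))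
  show "(\<lambda>n. LBINT z. norm (X n z * G1 n (Phi (a n) (e n) z) - v z, X n z * G2 n (Phi (a n) (e n) z)) powr p) \<longlonglongrightarrow> 0" by (rule G(2))
qed

lemma corrector_limit:
  "integrable lborel (\<lambda>z. \<bar>X n z * (du0 (fst (Phi (a n) (e n) z)) * h (fst (snd z))) - v z\<bar> powr p)"
  "(\<lambda>n. LBINT z. \<bar>X n z * (du0 (fst (Phi (a n) (e n) z)) * h (fst (snd z))) - v z\<bar> powr p) \<longlonglongrightarrow> 0"
  unfolding v_def
proof -
  note C = corrector_strong_convergence[OF cell_width e(1) p(1) u0_rep(2) h_measurable u0_rep(4,8) h_bound]
  show "integrable lborel (\<lambda>z. \<bar>X n z * (du0 (fst (Phi (a n) (e n) z)) * h (fst (snd z)))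
    - indicator Y (snd z) * (du0 (fst z) * h (fst (snd z)))\<bar> powr p)" by (rule C(1))
  show "(\<lambda>n. LBINT z. \<bar>X n z * (du0 (fst (Phi (a n) (e n) z)) * h (fst (snd z)))
    - indicator Y (snd z) * (du0 (fst z) * h (fst (snd z)))\<bar> powr p) \<longlonglongrightarrow> 0" by (rule C(2))
qed

text \<open>With \<open>D2\<close>, the components of the unfolded difference in terms of Borel
  representatives; the common limit \<open>v\<close> of both fields no longer appears.\<close>

definition D1 where "D1 n z = X n z * G1 n (Phi (a n) (e n) z) - X n z * (du0 (fst (Phi (a n) (e n) z)) * h (fst (snd z)))"
definition D2 where "D2 n z = X n z * G2 n (Phi (a n) (e n) z)"

lemma D_measurable [measurable]: "D1 n \<in> borel_measurable borel" "D2 n \<in> borel_measurable borel"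
  unfolding D1_def D2_def by measurable

lemma D_limit:
  "integrable lborel (\<lambda>z. norm (D1 n z, D2 n z) powr p)"
  "(\<lambda>n. LBINT z. norm (D1 n z, D2 n z) powr p) \<longlonglongrightarrow> 0"
proof -
  define P where "P n z = norm (X n z * G1 n (Phi (a n) (e n) z) - v z, X n z * G2 n (Phi (a n) (e n) z)) powr p" for n z
  define R where "R n z = \<bar>X n z * (du0 (fst (Phi (a n) (e n) z)) * h (fst (snd z))) - v z\<bar> powr p" for n z
  have Pi: "integrable lborel (P n)" and Ri: "integrable lborel (R n)" for n
    using gradient_limit(1)[of n] corrector_limit(1)[of n] by (simp_all add: P_def[abs_def] R_def[abs_def])
  have le: "norm (D1 n z, D2 n z) powr p \<le> 2 powr p * (P n z + R n z)" for n z
    using norm_diff_powr_le[of p "(X n z * G1 n (Phi (a n) (e n) z) - v z, X n z * G2 n (Phi (a n) (e n) z))"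
        "(X n z * (du0 (fst (Phi (a n) (e n) z)) * h (fst (snd z))) - v z, 0)"] p
    by (simp add: P_def R_def D1_def D2_def norm_Pair)
  have PRi: "integrable lborel (\<lambda>z. 2 powr p * (P n z + R n z))" for n using Pi[of n] Ri[of n] by simp
  show Di: "integrable lborel (\<lambda>z. norm (D1 n z, D2 n z) powr p)" for n
  proof (rule Bochner_Integration.integrable_bound[OF PRi])
    show "AE z in lborel. norm (norm (D1 n z, D2 n z) powr p) \<le> norm (2 powr p * (P n z + R n z))"
    proof (rule AE_I2)
      fix z show "norm (norm (D1 n z, D2 n z) powr p) \<le> norm (2 powr p * (P n z + R n z))"
        using order_trans[OF le[of n z] abs_ge_self] by simp
    qed
  qed measurable
  have "(\<lambda>n. 2 powr p * ((LBINT z. P n z) + (LBINT z. R n z))) \<longlonglongrightarrow> 2 powr p * (0 + 0)"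
    by (intro tendsto_intros) (use gradient_limit(2) corrector_limit(2) in \<open>simp_all add: P_def R_def\<close>)
  then have lim: "(\<lambda>n. 2 powr p * ((LBINT z. P n z) + (LBINT z. R n z))) \<longlonglongrightarrow> 0" by simp
  show "(\<lambda>n. LBINT z. norm (D1 n z, D2 n z) powr p) \<longlonglongrightarrow> 0"
  proof (rule Lim_null_comparison[OF always_eventually lim], rule allI)
    fix n
    have "(LBINT z. norm (D1 n z, D2 n z) powr p) \<le> (LBINT z. 2 powr p * (P n z + R n z))"
      by (rule integral_mono[OF Di PRi le])
    also have "\<dots> = 2 powr p * ((LBINT z. P n z) + (LBINT z. R n z))" using Pi[of n] Ri[of n] by simp
    finally have "(LBINT z. norm (D1 n z, D2 n z) powr p) \<le> 2 powr p * ((LBINT z. P n z) + (LBINT z. R n z))" .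
    moreover have "0 \<le> (LBINT z. norm (D1 n z, D2 n z) powr p)" by (intro integral_nonneg_AE) auto
    ultimately show "norm (LBINT z. norm (D1 n z, D2 n z) powr p) \<le> 2 powr p * ((LBINT z. P n z) + (LBINT z. R n z))"
      by simp
  qed
qed

text \<open>Unfolding is exact in the oscillating variable: the base point divided by
  \<open>a n\<close> is a whole number of periods, so the periodic extension evaluates the factor at
  y1 itself. Only \<open>du\<close> is seen at a shifted point.\<close>

lemma corrector_Phi:
  assumes z: "z \<in> full_cells (a n) L \<times> Y"
  shows "corrector L \<alpha> du d1u1 (e n) (Phi (a n) (e n) z) = (du (fst (Phi (a n) (e n) z)) * h (fst (snd z)), 0)"
proof -
  let ?P = "fst (Phi (a n) (e n) z)" and ?y = "fst (snd z)"
  have y: "0 < ?y" "?y < L" using z by (auto simp: Y_def)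
  have P: "?P \<in> {0<..<1}" using subsetD[OF full_cells_bounds(1)[OF cell_width(1)[of n] L] fst_Phi_in(1)[OF cell_width(1) z]] .
  have "?P / a n = of_int \<lfloor>fst z / a n / L\<rfloor> * L + ?y"
    using cell_width(1)[of n] by (simp add: Phi_def base_point_def field_simps)
  then have "per_frac L (?P / a n) = ?y"
  proof -
    assume e: "?P / a n = of_int \<lfloor>fst z / a n / L\<rfloor> * L + ?y"
    have "\<lfloor>(of_int \<lfloor>fst z / a n / L\<rfloor> * L + ?y) / L\<rfloor> = \<lfloor>fst z / a n / L\<rfloor>"
      using y L by (intro floor_unique) (simp_all add: field_simps)
    then show ?thesis unfolding e per_frac_def per_int_def by simp
  qed
  then show ?thesis
    using d1u1[OF P, of ?y] y by (simp add: corrector_def case_prod_beta a_def[symmetric] h_def M_def)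
qed

text \<open>The corrector evaluates \<open>du\<close> at image points of \<open>Phi\<close>, so its
  equality with \<open>du0\<close> almost everywhere has to be transported by
  \<open>unfold_AE\<close>, just as for the gradients.\<close>

lemma difference_AE:
  "AE z in lborel. z \<in> S \<longrightarrow> unfolding_op L \<alpha> (e n) (Dueps (e n)) z - unfolding_op L \<alpha> (e n) (corrector L \<alpha> du d1u1 (e n)) z = (D1 n z, D2 n z)"
proof -
  have t: "AE z in lborel. z \<in> thin (a n) (e n) \<longrightarrow> Dueps (e n) z = (G1 n z, G2 n z) \<and> du (fst z) = du0 (fst z)"
    using rep(11)[of n] rep(12)[of n] AE_lborel_fst[OF u0_rep(6), where ?'b = real]
    by eventually_elim (auto simp: prod_eq_iff thin_def)
  show ?thesis
    using unfold_AE[OF cell_width(1) e(1) t]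
  proof eventually_elim
    case (elim z)
    show ?case
    proof
      assume z: "z \<in> S"
      show "unfolding_op L \<alpha> (e n) (Dueps (e n)) z - unfolding_op L \<alpha> (e n) (corrector L \<alpha> du d1u1 (e n)) z = (D1 n z, D2 n z)"
      proof (cases "fst z \<in> full_cells (a n) L")
        case True
        then have zz: "z \<in> full_cells (a n) L \<times> Y" using z by auto
        show ?thesis
          using True elim zz corrector_Phi[OF zz]
          by (simp add: unfolding_op_eq[OF e(1)] a_def[symmetric] D1_def D2_def del: mem_Times_iff)
      next
        case False
        then have "X n z = 0" by (cases z) simp
        then show ?thesis
          using False by (simp add: unfolding_op_eq[OF e(1)] a_def[symmetric] D1_def D2_def zero_prod_def)
      qed
    qed
  qed
qed

lemma unfolded_gradient_convergence:
  defines "w \<equiv> \<lambda>n z. unfolding_op L \<alpha> (e n) (Dueps (e n)) z - unfolding_op L \<alpha> (e n) (corrector L \<alpha> du d1u1 (e n)) z"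
  shows "w n \<in> Lp p ({0<..<1} \<times> cell L g)"
    and "(\<lambda>n. Lp_norm p ({0<..<1} \<times> cell L g) (w n)) \<longlonglongrightarrow> 0"
proof -
  have Dn: "norm (D1 n z, D2 n z) powr p = 0" if "z \<notin> S" for n z
    using X_outside[OF that, of n] by (simp add: D1_def D2_def zero_prod_def[symmetric])
  have D0: "D1 n z = 0" "D2 n z = 0" if "z \<notin> S" for n z
    using X_outside[OF that, of n] by (simp_all add: D1_def D2_def)
  have wD: "AE z in lborel. z \<in> S \<longrightarrow> w n z = (D1 n z, D2 n z)" for n unfolding w_def by (rule difference_AE)
  have m1: "(\<lambda>z. fst (w n z)) \<in> borel_measurable (lebesgue_on S)" for n
    by (rule lebesgue_on_transfer(1)[OF I_Y_measurable, of "D1 n"]) (use wD[of n] D0 in \<open>auto elim!: eventually_mono\<close>)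
  have m2: "(\<lambda>z. snd (w n z)) \<in> borel_measurable (lebesgue_on S)" for n
    by (rule lebesgue_on_transfer(1)[OF I_Y_measurable, of "D2 n"]) (use wD[of n] D0 in \<open>auto elim!: eventually_mono\<close>)
  have wm: "w n \<in> borel_measurable (lebesgue_on S)" for n
    using borel_measurable_Pair[OF m1 m2, of n n] by simp
  have m: "(\<lambda>z. norm (D1 n z, D2 n z) powr p) \<in> borel_measurable borel" for n by measurable
  have ae: "AE z in lborel. z \<in> S \<longrightarrow> norm (w n z) powr p = norm (D1 n z, D2 n z) powr p" for n
    using wD[of n] by eventually_elim auto
  note T = lebesgue_on_transfer[OF I_Y_measurable m Dn ae]
  show "w n \<in> Lp p ({0<..<1} \<times> cell L g)"
    unfolding Lp_def cell_eq using wm T(2) D_limit(1) by blast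
  have "Lp_norm p ({0<..<1} \<times> cell L g) (w n) = (LBINT z. norm (D1 n z, D2 n z) powr p) powr (1 / p)" for n
    unfolding Lp_norm_def cell_eq by (rule arg_cong[where f = "\<lambda>s. s powr (1 / p)"], rule T(3))
  moreover have "(\<lambda>n. (LBINT z. norm (D1 n z, D2 n z) powr p) powr (1 / p)) \<longlonglongrightarrow> 0 powr (1 / p)"
    using p by (intro tendsto_powr' D_limit(2) tendsto_const) (auto intro!: always_eventually integral_nonneg_AE)
  ultimately show "(\<lambda>n. Lp_norm p ({0<..<1} \<times> cell L g) (w n)) \<longlonglongrightarrow> 0" by simp
qed

end

theorem corollary4p1p1:
  fixes g :: "real \<Rightarrow> real" and L \<alpha> p q c :: real
    and f :: "real \<Rightarrow> real \<times> real \<Rightarrow> real"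
    and fhat :: "real \<times> real \<times> real \<Rightarrow> real"
    and ueps :: "real \<Rightarrow> real \<times> real \<Rightarrow> real"
    and Dueps :: "real \<Rightarrow> real \<times> real \<Rightarrow> real \<times> real"
    and u du :: "real \<Rightarrow> real"
    and u1 :: "real \<times> real \<times> real \<Rightarrow> real"
    and d1u1 :: "real \<times> real \<Rightarrow> real"
  assumes g: "\<And>x. 0 < g x" "bounded (range g)" "lower_semicont g"
    and L: "0 < L" "\<And>x. g (x + L) = g x"
    and alpha: "0 < \<alpha>" "\<alpha> < 1"
    and p: "1 < p" "1 / p + 1 / q = 1"
    and c: "0 < c"
    and f_Lq: "\<And>\<epsilon>. 0 < \<epsilon> \<Longrightarrow> f \<epsilon> \<in> Lp q (thin_domain g \<alpha> \<epsilon>)"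
    and f_bound: "\<And>\<epsilon>. 0 < \<epsilon> \<Longrightarrow> \<epsilon> powr (- 1 / q) * Lp_norm q (thin_domain g \<alpha> \<epsilon>) (f \<epsilon>) \<le> c"
    and f_conv:
      "weakly_converges (Lp q ({0<..<1} \<times> cell L g)) (Lp_norm q ({0<..<1} \<times> cell L g))
         (\<lambda>\<epsilon>. unfolding_op L \<alpha> \<epsilon> (f \<epsilon>)) fhat (at_right 0)"
    and ueps: "\<And>\<epsilon>. 0 < \<epsilon> \<Longrightarrow>
      plaplace_solution p 1 (thin_domain g \<alpha> \<epsilon>) (f \<epsilon>) (ueps \<epsilon>) (Dueps \<epsilon>)"
    and u: "plaplace_solution p (hom_coeff p q L g) {0<..<1} (cell_average L g fhat) u du"
    and u1: "u1 \<in> Bochner_Lp p {0<..<1} (W1p_per p L g) (W1p_norm p (cell L g))"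
    and u1_grad: "AE x in lebesgue_on {0<..<1}.
      has_weak_gradient (cell L g) (\<lambda>y. u1 (x, y)) (\<lambda>y. (d1u1 (x, fst y), 0))"
    and d1u1: "\<And>x t. x \<in> {0<..<1} \<Longrightarrow> t \<in> {0..<L} \<Longrightarrow>
      d1u1 (x, t) = du x / (g t powr (q - 1) * mean L (\<lambda>s. 1 / g s powr (q - 1))) - du x"
    and ueps_conv:
      "weakly_converges
         (Bochner_Lp p {0<..<1} (W1p p (cell L g)) (W1p_norm p (cell L g)))
         (Bochner_norm p {0<..<1} (W1p_norm p (cell L g)))
         (\<lambda>\<epsilon>. unfolding_op L \<alpha> \<epsilon> (ueps \<epsilon>)) (\<lambda>(x, y). u x) (at_right 0)"
    and Dueps_conv:
      "weakly_converges (Lp p ({0<..<1} \<times> cell L g)) (Lp_norm p ({0<..<1} \<times> cell L g))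
         (\<lambda>\<epsilon>. unfolding_op L \<alpha> \<epsilon> (\<lambda>z. fst (Dueps \<epsilon> z)))
         (\<lambda>(x, y1, y2). du x + d1u1 (x, y1)) (at_right 0)"
  shows "(\<forall>\<epsilon>>0. (\<lambda>z. unfolding_op L \<alpha> \<epsilon> (Dueps \<epsilon>) z
                    - unfolding_op L \<alpha> \<epsilon> (corrector L \<alpha> du d1u1 \<epsilon>) z)
                  \<in> Lp p ({0<..<1} \<times> cell L g)) \<and>
         ((\<lambda>\<epsilon>. Lp_norm p ({0<..<1} \<times> cell L g)
             (\<lambda>z. unfolding_op L \<alpha> \<epsilon> (Dueps \<epsilon>) z
                  - unfolding_op L \<alpha> \<epsilon> (corrector L \<alpha> du d1u1 \<epsilon>) z)) \<longlongrightarrow> 0) (at_right 0)"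
proof -
  \<comment> \<open>A strict lower bound is required by the locale; the attained minimum of g would
    not do.\<close>
  obtain g0 where g0: "0 < g0" "\<And>x. g0 < g x"
    using lower_semicont_periodic_lower_bound[OF g(3) g(1) L] by blast
  obtain g1 where g1: "\<And>x. g x \<le> g1"
    using g(2) unfolding bounded_iff by (auto dest: abs_le_D1)
  interpret thin_corrector g L g0 g1 \<alpha> p q c f fhat ueps Dueps u du d1u1
    by unfold_locales (fact g0 g1 g L alpha p f_Lq f_bound f_conv ueps u d1u1 ueps_conv Dueps_conv)+
  show ?thesis
  proof (intro conjI allI impI)
    fix \<epsilon> :: real assume \<epsilon>: "0 < \<epsilon>"
    \<comment> \<open>Membership for one fixed \<epsilon> is read off from the term n = 0 of the
      sequence \<epsilon> / (n + 1).\<close>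
    interpret thin_sequence g L g0 g1 \<alpha> p q c f fhat ueps Dueps u du d1u1 "\<lambda>n. \<epsilon> / real (Suc n)"
    proof
      show "0 < \<epsilon> / real (Suc n)" for n using \<epsilon> by simp
      show "(\<lambda>n. \<epsilon> / real (Suc n)) \<longlonglongrightarrow> 0"
        using tendsto_mult_right_zero[OF LIMSEQ_inverse_real_of_nat, of \<epsilon>] by (simp add: divide_inverse)
    qed
    show "(\<lambda>z. unfolding_op L \<alpha> \<epsilon> (Dueps \<epsilon>) z - unfolding_op L \<alpha> \<epsilon> (corrector L \<alpha> du d1u1 \<epsilon>) z)
        \<in> Lp p ({0<..<1} \<times> cell L g)"
      using unfolded_gradient_convergence(1)[of 0] by simp
  next
    show "((\<lambda>\<epsilon>. Lp_norm p ({0<..<1} \<times> cell L g)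
        (\<lambda>z. unfolding_op L \<alpha> \<epsilon> (Dueps \<epsilon>) z - unfolding_op L \<alpha> \<epsilon> (corrector L \<alpha> du d1u1 \<epsilon>) z)) \<longlongrightarrow> 0) (at_right 0)"
    \<comment> \<open>The right end 1 is arbitrary; it only has to exceed 0.\<close>
    proof (rule tendsto_at_right_sequentially[of 0 1])
      fix e :: "nat \<Rightarrow> real"
      assume e: "\<And>n. 0 < e n" "e \<longlonglongrightarrow> 0"
      interpret thin_sequence g L g0 g1 \<alpha> p q c f fhat ueps Dueps u du d1u1 e
        by unfold_locales (fact e)+
      show "(\<lambda>n. Lp_norm p ({0<..<1} \<times> cell L g)
          (\<lambda>z. unfolding_op L \<alpha> (e n) (Dueps (e n)) z - unfolding_op L \<alpha> (e n) (corrector L \<alpha> du d1u1 (e n)) z)) \<longlonglongrightarrow> 0"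
        by (rule unfolded_gradient_convergence(2))
    qed simp
  qed
qed

end
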